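(* Let $S$ be a left cancellative monoid. Suppose that the norm $\|\cdot\|_e$ on $C_c(\partial\mathcal G_P(S))$ coincides with the reduced norm $\|\cdot\|_r$ and that $S$ is strongly C$^*$-regular on the boundary. Then the canonical map $C^*_e(\partial\mathcal G_P(S))\to C^*_r(S)/I$ defines an isomorphism $C_r^*(\partial\mathcal G_P(S))\cong C_r^*(S)/I$.
   Context: **Monoids.** $S$ is a left cancellative monoid with identity $e$ ($st=st'\Rightarrow t=t'$). Identify $s\in S$ with the injection $S\to S$, $t\mapsto st$, and let $s^{-1}$ be the inverse partial bijection $sS\to S$. $I_\ell(S)$ (left inverse hull) is the inverse semigroup of partial bijections of $S$ generated by the left translations; its elements are the compositions $s_{2n}^{-1}s_{2n-1}\cdots s_2^{-1}s_1$. $0$ is the empty map (if it lies in $I_\ell(S)$). $\mathcal J(S)=\{\operatorname{dom} g: g\in I_\ell(S)\}$ is the set of constructible right ideals, a semigroup under intersection. $p_X$ is the identity map on $X\subseteq S$. "$hs=s$" means $s\in\operatorname{dom}h$ and $h(s)=s$; "$hp_Y=p_Y$" means $Y\subseteq\operatorname{dom}h$ and $h$ fixes every point of $Y$. **Foundation sets.** A finite family $\{X_1,\dots,X_m\}\subseteq\mathcal J(S)$ is a foundation set for $X\in\mathcal J(S)$ if $X_i\subseteq X$ for all $i$ and every nonempty $Y\in\mathcal J(S)$ with $Y\subseteq X$ meets some $X_i$. **Strong C$^*$-regularity on the boundary.** $S$ is strongly C$^*$-regular on the boundary if, whenever $h_1,\dots,h_n\in I_\ell(S)$ and $X,X_1,\dots,X_m\in\mathcal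 J(S)$ ($m\ge 0$, $X_i\subseteq X$) satisfy $\emptyset\ne X\setminus\bigcup_iX_i\subseteq\bigcup_{k=1}^n\{s\in S: h_ks=s\}$, there are $Y_1,\dots,Y_l\in\mathcal J(S)$ ($l\ge0$) and indices $1\le k_j\le n$ with $h_{k_j}p_{Y_j}=p_{Y_j}$ for all $j$ and such that $\{X_1,\dots,X_m,Y_1,\dots,Y_l\}$ is a foundation set for $X$. **Groupoids.** Characters are nonzero semigroup homomorphisms $\chi:\mathcal J(S)\to\{0,1\}$, with the topology of pointwise convergence. $\chi_s(X)=1$ iff $s\in X$. $\Omega(S)=\overline{\{\chi_s:s\in S\}}$. $\mathcal G_P(S)$ is the set of classes $[g,\chi]$ of pairs $(g,\chi)\in I_\ell(S)\times\Omega(S)$ with $\chi(\operatorname{dom}g)=1$, where $(g_1,\chi_1)\sim(g_2,\chi_2)$ iff $\chi_1=\chi_2$ and $g_1|_A=g_2|_A$ for some $A\in\mathcal J(S)$ with $\chi_1(A)=1$. Product: $[g,\chi][h,\psi]=[gh,\psi]$ if $\chi=\psi(h^{-1}(\cdot))$; source $\chi$, range $\chi(g^{-1}(\cdot))$; unit space $\Omega(S)$ via $\chi\mapsto[p_S,\chi]$; a basis of topology consists of the sets $D(g,U)=\{[g,\chi]:\chi\in U\}$, $U\subseteq\{\chi\in\Omega(S):\chi(\operatorname{dom}g)=1\}$ open. This is a locally compact, possibly non-Hausdorff, étale groupoid. A filter on $\mathcal J(S)$ is a nonempty family of nonempty members of $\mathcal J(S)$ closed under finite intersections and upward inclusion;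 $\Omega_{\max}(S)\subseteq\Omega(S)$ is the set of characters $\chi$ such that $\chi^{-1}(1)$ is a maximal filter. $\partial\Omega(S)=\overline{\Omega_{\max}(S)}$ is a closed invariant subset, and $\partial\mathcal G_P(S)$ is the reduction of $\mathcal G_P(S)$ to $\partial\Omega(S)$. **C$^*$-algebras.** For an étale groupoid $\mathcal G$, $C_c(\mathcal G)$ is the span of the functions in $C_c(V)$ ($V\subseteq\mathcal G$ open Hausdorff) extended by $0$, a convolution $*$-algebra; $\rho_x$ ($x\in\mathcal G^{(0)}$) is its left regular representation on $\ell^2(\mathcal G_x)$, $\mathcal G_x=s^{-1}(x)$, $(\rho_x(f)\xi)(g)=\sum_{h\in \mathcal G^{r(g)}}f(h)\xi(h^{-1}g)$; $\|f\|_r=\sup_x\|\rho_x(f)\|$, and $C^*_r(\mathcal G)$ is the completion. $C_r^*(\mathcal G_P(S)\setminus\partial\mathcal G_P(S))$ is a closed ideal of $C^*_r(\mathcal G_P(S))$, and $\|\cdot\|_e$ is the unique C$^*$-norm on $C_c(\partial\mathcal G_P(S))$ for which restriction of functions induces a short exact sequence $0\to C_r^*(\mathcal G_P(S)\setminus\partial\mathcal G_P(S))\to C_r^*(\mathcal G_P(S))\xrightarrow{\phi}C^*_e(\partial\mathcal G_P(S))\to0$, where $C_e^*$ is the completion in $\|\cdot\|_e$. $C^*_r(S)\subseteq B(\ell^2(S))$ is generated by the isometries $\lambda_s\delta_t=\delta_{st}$. For $X\subseteq S$, $1_X$ is the projection onto $\overline{\mathrm{span}}\{\delta_s:s\in X\}$.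 $I$ is the closed two-sided ideal of $C_r^*(S)$ generated by the projections $1_{X\setminus\bigcup_{i=1}^mX_i}$ with $m\ge1$, $X,X_i\in\mathcal J(S)$, $\{X_1,\dots,X_m\}$ a foundation set for $X$. $q:C^*_r(S)\to C_r^*(S)/I$ is the quotient map. Identifying $\mathcal G_P(S)_{\chi_e}$ with $S$ via $[s,\chi_e]\leftrightarrow s$, $\rho_{\chi_e}$ becomes a surjective $*$-homomorphism $C_r^*(\mathcal G_P(S))\to C_r^*(S)$ with $\rho_{\chi_e}(1_{D(s,\Omega(S))})=\lambda_s$. The canonical map $C^*_e(\partial\mathcal G_P(S))\to C^*_r(S)/I$ is the unique $*$-homomorphism whose composition with $\phi$ equals $q\circ\rho_{\chi_e}$ (it always exists). *)

theory Defs
  imports "HOL-Analysis.Analysis"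
begin

section \<open>Left cancellative monoids and constructible ideals\<close>

class left_cancel_monoid = monoid_mult +
  assumes left_cancel: "s * t = s * t' \<Longrightarrow> t = t'"

definition left_translation :: "'a::left_cancel_monoid \<Rightarrow> ('a \<rightharpoonup> 'a)" where
  "left_translation s = (\<lambda>t. Some (s * t))"

definition partial_inverse :: "('a \<rightharpoonup> 'a) \<Rightarrow> ('a \<rightharpoonup> 'a)" where
  "partial_inverse g = (\<lambda>t. if t \<in> ran g then Some (THE u. g u = Some t) else None)"

inductive_set left_inverse_hull :: "('a::left_cancel_monoid \<rightharpoonup> 'a) set" where
  translation: "left_translation s \<in> left_inverse_hull"
| inverse: "g \<in> left_inverse_hull \<Longrightarrow> partial_inverse g \<in> left_inverse_hull"
| comp: "g \<in> left_inverse_hull \<Longrightarrow> h \<in> left_inverse_hull \<Longrightarrow> g \<circ>\<^sub>m h \<in> left_inverse_hull"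

definition constructible_ideals :: "'a::left_cancel_monoid set set" where
  "constructible_ideals = dom ` left_inverse_hull"

text \<open>A finite family of constructible ideals is given by the finite set of its members; the empty
  set is the family with \<open>m = 0\<close>.\<close>

definition foundation_set :: "'a::left_cancel_monoid set set \<Rightarrow> 'a set \<Rightarrow> bool" where
  "foundation_set \<X> X \<longleftrightarrow>
     finite \<X> \<and> \<X> \<subseteq> constructible_ideals \<and> X \<in> constructible_ideals \<and> (\<forall>X'\<in>\<X>. X' \<subseteq> X) \<and>
     (\<forall>Y\<in>constructible_ideals. Y \<noteq> {} \<and> Y \<subseteq> X \<longrightarrow> (\<exists>X'\<in>\<X>. Y \<inter> X' \<noteq> {}))"

definition strongly_cstar_regular_on_boundary :: "'a::left_cancel_monoid itself \<Rightarrow> bool" where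
  "strongly_cstar_regular_on_boundary _ \<longleftrightarrow>
     (\<forall>(H :: ('a \<rightharpoonup> 'a) set) X \<X>.
        finite H \<and> H \<subseteq> left_inverse_hull \<and> X \<in> constructible_ideals \<and>
        finite \<X> \<and> \<X> \<subseteq> constructible_ideals \<and> (\<forall>X'\<in>\<X>. X' \<subseteq> X) \<and>
        X - \<Union>\<X> \<noteq> {} \<and> X - \<Union>\<X> \<subseteq> (\<Union>h\<in>H. {s. h s = Some s}) \<longrightarrow>
        (\<exists>\<Y>. finite \<Y> \<and> \<Y> \<subseteq> constructible_ideals \<and>
             (\<forall>Y\<in>\<Y>. \<exists>h\<in>H. \<forall>y\<in>Y. h y = Some y) \<and> foundation_set (\<X> \<union> \<Y>) X))"

section \<open>Characters\<close>

text \<open>Characters take values in \<open>bool\<close>, which is the semigroup \<open>{0, 1}\<close> with conjunction as its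
  multiplication. They are functions on the constructible ideals only, hence
  \<^const>\<open>extensional\<close>. They are called \<open>\<omega>\<close> because the letter chi is a binder for vectors.\<close>

definition characters :: "('a::left_cancel_monoid set \<Rightarrow> bool) set" where
  "characters = {\<omega> \<in> extensional constructible_ideals.
     (\<forall>X\<in>constructible_ideals. \<forall>Y\<in>constructible_ideals. \<omega> (X \<inter> Y) \<longleftrightarrow> \<omega> X \<and> \<omega> Y) \<and>
     (\<exists>X\<in>constructible_ideals. \<omega> X)}"

definition character_topology :: "('a::left_cancel_monoid set \<Rightarrow> bool) topology" where
  "character_topology =
     subtopology (product_topology (\<lambda>_. discrete_topology UNIV) constructible_ideals) characters"

definition point_character :: "'a::left_cancel_monoid \<Rightarrow> 'a set \<Rightarrow> bool" where
  "point_character s = (\<lambda>X\<in>constructible_ideals. s \<in> X)"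

definition Omega :: "('a::left_cancel_monoid set \<Rightarrow> bool) set" where
  "Omega = character_topology closure_of (range point_character)"

definition Omega_topology :: "('a::left_cancel_monoid set \<Rightarrow> bool) topology" where
  "Omega_topology = subtopology character_topology Omega"

definition ideal_filter :: "'a::left_cancel_monoid set set \<Rightarrow> bool" where
  "ideal_filter \<F> \<longleftrightarrow> \<F> \<noteq> {} \<and> \<F> \<subseteq> constructible_ideals \<and> {} \<notin> \<F> \<and>
     (\<forall>X\<in>\<F>. \<forall>Y\<in>\<F>. X \<inter> Y \<in> \<F>) \<and> (\<forall>X\<in>\<F>. \<forall>Y\<in>constructible_ideals. X \<subseteq> Y \<longrightarrow> Y \<in> \<F>)"

definition maximal_filter :: "'a::left_cancel_monoid set set \<Rightarrow> bool" where
  "maximal_filter \<F> \<longleftrightarrow> ideal_filter \<F> \<and> (\<forall>\<F>'. ideal_filter \<F>' \<and> \<F> \<subseteq> \<F>' \<longrightarrow> \<F>' = \<F>)"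

definition Omega_max :: "('a::left_cancel_monoid set \<Rightarrow> bool) set" where
  "Omega_max = {\<omega> \<in> Omega. maximal_filter {X \<in> constructible_ideals. \<omega> X}}"

definition boundary_Omega :: "('a::left_cancel_monoid set \<Rightarrow> bool) set" where
  "boundary_Omega = Omega_topology closure_of Omega_max"

section \<open>Topological groupoids\<close>

text \<open>The arrows are the points of the topology, and units are arrows. The values of the
  operations off the arrows (for the product: off the composable pairs) are irrelevant.\<close>

record 'g top_groupoid =
  arrow_topology :: "'g topology"
  src :: "'g \<Rightarrow> 'g"
  rng :: "'g \<Rightarrow> 'g"
  gmul :: "'g \<Rightarrow> 'g \<Rightarrow> 'g"
  ginv :: "'g \<Rightarrow> 'g"

definition arrows :: "'g top_groupoid \<Rightarrow> 'g set" where
  "arrows G = topspace (arrow_topology G)"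

definition units :: "'g top_groupoid \<Rightarrow> 'g set" where
  "units G = src G ` arrows G"

definition subgroupoid :: "'g top_groupoid \<Rightarrow> 'g set \<Rightarrow> 'g top_groupoid" where
  "subgroupoid G B = G\<lparr>arrow_topology := subtopology (arrow_topology G) B\<rparr>"

definition reduction :: "'g top_groupoid \<Rightarrow> 'g set \<Rightarrow> 'g top_groupoid" where
  "reduction G U = subgroupoid G {\<gamma> \<in> arrows G. src G \<gamma> \<in> U \<and> rng G \<gamma> \<in> U}"

subsection \<open>The partial transformation groupoid of a monoid\<close>

type_synonym 'a germ = "(('a \<rightharpoonup> 'a) \<times> ('a set \<Rightarrow> bool)) set"

definition germ_pairs :: "(('a::left_cancel_monoid \<rightharpoonup> 'a) \<times> ('a set \<Rightarrow> bool)) set" where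
  "germ_pairs = {(g, \<omega>). g \<in> left_inverse_hull \<and> \<omega> \<in> Omega \<and> \<omega> (dom g)}"

definition germ_rel ::
    "((('a::left_cancel_monoid \<rightharpoonup> 'a) \<times> ('a set \<Rightarrow> bool)) \<times> (('a \<rightharpoonup> 'a) \<times> ('a set \<Rightarrow> bool))) set" where
  "germ_rel = {((g\<^sub>1, \<omega>\<^sub>1), (g\<^sub>2, \<omega>\<^sub>2)). (g\<^sub>1, \<omega>\<^sub>1) \<in> germ_pairs \<and> (g\<^sub>2, \<omega>\<^sub>2) \<in> germ_pairs \<and>
     \<omega>\<^sub>1 = \<omega>\<^sub>2 \<and> (\<exists>A\<in>constructible_ideals. \<omega>\<^sub>1 A \<and> g\<^sub>1 |` A = g\<^sub>2 |` A)}"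

definition germ :: "('a::left_cancel_monoid \<rightharpoonup> 'a) \<Rightarrow> ('a set \<Rightarrow> bool) \<Rightarrow> 'a germ" where
  "germ g \<omega> = germ_rel `` {(g, \<omega>)}"

text \<open>The character \<open>X \<mapsto> \<omega> (g\<^sup>-\<^sup>1 X)\<close>.\<close>

definition push_character ::
    "('a::left_cancel_monoid \<rightharpoonup> 'a) \<Rightarrow> ('a set \<Rightarrow> bool) \<Rightarrow> 'a set \<Rightarrow> bool" where
  "push_character g \<omega> = (\<lambda>X\<in>constructible_ideals. \<omega> (g -` Some ` X))"

definition germ_bisection ::
    "('a::left_cancel_monoid \<rightharpoonup> 'a) \<Rightarrow> ('a set \<Rightarrow> bool) set \<Rightarrow> 'a germ set" where
  "germ_bisection g U = germ g ` U"

definition unit_germ :: "('a::left_cancel_monoid set \<Rightarrow> bool) \<Rightarrow> 'a germ" where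
  "unit_germ \<omega> = germ Some \<omega>"

text \<open>The operations on classes are unions over all representatives; each of these unions runs over
  a single class because the operations respect \<^const>\<open>germ_rel\<close>. The sets \<open>D(g, U)\<close> are a basis, so
  they generate the topology that they are a basis of.\<close>

definition groupoid_P :: "'a::left_cancel_monoid germ top_groupoid" where
  "groupoid_P = \<lparr>
     arrow_topology = topology_generated_by
       {germ_bisection g U | g U. g \<in> left_inverse_hull \<and> openin Omega_topology U \<and>
          (\<forall>\<omega>\<in>U. \<omega> (dom g))},
     src = (\<lambda>\<gamma>. \<Union>(g, \<omega>)\<in>\<gamma>. unit_germ \<omega>),
     rng = (\<lambda>\<gamma>. \<Union>(g, \<omega>)\<in>\<gamma>. unit_germ (push_character g \<omega>)),
     gmul = (\<lambda>\<gamma> \<delta>. \<Union>(g, \<omega>)\<in>\<gamma>. \<Union>(h, \<psi>)\<in>\<delta>.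
               if \<omega> = push_character h \<psi> then germ (g \<circ>\<^sub>m h) \<psi> else {}),
     ginv = (\<lambda>\<gamma>. \<Union>(g, \<omega>)\<in>\<gamma>. germ (partial_inverse g) (push_character g \<omega>))\<rparr>"

definition boundary_groupoid :: "'a::left_cancel_monoid germ top_groupoid" where
  "boundary_groupoid = reduction groupoid_P (unit_germ ` boundary_Omega)"

definition off_boundary_groupoid :: "'a::left_cancel_monoid germ top_groupoid" where
  "off_boundary_groupoid = subgroupoid groupoid_P (arrows groupoid_P - arrows boundary_groupoid)"

section \<open>Normed *-algebras and C*-algebras\<close>

record 'b star_algebra =
  elems :: "'b set"
  zer :: 'b
  add :: "'b \<Rightarrow> 'b \<Rightarrow> 'b"
  scl :: "complex \<Rightarrow> 'b \<Rightarrow> 'b"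
  mul :: "'b \<Rightarrow> 'b \<Rightarrow> 'b"
  adj :: "'b \<Rightarrow> 'b"
  nrm :: "'b \<Rightarrow> real"

definition dst :: "'b star_algebra \<Rightarrow> 'b \<Rightarrow> 'b \<Rightarrow> real" where
  "dst A a b = nrm A (add A a (scl A (-1) b))"

definition star_hom :: "'b star_algebra \<Rightarrow> 'c star_algebra \<Rightarrow> ('b \<Rightarrow> 'c) \<Rightarrow> bool" where
  "star_hom A B \<pi> \<longleftrightarrow>
     \<pi> \<in> elems A \<rightarrow> elems B \<and>
     (\<forall>a\<in>elems A. \<forall>b\<in>elems A. \<pi> (add A a b) = add B (\<pi> a) (\<pi> b)) \<and>
     (\<forall>c. \<forall>a\<in>elems A. \<pi> (scl A c a) = scl B c (\<pi> a)) \<and>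
     (\<forall>a\<in>elems A. \<forall>b\<in>elems A. \<pi> (mul A a b) = mul B (\<pi> a) (\<pi> b)) \<and>
     (\<forall>a\<in>elems A. \<pi> (adj A a) = adj B (\<pi> a))"

definition star_iso :: "'b star_algebra \<Rightarrow> 'c star_algebra \<Rightarrow> ('b \<Rightarrow> 'c) \<Rightarrow> bool" where
  "star_iso A B \<pi> \<longleftrightarrow> star_hom A B \<pi> \<and> bij_betw \<pi> (elems A) (elems B)"

text \<open>The norm of \<open>A\<close> is a C*-norm on the underlying *-algebra.\<close>

definition has_cstar_norm :: "'b star_algebra \<Rightarrow> bool" where
  "has_cstar_norm A \<longleftrightarrow>
     (\<forall>a\<in>elems A. 0 \<le> nrm A a) \<and>
     (\<forall>a\<in>elems A. nrm A a = 0 \<longleftrightarrow> a = zer A) \<and>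
     (\<forall>a\<in>elems A. \<forall>b\<in>elems A. nrm A (add A a b) \<le> nrm A a + nrm A b) \<and>
     (\<forall>c. \<forall>a\<in>elems A. nrm A (scl A c a) = cmod c * nrm A a) \<and>
     (\<forall>a\<in>elems A. \<forall>b\<in>elems A. nrm A (mul A a b) \<le> nrm A a * nrm A b) \<and>
     (\<forall>a\<in>elems A. nrm A (mul A (adj A a) a) = (nrm A a)\<^sup>2)"

definition norm_closed :: "'b star_algebra \<Rightarrow> 'b set \<Rightarrow> bool" where
  "norm_closed A D \<longleftrightarrow>
     (\<forall>F. \<forall>a\<in>elems A. (\<forall>n. F n \<in> D) \<and> (\<lambda>n. dst A (F n) a) \<longlonglongrightarrow> 0 \<longrightarrow> a \<in> D)"

definition closed_star_subalgebra :: "'b star_algebra \<Rightarrow> 'b set \<Rightarrow> bool" where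
  "closed_star_subalgebra A D \<longleftrightarrow> D \<subseteq> elems A \<and> zer A \<in> D \<and>
     (\<forall>a\<in>D. \<forall>b\<in>D. add A a b \<in> D \<and> mul A a b \<in> D) \<and>
     (\<forall>c. \<forall>a\<in>D. scl A c a \<in> D) \<and> (\<forall>a\<in>D. adj A a \<in> D) \<and> norm_closed A D"

definition generated_cstar_algebra :: "'b star_algebra \<Rightarrow> 'b set \<Rightarrow> 'b star_algebra" where
  "generated_cstar_algebra A M = A\<lparr>elems := \<Inter>{D. closed_star_subalgebra A D \<and> M \<subseteq> D}\<rparr>"

definition closed_ideal :: "'b star_algebra \<Rightarrow> 'b set \<Rightarrow> bool" where
  "closed_ideal A J \<longleftrightarrow> J \<subseteq> elems A \<and> zer A \<in> J \<and>
     (\<forall>a\<in>J. \<forall>b\<in>J. add A a b \<in> J) \<and> (\<forall>c. \<forall>a\<in>J. scl A c a \<in> J) \<and>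
     (\<forall>a\<in>J. \<forall>b\<in>elems A. mul A a b \<in> J \<and> mul A b a \<in> J) \<and> norm_closed A J"

definition generated_closed_ideal :: "'b star_algebra \<Rightarrow> 'b set \<Rightarrow> 'b set" where
  "generated_closed_ideal A M = \<Inter>{J. closed_ideal A J \<and> M \<subseteq> J}"

definition coset :: "'b star_algebra \<Rightarrow> 'b set \<Rightarrow> 'b \<Rightarrow> 'b set" where
  "coset A J a = add A a ` J"

definition quotient_algebra :: "'b star_algebra \<Rightarrow> 'b set \<Rightarrow> 'b set star_algebra" where
  "quotient_algebra A J = \<lparr>
     elems = coset A J ` elems A,
     zer = coset A J (zer A),
     add = (\<lambda>x y. \<Union>a\<in>x. \<Union>b\<in>y. coset A J (add A a b)),
     scl = (\<lambda>c x. \<Union>a\<in>x. coset A J (scl A c a)),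
     mul = (\<lambda>x y. \<Union>a\<in>x. \<Union>b\<in>y. coset A J (mul A a b)),
     adj = (\<lambda>x. \<Union>a\<in>x. coset A J (adj A a)),
     nrm = (\<lambda>x. Inf (nrm A ` x))\<rparr>"

subsection \<open>Completion\<close>

definition cauchy_seqs :: "'b star_algebra \<Rightarrow> (nat \<Rightarrow> 'b) set" where
  "cauchy_seqs A = {F. (\<forall>n. F n \<in> elems A) \<and>
     (\<forall>\<epsilon>>0. \<exists>N. \<forall>m\<ge>N. \<forall>n\<ge>N. dst A (F m) (F n) < \<epsilon>)}"

definition cauchy_class :: "'b star_algebra \<Rightarrow> (nat \<Rightarrow> 'b) \<Rightarrow> (nat \<Rightarrow> 'b) set" where
  "cauchy_class A F = {F' \<in> cauchy_seqs A. (\<lambda>n. dst A (F n) (F' n)) \<longlonglongrightarrow> 0}"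

definition completion :: "'b star_algebra \<Rightarrow> (nat \<Rightarrow> 'b) set star_algebra" where
  "completion A = \<lparr>
     elems = cauchy_class A ` cauchy_seqs A,
     zer = cauchy_class A (\<lambda>_. zer A),
     add = (\<lambda>x y. \<Union>F\<in>x. \<Union>F'\<in>y. cauchy_class A (\<lambda>n. add A (F n) (F' n))),
     scl = (\<lambda>c x. \<Union>F\<in>x. cauchy_class A (\<lambda>n. scl A c (F n))),
     mul = (\<lambda>x y. \<Union>F\<in>x. \<Union>F'\<in>y. cauchy_class A (\<lambda>n. mul A (F n) (F' n))),
     adj = (\<lambda>x. \<Union>F\<in>x. cauchy_class A (\<lambda>n. adj A (F n))),
     nrm = (\<lambda>x. THE r. \<forall>F\<in>x. (\<lambda>n. nrm A (F n)) \<longlonglongrightarrow> r)\<rparr>"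

definition embed :: "'b star_algebra \<Rightarrow> 'b \<Rightarrow> (nat \<Rightarrow> 'b) set" where
  "embed A a = cauchy_class A (\<lambda>_. a)"

text \<open>The extension by continuity of \<open>\<pi> : A \<rightarrow> B\<close> to the completion of \<open>A\<close>.\<close>

definition extension ::
    "'b star_algebra \<Rightarrow> 'c star_algebra \<Rightarrow> ('b \<Rightarrow> 'c) \<Rightarrow> (nat \<Rightarrow> 'b) set \<Rightarrow> 'c" where
  "extension A B \<pi> x = (THE b. b \<in> elems B \<and> (\<forall>F\<in>x. (\<lambda>n. dst B (\<pi> (F n)) b) \<longlonglongrightarrow> 0))"

definition induces_hom :: "'b star_algebra \<Rightarrow> 'c star_algebra \<Rightarrow> ('b \<Rightarrow> 'c) \<Rightarrow> bool" where
  "induces_hom A B \<pi> \<longleftrightarrow> star_hom (completion A) B (extension A B \<pi>) \<and>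
     (\<forall>a\<in>elems A. extension A B \<pi> (embed A a) = \<pi> a)"

definition short_exact ::
    "'b star_algebra \<Rightarrow> 'c star_algebra \<Rightarrow> 'd star_algebra \<Rightarrow> ('b \<Rightarrow> 'c) \<Rightarrow> ('c \<Rightarrow> 'd) \<Rightarrow> bool" where
  "short_exact A B C \<iota> \<phi> \<longleftrightarrow> star_hom A B \<iota> \<and> star_hom B C \<phi> \<and>
     inj_on \<iota> (elems A) \<and> \<iota> ` elems A = {b \<in> elems B. \<phi> b = zer C} \<and> \<phi> ` elems B = elems C"

subsection \<open>Operators on \<open>\<ell>\<^sup>2\<close>\<close>

text \<open>\<open>\<ell>\<^sup>2(I)\<close> consists of functions that vanish off \<open>I\<close>.\<close>

definition ell2 :: "'i set \<Rightarrow> ('i \<Rightarrow> complex) set" where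
  "ell2 I = {\<xi>. (\<forall>i. i \<notin> I \<longrightarrow> \<xi> i = 0) \<and> (\<lambda>i. (cmod (\<xi> i))\<^sup>2) summable_on I}"

definition ell2_norm :: "('i \<Rightarrow> complex) \<Rightarrow> real" where
  "ell2_norm \<xi> = sqrt (\<Sum>\<^sub>\<infinity>i. (cmod (\<xi> i))\<^sup>2)"

definition ell2_inner :: "('i \<Rightarrow> complex) \<Rightarrow> ('i \<Rightarrow> complex) \<Rightarrow> complex" where
  "ell2_inner \<xi> \<eta> = (\<Sum>\<^sub>\<infinity>i. \<xi> i * cnj (\<eta> i))"

type_synonym 'i op = "('i \<Rightarrow> complex) \<Rightarrow> ('i \<Rightarrow> complex)"

definition bounded_ops :: "'i set \<Rightarrow> 'i op set" where
  "bounded_ops I = {T \<in> ell2 I \<rightarrow>\<^sub>E ell2 I.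
     (\<forall>\<xi>\<in>ell2 I. \<forall>\<eta>\<in>ell2 I. T (\<lambda>i. \<xi> i + \<eta> i) = (\<lambda>i. T \<xi> i + T \<eta> i)) \<and>
     (\<forall>c. \<forall>\<xi>\<in>ell2 I. T (\<lambda>i. c * \<xi> i) = (\<lambda>i. c * T \<xi> i)) \<and>
     (\<exists>K. \<forall>\<xi>\<in>ell2 I. ell2_norm (T \<xi>) \<le> K * ell2_norm \<xi>)}"

definition op_norm :: "'i set \<Rightarrow> 'i op \<Rightarrow> real" where
  "op_norm I T = Sup {ell2_norm (T \<xi>) | \<xi>. \<xi> \<in> ell2 I \<and> ell2_norm \<xi> \<le> 1}"

definition op_algebra :: "'i set \<Rightarrow> 'i op star_algebra" where
  "op_algebra I = \<lparr>
     elems = bounded_ops I,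
     zer = (\<lambda>\<xi>\<in>ell2 I. \<lambda>i. 0),
     add = (\<lambda>T T'. \<lambda>\<xi>\<in>ell2 I. \<lambda>i. T \<xi> i + T' \<xi> i),
     scl = (\<lambda>c T. \<lambda>\<xi>\<in>ell2 I. \<lambda>i. c * T \<xi> i),
     mul = (\<lambda>T T'. \<lambda>\<xi>\<in>ell2 I. T (T' \<xi>)),
     adj = (\<lambda>T. THE T'. T' \<in> bounded_ops I \<and>
              (\<forall>\<xi>\<in>ell2 I. \<forall>\<eta>\<in>ell2 I. ell2_inner (T \<xi>) \<eta> = ell2_inner \<xi> (T' \<eta>))),
     nrm = op_norm I\<rparr>"

section \<open>Groupoid C*-algebras\<close>

text \<open>\<open>C\<^sub>c(V)\<close> for \<open>V\<close> open and Hausdorff, as functions on the whole type that vanish off \<open>V\<close>.\<close>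

definition Cc_on :: "'g top_groupoid \<Rightarrow> 'g set \<Rightarrow> ('g \<Rightarrow> complex) set" where
  "Cc_on G V = {f. (\<forall>\<gamma>. \<gamma> \<notin> V \<longrightarrow> f \<gamma> = 0) \<and>
     continuous_map (subtopology (arrow_topology G) V) euclidean f \<and>
     compactin (subtopology (arrow_topology G) V)
       (subtopology (arrow_topology G) V closure_of {\<gamma> \<in> V. f \<gamma> \<noteq> 0})}"

definition Cc :: "'g top_groupoid \<Rightarrow> ('g \<Rightarrow> complex) set" where
  "Cc G = {(\<lambda>\<gamma>. \<Sum>f\<in>F. c f * f \<gamma>) | F c. finite F \<and>
     F \<subseteq> (\<Union>V\<in>{V. openin (arrow_topology G) V \<and>
                  Hausdorff_space (subtopology (arrow_topology G) V)}. Cc_on G V)}"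

definition source_fibre :: "'g top_groupoid \<Rightarrow> 'g \<Rightarrow> 'g set" where
  "source_fibre G x = {\<gamma> \<in> arrows G. src G \<gamma> = x}"

definition range_fibre :: "'g top_groupoid \<Rightarrow> 'g \<Rightarrow> 'g set" where
  "range_fibre G x = {\<gamma> \<in> arrows G. rng G \<gamma> = x}"

text \<open>For \<open>f\<close> in \<open>C\<^sub>c(G)\<close> and \<open>G\<close> with Hausdorff unit space, \<open>f\<close> has finite support on every range
  fibre, so the sums below are finite.\<close>

definition convolution ::
    "'g top_groupoid \<Rightarrow> ('g \<Rightarrow> complex) \<Rightarrow> ('g \<Rightarrow> complex) \<Rightarrow> 'g \<Rightarrow> complex" where
  "convolution G f f' = (\<lambda>\<gamma>. if \<gamma> \<in> arrows G
     then \<Sum>\<^sub>\<infinity>\<eta>\<in>range_fibre G (rng G \<gamma>). f \<eta> * f' (gmul G (ginv G \<eta>) \<gamma>) else 0)"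

definition involution :: "'g top_groupoid \<Rightarrow> ('g \<Rightarrow> complex) \<Rightarrow> 'g \<Rightarrow> complex" where
  "involution G f = (\<lambda>\<gamma>. if \<gamma> \<in> arrows G then cnj (f (ginv G \<gamma>)) else 0)"

definition regular_rep :: "'g top_groupoid \<Rightarrow> 'g \<Rightarrow> ('g \<Rightarrow> complex) \<Rightarrow> 'g op" where
  "regular_rep G x f = (\<lambda>\<xi>\<in>ell2 (source_fibre G x). \<lambda>\<gamma>. if \<gamma> \<in> source_fibre G x
     then \<Sum>\<^sub>\<infinity>\<eta>\<in>range_fibre G (rng G \<gamma>). f \<eta> * \<xi> (gmul G (ginv G \<eta>) \<gamma>) else 0)"

text \<open>The inserted \<open>0\<close> only matters for the empty groupoid, where the supremum is over the empty
  set.\<close>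

definition reduced_norm :: "'g top_groupoid \<Rightarrow> ('g \<Rightarrow> complex) \<Rightarrow> real" where
  "reduced_norm G f =
     Sup (insert 0 {op_norm (source_fibre G x) (regular_rep G x f) | x. x \<in> units G})"

definition Cc_algebra ::
    "'g top_groupoid \<Rightarrow> (('g \<Rightarrow> complex) \<Rightarrow> real) \<Rightarrow> ('g \<Rightarrow> complex) star_algebra" where
  "Cc_algebra G N = \<lparr>
     elems = Cc G,
     zer = (\<lambda>\<gamma>. 0),
     add = (\<lambda>f f'. \<lambda>\<gamma>. f \<gamma> + f' \<gamma>),
     scl = (\<lambda>c f. \<lambda>\<gamma>. c * f \<gamma>),
     mul = convolution G,
     adj = involution G,
     nrm = N\<rparr>"

abbreviation reduced_Cc_algebra :: "'g top_groupoid \<Rightarrow> ('g \<Rightarrow> complex) star_algebra" where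
  "reduced_Cc_algebra G \<equiv> Cc_algebra G (reduced_norm G)"

definition reduced_cstar_algebra ::
    "'g top_groupoid \<Rightarrow> (nat \<Rightarrow> 'g \<Rightarrow> complex) set star_algebra" where
  "reduced_cstar_algebra G = completion (reduced_Cc_algebra G)"

subsection \<open>The norm \<open>\<parallel>\<cdot>\<parallel>\<^sub>e\<close> on the boundary\<close>

type_synonym 'a germ_fun = "'a germ \<Rightarrow> complex"

abbreviation boundary_Cc_algebra ::
    "('a::left_cancel_monoid germ_fun \<Rightarrow> real) \<Rightarrow> 'a germ_fun star_algebra" where
  "boundary_Cc_algebra N \<equiv> Cc_algebra boundary_groupoid N"

definition boundary_cstar_algebra ::
    "('a::left_cancel_monoid germ_fun \<Rightarrow> real) \<Rightarrow> (nat \<Rightarrow> 'a germ_fun) set star_algebra" where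
  "boundary_cstar_algebra N = completion (boundary_Cc_algebra N)"

definition restrict_to_boundary :: "'a::left_cancel_monoid germ_fun \<Rightarrow> 'a germ_fun" where
  "restrict_to_boundary f = (\<lambda>\<gamma>. if \<gamma> \<in> arrows boundary_groupoid then f \<gamma> else 0)"

text \<open>The dense part of the inclusion
  \<open>C\<^sup>*\<^sub>r(\<G>\<^sub>P(S) \<setminus> \<partial>\<G>\<^sub>P(S)) \<rightarrow> C\<^sup>*\<^sub>r(\<G>\<^sub>P(S))\<close>. Elements of \<open>C\<^sub>c\<close> of the open subgroupoid vanish off it, so
  they already are their extensions by zero.\<close>

definition inclusion_Cc ::
    "'a::left_cancel_monoid germ_fun \<Rightarrow> (nat \<Rightarrow> 'a germ_fun) set" where
  "inclusion_Cc f = embed (reduced_Cc_algebra groupoid_P) f"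

definition restriction_Cc ::
    "('a::left_cancel_monoid germ_fun \<Rightarrow> real) \<Rightarrow> 'a germ_fun \<Rightarrow> (nat \<Rightarrow> 'a germ_fun) set" where
  "restriction_Cc N f = embed (boundary_Cc_algebra N) (restrict_to_boundary f)"

definition inclusion_map ::
    "(nat \<Rightarrow> 'a::left_cancel_monoid germ_fun) set \<Rightarrow> (nat \<Rightarrow> 'a germ_fun) set" where
  "inclusion_map = extension (reduced_Cc_algebra off_boundary_groupoid)
     (reduced_cstar_algebra groupoid_P) inclusion_Cc"

definition restriction_map :: "('a::left_cancel_monoid germ_fun \<Rightarrow> real) \<Rightarrow>
    (nat \<Rightarrow> 'a germ_fun) set \<Rightarrow> (nat \<Rightarrow> 'a germ_fun) set" where
  "restriction_map N = extension (reduced_Cc_algebra groupoid_P)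
     (boundary_cstar_algebra N) (restriction_Cc N)"

definition is_norm_e :: "('a::left_cancel_monoid germ_fun \<Rightarrow> real) \<Rightarrow> bool" where
  "is_norm_e N \<longleftrightarrow>
     has_cstar_norm (boundary_Cc_algebra N) \<and>
     induces_hom (reduced_Cc_algebra off_boundary_groupoid)
       (reduced_cstar_algebra groupoid_P) (inclusion_Cc :: 'a germ_fun \<Rightarrow> _) \<and>
     induces_hom (reduced_Cc_algebra groupoid_P) (boundary_cstar_algebra N) (restriction_Cc N) \<and>
     short_exact (reduced_cstar_algebra off_boundary_groupoid) (reduced_cstar_algebra groupoid_P)
       (boundary_cstar_algebra N) inclusion_map (restriction_map N)"

section \<open>The reduced C*-algebra of the monoid and the canonical map\<close>

text \<open>The set \<open>{t. s * t = u}\<close> has at most one element; the formula is \<open>\<lambda>\<^sub>s \<delta>\<^sub>t = \<delta>\<^bsub>st\<^esub>\<close>.\<close>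

definition translation_op :: "'a::left_cancel_monoid \<Rightarrow> 'a op" where
  "translation_op s = (\<lambda>\<xi>\<in>ell2 UNIV. \<lambda>u. \<Sum>t | s * t = u. \<xi> t)"

definition monoid_cstar_algebra :: "'a::left_cancel_monoid op star_algebra" where
  "monoid_cstar_algebra = generated_cstar_algebra (op_algebra UNIV) (range translation_op)"

definition projection_op :: "'a set \<Rightarrow> 'a op" where
  "projection_op X = (\<lambda>\<xi>\<in>ell2 UNIV. \<lambda>t. if t \<in> X then \<xi> t else 0)"

definition boundary_ideal :: "'a::left_cancel_monoid op set" where
  "boundary_ideal = generated_closed_ideal monoid_cstar_algebra
     {projection_op (X - \<Union>\<X>) | X \<X>. \<X> \<noteq> {} \<and> foundation_set \<X> X}"

definition boundary_quotient :: "'a::left_cancel_monoid op set star_algebra" where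
  "boundary_quotient = quotient_algebra monoid_cstar_algebra boundary_ideal"

definition quotient_map :: "'a::left_cancel_monoid op \<Rightarrow> 'a op set" where
  "quotient_map = coset monoid_cstar_algebra boundary_ideal"

text \<open>The regular representation at \<open>\<omega>\<^sub>e\<close>, transported from the source fibre of \<open>\<omega>\<^sub>e\<close> to the monoid
  along the bijection \<open>s \<mapsto> [s, \<omega>\<^sub>e]\<close>.\<close>

definition fibre_germ :: "'a::left_cancel_monoid \<Rightarrow> 'a germ" where
  "fibre_germ s = germ (left_translation s) (point_character 1)"

definition rho_Cc :: "'a::left_cancel_monoid germ_fun \<Rightarrow> 'a op" where
  "rho_Cc f = (\<lambda>\<xi>\<in>ell2 UNIV. \<lambda>s.
     regular_rep groupoid_P (unit_germ (point_character 1)) f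
       (\<lambda>\<gamma>. if \<gamma> \<in> range fibre_germ then \<xi> (inv fibre_germ \<gamma>) else 0) (fibre_germ s))"

definition rho_map :: "(nat \<Rightarrow> 'a::left_cancel_monoid germ_fun) set \<Rightarrow> 'a op" where
  "rho_map = extension (reduced_Cc_algebra groupoid_P) monoid_cstar_algebra rho_Cc"

definition is_canonical_map :: "('a::left_cancel_monoid germ_fun \<Rightarrow> real) \<Rightarrow>
    ((nat \<Rightarrow> 'a germ_fun) set \<Rightarrow> 'a op set) \<Rightarrow> bool" where
  "is_canonical_map N \<Phi> \<longleftrightarrow>
     \<Phi> \<in> extensional (elems (boundary_cstar_algebra N)) \<and>
     star_hom (boundary_cstar_algebra N) boundary_quotient \<Phi> \<and>
     (\<forall>a\<in>elems (reduced_cstar_algebra groupoid_P).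
        \<Phi> (restriction_map N a) = quotient_map (rho_map a))"

end

theory Submission
  imports Defs
begin

text \<open>Write \<open>\<rho>\<close> for the regular representation at the character of the identity. Regularity is used once: for
  \<open>\<omega>\<close> in the boundary it yields points \<open>s \<in> S\<close> close to \<open>\<omega>\<close> at which finitely many distinct germs at \<open>\<omega>\<close> take
  distinct values. Any finite piece of the representation at \<open>\<omega>\<close> can then be copied approximately into
  \<open>\<ell>\<^sup>2(S)\<close>, so the norm of \<open>f|\<partial>\<G>\<close> is at most \<open>\<parallel>\<rho>(f)\<parallel>\<close> for \<open>f \<in> C\<^sub>c(\<G>)\<close>. Since the generators of \<open>I\<close> are
  images of functions that vanish on the boundary, even \<open>\<parallel>f|\<partial>\<G>\<parallel> \<le> \<parallel>\<rho>(f) + T\<parallel>\<close> for \<open>T \<in> I\<close>, which is injectivity.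
  Conversely, exactness provides a function supported off the boundary within distance about \<open>\<parallel>f|\<partial>\<G>\<parallel>\<close>
  of \<open>f\<close>, and \<open>\<rho>\<close> maps such functions into \<open>I\<close>, so the map is well defined. Completeness of the boundary
  algebra then gives surjectivity.\<close>

text \<open>Exactness equates the kernel of restriction with the image of an ideal but gives no
  estimate, while an operator in C*_r(S) has to be approximated from \<open>boundary_ideal\<close>
  as soon as its boundary norm is small. The estimate comes from polynomials in C_c: the function (1
  - f f* / M^2)^n f has reduced norm at most M / sqrt (n + 1), as x (1 - x^2 / M^2)^n does on
  [0, M], and on the boundary it differs from f by at most n \<rho>^3 / M^2 if the boundary norm of
  f is at most \<rho>. With n near M^2 / (2 \<rho>^2) the boundary norm is halved at a cost of 2
  \<rho>, and a geometric series of such steps converges to an element of the kernel.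

  The groupoid may be non-Hausdorff, so C_c is a span over Hausdorff pieces. Since the characters
  form a totally disconnected compact space, every function in it is a finite sum of functions each
  carried by the germs of one partial bijection. Such a function acts as a weighted partial
  permutation on every source fibre and on S, and representations are compared summand by
  summand.\<close>

abbreviation ideals ("\<J>") where "\<J> \<equiv> constructible_ideals"
abbreviation hull ("\<I>") where "\<I> \<equiv> left_inverse_hull"
abbreviation arrow_groupoid ("\<G>") where "\<G> \<equiv> groupoid_P"
abbreviation Omega_top ("\<O>") where "\<O> \<equiv> Omega_topology"
abbreviation "pinv \<equiv> partial_inverse"
abbreviation "push \<equiv> push_character"
abbreviation "pt \<equiv> point_character"
abbreviation "restr \<equiv> restrict_to_boundary"
abbreviation "cls \<equiv> cauchy_class"
abbreviation "cseqs \<equiv> cauchy_seqs"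
abbreviation "Bop \<equiv> op_algebra UNIV"
abbreviation monoid_algebra ("\<M>") where "\<M> \<equiv> monoid_cstar_algebra"
abbreviation "vanishes f \<equiv> f \<longlonglongrightarrow> 0"

section \<open>The left inverse hull and the constructible ideals\<close>

lemmas inv_hull = left_inverse_hull.inverse and comp_hull = left_inverse_hull.comp and trans_hull = left_inverse_hull.translation

text \<open>Left cancellation makes translations injective, and the induction carries this through
  the hull. It has to come first: the \<open>THE\<close> in \<open>partial_inverse\<close> denotes a
  preimage only when that preimage is unique, so \<open>pinv g\<close> can be computed only once
  \<open>g\<close> is known to be injective.\<close>

lemma hull_inj:
 assumes "g \<in> \<I>" "g x = Some z" "g y = Some z"
 shows "x = y"
 using assms
proof (induction arbitrary: x y z)
 case (translation s)
 thus ?case by (simp add: left_translation_def) (metis left_cancel)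
next
 case (inverse g)
 have *: "g u = Some t" if "pinv g t = Some u" for u t
 proof -
  have "t \<in> ran g" using that by (auto simp: partial_inverse_def split: if_splits)
  then obtain v where v: "g v = Some t" by (auto simp: ran_def)
  have "(THE w. g w = Some t) = v" using v inverse.IH by blast
  thus ?thesis using that v by (auto simp: partial_inverse_def split: if_splits)
 qed
 show ?case using *[OF inverse.prems(1)] *[OF inverse.prems(2)] by simp
next
 case (comp g h)
 thus ?case by (auto simp: map_comp_Some_iff)
qed

lemma partial_inverse_iff [simp]:
 assumes "g \<in> \<I>"
 shows "pinv g t = Some u \<longleftrightarrow> g u = Some t"
proof
 assume a: "pinv g t = Some u"
 hence "t \<in> ran g" by (auto simp: partial_inverse_def split: if_splits)
 then obtain v where v: "g v = Some t" by (auto simp: ran_def)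
 have "(THE w. g w = Some t) = v" using v hull_inj[OF assms] by blast
 thus "g u = Some t" using a v by (auto simp: partial_inverse_def split: if_splits)
next
 assume a: "g u = Some t"
 hence "(THE w. g w = Some t) = u" using hull_inj[OF assms] by blast
 thus "pinv g t = Some u" using a by (auto simp: partial_inverse_def ran_def)
qed

lemma partial_inverse_partial_inverse:
 assumes "g \<in> \<I>"
 shows "pinv (pinv g) = g"
proof
 fix x show "pinv (pinv g) x = g x"
  using partial_inverse_iff[OF inv_hull[OF assms], of x] partial_inverse_iff[OF assms]
  by (metis not_Some_eq)
qed

lemma partial_inverse_comp:
 assumes "g \<in> \<I>" "h \<in> \<I>"
 shows "pinv (g \<circ>\<^sub>m h) = pinv h \<circ>\<^sub>m pinv g"
proof
 fix x
 have "pinv (g \<circ>\<^sub>m h) x = Some u \<longleftrightarrow> (pinv h \<circ>\<^sub>m pinv g) x = Some u" for u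
  using assms by (auto simp: map_comp_Some_iff comp_hull)
 thus "pinv (g \<circ>\<^sub>m h) x = (pinv h \<circ>\<^sub>m pinv g) x"
  by (metis not_Some_eq)
qed

text \<open>Left translations commute with right multiplications, and inverses and compositions
  inherit this. Its use is \<open>hull_at_one\<close>: an element of the hull that is defined at
  \<open>1\<close> is determined by its value there.\<close>

lemma hull_equivariant:
 assumes "g \<in> \<I>" "g x = Some y"
 shows "g (x * z) = Some (y * z)"
 using assms
proof (induction arbitrary: x y)
 case (translation s)
 thus ?case by (auto simp: left_translation_def mult.assoc)
next
 case (comp g h)
 thus ?case by (auto simp: map_comp_Some_iff)
qed simp

lemma dom_hull [simp]: "g \<in> \<I> ==> dom g \<in> \<J>"
 by (simp add: constructible_ideals_def)

lemma Some_hull: "Some \<in> \<I>"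
 using trans_hull[of 1] by (simp add: left_translation_def)

lemma UNIV_ideal [simp]: "UNIV \<in> \<J>"
 using dom_hull[OF Some_hull] by (simp add: dom_def)

text \<open>For \<open>X = dom g\<close> the identity on \<open>X\<close> is \<open>g\<close>
  followed by its inverse. Once it belongs to the hull, preimages and intersections of constructible
  ideals are domains of compositions, which is how both closure properties below are
  obtained.\<close>

lemma partial_identity_hull:
 assumes "X \<in> \<J>"
 shows "Some |` X \<in> \<I>"
proof -
 obtain g where g: "g \<in> \<I>" "X = dom g"
  using assms by (auto simp: constructible_ideals_def)
 have "pinv g \<circ>\<^sub>m g = Some |` X"
  using g by (auto simp: fun_eq_iff restrict_map_def map_comp_def split: option.splits)
 thus ?thesis using comp_hull[OF inv_hull[OF g(1)] g(1)] by simp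
qed

lemma dom_map_comp: "dom (g \<circ>\<^sub>m h) = h -` Some ` dom g"
 by (auto simp: map_comp_Some_iff dom_def)

lemma vimage_ideal [simp]:
 assumes "g \<in> \<I>" "X \<in> \<J>"
 shows "g -` Some ` X \<in> \<J>"
 using dom_hull[OF comp_hull[OF partial_identity_hull[OF assms(2)] assms(1)]]
 by (simp add: dom_map_comp)

lemma Int_ideal [simp]:
 assumes "X \<in> \<J>" "Y \<in> \<J>"
 shows "X \<inter> Y \<in> \<J>"
proof -
 have "(Some |` X) -` Some ` Y = X \<inter> Y" by (auto simp: restrict_map_def split: if_splits)
 thus ?thesis using vimage_ideal[OF partial_identity_hull[OF assms(1)] assms(2)] by simp
qed

lemma Inter_ideal:
 assumes "finite \<X>" "\<X> \<subseteq> \<J>"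
 shows "\<Inter>\<X> \<in> \<J>"
 using assms by (induction) auto

lemma vimage_dom_inverse:
 assumes "g \<in> \<I>"
 shows "g -` Some ` dom (pinv g) = dom g"
 using assms by (force simp: dom_def)

section \<open>Characters and the topology of \<open>Omega\<close>\<close>

lemma charactersD:
 assumes "w \<in> characters"
 shows char_extensional: "w \<in> extensional \<J>"
  and char_Int: "\<And>X Y. X \<in> \<J> ==> Y \<in> \<J> ==> w (X \<inter> Y) \<longleftrightarrow> w X \<and> w Y"
  and char_mono: "\<And>X Y. X \<in> \<J> ==> Y \<in> \<J> ==> w X ==> X \<subseteq> Y ==> w Y"
  and char_UNIV: "w UNIV"
proof -
 show 1: "w \<in> extensional \<J>" using assms by (simp add: characters_def)
 show 2: "w (X \<inter> Y) \<longleftrightarrow> w X \<and> w Y" if "X \<in> \<J>" "Y \<in> \<J>" for X Y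
  using assms that by (simp add: characters_def)
 show 3: "w Y" if "X \<in> \<J>" "Y \<in> \<J>" "w X" "X \<subseteq> Y" for X Y
  using 2[OF that(1,2)] that by (metis inf.absorb1)
 show "w UNIV" using assms 3[OF _ UNIV_ideal] by (auto simp: characters_def)
qed

lemma char_Inter:
 assumes "w \<in> characters" "finite \<X>" "\<X> \<subseteq> \<J>"
 shows "w (\<Inter>\<X>) \<longleftrightarrow> (\<forall>X\<in>\<X>. w X)"
 using assms(2,3)
proof (induction)
 case empty
 thus ?case using char_UNIV[OF assms(1)] by simp
next
 case (insert X \<X>)
 thus ?case using char_Int[OF assms(1)] Inter_ideal by auto
qed

lemma point_character_eq [simp]: "X \<in> \<J> ==> pt s X \<longleftrightarrow> s \<in> X"
 by (simp add: point_character_def)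

lemma point_character_in_characters: "pt s \<in> characters"
 unfolding characters_def
proof (intro CollectI conjI ballI)
 show "\<exists>X\<in>\<J>. pt s X"
  by (rule bexI[OF _ UNIV_ideal]) (simp add: point_character_def)
qed (simp_all add: point_character_def)

lemma openin_cylinder:
 assumes "X \<in> \<J>"
 shows "openin (product_topology (\<lambda>_. discrete_topology UNIV) \<J>)
     {w \<in> extensional \<J>. w X = b}"
 using openin_continuous_map_preimage[OF continuous_map_product_projection[OF assms, of "\<lambda>_. discrete_topology UNIV"], of "{b}"]
 by (simp add: PiE_UNIV_domain PiE_def Pi_UNIV)

lemma topspace_character_product:
 "topspace (product_topology (\<lambda>_. discrete_topology UNIV) \<J>) = extensional \<J>"
 by (simp add: PiE_def)

lemma closedin_cylinder:
 assumes "X \<in> \<J>"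
 shows "closedin (product_topology (\<lambda>_. discrete_topology (UNIV::bool set)) \<J>)
     {w \<in> extensional \<J>. w X = b}"
proof -
 have "extensional \<J> - {w \<in> extensional \<J>. w X = b} =
  {w \<in> extensional \<J>. w X = (\<not> b)}" by auto
 thus ?thesis using openin_cylinder[OF assms, of "\<not> b"]
  unfolding closedin_def topspace_character_product by auto
qed

text \<open>Each multiplicativity condition involves three coordinates and is closed in the product.
  Being nonzero is an existential condition and not visibly closed; by monotonicity it is equivalent
  to the single condition at \<open>UNIV\<close>.\<close>

lemma closedin_characters:
 "closedin (product_topology (\<lambda>_. discrete_topology UNIV) (\<J> :: 'a::left_cancel_monoid set set)) characters"
proof -
 let ?J = "\<J> :: 'a set set"
 let ?T = "product_topology (\<lambda>_. discrete_topology (UNIV::bool set)) ?J"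
 let ?E = "extensional ?J :: ('a set => bool) set"
 let ?C = "\<lambda>X b. {w \<in> ?E. w X = b}"
 let ?D = "\<lambda>X Y. {w \<in> ?E. w (X \<inter> Y) \<longleftrightarrow> w X \<and> w Y}"
 let ?K = "insert (?C UNIV True) {?D X Y | X Y. X \<in> ?J \<and> Y \<in> ?J}"
 have D: "closedin ?T (?D X Y)" if "X \<in> \<J>" "Y \<in> \<J>" for X Y
 proof -
  have "?D X Y = (?C (X \<inter> Y) True \<inter> ?C X True \<inter> ?C Y True) \<union> (?C (X \<inter> Y) False \<inter> (?C X False \<union> ?C Y False))"
   by auto
  moreover have "closedin ?T \<dots>"
   using that by (intro closedin_Un closedin_Int closedin_cylinder) auto
  ultimately show ?thesis by simp
 qed
 have "characters = \<Inter>?K"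
 proof (intro subset_antisym subsetI)
  fix w :: "'a set => bool" assume w: "w \<in> characters"
  show "w \<in> \<Inter>?K"
   using char_extensional[OF w] char_Int[OF w] char_UNIV[OF w] by auto
 next
  fix w :: "'a set => bool" assume w: "w \<in> \<Inter>?K"
  have "w \<in> ?D X Y" if "X \<in> ?J" "Y \<in> ?J" for X Y
  proof -
   have "?D X Y \<in> ?K" using that by blast
   thus ?thesis by (rule InterD[OF w])
  qed
  moreover have "w \<in> ?C UNIV True" by (rule InterD[OF w]) (rule insertI1)
  ultimately show "w \<in> characters" using UNIV_ideal unfolding characters_def mem_Collect_eq by meson
 qed
 moreover have "closedin ?T (\<Inter>?K)"
 proof (rule closedin_Inter)
  fix S assume "S \<in> ?K"
  then consider "S = ?C UNIV True" | X Y where "X \<in> \<J>" "Y \<in> \<J>" "S = ?D X Y"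
   by blast
  thus "closedin ?T S"
  proof cases
   case 1
   show ?thesis unfolding 1 by (rule closedin_cylinder[OF UNIV_ideal])
  next
   case 2
   show ?thesis unfolding 2(3) by (rule D[OF 2(1,2)])
  qed
 qed blast
 ultimately show ?thesis by simp
qed

lemma topspace_character_topology [simp]: "topspace character_topology = characters"
 using charactersD(1) by (auto simp: character_topology_def topspace_character_product PiE_def)

lemma Omega_subset_characters: "Omega \<subseteq> characters"
 using closure_of_subset_topspace[of character_topology] by (simp add: Omega_def)

lemma Omega_char [simp]: "w \<in> Omega ==> w \<in> characters"
 using Omega_subset_characters by blast

lemma topspace_Omega_topology [simp]: "topspace \<O> = Omega"
 using Omega_subset_characters by (auto simp: Omega_topology_def)

lemma compact_space_Omega: "compact_space \<O>"
proof -
 let ?T = "product_topology (\<lambda>_. discrete_topology (UNIV::bool set)) \<J>"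
 have "compact_space ?T" by (simp add: compact_space_product_topology compact_space_discrete_topology)
 hence "compact_space character_topology"
  unfolding character_topology_def
  by (intro compact_space_subtopology closedin_compact_space closedin_characters)
 moreover have "closedin character_topology Omega" by (simp add: Omega_def)
 ultimately show ?thesis unfolding Omega_topology_def
  by (intro compact_space_subtopology closedin_compact_space)
qed

lemma Hausdorff_space_Omega: "Hausdorff_space \<O>"
 unfolding Omega_topology_def character_topology_def
 by (intro Hausdorff_space_subtopology) (simp add: Hausdorff_space_product_topology Hausdorff_space_discrete_topology)

text \<open>For finite families these sets are clopen, and those with all \<open>X'\<close> inside
  \<open>X\<close> already form a basis of \<open>Omega\<close>. The point characters in such a set
  are those of the points of \<open>X - \<Union>\<X>\<close>, the difference sets that occur in
  strong regularity and in the generators of the ideal.\<close>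

definition basic_open :: "'a::left_cancel_monoid set => 'a set set => ('a set => bool) set" where
 "basic_open X \<X> = {w \<in> Omega. w X \<and> (\<forall>X'\<in>\<X>. \<not> w X')}"

lemma openin_character_cylinder:
 assumes "X \<in> \<J>"
 shows "openin character_topology {w \<in> characters. w X = b}"
proof -
 have "{w \<in> characters. w X = b} = {w \<in> extensional \<J>. w X = b} \<inter> characters"
  using charactersD(1) by auto
 thus ?thesis unfolding character_topology_def using openin_cylinder[OF assms, of b]
  by (auto simp: openin_subtopology)
qed

lemma openin_Omega_cylinder:
 assumes "X \<in> \<J>"
 shows "openin \<O> {w \<in> Omega. w X = b}"
proof -
 have "{w \<in> Omega. w X = b} = {w \<in> characters. w X = b} \<inter> Omega" by auto
 thus ?thesis unfolding Omega_topology_def using openin_character_cylinder[OF assms, of b]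
  by (auto simp: openin_subtopology)
qed

lemma openin_Omega_ideal [simp]:
 "X \<in> \<J> ==> openin \<O> {w \<in> Omega. w X}"
 using openin_Omega_cylinder[of X True] by simp

lemma openin_Omega_not_ideal:
 "X \<in> \<J> ==> openin \<O> {w \<in> Omega. \<not> w X}"
 using openin_Omega_cylinder[of X False] by simp

lemma closedin_Omega_ideal:
 "X \<in> \<J> ==> closedin \<O> {w \<in> Omega. w X}"
proof -
 assume X: "X \<in> \<J>"
 have "Omega - {w \<in> Omega. w X} = {w \<in> Omega. \<not> w X}" by auto
 thus ?thesis using openin_Omega_not_ideal[OF X] by (auto simp: closedin_def)
qed

lemma basic_open_eq:
 "basic_open X \<X> = {w \<in> Omega. w X} \<inter> (Omega - (\<Union>X'\<in>\<X>. {w \<in> Omega. w X'}))"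
 by (auto simp: basic_open_def)

lemma basic_open_clopen:
 assumes "X \<in> \<J>" "finite \<X>" "\<X> \<subseteq> \<J>"
 shows "openin \<O> (basic_open X \<X>)" "closedin \<O> (basic_open X \<X>)"
proof -
 have o: "openin \<O> (\<Union>X'\<in>\<X>. {w \<in> Omega. w X'})" using assms by (intro openin_Union) auto
 have c: "closedin \<O> (\<Union>X'\<in>\<X>. {w \<in> Omega. w X'})"
  using assms by (intro closedin_Union) (auto intro: closedin_Omega_ideal)
 have *: "closedin \<O> Omega" "openin \<O> Omega"
  using closedin_topspace[of \<O>] openin_topspace[of \<O>] by simp_all
 show "openin \<O> (basic_open X \<X>)" unfolding basic_open_eq
  by (intro openin_Int openin_diff openin_Omega_ideal assms * c)
 show "closedin \<O> (basic_open X \<X>)" unfolding basic_open_eq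
  by (intro closedin_Int closedin_diff closedin_Omega_ideal assms * o)
qed

lemma character_neighbourhood:
 assumes W: "openin (product_topology (\<lambda>_. discrete_topology UNIV) \<J>) W"
  and w: "w \<in> W" "w \<in> characters"
 obtains X \<X> where "X \<in> \<J>" "finite \<X>" "\<X> \<subseteq> \<J>"
  "\<forall>X'\<in>\<X>. X' \<subseteq> X" "w X" "\<forall>X'\<in>\<X>. \<not> w X'"
  "{w' \<in> characters. w' X \<and> (\<forall>X'\<in>\<X>. \<not> w' X')} \<subseteq> W"
proof -
 obtain V where V: "finite {i \<in> \<J>. V i \<noteq> UNIV}" "w \<in> Pi\<^sub>E \<J> V"
  "Pi\<^sub>E \<J> V \<subseteq> W"
  using W w(1) by (force simp: openin_product_topology_alt)
 \<comment> \<open>Only finitely many coordinates are constrained. Those where \<open>w\<close> is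
   true are merged into the one ideal \<open>\<Inter>P\<close>, which is \<open>UNIV\<close> if
   there are none; the others are cut down to subsets of it, because foundation sets and strong
   regularity ask for \<open>X' \<subseteq> X\<close>. For a character that takes
   \<open>\<Inter>P\<close>, omitting \<open>\<Inter>P \<inter> i\<close> is the same as omitting
   \<open>i\<close>.\<close>
 define I0 where "I0 = {i \<in> \<J>. V i \<noteq> UNIV}"
 define P where "P = {i \<in> I0. w i}"
 define \<X> where "\<X> = (\<lambda>i. \<Inter>P \<inter> i) ` (I0 - P)"
 have I0: "finite I0" "I0 \<subseteq> \<J>" using V(1) unfolding I0_def by blast+
 have fin: "finite I0" "finite P" "I0 \<subseteq> \<J>" "P \<subseteq> \<J>"
  using I0 unfolding P_def by auto
 have X: "\<Inter>P \<in> \<J>" using Inter_ideal fin by blast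
 have wX: "w (\<Inter>P)" using char_Inter[OF w(2) fin(2,4)] by (simp add: P_def)
 show ?thesis
 proof (rule that[OF X, of \<X>])
  show "finite \<X>" "\<X> \<subseteq> \<J>" "\<forall>X'\<in>\<X>. X' \<subseteq> \<Inter>P"
   using fin X by (auto simp: \<X>_def)
  show "w (\<Inter>P)" by fact
  show "\<forall>X'\<in>\<X>. \<not> w X'"
  proof
   fix X' assume "X' \<in> \<X>"
   then obtain i where i: "i \<in> I0" "i \<notin> P" "X' = \<Inter>P \<inter> i" unfolding \<X>_def by blast
   hence "\<not> w i" by (simp add: P_def)
   thus "\<not> w X'" using i char_Int[OF w(2) X, of i] fin(3) by blast
  qed
  show "{w' \<in> characters. w' (\<Inter>P) \<and> (\<forall>X'\<in>\<X>. \<not> w' X')} \<subseteq> W"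
  proof
   fix w' assume a: "w' \<in> {w' \<in> characters. w' (\<Inter>P) \<and> (\<forall>X'\<in>\<X>. \<not> w' X')}"
   hence c: "w' \<in> characters" by simp
   have "w' i \<in> V i" if i: "i \<in> \<J>" for i
   proof (cases "i \<in> I0")
    case True
    have "w' i = w i"
    proof (cases "i \<in> P")
     case True
     thus ?thesis using char_Inter[OF c fin(2,4)] a by (auto simp: P_def)
    next
     case False
     hence "\<Inter>P \<inter> i \<in> \<X>" using True unfolding \<X>_def by blast
     hence "\<not> w' (\<Inter>P \<inter> i)" using a by blast
     hence "\<not> w' i" using char_Int[OF c X i] a by blast
     thus ?thesis using False True by (simp add: P_def)
    qed
    thus ?thesis using V(2) i by (auto simp: PiE_def)
   next
    case False
    thus ?thesis using i by (simp add: I0_def)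
   qed
   hence "w' \<in> Pi\<^sub>E \<J> V"
    using charactersD(1)[OF c] by (auto simp: PiE_def)
   thus "w' \<in> W" using V(3) by blast
  qed
 qed
qed

lemma Omega_meets_open:
 assumes "w \<in> Omega" "openin character_topology U" "w \<in> U"
 shows "\<exists>s. pt s \<in> U"
proof -
 have "\<forall>T. w \<in> T \<and> openin character_topology T \<longrightarrow> (\<exists>y. y \<in> range pt \<and> y \<in> T)"
  using assms(1) unfolding Omega_def in_closure_of by (rule conjunct2)
 thus ?thesis using assms(2,3) by blast
qed

text \<open>A basic neighbourhood prescribes that \<open>X\<close> is taken and that finitely many
  \<open>X'\<close> are omitted; it contains \<open>pt s\<close> exactly if
  \<open>s \<in> X - \<Union>\<X>\<close>. So the closure that defines \<open>Omega\<close> turns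
  into a condition on subsets of \<open>S\<close>.\<close>

lemma Omega_iff:
 "w \<in> Omega \<longleftrightarrow> w \<in> characters \<and> (\<forall>X\<in>\<J>. \<forall>\<X>. finite \<X> \<and> \<X> \<subseteq> \<J> \<and>
  w X \<and> (\<forall>X'\<in>\<X>. \<not> w X') \<longrightarrow> X - \<Union>\<X> \<noteq> {})"
  (is "_ \<longleftrightarrow> _ \<and> ?R")
proof (intro iffI conjI)
 assume w: "w \<in> Omega"
 thus "w \<in> characters" by simp
 show ?R
 proof (intro ballI allI impI)
  fix X and \<X> :: "'a set set"
  assume X: "X \<in> \<J>"
   and a: "finite \<X> \<and> \<X> \<subseteq> \<J> \<and> w X \<and> (\<forall>X'\<in>\<X>. \<not> w X')"
  let ?U = "{w \<in> characters. w X = True} \<inter> (characters \<inter> (\<Inter>X'\<in>\<X>. {w \<in> characters. w X' = False}))"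
  have "openin character_topology ?U"
  proof (rule openin_Int)
   show "openin character_topology {w \<in> characters. w X = True}"
    using openin_character_cylinder[OF X] .
   have "openin character_topology (topspace character_topology \<inter> (\<Inter>X'\<in>\<X>. {w \<in> characters. w X' = False}))"
    using a openin_character_cylinder[of _ False]
    by (intro openin_Int_Inter) (auto simp del: topspace_character_topology)
   thus "openin character_topology (characters \<inter> (\<Inter>X'\<in>\<X>. {w \<in> characters. w X' = False}))"
    by simp
  qed
  moreover have "w \<in> ?U" using a \<open>w \<in> characters\<close> by auto
  ultimately obtain s where "pt s \<in> ?U"
   using Omega_meets_open[OF w] by meson
  hence "pt s X" "\<forall>X'\<in>\<X>. \<not> pt s X'" by blast+
  hence "s \<in> X - \<Union>\<X>" using X a by (simp add: subset_iff)
  thus "X - \<Union>\<X> \<noteq> {}" by blast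
 qed
next
 assume a: "w \<in> characters \<and> ?R"
 show "w \<in> Omega"
  unfolding Omega_def in_closure_of
 proof (intro conjI allI impI)
  show "w \<in> topspace character_topology" using a by simp
  fix T assume T: "w \<in> T \<and> openin character_topology T"
  then obtain W where W: "openin (product_topology (\<lambda>_. discrete_topology UNIV) \<J>) W"
   "T = W \<inter> characters" unfolding character_topology_def openin_subtopology by blast
  obtain X \<X> where X: "X \<in> \<J>" "finite \<X>" "\<X> \<subseteq> \<J>"
  "\<forall>X'\<in>\<X>. X' \<subseteq> X" "w X" "\<forall>X'\<in>\<X>. \<not> w X'"
  "{w' \<in> characters. w' X \<and> (\<forall>X'\<in>\<X>. \<not> w' X')} \<subseteq> W"
   using character_neighbourhood[OF W(1), of w] T W(2) by blast
  have "X - \<Union>\<X> \<noteq> {}" using a X by blast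
  then obtain s where "s \<in> X - \<Union>\<X>" by blast
  hence "pt s X \<and> (\<forall>X'\<in>\<X>. \<not> pt s X')"
   using X(1,3) by (auto simp: subset_iff)
  hence "pt s \<in> T"
   using X(7) W(2) point_character_in_characters by blast
  thus "\<exists>y. y \<in> range pt \<and> y \<in> T" by blast
 qed
qed

lemma Omega_cylinder_nonempty:
 assumes "w \<in> Omega" "X \<in> \<J>" "finite \<X>" "\<X> \<subseteq> \<J>"
  "w X" "\<forall>X'\<in>\<X>. \<not> w X'"
 shows "X - \<Union>\<X> \<noteq> {}"
 using iffD1[OF Omega_iff assms(1)] assms(2-) by meson

lemma Omega_neighbourhood:
 assumes "openin \<O> U" "w \<in> U"
 obtains X \<X> where "X \<in> \<J>" "finite \<X>" "\<X> \<subseteq> \<J>"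
  "\<forall>X'\<in>\<X>. X' \<subseteq> X" "w \<in> basic_open X \<X>" "basic_open X \<X> \<subseteq> U"
proof -
 obtain W where W: "openin (product_topology (\<lambda>_. discrete_topology UNIV) \<J>) W"
   "U = W \<inter> characters \<inter> Omega"
  using assms(1) unfolding Omega_topology_def character_topology_def openin_subtopology by blast
 show ?thesis
 proof (rule character_neighbourhood[OF W(1), of w])
  show "w \<in> W" "w \<in> characters" using assms W by auto
  fix X \<X> assume X: "X \<in> \<J>" "finite \<X>" "\<X> \<subseteq> \<J>"
  "\<forall>X'\<in>\<X>. X' \<subseteq> X" "w X" "\<forall>X'\<in>\<X>. \<not> w X'"
  "{w' \<in> characters. w' X \<and> (\<forall>X'\<in>\<X>. \<not> w' X')} \<subseteq> W"
  show thesis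
   by (rule that[OF X(1-4)]) (use X assms W in \<open>auto simp: basic_open_def\<close>)
 qed
qed

lemma point_character_Omega [simp]: "pt s \<in> Omega"
proof -
 have "range pt \<subseteq> (Omega :: ('a set => bool) set)"
  unfolding Omega_def by (rule closure_of_subset) (use point_character_in_characters in auto)
 thus ?thesis by blast
qed

text \<open>The instance of \<open>Omega_cylinder_nonempty\<close> with the empty family: point
  characters omit the empty set, and so do their limits.\<close>

lemma Omega_empty:
 fixes w :: "'a::left_cancel_monoid set => bool"
 assumes "w \<in> Omega" "({} :: 'a set) \<in> \<J>"
 shows "\<not> w {}"
proof
 assume "w {}"
 hence "{} - \<Union>{} \<noteq> ({} :: 'a set)"
  by (intro Omega_cylinder_nonempty[OF assms]) simp_all
 thus False by simp
qed

subsection \<open>The partial action on characters\<close>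

lemma push_character_eq [simp]:
 "X \<in> \<J> ==> push g w X \<longleftrightarrow> w (g -` Some ` X)"
 by (simp add: push_character_def)

lemma push_character_extensional: "push g w \<in> extensional \<J>"
 by (simp add: push_character_def)

lemma push_character_characters:
 assumes g: "g \<in> \<I>" and w: "w \<in> characters" "w (dom g)"
 shows "push g w \<in> characters"
proof -
 have "g -` Some ` UNIV = dom g" by auto
 moreover have "g -` Some ` (X \<inter> Y) = g -` Some ` X \<inter> g -` Some ` Y" for X Y by auto
 ultimately show ?thesis
  using UNIV_ideal g w push_character_extensional[of g w] char_Int[OF w(1)] unfolding characters_def
  by (auto intro!: bexI[of _ UNIV])
qed

text \<open>A point of the preimage of \<open>X\<close> outside the preimages of the
  \<open>X'\<close> is mapped by \<open>g\<close> to a point of \<open>X - \<Union>\<X>\<close>, so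
  the criterion \<open>Omega_iff\<close> passes from \<open>w\<close> to its push-forward.\<close>

lemma push_character_Omega:
 assumes g: "g \<in> \<I>" and w: "w \<in> Omega" "w (dom g)"
 shows "push g w \<in> Omega"
 unfolding Omega_iff
proof (intro conjI ballI allI impI)
 show "push g w \<in> characters" by (rule push_character_characters[OF g Omega_char[OF w(1)] w(2)])
 fix X and \<X> :: "'a set set"
 assume X: "X \<in> \<J>" and a: "finite \<X> \<and> \<X> \<subseteq> \<J> \<and>
   push g w X \<and> (\<forall>X'\<in>\<X>. \<not> push g w X')"
 let ?\<Y> = "(\<lambda>X'. g -` Some ` X') ` \<X>"
 have sub: "\<forall>X'\<in>\<X>. X' \<in> \<J>" using a by blast
 hence "finite ?\<Y>" "?\<Y> \<subseteq> \<J>" "g -` Some ` X \<in> \<J>"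
  using a X g by (simp_all add: image_subset_iff)
 moreover have "w (g -` Some ` X)" using a X by simp
 moreover have "\<forall>X'\<in>?\<Y>. \<not> w X'" using a sub push_character_eq[of _ g w] by blast
 ultimately have "g -` Some ` X - \<Union>?\<Y> \<noteq> {}" by (intro Omega_cylinder_nonempty[OF w(1)])
 thus "X - \<Union>\<X> \<noteq> {}" by blast
qed

lemma push_character_comp:
 assumes "g \<in> \<I>"
 shows "push (g \<circ>\<^sub>m h) w = push g (push h w)"
proof -
 have "(g \<circ>\<^sub>m h) -` Some ` X = h -` Some ` (g -` Some ` X)" for X
  by (auto simp: map_comp_Some_iff)
 thus ?thesis using assms by (auto simp: push_character_def restrict_def fun_eq_iff)
qed

lemma push_character_Some: "w \<in> characters ==> push Some w = w"
proof -
 have "Some -` Some ` X = X" for X :: "'a set" by auto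
 thus "w \<in> characters ==> push Some w = w"
  using charactersD(1)[of w] by (auto simp: push_character_def extensional_def fun_eq_iff)
qed

lemma push_character_cong:
 assumes "g \<in> \<I>" "k \<in> \<I>" "w \<in> characters" "A \<in> \<J>" "w A"
  "g |` A = k |` A"
 shows "push g w = push k w"
proof -
 have "g x = k x" if "x \<in> A" for x using fun_cong[OF assms(6), of x] that by simp
 hence "g -` Some ` X \<inter> A = k -` Some ` X \<inter> A" for X by auto
 hence "w (g -` Some ` X) = w (k -` Some ` X)" if "X \<in> \<J>" for X
  using char_Int[OF assms(3), of _ A] assms that by (metis vimage_ideal)
 thus ?thesis by (auto simp: push_character_def restrict_def fun_eq_iff)
qed

lemma push_character_dom_comp:
 assumes "g \<in> \<I>" "k \<in> \<I>"
 shows "push k w (dom g) \<longleftrightarrow> w (dom (g \<circ>\<^sub>m k))"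
 using assms by (simp add: dom_map_comp)

lemma push_character_dom_inverse:
 assumes "g \<in> \<I>"
 shows "push g w (dom (pinv g)) \<longleftrightarrow> w (dom g)"
 using assms by (simp add: vimage_dom_inverse inv_hull)

lemma push_character_inverse:
 assumes "g \<in> \<I>" "w \<in> characters" "w (dom g)"
 shows "push (pinv g) (push g w) = w"
proof -
 let ?k = "pinv g \<circ>\<^sub>m g"
 have "?k |` dom g = Some |` dom g"
  using assms(1) by (auto simp: fun_eq_iff restrict_map_def map_comp_def split: option.splits)
 hence "push ?k w = push Some w"
  using assms by (intro push_character_cong[where A="dom g"]) (auto intro: left_inverse_hull.intros Some_hull)
 thus ?thesis using push_character_comp[of "pinv g" g w] assms push_character_Some
  by (simp add: inv_hull)
qed

lemma push_point_character:
 assumes "g \<in> \<I>" "g s = Some t"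
 shows "push g (pt s) = pt t"
 using assms by (auto simp: push_character_def point_character_def fun_eq_iff restrict_def)

lemma continuous_push_character:
 assumes "g \<in> \<I>"
 shows "continuous_map (subtopology \<O> {w \<in> Omega. w (dom g)}) \<O> (push g)"
proof -
 let ?S = "subtopology \<O> {w \<in> Omega. w (dom g)}"
 have ts: "topspace ?S = {w \<in> Omega. w (dom g)}" by auto
 have 1: "continuous_map ?S (discrete_topology UNIV) (\<lambda>w. push g w X)"
  if X: "X \<in> \<J>" for X
  unfolding continuous_map_def
 proof (intro conjI allI impI)
  fix B :: "bool set"
  have *: "openin ?S {w \<in> topspace ?S. w (g -` Some ` X) = b}" for b
  proof -
   have "{w \<in> topspace ?S. w (g -` Some ` X) = b} = {w \<in> Omega. w (g -` Some ` X) = b} \<inter> {w \<in> Omega. w (dom g)}"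
    by auto
   thus ?thesis using openin_Omega_cylinder[OF vimage_ideal[OF assms X], of b]
    by (auto simp: openin_subtopology)
  qed
  have "{w \<in> topspace ?S. push g w X \<in> B} = (\<Union>b\<in>B. {w \<in> topspace ?S. w (g -` Some ` X) = b})"
   using X by auto
  moreover have "openin ?S \<dots>" by (rule openin_Union) (use * in auto)
  ultimately show "openin ?S {w \<in> topspace ?S. push g w X \<in> B}" by simp
 qed simp
 have im: "push g \<in> topspace ?S \<rightarrow> Omega" using push_character_Omega[OF assms] ts by auto
 have "continuous_map ?S (product_topology (\<lambda>_. discrete_topology UNIV) \<J>) (push g)"
  using 1 push_character_extensional by (auto simp: continuous_map_componentwise)
 thus ?thesis using im Omega_subset_characters
  unfolding Omega_topology_def character_topology_def continuous_map_in_subtopology by auto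
qed

subsection \<open>Maximal filters and the boundary\<close>

lemma ideal_filterD:
 assumes "ideal_filter F"
 shows "F \<noteq> {}" "F \<subseteq> \<J>" "{} \<notin> F"
  "\<And>A B. A \<in> F ==> B \<in> F ==> A \<inter> B \<in> F"
  "\<And>A B. A \<in> F ==> B \<in> \<J> ==> A \<subseteq> B ==> B \<in> F"
 using assms by (simp_all add: ideal_filter_def)

lemma ideal_filter_Omega:
 assumes "w \<in> Omega"
 shows "ideal_filter {X \<in> \<J>. w X}"
proof -
 note c = Omega_char[OF assms]
 show ?thesis
  unfolding ideal_filter_def
 proof (intro conjI ballI impI)
  show "{X \<in> \<J>. w X} \<noteq> {}" using char_UNIV[OF c] UNIV_ideal by blast
  show "{} \<notin> {X \<in> \<J>. w X}" using Omega_empty[OF assms] by blast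
  show "A \<inter> B \<in> {X \<in> \<J>. w X}"
   if "A \<in> {X \<in> \<J>. w X}" "B \<in> {X \<in> \<J>. w X}" for A B
   using that char_Int[OF c, of A B] by simp
  show "B \<in> {X \<in> \<J>. w X}"
   if "A \<in> {X \<in> \<J>. w X}" "B \<in> \<J>" "A \<subseteq> B" for A B
   using that char_mono[OF c, of A B] by simp
 qed simp
qed

text \<open>Otherwise the intersections of \<open>X\<close> with the members of \<open>F\<close> are
  all nonempty and generate a proper filter that contains both \<open>F\<close> and
  \<open>X\<close>, against maximality.\<close>

lemma maximal_filter_disjoint:
 assumes F: "maximal_filter F" and X: "X \<in> \<J>" "X \<notin> F"
 shows "\<exists>Z\<in>F. X \<inter> Z = {}"
proof (rule ccontr)
 assume c: "\<not> (\<exists>Z\<in>F. X \<inter> Z = {})"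
 have f: "ideal_filter F" using F by (simp add: maximal_filter_def)
 define F' where "F' = {Y \<in> \<J>. \<exists>Z\<in>F. X \<inter> Z \<subseteq> Y}"
 hence sub: "F \<subseteq> F'" "X \<in> F'" using X ideal_filterD(1,2)[OF f] unfolding F'_def by blast+
 have "ideal_filter F'"
  unfolding ideal_filter_def
 proof (intro conjI ballI impI)
  show "F' \<noteq> {}" using sub by blast
  show "F' \<subseteq> \<J>" by (auto simp: F'_def)
  show "{} \<notin> F'" using c by (auto simp: F'_def)
  show "A \<inter> B \<in> F'" if AB: "A \<in> F'" "B \<in> F'" for A B
  proof -
   obtain Z1 Z2 where Z: "Z1 \<in> F" "X \<inter> Z1 \<subseteq> A" "Z2 \<in> F" "X \<inter> Z2 \<subseteq> B" using AB by (auto simp: F'_def)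
   hence "Z1 \<inter> Z2 \<in> F" "X \<inter> (Z1 \<inter> Z2) \<subseteq> A \<inter> B" using ideal_filterD(4)[OF f] by blast+
   moreover have "A \<inter> B \<in> \<J>" using AB by (simp add: F'_def)
   ultimately show ?thesis unfolding F'_def by blast
  qed
  show "B \<in> F'" if "A \<in> F'" "B \<in> \<J>" "A \<subseteq> B" for A B
   using that by (auto simp: F'_def)
 qed
 hence "F' = F" using F sub by (auto simp: maximal_filter_def)
 thus False using sub X by blast
qed

text \<open>Iterates \<open>maximal_filter_disjoint\<close> over the family and intersects the
  witnesses. The resulting nonempty ideal is what lets maximal filters detect foundation
  sets.\<close>

lemma maximal_filter_avoid:
 assumes F: "maximal_filter F" and "finite \<X>" "\<X> \<subseteq> \<J>" "\<forall>X'\<in>\<X>. X' \<notin> F" "X \<in> F"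
 shows "\<exists>Y\<in>F. Y \<subseteq> X \<and> (\<forall>X'\<in>\<X>. Y \<inter> X' = {})"
 using assms(2-4)
proof induction
 case empty
 thus ?case using assms(5) by blast
next
 case (insert X' \<X>)
 then obtain Y where Y: "Y \<in> F" "Y \<subseteq> X" "\<forall>X'\<in>\<X>. Y \<inter> X' = {}" by auto
 obtain Z where Z: "Z \<in> F" "X' \<inter> Z = {}" using maximal_filter_disjoint[OF F] insert.prems by blast
 have "Y \<inter> Z \<in> F" using F Y Z by (auto simp: maximal_filter_def ideal_filter_def)
 thus ?case using Y Z by (intro bexI[of _ "Y \<inter> Z"]) auto
qed

text \<open>Zorn's lemma on the filters that contain \<open>X\<close>; a filter maximal among these
  is maximal among all, as every larger filter also contains \<open>X\<close>.\<close>

lemma Omega_max_ex: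
 assumes X: "X \<in> \<J>" "X \<noteq> {}"
 shows "\<exists>w\<in>Omega_max. w X"
proof -
 define \<F> where "\<F> = {F. ideal_filter F \<and> X \<in> F}"
 have ne: "\<F> \<noteq> {}"
 proof -
  have "ideal_filter {Y \<in> \<J>. X \<subseteq> Y}"
   using X by (auto simp: ideal_filter_def)
  thus ?thesis using X unfolding \<F>_def by blast
 qed
 have "\<exists>M\<in>\<F>. \<forall>Z\<in>\<F>. M \<subseteq> Z \<longrightarrow> Z = M"
 proof (rule subset_Zorn_nonempty[OF ne])
  fix C assume C: "C \<noteq> {}" "subset.chain \<F> C"
  have sub: "C \<subseteq> \<F>" using C by (simp add: subset.chain_def)
  have lin: "F \<subseteq> F' \<or> F' \<subseteq> F" if "F \<in> C" "F' \<in> C" for F F'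
   using C that by (auto simp: subset_chain_def)
  have filt: "ideal_filter F" if "F \<in> C" for F using that sub by (auto simp: \<F>_def)
  have XC: "X \<in> \<Union>C" using C(1) sub by (auto simp: \<F>_def)
  have "ideal_filter (\<Union>C)"
   unfolding ideal_filter_def
  proof (intro conjI ballI impI)
   show "\<Union>C \<noteq> {}" using XC by blast
   show "\<Union>C \<subseteq> \<J>" using ideal_filterD(2)[OF filt] by blast
   show "{} \<notin> \<Union>C" using ideal_filterD(3)[OF filt] by blast
   show "A \<inter> B \<in> \<Union>C" if AB: "A \<in> \<Union>C" "B \<in> \<Union>C" for A B
   proof -
    obtain F F' where "F \<in> C" "A \<in> F" "F' \<in> C" "B \<in> F'" using AB by blast
    then obtain F0 where "F0 \<in> C" "A \<in> F0" "B \<in> F0" using lin[of F F'] by blast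
    thus ?thesis using ideal_filterD(4)[OF filt] by blast
   qed
   show "B \<in> \<Union>C" if "A \<in> \<Union>C" "B \<in> \<J>" "A \<subseteq> B" for A B
    using that ideal_filterD(5)[OF filt] by blast
  qed
  thus "\<Union>C \<in> \<F>" using XC by (simp add: \<F>_def)
 qed
 then obtain F where F: "ideal_filter F" "X \<in> F" "\<And>Z. Z \<in> \<F> ==> F \<subseteq> Z ==> Z = F" unfolding \<F>_def by blast
 have max: "maximal_filter F" unfolding maximal_filter_def
  using F by (auto simp: \<F>_def)
 define w where "w = (\<lambda>Y\<in>\<J>. Y \<in> F)"
 have up: "B \<in> F" if "A \<in> F" "B \<in> \<J>" "A \<subseteq> B" for A B
  using that F(1) by (auto simp: ideal_filter_def)
 have "w \<in> characters"
  unfolding characters_def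
 proof (intro CollectI conjI ballI)
  show "w \<in> extensional \<J>" by (simp add: w_def)
  show "\<exists>X\<in>\<J>. w X" using F X by (auto simp: w_def)
  fix A B assume "A \<in> (\<J> :: 'a set set)" "B \<in> (\<J> :: 'a set set)"
  thus "w (A \<inter> B) \<longleftrightarrow> w A \<and> w B"
   using up[of "A \<inter> B"] F(1) by (auto simp: w_def ideal_filter_def)
 qed
 \<comment> \<open>Maximality puts the character into \<open>Omega\<close>: a member of the filter
   inside \<open>A\<close> can be made disjoint from the finitely many \<open>X'\<close> outside the
   filter, and it is nonempty.\<close>
 moreover have "A - \<Union>\<X> \<noteq> {}" if A: "A \<in> \<J>" "finite \<X>" "\<X> \<subseteq> \<J>"
   "w A" "\<forall>X'\<in>\<X>. \<not> w X'" for A \<X>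
 proof -
  have "A \<in> F" "\<forall>X'\<in>\<X>. X' \<notin> F" using A by (auto simp: w_def subset_iff)
  then obtain Y where Y: "Y \<in> F" "Y \<subseteq> A" "\<forall>X'\<in>\<X>. Y \<inter> X' = {}"
   using maximal_filter_avoid[OF max A(2,3)] by blast
  moreover have "Y \<noteq> {}" using Y(1) F(1) by (auto simp: ideal_filter_def)
  ultimately show ?thesis by blast
 qed
 ultimately have "w \<in> Omega" by (intro iffD2[OF Omega_iff]) blast
 moreover have "{Y \<in> \<J>. w Y} = F"
  using F(1) by (auto simp: w_def ideal_filter_def)
 ultimately have "w \<in> Omega_max" using max by (simp add: Omega_max_def)
 moreover have "w X" using X F by (simp add: w_def)
 ultimately show ?thesis by blast
qed

lemma Omega_max_subset: "Omega_max \<subseteq> Omega" by (auto simp: Omega_max_def)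

lemma boundary_subset_Omega: "boundary_Omega \<subseteq> Omega"
 using closure_of_subset_topspace[of \<O>] by (simp add: boundary_Omega_def)

lemma closedin_boundary: "closedin \<O> boundary_Omega"
 by (simp add: boundary_Omega_def)

text \<open>A boundary character that takes \<open>X\<close> and omits every \<open>X'\<close> would
  have the character of a maximal filter nearby that does the same; the member of that filter given
  by \<open>maximal_filter_avoid\<close> is a nonempty ideal inside \<open>X\<close> that misses the
  whole family. Through this property foundation sets act on the boundary, both in the use of
  regularity and in placing the generators of the ideal.\<close>

lemma foundation_set_boundary:
 assumes fs: "foundation_set \<X> X" and w: "w \<in> boundary_Omega" "w X"
 shows "\<exists>X'\<in>\<X>. w X'"
proof (rule ccontr)
 assume c: "\<not> ?thesis"
 have f: "finite \<X>" "\<X> \<subseteq> \<J>" "X \<in> \<J>" using fs by (auto simp: foundation_set_def)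
 have "w \<in> basic_open X \<X>" using c w boundary_subset_Omega by (auto simp: basic_open_def)
 then obtain v where p: "v \<in> Omega_max" "v \<in> basic_open X \<X>"
  using w(1) basic_open_clopen(1)[OF f(3,1,2)] unfolding boundary_Omega_def in_closure_of by blast
 let ?F = "{Y \<in> \<J>. v Y}"
 have max: "maximal_filter ?F" using p by (simp add: Omega_max_def)
 have "\<forall>X'\<in>\<X>. X' \<notin> ?F" "X \<in> ?F" using p f by (auto simp: basic_open_def)
 then obtain Y where Y: "Y \<in> ?F" "Y \<subseteq> X" "\<forall>X'\<in>\<X>. Y \<inter> X' = {}"
  using maximal_filter_avoid[OF max f(1,2)] by blast
 moreover have "Y \<noteq> {}" using Y(1) max by (auto simp: maximal_filter_def ideal_filter_def)
 moreover have "Y \<in> \<J>" using Y(1) by simp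
 moreover have "\<forall>Y\<in>\<J>. Y \<noteq> {} \<and> Y \<subseteq> X \<longrightarrow> (\<exists>X'\<in>\<X>. Y \<inter> X' \<noteq> {})"
  using fs by (simp add: foundation_set_def)
 ultimately have "\<exists>X'\<in>\<X>. Y \<inter> X' \<noteq> {}" using Y(2) by meson
 thus False using Y(3) by blast
qed

text \<open>Converse direction: a nonempty \<open>Y\<close> inside \<open>X\<close> is taken by the
  character of a maximal filter, which lies in the boundary and hence takes some \<open>X'\<close>,
  so that \<open>Y\<close> and \<open>X'\<close> meet. It produces foundation sets from compact sets
  of characters off the boundary.\<close>

lemma foundation_set_if_disjoint_boundary:
 assumes X: "X \<in> \<J>" "finite \<X>" "\<X> \<subseteq> \<J>" "\<forall>X'\<in>\<X>. X' \<subseteq> X"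
  and disj: "basic_open X \<X> \<inter> boundary_Omega = {}"
 shows "foundation_set \<X> X"
 unfolding foundation_set_def
proof (intro conjI ballI impI)
 fix Y assume Y: "Y \<in> \<J>" "Y \<noteq> {} \<and> Y \<subseteq> X"
 then obtain w where w: "w \<in> Omega_max" "w Y" using Omega_max_ex by blast
 have wO: "w \<in> Omega" using w Omega_max_subset by blast
 have "Omega_max \<subseteq> boundary_Omega" unfolding boundary_Omega_def
  by (rule closure_of_subset) (use Omega_max_subset in auto)
 hence "w \<notin> basic_open X \<X>" using disj w by blast
 moreover have "w X" using char_mono[OF Omega_char[OF wO] Y(1) X(1) w(2)] Y(2) by blast
 ultimately obtain X' where X': "X' \<in> \<X>" "w X'" using wO by (auto simp: basic_open_def)
 have X'J: "X' \<in> \<J>" using X' X by blast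
 have "w (Y \<inter> X')" using char_Int[OF Omega_char[OF wO] Y(1) X'J] w X' by blast
 hence "Y \<inter> X' \<noteq> {}" using Omega_empty[OF wO] Int_ideal[OF Y(1) X'J] by metis
 thus "\<exists>X'\<in>\<X>. Y \<inter> X' \<noteq> {}" using X' by blast
qed (use X in auto)

lemma push_character_Omega_max:
 assumes g: "g \<in> \<I>" and w: "w \<in> Omega_max" "w (dom g)"
 shows "push g w \<in> Omega_max"
proof -
 have wO: "w \<in> Omega" using w Omega_max_subset by blast
 have pO: "push g w \<in> Omega" using push_character_Omega[OF g wO w(2)] .
 let ?F = "{X \<in> \<J>. w X}"
 let ?G = "{X \<in> \<J>. push g w X}"
 have max: "maximal_filter ?F" using w by (simp add: Omega_max_def)
 have "F' = ?G" if F': "ideal_filter F'" "?G \<subseteq> F'" for F'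
 proof (rule ccontr)
  assume "F' \<noteq> ?G"
  then obtain Y where Y: "Y \<in> F'" "Y \<notin> ?G" using F' by blast
  hence YJ: "Y \<in> \<J>" using F' by (auto simp: ideal_filter_def)
  hence "\<not> w (g -` Some ` Y)" using Y by simp
  then obtain Z where Z: "Z \<in> \<J>" "w Z" "g -` Some ` Y \<inter> Z = {}"
   using maximal_filter_disjoint[OF max, of "g -` Some ` Y"] g YJ by auto
  \<comment> \<open>The image of \<open>Z\<close> under \<open>g\<close>, written as a preimage
    under the inverse. The push-forward takes it, and it misses \<open>Y\<close> because
    \<open>Z\<close> misses the preimage of \<open>Y\<close>.\<close>
  let ?Z = "pinv g -` Some ` Z"
  have "g -` Some ` ?Z = dom g \<inter> Z"
   by (auto simp: dom_def partial_inverse_iff[OF g] vimage_def image_iff dest: hull_inj[OF g])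
  hence "w (g -` Some ` ?Z)" using char_Int[of w "dom g" Z] wO w Z g by simp
  hence "?Z \<in> ?G" using g Z by (simp add: inv_hull)
  hence "?Z \<inter> Y \<in> F'" using F' Y by (auto simp: ideal_filter_def)
  moreover have "?Z \<inter> Y = {}" using Z(3) g by force
  ultimately show False using F' by (auto simp: ideal_filter_def)
 qed
 hence "maximal_filter ?G" using ideal_filter_Omega[OF pO] unfolding maximal_filter_def by blast
 thus ?thesis using pO by (simp add: Omega_max_def)
qed

text \<open>Push-forward is continuous on an open set of characters and preserves
  \<open>Omega_max\<close>, hence also its closure.\<close>

lemma push_character_boundary:
 assumes g: "g \<in> \<I>" and w: "w \<in> boundary_Omega" "w (dom g)"
 shows "push g w \<in> boundary_Omega"
 unfolding boundary_Omega_def in_closure_of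
proof (intro conjI allI impI)
 have wO: "w \<in> Omega" using w boundary_subset_Omega by blast
 show "push g w \<in> topspace \<O>" using push_character_Omega[OF g wO w(2)] by simp
 fix T assume T: "push g w \<in> T \<and> openin \<O> T"
 let ?D = "{w \<in> Omega. w (dom g)}"
 let ?V = "{w \<in> topspace (subtopology \<O> ?D). push g w \<in> T}"
 have "openin (subtopology \<O> ?D) ?V"
  using openin_continuous_map_preimage[OF continuous_push_character[OF g]] T by blast
 hence V: "openin \<O> ?V"
  by (rule openin_trans_full) (rule openin_Omega_ideal[OF dom_hull[OF g]])
 have "w \<in> ?V" using wO w(2) T by simp
 moreover have "\<forall>T. w \<in> T \<and> openin \<O> T \<longrightarrow> (\<exists>y. y \<in> Omega_max \<and> y \<in> T)"
  using w(1) unfolding boundary_Omega_def in_closure_of by (rule conjunct2)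
 ultimately obtain v where "v \<in> Omega_max" "v \<in> ?V" using V by meson
 hence "v \<in> Omega_max" "v (dom g)" "push g v \<in> T" by simp_all
 thus "\<exists>y. y \<in> Omega_max \<and> y \<in> T" using push_character_Omega_max[OF g] by blast
qed

declare push_character_eq [simp del]

lemma infsum_single:
 fixes f :: "'b => 'c::{comm_monoid_add, t2_space}"
 assumes "\<And>j. j \<noteq> i ==> j \<in> A ==> f j = 0"
 shows "infsum f A = (if i \<in> A then f i else 0)"
proof -
 have "infsum f A = infsum f (A \<inter> {i})" by (rule infsum_cong_neutral) (use assms in auto)
 thus ?thesis by simp
qed

section \<open>Germs and the structure maps of the groupoid\<close>

lemma germ_pairs_iff [simp]:
 "(g, w) \<in> germ_pairs \<longleftrightarrow> g \<in> \<I> \<and> w \<in> Omega \<and> w (dom g)"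
 by (simp add: germ_pairs_def)

lemma germ_rel_iff:
 "((g, w), (k, v)) \<in> germ_rel \<longleftrightarrow> (g, w) \<in> germ_pairs \<and> (k, v) \<in> germ_pairs \<and> w = v \<and>
  (\<exists>A\<in>\<J>. w A \<and> g |` A = k |` A)"
 by (simp add: germ_rel_def)

lemma restrict_map_eq_iff: "g |` A = k |` A \<longleftrightarrow> (\<forall>x\<in>A. g x = k x)"
 by (auto simp: fun_eq_iff restrict_map_def)

lemma equiv_germ_rel:
 "equiv (germ_pairs :: (('a::left_cancel_monoid \<rightharpoonup> 'a) \<times> ('a set => bool)) set) germ_rel"
proof (rule equivI)
 let ?r = "germ_rel :: ((('a \<rightharpoonup> 'a) \<times> ('a set => bool)) \<times> (('a \<rightharpoonup> 'a) \<times> ('a set => bool))) set"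
 show "?r \<subseteq> germ_pairs \<times> germ_pairs" unfolding germ_rel_def by blast
 show "refl_on germ_pairs ?r"
 proof (rule refl_onI)
  fix p :: "('a \<rightharpoonup> 'a) \<times> ('a set => bool)" assume "p \<in> germ_pairs"
  thus "(p, p) \<in> germ_rel"
   by (cases p) (auto simp: germ_rel_iff intro!: bexI[of _ UNIV] dest: char_UNIV[OF Omega_char])
 qed
 show "sym ?r"
  by (rule symI) (auto simp: germ_rel_def)
 show "trans ?r"
 proof (rule transI)
  fix p q r :: "('a \<rightharpoonup> 'a) \<times> ('a set => bool)"
  assume pq: "(p, q) \<in> germ_rel" and qr: "(q, r) \<in> germ_rel"
  obtain g w k v l t where e: "p = (g, w)" "q = (k, v)" "r = (l, t)" by (metis surj_pair)
  obtain A where A: "A \<in> \<J>" "w A" "g |` A = k |` A" using pq unfolding e germ_rel_iff by blast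
  obtain B where B: "B \<in> \<J>" "v B" "k |` B = l |` B" using qr unfolding e germ_rel_iff by blast
  have w: "w = v" "v = t" "(g, w) \<in> germ_pairs" "(l, t) \<in> germ_pairs" using pq qr unfolding e germ_rel_iff by blast+
  hence "w \<in> characters" by simp
  hence "w (A \<inter> B)" using A B w char_Int by blast
  moreover have "g |` (A \<inter> B) = l |` (A \<inter> B)" using A(3) B(3) unfolding restrict_map_eq_iff by simp
  ultimately show "(p, r) \<in> germ_rel" unfolding e germ_rel_iff using w A(1) B(1) Int_ideal by blast
 qed
qed

lemma germ_eq_iff:
 assumes "(g, w) \<in> germ_pairs" "(k, v) \<in> germ_pairs"
 shows "germ g w = germ k v \<longleftrightarrow> w = v \<and> (\<exists>A\<in>\<J>. w A \<and> (\<forall>x\<in>A. g x = k x))"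
proof -
 have "germ g w = germ k v \<longleftrightarrow> ((g, w), (k, v)) \<in> germ_rel"
  unfolding germ_def using eq_equiv_class_iff[OF equiv_germ_rel assms] .
 thus ?thesis unfolding germ_rel_iff restrict_map_eq_iff using assms by blast
qed

lemma mem_germ_iff: "(k, v) \<in> germ g w \<longleftrightarrow> ((g, w), (k, v)) \<in> germ_rel"
 by (simp add: germ_def)

lemma mem_germ_self: "(g, w) \<in> germ_pairs ==> (g, w) \<in> germ g w"
 unfolding germ_def by (rule equiv_class_self[OF equiv_germ_rel])

lemma mem_germD:
 assumes "(k, v) \<in> germ g w"
 shows "v = w" "(k, w) \<in> germ_pairs" "(g, w) \<in> germ_pairs" "germ k w = germ g w"
proof -
 have r: "((g, w), (k, v)) \<in> germ_rel" using assms mem_germ_iff by blast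
 thus 1: "v = w" "(k, w) \<in> germ_pairs" "(g, w) \<in> germ_pairs" unfolding germ_rel_iff by blast+
 show "germ k w = germ g w" using equiv_class_eq[OF equiv_germ_rel r] 1 unfolding germ_def by simp
qed

definition char_of :: "'a::left_cancel_monoid germ => 'a set => bool" where
 "char_of z = (THE w. \<exists>g. (g, w) \<in> z)"

text \<open>A chosen representative allows operations on arrows to be written as functions; the
  congruence lemmas for germs show that the choice does not matter. \<open>char_of\<close> involves
  no choice, since equivalent pairs share their character.\<close>

definition rep_of :: "'a::left_cancel_monoid germ => ('a \<rightharpoonup> 'a)" where
 "rep_of z = (SOME g. (g, char_of z) \<in> z)"

definition range_char :: "'a::left_cancel_monoid germ => 'a set => bool" where
 "range_char z = push (rep_of z) (char_of z)"

lemma char_of_germ [simp]: "(g, w) \<in> germ_pairs ==> char_of (germ g w) = w"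
 unfolding char_of_def by (rule the_equality) (use mem_germ_self mem_germD(1) in blast)+

lemma rep_of_germ:
 assumes "(g, w) \<in> germ_pairs"
 shows "(rep_of (germ g w), w) \<in> germ_pairs" "germ (rep_of (germ g w)) w = germ g w"
proof -
 have "(rep_of (germ g w), w) \<in> germ g w"
  unfolding rep_of_def char_of_germ[OF assms]
  by (rule someI[of "\<lambda>k. (k, w) \<in> germ g w", OF mem_germ_self[OF assms]])
 thus "(rep_of (germ g w), w) \<in> germ_pairs" "germ (rep_of (germ g w)) w = germ g w"
  using mem_germD by blast+
qed

lemma germ_eqE:
 assumes "(g, w) \<in> germ_pairs" "(k, w) \<in> germ_pairs" "germ g w = germ k w"
 obtains A where "A \<in> \<J>" "w A" "\<And>x. x \<in> A ==> g x = k x"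
 using assms germ_eq_iff by blast

lemma germ_eqI:
 assumes "(g, w) \<in> germ_pairs" "(k, w) \<in> germ_pairs" "A \<in> \<J>" "w A" "\<And>x. x \<in> A ==> g x = k x"
 shows "germ g w = germ k w"
 using assms germ_eq_iff by blast

lemma push_character_germ_cong:
 assumes "(g, w) \<in> germ_pairs" "(k, w) \<in> germ_pairs" "germ g w = germ k w"
 shows "push g w = push k w"
proof -
 obtain A where A: "A \<in> \<J>" "w A" "\<And>x. x \<in> A ==> g x = k x"
  using germ_eqE[OF assms] by blast
 show ?thesis
  by (rule push_character_cong[where A = A]) (use assms A in \<open>auto simp: restrict_map_eq_iff\<close>)
qed

lemma range_char_germ [simp]:
 assumes "(g, w) \<in> germ_pairs"
 shows "range_char (germ g w) = push g w"
 unfolding range_char_def char_of_germ[OF assms]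
 using push_character_germ_cong[OF rep_of_germ(1)[OF assms] assms rep_of_germ(2)[OF assms]] .

lemma germ_pairs_comp_iff:
 assumes "g \<in> \<I>" "(h, v) \<in> germ_pairs"
 shows "(g \<circ>\<^sub>m h, v) \<in> germ_pairs \<longleftrightarrow> (g, push h v) \<in> germ_pairs"
proof -
 have h: "h \<in> \<I>" "v \<in> Omega" "v (dom h)" using assms(2) by simp_all
 show ?thesis
  using push_character_Omega[OF h] push_character_dom_comp[OF assms(1) h(1), of v] h assms(1) comp_hull[OF assms(1) h(1)]
  by simp
qed

lemma germ_comp_cong:
 assumes g: "(g, push h v) \<in> germ_pairs" "(g', push h v) \<in> germ_pairs"
   "germ g (push h v) = germ g' (push h v)"
  and h: "(h, v) \<in> germ_pairs" "(h', v) \<in> germ_pairs" "germ h v = germ h' v"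
 shows "germ (g \<circ>\<^sub>m h) v = germ (g' \<circ>\<^sub>m h') v"
proof -
 obtain A where A: "A \<in> \<J>" "push h v A" "\<And>x. x \<in> A ==> g x = g' x"
  using germ_eqE[OF g] by blast
 obtain B where B: "B \<in> \<J>" "v B" "\<And>x. x \<in> B ==> h x = h' x"
  using germ_eqE[OF h] by blast
 have hg: "h \<in> \<I>" "v \<in> characters" using h by simp_all
 have p: "push h v = push h' v" using push_character_germ_cong[OF h] .
 have 1: "(g \<circ>\<^sub>m h, v) \<in> germ_pairs" using germ_pairs_comp_iff[OF _ h(1), of g] g by simp
 have 2: "(g' \<circ>\<^sub>m h', v) \<in> germ_pairs" using germ_pairs_comp_iff[OF _ h(2), of g'] g p by simp
 show ?thesis
 proof (rule germ_eqI[OF 1 2, of "h -` Some ` A \<inter> B"])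
  show "h -` Some ` A \<inter> B \<in> \<J>" using A B hg by simp
  show "v (h -` Some ` A \<inter> B)" using A B hg char_Int[OF hg(2)] by (simp add: push_character_eq)
  fix x assume "x \<in> h -` Some ` A \<inter> B"
  then obtain y where "h x = Some y" "y \<in> A" "h' x = Some y" using B(3)[of x] by auto
  thus "(g \<circ>\<^sub>m h) x = (g' \<circ>\<^sub>m h') x" using A(3) by (simp add: map_comp_def)
 qed
qed

lemma germ_inverse_pair:
 assumes "(g, w) \<in> germ_pairs"
 shows "(pinv g, push g w) \<in> germ_pairs"
 using assms push_character_Omega[of g w] push_character_dom_inverse[of g w] by (simp add: inv_hull)

lemma germ_inverse_cong:
 assumes "(g, w) \<in> germ_pairs" "(k, w) \<in> germ_pairs" "germ g w = germ k w"
 shows "germ (pinv g) (push g w) = germ (pinv k) (push k w)"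
proof -
 obtain A where A: "A \<in> \<J>" "w A" "\<And>x. x \<in> A ==> g x = k x"
  using germ_eqE[OF assms] by blast
 have p: "push g w = push k w" using push_character_germ_cong[OF assms] .
 have gk: "g \<in> \<I>" "k \<in> \<I>" "w \<in> characters" "w (dom g)" using assms by simp_all
 let ?B = "pinv g -` Some ` A"
 show ?thesis unfolding p[symmetric]
 proof (rule germ_eqI[of _ _ _ ?B])
  show "(pinv g, push g w) \<in> germ_pairs" by (rule germ_inverse_pair[OF assms(1)])
  show "(pinv k, push g w) \<in> germ_pairs" unfolding p by (rule germ_inverse_pair[OF assms(2)])
  show B: "?B \<in> \<J>" using gk A by (simp add: inv_hull)
  have "g -` Some ` ?B = dom g \<inter> A"
   by (auto simp: dom_def partial_inverse_iff[OF gk(1)] vimage_def image_iff dest: hull_inj[OF gk(1)])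
  thus "push g w ?B" using B char_Int[OF gk(3), of "dom g" A] gk A by (simp add: push_character_eq)
  fix x assume "x \<in> ?B"
  then obtain y where y: "y \<in> A" "g y = Some x" using gk(1) by auto
  hence "k y = Some x" using A(3) by simp
  hence "pinv g x = Some y" "pinv k x = Some y" using y gk by simp_all
  thus "pinv g x = pinv k x" by simp
 qed
qed

lemma unit_germ_pair [simp]: "w \<in> Omega ==> (Some, w) \<in> germ_pairs"
 using char_UNIV[of w] Some_hull by (simp add: dom_def)

lemma unit_germ_inj: "w \<in> Omega ==> v \<in> Omega ==> unit_germ w = unit_germ v \<longleftrightarrow> w = v"
 unfolding unit_germ_def by (metis char_of_germ unit_germ_pair)

lemma arrows_groupoid_P: "arrows \<G> = {germ g w | g w. (g, w) \<in> germ_pairs}"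
proof -
 have "\<Union>{germ_bisection g U | g U. g \<in> \<I> \<and> openin \<O> U \<and> (\<forall>w\<in>U. w (dom g))} =
  {germ g w | g w. (g, w) \<in> germ_pairs}" (is "\<Union>?D = ?A")
 proof (intro subset_antisym subsetI)
  fix z assume "z \<in> \<Union>?D"
  then obtain g U w where "g \<in> \<I>" "openin \<O> U" "\<forall>w\<in>U. w (dom g)" "w \<in> U" "z = germ g w"
   unfolding germ_bisection_def by blast
  thus "z \<in> ?A" using openin_subset[of \<O> U] by auto
 next
  fix z assume "z \<in> ?A"
  then obtain g w where g: "g \<in> \<I>" "w \<in> Omega" "w (dom g)" "z = germ g w" by auto
  hence "germ_bisection g {w \<in> Omega. w (dom g)} \<in> ?D" using openin_Omega_ideal[OF dom_hull[OF g(1)]] by blast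
  moreover have "z \<in> germ_bisection g {w \<in> Omega. w (dom g)}" using g by (auto simp: germ_bisection_def)
  ultimately show "z \<in> \<Union>?D" by blast
 qed
 thus ?thesis by (simp add: arrows_def groupoid_P_def topology_generated_by_topspace)
qed

lemma arrowE:
 assumes "z \<in> arrows \<G>"
 obtains g w where "(g, w) \<in> germ_pairs" "z = germ g w"
 using assms unfolding arrows_groupoid_P by blast

lemma germ_arrow [simp]: "(g, w) \<in> germ_pairs ==> germ g w \<in> arrows \<G>"
 unfolding arrows_groupoid_P by blast

lemma src_germ:
 assumes "(g, w) \<in> germ_pairs" shows "src \<G> (germ g w) = unit_germ w"
proof -
 have "(\<Union>(k, v)\<in>germ g w. unit_germ v) = unit_germ w"
  using mem_germ_self[OF assms] mem_germD(1)[of _ _ g w] by blast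
 thus ?thesis by (simp add: groupoid_P_def)
qed

lemma rng_germ:
 assumes "(g, w) \<in> germ_pairs" shows "rng \<G> (germ g w) = unit_germ (push g w)"
proof -
 have *: "push k v = push g w" if "(k, v) \<in> germ g w" for k v
  using push_character_germ_cong[of k w g] mem_germD[OF that] by blast
 have "(\<Union>(k, v)\<in>germ g w. unit_germ (push k v)) = unit_germ (push g w)"
 proof (rule UN_constant_eq[OF mem_germ_self[OF assms]], rule ballI)
  fix p assume "p \<in> germ g w"
  thus "(case p of (k, v) => unit_germ (push k v)) = unit_germ (push g w)"
   using * by (cases p) simp
 qed
 thus ?thesis by (simp add: groupoid_P_def)
qed

lemma ginv_germ:
 assumes "(g, w) \<in> germ_pairs"
 shows "ginv \<G> (germ g w) = germ (pinv g) (push g w)"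
proof -
 have *: "germ (pinv k) (push k v) = germ (pinv g) (push g w)"
  if "(k, v) \<in> germ g w" for k v
  using germ_inverse_cong[of k w g] mem_germD[OF that] by blast
 have "(\<Union>(k, v)\<in>germ g w. germ (pinv k) (push k v)) = germ (pinv g) (push g w)"
 proof (rule UN_constant_eq[OF mem_germ_self[OF assms]], rule ballI)
  fix p assume "p \<in> germ g w"
  thus "(case p of (k, v) => germ (pinv k) (push k v)) = germ (pinv g) (push g w)"
   using * by (cases p) simp
 qed
 thus ?thesis by (simp add: groupoid_P_def)
qed

lemma gmul_germ:
 assumes "(g, w) \<in> germ_pairs" "(h, v) \<in> germ_pairs" "w = push h v"
 shows "gmul \<G> (germ g w) (germ h v) = germ (g \<circ>\<^sub>m h) v"
proof -
 let ?f = "\<lambda>(k, w') (l, v'). if w' = push l v' then germ (k \<circ>\<^sub>m l) v' else {}"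
 have *: "?f p q = germ (g \<circ>\<^sub>m h) v" if p: "p \<in> germ g w" and q: "q \<in> germ h v" for p q
 proof -
  obtain k w' l v' where e: "p = (k, w')" "q = (l, v')" by (metis surj_pair)
  note P = mem_germD[OF p[unfolded e]] and Q = mem_germD[OF q[unfolded e]]
  have pp: "push l v = push h v" using push_character_germ_cong[OF Q(2,3,4)] .
  have "germ (k \<circ>\<^sub>m l) v = germ (g \<circ>\<^sub>m h) v"
   by (rule germ_comp_cong[OF _ _ _ Q(2,3,4)]) (use P assms(3) pp in simp_all)
  thus ?thesis using P(1) Q(1) assms(3) pp by (simp add: e)
 qed
 have "(\<Union>p\<in>germ g w. \<Union>q\<in>germ h v. ?f p q) = (\<Union>p\<in>germ g w. germ (g \<circ>\<^sub>m h) v)"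
 proof (rule SUP_cong[OF refl])
  fix p assume "p \<in> germ g w"
  thus "(\<Union>q\<in>germ h v. ?f p q) = germ (g \<circ>\<^sub>m h) v"
   by (intro UN_constant_eq[OF mem_germ_self[OF assms(2)]] ballI *)
 qed
 also have "\<dots> = germ (g \<circ>\<^sub>m h) v" by (rule UN_constant_eq[OF mem_germ_self[OF assms(1)]]) simp
 finally have "(\<Union>p\<in>germ g w. \<Union>q\<in>germ h v. ?f p q) = germ (g \<circ>\<^sub>m h) v" .
 thus ?thesis by (simp add: groupoid_P_def case_prod_unfold)
qed

subsection \<open>The action of the inverse hull on arrows\<close>

text \<open>Left multiplication by the germ of \<open>g\<close> at the range of the arrow, defined
  when that range character takes \<open>dom g\<close>. Convolution with a function carried by the
  germs of one \<open>g\<close> amounts to this partial permutation of arrows, so operators can be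
  computed without sums over fibres.\<close>

definition act :: "('a::left_cancel_monoid \<rightharpoonup> 'a) => 'a germ => 'a germ option" where
 "act g z = (if char_of z (dom (g \<circ>\<^sub>m rep_of z)) then Some (germ (g \<circ>\<^sub>m rep_of z) (char_of z)) else None)"

lemma act_germ:
 assumes g: "g \<in> \<I>" and k: "(k, w) \<in> germ_pairs"
 shows "act g (germ k w) = (if w (dom (g \<circ>\<^sub>m k)) then Some (germ (g \<circ>\<^sub>m k) w) else None)"
proof -
 let ?r = "rep_of (germ k w)"
 note r = rep_of_germ[OF k]
 have pc: "push ?r w = push k w" by (rule push_character_germ_cong[OF r(1) k r(2)])
 have "w (dom (g \<circ>\<^sub>m ?r)) \<longleftrightarrow> w (dom (g \<circ>\<^sub>m k))"
  using push_character_dom_comp[OF g, of ?r w] push_character_dom_comp[OF g, of k w] r(1) k pc by simp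
 moreover have "germ (g \<circ>\<^sub>m ?r) w = germ (g \<circ>\<^sub>m k) w" if "w (dom (g \<circ>\<^sub>m ?r))"
 proof -
  have "(g, push ?r w) \<in> germ_pairs"
   using push_character_dom_comp[OF g, of ?r w] r(1) push_character_Omega[of ?r w] that g by simp
  thus ?thesis by (intro germ_comp_cong[OF _ _ _ r(1) k r(2)]) simp_all
 qed
 ultimately show ?thesis by (simp add: act_def char_of_germ[OF k])
qed

lemma germ_comp_pair:
 assumes "g \<in> \<I>" "(k, w) \<in> germ_pairs" "w (dom (g \<circ>\<^sub>m k))"
 shows "(g \<circ>\<^sub>m k, w) \<in> germ_pairs"
 using assms by (simp add: comp_hull)

lemma act_SomeD:
 assumes g: "g \<in> \<I>" and z: "z \<in> arrows \<G>" and a: "act g z = Some d"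
 shows "d \<in> arrows \<G>" "char_of d = char_of z" "range_char d = push g (range_char z)"
  "act (pinv g) d = Some z"
proof -
 obtain k w where k: "(k, w) \<in> germ_pairs" "z = germ k w" using arrowE[OF z] .
 have d: "w (dom (g \<circ>\<^sub>m k))" "d = germ (g \<circ>\<^sub>m k) w" using a act_germ[OF g k(1)] k(2) by (auto split: if_splits)
 note p = germ_comp_pair[OF g k(1) d(1)]
 show "d \<in> arrows \<G>" "char_of d = char_of z" unfolding d k(2) using p k(1) by (simp_all only: germ_arrow char_of_germ)
 show "range_char d = push g (range_char z)"
  unfolding d k(2) range_char_germ[OF p] range_char_germ[OF k(1)] by (rule push_character_comp[OF g])
 have gi: "pinv g \<in> \<I>" using g by (rule inv_hull)
 have dom: "dom (pinv g \<circ>\<^sub>m (g \<circ>\<^sub>m k)) = dom (g \<circ>\<^sub>m k)"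
  using g by (auto simp: dom_def map_comp_Some_iff)
 have "act (pinv g) d = Some (germ (pinv g \<circ>\<^sub>m (g \<circ>\<^sub>m k)) w)"
  unfolding d act_germ[OF gi p] dom using d(1) by simp
 also have "germ (pinv g \<circ>\<^sub>m (g \<circ>\<^sub>m k)) w = germ k w"
 proof (rule germ_eqI[where A = "dom (g \<circ>\<^sub>m k)"])
  show "(pinv g \<circ>\<^sub>m (g \<circ>\<^sub>m k), w) \<in> germ_pairs" by (rule germ_comp_pair[OF gi p]) (simp add: dom d)
  show "(pinv g \<circ>\<^sub>m (g \<circ>\<^sub>m k)) x = k x" if "x \<in> dom (g \<circ>\<^sub>m k)" for x
   using that g by (auto simp: map_comp_def split: option.splits)
 qed (use p d k in simp_all)
 finally show "act (pinv g) d = Some z" using k by simp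
qed

lemma act_inverse_iff:
 assumes g: "g \<in> \<I>" and z: "z \<in> arrows \<G>" "d \<in> arrows \<G>"
 shows "act (pinv g) d = Some z \<longleftrightarrow> act g z = Some d"
 using act_SomeD(4)[OF g z(1), of d] act_SomeD(4)[OF inv_hull[OF g] z(2), of z]
  partial_inverse_partial_inverse[OF g] by auto

lemma act_defined_iff:
 assumes g: "g \<in> \<I>" and z: "z \<in> arrows \<G>"
 shows "act g z \<noteq> None \<longleftrightarrow> range_char z (dom g)"
proof -
 obtain k w where k: "(k, w) \<in> germ_pairs" "z = germ k w" using arrowE[OF z] .
 hence "k \<in> \<I>" by simp
 thus ?thesis unfolding k(2) act_germ[OF g k(1)] range_char_germ[OF k(1)] push_character_dom_comp[OF g \<open>k \<in> _\<close>]
  by simp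
qed

lemma act_comp:
 assumes g: "g \<in> \<I>" and h: "h \<in> \<I>" and z: "z \<in> arrows \<G>"
 shows "act (g \<circ>\<^sub>m h) z = (case act h z of None => None | Some d => act g d)"
proof -
 obtain k w where k: "(k, w) \<in> germ_pairs" "z = germ k w" using arrowE[OF z] .
 have assoc: "(g \<circ>\<^sub>m h) \<circ>\<^sub>m k = g \<circ>\<^sub>m (h \<circ>\<^sub>m k)" by (simp add: map_comp_def fun_eq_iff split: option.splits)
 show ?thesis
 proof (cases "w (dom (h \<circ>\<^sub>m k))")
  case True
  thus ?thesis unfolding k(2) act_germ[OF h k(1)] act_germ[OF comp_hull[OF g h] k(1)]
   using act_germ[OF g germ_comp_pair[OF h k(1) True]] assoc by simp
 next
  case False
  have "\<not> w (dom (g \<circ>\<^sub>m (h \<circ>\<^sub>m k)))"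
  proof
   assume a: "w (dom (g \<circ>\<^sub>m (h \<circ>\<^sub>m k)))"
   have "dom (g \<circ>\<^sub>m (h \<circ>\<^sub>m k)) \<subseteq> dom (h \<circ>\<^sub>m k)" by (auto simp: dom_def map_comp_Some_iff)
   moreover have "w \<in> characters" "k \<in> \<I>" using k(1) by simp_all
   ultimately have "w (dom (h \<circ>\<^sub>m k))"
    using char_mono a g h by (meson dom_hull comp_hull)
   thus False using False by simp
  qed
  thus ?thesis unfolding k(2) act_germ[OF h k(1)] act_germ[OF comp_hull[OF g h] k(1)] assoc
   using False by simp
 qed
qed

lemma src_arrow: "z \<in> arrows \<G> ==> src \<G> z = unit_germ (char_of z)"
 by (metis arrowE char_of_germ src_germ)

lemma rng_arrow: "z \<in> arrows \<G> ==> rng \<G> z = unit_germ (range_char z)"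
 by (metis arrowE range_char_germ rng_germ)

lemma char_of_Omega [simp]: "z \<in> arrows \<G> ==> char_of z \<in> Omega"
 by (metis arrowE char_of_germ germ_pairs_iff)

lemma range_char_Omega [simp]: "z \<in> arrows \<G> ==> range_char z \<in> Omega"
 by (metis arrowE range_char_germ germ_pairs_iff push_character_Omega)

subsection \<open>Restriction to an invariant set of characters\<close>

definition invariant_chars :: "('a::left_cancel_monoid set => bool) set => bool" where
 "invariant_chars Y \<longleftrightarrow> Y \<subseteq> Omega \<and> (\<forall>g\<in>\<I>. \<forall>w\<in>Y. w (dom g) \<longrightarrow> push g w \<in> Y)"

lemma invariant_Omega: "invariant_chars Omega"
 using push_character_Omega by (auto simp: invariant_chars_def)

lemma invariant_boundary: "invariant_chars boundary_Omega"
 using push_character_boundary boundary_subset_Omega by (auto simp: invariant_chars_def)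

lemma invariant_charsD:
 assumes "invariant_chars Y"
 shows "Y \<subseteq> Omega" "\<And>g w. g \<in> \<I> ==> w \<in> Y ==> w (dom g) ==> push g w \<in> Y"
 using assms by (simp_all add: invariant_chars_def)

lemma range_char_invariant_iff:
 assumes Y: "invariant_chars Y" and z: "z \<in> arrows \<G>"
 shows "range_char z \<in> Y \<longleftrightarrow> char_of z \<in> Y"
proof -
 obtain k w where k: "(k, w) \<in> germ_pairs" "z = germ k w" using arrowE[OF z] .
 have k': "k \<in> \<I>" "w \<in> Omega" "w (dom k)" using k(1) by simp_all
 have "w \<in> Y" if "push k w \<in> Y"
  using invariant_charsD(2)[OF Y inv_hull[OF k'(1)] that] push_character_dom_inverse[OF k'(1)] k'
   push_character_inverse[OF k'(1)] by simp
 thus ?thesis unfolding k(2) char_of_germ[OF k(1)] range_char_germ[OF k(1)]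
  using invariant_charsD(2)[OF Y k'(1)] k' by blast
qed

lemma invariant_complement:
 assumes Y: "invariant_chars Y"
 shows "invariant_chars (Omega - Y)"
 unfolding invariant_chars_def
proof (intro conjI ballI impI DiffI)
 fix g w assume g: "g \<in> \<I>" "w \<in> Omega - Y" "w (dom g)"
 hence p: "(g, w) \<in> germ_pairs" by simp
 show "push g w \<in> Omega" using g push_character_Omega by blast
 show "push g w \<notin> Y"
  using range_char_invariant_iff[OF Y germ_arrow[OF p]] g unfolding char_of_germ[OF p] range_char_germ[OF p] by blast
qed blast

text \<open>Filters by the source character alone; for an invariant \<open>Y\<close> this is the
  reduction to \<open>Y\<close>. The whole groupoid, the boundary groupoid and its complement are
  the cases \<open>Omega\<close>, \<open>boundary_Omega\<close> and
  \<open>Omega - boundary_Omega\<close>, so that facts about reductions are proved once.\<close>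

definition groupoid_on :: "('a::left_cancel_monoid set => bool) set => 'a germ top_groupoid" where
 "groupoid_on Y = subgroupoid \<G> {z \<in> arrows \<G>. char_of z \<in> Y}"

abbreviation "top_on Y \<equiv> arrow_topology (groupoid_on Y)"
abbreviation "conv_on Y \<equiv> convolution (groupoid_on Y)"

lemma groupoid_on_simps [simp]:
 "src (groupoid_on Y) = src \<G>" "rng (groupoid_on Y) = rng \<G>"
 "gmul (groupoid_on Y) = gmul \<G>" "ginv (groupoid_on Y) = ginv \<G>"
 "arrow_topology (groupoid_on Y) = subtopology (arrow_topology \<G>) {z \<in> arrows \<G>. char_of z \<in> Y}"
 by (simp_all add: groupoid_on_def subgroupoid_def)

lemma arrows_groupoid_on [simp]: "arrows (groupoid_on Y) = {z \<in> arrows \<G>. char_of z \<in> Y}"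
 by (auto simp: arrows_def)

lemma groupoid_on_Omega: "groupoid_on Omega = (\<G> :: 'a::left_cancel_monoid germ top_groupoid)"
proof -
 have "{z \<in> arrows \<G>. char_of z \<in> (Omega :: ('a set => bool) set)} = topspace (arrow_topology \<G>)"
  using char_of_Omega by (auto simp: arrows_def)
 thus ?thesis unfolding groupoid_on_def subgroupoid_def by (simp add: subtopology_topspace del: topspace_subtopology)
qed

text \<open>By invariance of the boundary the source condition and the range condition of the
  reduction are equivalent.\<close>

lemma boundary_groupoid_eq: "(boundary_groupoid :: 'a::left_cancel_monoid germ top_groupoid) = groupoid_on boundary_Omega"
proof -
 have *: "unit_germ w \<in> unit_germ ` boundary_Omega \<longleftrightarrow> w \<in> boundary_Omega" if "w \<in> Omega" for w
  using unit_germ_inj[OF that] boundary_subset_Omega by blast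
 have "{z \<in> arrows \<G>. src \<G> z \<in> unit_germ ` boundary_Omega \<and> rng \<G> z \<in> unit_germ ` boundary_Omega}
  = {z \<in> arrows \<G>. char_of z \<in> (boundary_Omega :: ('a set => bool) set)}"
 proof (rule Collect_cong)
  fix z :: "'a germ"
  show "z \<in> arrows \<G> \<and> src \<G> z \<in> unit_germ ` boundary_Omega \<and> rng \<G> z \<in> unit_germ ` boundary_Omega
   \<longleftrightarrow> z \<in> arrows \<G> \<and> char_of z \<in> boundary_Omega"
  proof (cases "z \<in> arrows \<G>")
   case True
   thus ?thesis using *[OF char_of_Omega[OF True]] *[OF range_char_Omega[OF True]]
     range_char_invariant_iff[OF invariant_boundary True] src_arrow[OF True] rng_arrow[OF True] by simp
  qed simp
 qed
 thus ?thesis by (simp add: boundary_groupoid_def reduction_def groupoid_on_def)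
qed

lemma off_boundary_groupoid_eq:
 "(off_boundary_groupoid :: 'a::left_cancel_monoid germ top_groupoid) = groupoid_on (Omega - boundary_Omega)"
proof -
 have "arrows \<G> - arrows boundary_groupoid =
  {z \<in> arrows \<G>. char_of z \<in> (Omega - boundary_Omega :: ('a set => bool) set)}"
  unfolding boundary_groupoid_eq by auto
 thus ?thesis unfolding off_boundary_groupoid_def groupoid_on_def by (simp only:)
qed

subsection \<open>Functions carried by a bisection\<close>

text \<open>The building block of C_c: a function \<open>h\<close> of the source, placed on the
  germs of \<open>g\<close>. Taking \<open>dom g\<close> is a clopen condition on characters, so
  \<open>h\<close> only has to be continuous where \<open>g\<close> is defined, with no decay
  towards an edge.\<close>

definition gen :: "('a::left_cancel_monoid set => bool) set => ('a \<rightharpoonup> 'a) => (('a set => bool) => complex) => 'a germ_fun" where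
 "gen Y g h z = (if z \<in> germ g ` {w \<in> Y. w (dom g)} then h (char_of z) else 0)"

lemma gen_germ:
 assumes "Y \<subseteq> Omega" "g \<in> \<I>" "(k, w) \<in> germ_pairs" "w \<in> Y"
 shows "gen Y g h (germ k w) = (if w (dom g) \<and> germ k w = germ g w then h w else 0)"
proof -
 have "germ k w \<in> germ g ` {w \<in> Y. w (dom g)} \<longleftrightarrow> w (dom g) \<and> germ k w = germ g w"
 proof
  assume "germ k w \<in> germ g ` {w \<in> Y. w (dom g)}"
  then obtain v where p: "v \<in> Y" "v (dom g)" "germ k w = germ g v" by blast
  hence "(g, v) \<in> germ_pairs" using assms by auto
  hence "w = v" using p(3) char_of_germ assms(3) by metis
  thus "w (dom g) \<and> germ k w = germ g w" using p by simp
 next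
  assume "w (dom g) \<and> germ k w = germ g w"
  thus "germ k w \<in> germ g ` {w \<in> Y. w (dom g)}" using assms(4) by blast
 qed
 thus ?thesis unfolding gen_def char_of_germ[OF assms(3)] by simp
qed

lemma gen_nonzeroD:
 assumes "Y \<subseteq> Omega" "g \<in> \<I>" "gen Y g h z \<noteq> 0"
 shows "z = germ g (char_of z)" "(g, char_of z) \<in> germ_pairs" "char_of z \<in> Y"
proof -
 obtain w where w: "w \<in> Y" "w (dom g)" "z = germ g w" using assms(3) unfolding gen_def by (auto split: if_splits)
 hence p: "(g, w) \<in> germ_pairs" using assms by auto
 show "z = germ g (char_of z)" "(g, char_of z) \<in> germ_pairs" "char_of z \<in> Y"
  unfolding w(3) char_of_germ[OF p] using p w by simp_all
qed

text \<open>The sum common to convolution, where \<open>q\<close> is a function on arrows, and to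
  the regular representation, where \<open>q\<close> is a vector on a source fibre. It always runs
  over a range fibre of the whole groupoid; for invariant \<open>Y\<close> this is also the fibre of
  the reduction (\<open>range_fibre_groupoid_on\<close>), so one formula serves all
  reductions.\<close>

definition lconv :: "'a::left_cancel_monoid germ_fun => 'a germ_fun => 'a germ_fun" where
 "lconv f q z = (\<Sum>\<^sub>\<infinity>y\<in>range_fibre \<G> (rng \<G> z). f y * q (gmul \<G> (ginv \<G> y) z))"

text \<open>The germs of a fixed \<open>g\<close> form a bisection: the range character
  \<open>v\<close> determines the source as the push-forward of \<open>v\<close> along the inverse
  of \<open>g\<close>.\<close>

lemma gen_range_fibre_unique:
 assumes Y: "Y \<subseteq> Omega" and g: "g \<in> \<I>" and p: "v \<in> Omega"
  and y: "y \<in> range_fibre \<G> (unit_germ v)" "gen Y g h y \<noteq> 0"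
 shows "y = germ g (push (pinv g) v)"
proof -
 note d = gen_nonzeroD[OF Y g y(2)]
 let ?w = "char_of y"
 have "unit_germ (push g ?w) = unit_germ v"
  using y(1) rng_germ[OF d(2)] d(1) by (simp add: range_fibre_def)
 moreover have w: "?w \<in> Omega" "?w (dom g)" using d by simp_all
 ultimately have "push g ?w = v" using unit_germ_inj push_character_Omega[OF g] p by blast
 hence "?w = push (pinv g) v" using push_character_inverse[OF g Omega_char[OF w(1)] w(2)] by simp
 thus ?thesis using d(1) by simp
qed

text \<open>By \<open>gen_range_fibre_unique\<close> at most one arrow \<open>y\<close> of the range
  fibre contributes, namely the germ of \<open>g\<close> whose range is that of \<open>z\<close>.
  Then the inverse of \<open>y\<close> times \<open>z\<close> is \<open>act (pinv g) z\<close>, and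
  the weight \<open>h\<close> is read at the source of \<open>y\<close>, which is the range of that
  product.\<close>

lemma lconv_gen:
 assumes Y: "invariant_chars Y" and g: "g \<in> \<I>" and z: "z \<in> arrows \<G>" "char_of z \<in> Y"
 shows "lconv (gen Y g h) q z =
  (case act (pinv g) z of None => 0 | Some d => h (range_char d) * q d)"
proof -
 have YO: "Y \<subseteq> Omega" using Y by (rule invariant_charsD)
 obtain k w where k: "(k, w) \<in> germ_pairs" "z = germ k w" using arrowE[OF z(1)] .
 have k': "k \<in> \<I>" "w \<in> Omega" "w (dom k)" "w \<in> Y" using k z(2) char_of_germ[OF k(1)] by simp_all
 let ?gi = "pinv g" and ?v = "push k w"
 have gi: "?gi \<in> \<I>" using g by (rule inv_hull)
 have v: "?v \<in> Omega" using push_character_Omega k' by blast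
 have rg: "rng \<G> z = unit_germ ?v" unfolding k(2) by (rule rng_germ[OF k(1)])
 let ?t = "push ?gi ?v"
 let ?F = "\<lambda>y. gen Y g h y * q (gmul \<G> (ginv \<G> y) z)"
 let ?R = "range_fibre \<G> (unit_germ ?v)"
 have single: "?F y = 0" if "y \<noteq> germ g ?t" "y \<in> ?R" for y
  using gen_range_fibre_unique[OF YO g v that(2), of h] that(1) by auto
 have eq: "lconv (gen Y g h) q z = (if germ g ?t \<in> ?R then ?F (germ g ?t) else 0)"
  unfolding lconv_def rg by (rule infsum_single[OF single])
 show ?thesis
 proof (cases "act ?gi z")
  case None
  have "?F (germ g ?t) = 0" if R: "germ g ?t \<in> ?R"
  proof (rule ccontr)
   assume "?F (germ g ?t) \<noteq> 0"
   hence nz: "gen Y g h (germ g ?t) \<noteq> 0" by auto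
   note d = gen_nonzeroD[OF YO g nz]
   let ?w = "char_of (germ g ?t)"
   have "rng \<G> (germ g ?w) = unit_germ ?v" using R d(1) by (simp add: range_fibre_def)
   hence "unit_germ (push g ?w) = unit_germ ?v" using rng_germ[OF d(2)] by simp
   moreover have "push g ?w \<in> Omega" using push_character_Omega[OF g, of ?w] d(2) by simp
   ultimately have "push g ?w = ?v" using unit_germ_inj[OF _ v] by simp
   hence "?v (dom ?gi)" using push_character_dom_inverse[OF g, of ?w] d(2) by simp
   hence "act ?gi z \<noteq> None" using act_defined_iff[OF gi z(1)] k(2) range_char_germ[OF k(1)] by simp
   thus False using None by simp
  qed
  thus ?thesis using eq None by simp
 next
  case (Some d)
  have d: "w (dom (?gi \<circ>\<^sub>m k))" "d = germ (?gi \<circ>\<^sub>m k) w"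
   using Some act_germ[OF gi k(1)] k(2) by (auto split: if_splits)
  note p = germ_comp_pair[OF gi k(1) d(1)]
  have rd: "range_char d = ?t" unfolding d(2) range_char_germ[OF p] by (rule push_character_comp[OF gi])
  have psid: "?v (dom ?gi)" using push_character_dom_comp[OF gi k'(1)] d(1) by simp
  have tY: "?t \<in> Y" by (rule invariant_charsD(2)[OF Y gi invariant_charsD(2)[OF Y k'(1,4,3)] psid])
  have td: "?t (dom g)" using push_character_dom_inverse[OF gi, of ?v] partial_inverse_partial_inverse[OF g] psid by simp
  have gp: "(g, ?t) \<in> germ_pairs" using g tY YO td by auto
  have bk: "push g ?t = ?v"
   using push_character_inverse[OF gi Omega_char[OF v] psid] partial_inverse_partial_inverse[OF g] by simp
  have R: "germ g ?t \<in> ?R" using germ_arrow[OF gp] rng_germ[OF gp] bk by (simp add: range_fibre_def)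
  have gip: "(?gi, ?v) \<in> germ_pairs" using gi v psid by simp
  have "gmul \<G> (ginv \<G> (germ g ?t)) z = d"
   unfolding ginv_germ[OF gp] bk k(2) d(2) by (rule gmul_germ[OF gip k(1) refl])
  moreover have "gen Y g h (germ g ?t) = h ?t" using gen_germ[OF YO g gp tY] td by simp
  ultimately show ?thesis using eq R Some rd by simp
 qed
qed

lemma finite_gen_range_fibre:
 assumes Y: "Y \<subseteq> Omega" and g: "g \<in> \<I>" and p: "v \<in> Omega"
 shows "finite {y \<in> range_fibre \<G> (unit_germ v). gen Y g h y \<noteq> 0}"
 by (rule finite_subset[where B = "{germ g (push (pinv g) v)}"])
  (use gen_range_fibre_unique[OF Y g p] in auto)

section \<open>The topology of the arrow space\<close>

lemma openin_germ_bisection: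
 assumes "g \<in> \<I>" "openin \<O> U" "\<forall>w\<in>U. w (dom g)"
 shows "openin (arrow_topology \<G>) (germ_bisection g U)"
proof -
 let ?D = "{germ_bisection g U | g U. g \<in> \<I> \<and> openin \<O> U \<and> (\<forall>w\<in>U. w (dom g))}"
 have "germ_bisection g U \<in> ?D" by (rule CollectI, rule exI[of _ g], rule exI[of _ U]) (use assms in simp)
 hence "openin (topology_generated_by ?D) (germ_bisection g U)" by (rule topology_generated_by_Basis)
 thus ?thesis by (simp add: groupoid_P_def)
qed

text \<open>A description by charts: every \<open>g\<close> gives a map from characters to germs,
  and a set of arrows is open iff all its preimages are. Since the topology is given by generators,
  the forward direction is an induction over the generated open sets.\<close>

lemma openin_arrow_topology_iff:
 "openin (arrow_topology \<G>) V \<longleftrightarrow> V \<subseteq> arrows \<G> \<and>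
  (\<forall>g\<in>\<I>. openin \<O> {w \<in> Omega. w (dom g) \<and> germ g w \<in> V})" (is "?L \<longleftrightarrow> ?R")
proof
 let ?D = "{germ_bisection g U | g U. g \<in> \<I> \<and> openin \<O> U \<and> (\<forall>w\<in>U. w (dom g))}"
 have top: "arrow_topology \<G> = topology_generated_by ?D" by (simp add: groupoid_P_def)
 {
  assume V: ?L
  have "openin \<O> {w \<in> Omega. w (dom g) \<and> germ g w \<in> V}" if g: "g \<in> \<I>" for g
   using V unfolding top openin_topology_generated_by_iff
  proof (induction rule: generate_topology_on.induct)
   case Empty
   thus ?case by simp
  next
   case (Int a b)
   have "{w \<in> Omega. w (dom g) \<and> germ g w \<in> a \<inter> b} =
    {w \<in> Omega. w (dom g) \<and> germ g w \<in> a} \<inter> {w \<in> Omega. w (dom g) \<and> germ g w \<in> b}" by blast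
   thus ?case using openin_Int[OF Int.IH] by metis
  next
   case (UN K)
   have "{w \<in> Omega. w (dom g) \<and> germ g w \<in> \<Union>K} = \<Union>((\<lambda>k. {w \<in> Omega. w (dom g) \<and> germ g w \<in> k}) ` K)" by blast
   moreover have "openin \<O> \<dots>" by (rule openin_Union) (use UN.IH in blast)
   ultimately show ?case by metis
  next
   case (Basis s)
   then obtain h U where h: "s = germ_bisection h U" "h \<in> \<I>" "openin \<O> U" "\<forall>w\<in>U. w (dom h)" by blast
   have UO: "U \<subseteq> Omega" using openin_subset[OF h(3)] by simp
   \<comment> \<open>Two germs at \<open>w\<close> agree iff the maps agree on some ideal
     \<open>A\<close> with \<open>w A\<close>, and for fixed \<open>A\<close> this is an open
     condition on \<open>w\<close>. Hence the preimage of a basic set under another chart is a union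
     of open sets.\<close>
   let ?S = "(\<lambda>A. {w \<in> Omega. w (dom g)} \<inter> (U \<inter> {w \<in> Omega. w A})) ` {A \<in> \<J>. \<forall>x\<in>A. g x = h x}"
   have "{w \<in> Omega. w (dom g) \<and> germ g w \<in> s} = \<Union>?S"
   proof (intro subset_antisym subsetI)
    fix w assume w: "w \<in> {w \<in> Omega. w (dom g) \<and> germ g w \<in> s}"
    then obtain v where p: "v \<in> U" "germ g w = germ h v" unfolding h(1) germ_bisection_def by blast
    have "(g, w) \<in> germ_pairs" "(h, v) \<in> germ_pairs" using w g h p UO by auto
    thus "w \<in> \<Union>?S" using p w germ_eq_iff[of g w h v] by auto
   next
    fix w assume "w \<in> \<Union>?S"
    then obtain A where A: "A \<in> \<J>" "\<forall>x\<in>A. g x = h x" "w \<in> Omega" "w (dom g)" "w \<in> U" "w A" by blast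
    hence "germ g w = germ h w" using g h by (intro germ_eqI[of _ _ _ A]) auto
    thus "w \<in> {w \<in> Omega. w (dom g) \<and> germ g w \<in> s}" using A unfolding h(1) germ_bisection_def by blast
   qed
   moreover have "openin \<O> (\<Union>?S)"
   proof (rule openin_Union)
    fix T assume "T \<in> ?S"
    then obtain A where A: "A \<in> \<J>" "T = {w \<in> Omega. w (dom g)} \<inter> (U \<inter> {w \<in> Omega. w A})" by blast
    show "openin \<O> T" unfolding A(2)
     by (intro openin_Int h(3) openin_Omega_ideal A(1) dom_hull g)
   qed
   ultimately show ?case by metis
  qed
  moreover have "V \<subseteq> arrows \<G>" using openin_subset[OF V] by (simp add: arrows_def)
  ultimately show ?R by blast
 }
 {
  assume R: ?R
  let ?K = "(\<lambda>g. germ_bisection g {w \<in> Omega. w (dom g) \<and> germ g w \<in> V}) ` \<I>"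
  have "V = \<Union>?K"
  proof (intro subset_antisym subsetI)
   fix z assume z: "z \<in> V"
   then obtain g w where g: "(g, w) \<in> germ_pairs" "z = germ g w" using R arrowE by blast
   thus "z \<in> \<Union>?K" using z by (auto simp: germ_bisection_def)
  qed (auto simp: germ_bisection_def)
  moreover have "openin (arrow_topology \<G>) (\<Union>?K)"
  proof (rule openin_Union)
   fix T assume "T \<in> ?K"
   then obtain g where "g \<in> \<I>" "T = germ_bisection g {w \<in> Omega. w (dom g) \<and> germ g w \<in> V}" by blast
   moreover have "openin \<O> {w \<in> Omega. w (dom g) \<and> germ g w \<in> V}" using R calculation(1) by blast
   ultimately show "openin (arrow_topology \<G>) T" using openin_germ_bisection[of g] by simp
  qed
  ultimately show ?L by simp
 }
qed

text \<open>The chart criterion passes to a reduction. For the converse, each relatively open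
  preimage is extended to an open set of characters, one choice for every \<open>g\<close>; the
  union of the corresponding bisections cuts out \<open>V\<close>.\<close>

lemma openin_groupoid_on_iff:
 assumes Y: "Y \<subseteq> Omega"
 shows "openin (top_on Y) V \<longleftrightarrow> V \<subseteq> arrows (groupoid_on Y) \<and>
  (\<forall>g\<in>\<I>. openin (subtopology \<O> Y) {w \<in> Y. w (dom g) \<and> germ g w \<in> V})" (is "?L \<longleftrightarrow> ?R")
proof
 let ?A = "{z \<in> arrows \<G>. char_of z \<in> Y}"
 assume ?L
 then obtain W where W: "openin (arrow_topology \<G>) W" "V = W \<inter> ?A" unfolding groupoid_on_simps openin_subtopology by blast
 have "openin (subtopology \<O> Y) {w \<in> Y. w (dom g) \<and> germ g w \<in> V}" if g: "g \<in> \<I>" for g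
 proof -
  have "{w \<in> Y. w (dom g) \<and> germ g w \<in> V} = {w \<in> Omega. w (dom g) \<and> germ g w \<in> W} \<inter> Y"
  proof -
   have "germ g w \<in> ?A" if "w \<in> Y" "w (dom g)" for w
   proof -
    have p: "(g, w) \<in> germ_pairs" using that g Y by auto
    show ?thesis using germ_arrow[OF p] char_of_germ[OF p] that by simp
   qed
   thus ?thesis unfolding W(2) using Y by blast
  qed
  moreover have "openin \<O> {w \<in> Omega. w (dom g) \<and> germ g w \<in> W}"
   using iffD1[OF openin_arrow_topology_iff W(1)] g by blast
  ultimately show ?thesis unfolding openin_subtopology by blast
 qed
 thus ?R using W(2) by auto
next
 assume R: ?R
 let ?A = "{z \<in> arrows \<G>. char_of z \<in> Y}"
 have "\<forall>g\<in>\<I>. \<exists>U. openin \<O> U \<and> {w \<in> Y. w (dom g) \<and> germ g w \<in> V} = U \<inter> Y"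
  using R unfolding openin_subtopology by blast
 from bchoice[OF this]
 obtain U where U: "\<And>g. g \<in> \<I> ==> openin \<O> (U g)"
  "\<And>g. g \<in> \<I> ==> {w \<in> Y. w (dom g) \<and> germ g w \<in> V} = U g \<inter> Y" by blast
 let ?B = "\<lambda>g. germ_bisection g (U g \<inter> {w \<in> Omega. w (dom g)})"
 let ?W = "\<Union>(?B ` \<I>)"
 have "openin (arrow_topology \<G>) ?W"
 proof (rule openin_Union)
  fix T assume "T \<in> ?B ` \<I>"
  then obtain g where g: "g \<in> \<I>" "T = ?B g" by blast
  have "openin \<O> (U g \<inter> {w \<in> Omega. w (dom g)})" using U(1) g by (intro openin_Int openin_Omega_ideal) auto
  thus "openin (arrow_topology \<G>) T" unfolding g(2) by (intro openin_germ_bisection g(1)) simp_all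
 qed
 moreover have "V = ?W \<inter> ?A"
 proof (intro subset_antisym subsetI)
  fix z assume z: "z \<in> V"
  hence A: "z \<in> ?A" using R by auto
  then obtain g w where g: "(g, w) \<in> germ_pairs" "z = germ g w" using arrowE by blast
  hence "w \<in> Y" using A char_of_germ by auto
  hence "w \<in> U g" using U(2)[of g] g z by auto
  thus "z \<in> ?W \<inter> ?A" using A g by (auto simp: germ_bisection_def)
 next
  fix z assume z: "z \<in> ?W \<inter> ?A"
  then obtain g w where g: "g \<in> \<I>" "w \<in> U g" "w \<in> Omega" "w (dom g)" "z = germ g w"
   unfolding germ_bisection_def by blast
  hence "char_of z = w" by simp
  hence "w \<in> U g \<inter> Y" using z g by auto
  thus "z \<in> V" using U(2)[OF g(1)] g(5) by blast
 qed
 ultimately show ?L unfolding groupoid_on_simps openin_subtopology by blast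
qed

lemma openin_bisection:
 assumes Y: "Y \<subseteq> Omega" and g: "g \<in> \<I>" and U: "openin (subtopology \<O> Y) U" "\<forall>w\<in>U. w (dom g)"
 shows "openin (top_on Y) (germ g ` U)"
proof -
 obtain U' where U': "openin \<O> U'" "U = U' \<inter> Y" using U(1) unfolding openin_subtopology by blast
 let ?V = "U' \<inter> {w \<in> Omega. w (dom g)}"
 have "openin \<O> ?V" using U'(1) g by (intro openin_Int openin_Omega_ideal) auto
 hence o: "openin (arrow_topology \<G>) (germ_bisection g ?V)" by (rule openin_germ_bisection[OF g]) simp
 have "germ g ` U = germ_bisection g ?V \<inter> {z \<in> arrows \<G>. char_of z \<in> Y}"
 proof (intro subset_antisym subsetI)
  fix z assume "z \<in> germ g ` U"
  then obtain w where w: "w \<in> U" "z = germ g w" by blast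
  have p: "(g, w) \<in> germ_pairs" using w U U' Y g by auto
  show "z \<in> germ_bisection g ?V \<inter> {z \<in> arrows \<G>. char_of z \<in> Y}"
   using w p germ_arrow[OF p] char_of_germ[OF p] U U' by (auto simp: germ_bisection_def)
 next
  fix z assume "z \<in> germ_bisection g ?V \<inter> {z \<in> arrows \<G>. char_of z \<in> Y}"
  then obtain w where w: "w \<in> ?V" "z = germ g w" "char_of z \<in> Y" unfolding germ_bisection_def by blast
  have "(g, w) \<in> germ_pairs" using w g by auto
  hence "w \<in> Y" using w by simp
  thus "z \<in> germ g ` U" using w U' by blast
 qed
 thus ?thesis using o unfolding groupoid_on_simps openin_subtopology by blast
qed

abbreviation (input) dom_chars :: "('a::left_cancel_monoid set => bool) set => ('a \<rightharpoonup> 'a) => ('a set => bool) set" where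
 "dom_chars Y g \<equiv> {w \<in> Y. w (dom g)}"

abbreviation "dom_top Y g \<equiv> subtopology \<O> {w \<in> Y. w (dom g)}"

lemma openin_dom_chars:
 assumes "Y \<subseteq> Omega" "g \<in> \<I>"
 shows "openin (subtopology \<O> Y) (dom_chars Y g)"
proof -
 have "dom_chars Y g = {w \<in> Omega. w (dom g)} \<inter> Y" using assms by blast
 thus ?thesis using openin_Omega_ideal[OF dom_hull[OF assms(2)]] unfolding openin_subtopology by blast
qed

lemma closedin_dom_chars:
 assumes "closedin \<O> Y" "g \<in> \<I>"
 shows "closedin \<O> (dom_chars Y g)"
proof -
 have "dom_chars Y g = {w \<in> Omega. w (dom g)} \<inter> Y" using closedin_subset[OF assms(1)] by auto
 thus ?thesis using closedin_Omega_ideal[OF dom_hull[OF assms(2)]] assms(1) by (simp add: closedin_Int)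
qed

lemma continuous_germ:
 assumes Y: "Y \<subseteq> Omega" and g: "g \<in> \<I>"
 shows "continuous_map (dom_top Y g) (top_on Y) (germ g)"
 unfolding continuous_map_def
proof (intro conjI allI impI)
 have ts: "topspace (dom_top Y g) = dom_chars Y g" using Y by auto
 have p: "(g, w) \<in> germ_pairs" if "w \<in> dom_chars Y g" for w using that Y g by auto
 have top: "topspace (top_on Y) = arrows (groupoid_on Y)" by (simp add: arrows_def)
 show "germ g \<in> topspace (dom_top Y g) \<rightarrow> topspace (top_on Y)"
  unfolding ts top using p germ_arrow char_of_germ by fastforce
 fix V assume V: "openin (top_on Y) V"
 hence "openin (subtopology \<O> Y) {w \<in> Y. w (dom g) \<and> germ g w \<in> V}"
  using iffD1[OF openin_groupoid_on_iff[OF Y] V] g by blast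
 then obtain U where U: "openin \<O> U" "{w \<in> Y. w (dom g) \<and> germ g w \<in> V} = U \<inter> Y"
  unfolding openin_subtopology by blast
 have "{w \<in> topspace (dom_top Y g). germ g w \<in> V} = U \<inter> dom_chars Y g"
  unfolding ts using U(2) by blast
 thus "openin (dom_top Y g) {w \<in> topspace (dom_top Y g). germ g w \<in> V}"
  using U(1) unfolding openin_subtopology by blast
qed

lemma continuous_map_mult_complex:
 fixes f :: "'b => complex"
 assumes "continuous_map X euclidean f" "continuous_map X euclidean g"
 shows "continuous_map X euclidean (\<lambda>x. f x * g x)"
 using assms unfolding continuous_map_atin by (auto intro: tendsto_mult)

text \<open>Extension by zero is continuous because both the piece and its complement are
  open.\<close>

lemma continuous_map_clopen_piece:
 fixes f :: "'b => complex"
 assumes S: "openin X S" "closedin X S" and f: "continuous_map (subtopology X S) euclidean f"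
 shows "continuous_map X euclidean (\<lambda>x. if x \<in> S then f x else 0)"
 unfolding continuous_map_def
proof (intro conjI allI impI)
 fix U :: "complex set" assume U: "openin euclidean U"
 have sub: "S \<subseteq> topspace X" using openin_subset[OF S(1)] .
 have "openin (subtopology X S) {x \<in> topspace (subtopology X S). f x \<in> U}"
  by (rule openin_continuous_map_preimage[OF f U])
 hence 1: "openin X {x \<in> topspace (subtopology X S). f x \<in> U}" by (rule openin_trans_full[OF _ S(1)])
 have 2: "openin X (topspace X - S)" using S(2) by (simp add: closedin_def)
 have "{x \<in> topspace X. (if x \<in> S then f x else 0) \<in> U} =
  {x \<in> topspace (subtopology X S). f x \<in> U} \<union> (if 0 \<in> U then topspace X - S else {})" using sub by auto
 thus "openin X {x \<in> topspace X. (if x \<in> S then f x else 0) \<in> U}" using 1 2 by auto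
qed simp

subsection \<open>The span of the functions carried by bisections\<close>

text \<open>\<open>P\<close> restricts the characters at which coefficients may be nonzero:
  constantly true it gives C_c, and excluding the boundary it gives sums in which every single
  summand vanishes over the boundary. The inductive form matches the later proofs, which settle an
  identity for one \<open>gen\<close> function and extend it by additivity.\<close>

inductive_set gen_span :: "('a::left_cancel_monoid set => bool) set => (('a set => bool) => bool) => 'a germ_fun set"
 for Y P where
 zero: "(\<lambda>_. 0) \<in> gen_span Y P"
| add_gen: "f \<in> gen_span Y P ==> g \<in> \<I> ==>
  continuous_map (dom_top Y g) euclidean h ==>
  (\<forall>w\<in>dom_chars Y g. h w \<noteq> 0 \<longrightarrow> P w) ==> (\<lambda>z. f z + gen Y g h z) \<in> gen_span Y P"

abbreviation "CcP \<equiv> gen_span Omega (\<lambda>_. True)"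
abbreviation "CcOff \<equiv> gen_span Omega (\<lambda>w. w \<notin> boundary_Omega)"

lemma gen_span_gen:
 assumes "g \<in> \<I>" "continuous_map (dom_top Y g) euclidean h"
  "\<forall>w\<in>dom_chars Y g. h w \<noteq> 0 \<longrightarrow> P w"
 shows "gen Y g h \<in> gen_span Y P"
 using gen_span.add_gen[OF gen_span.zero assms] by simp

lemma gen_span_add:
 assumes "f \<in> gen_span Y P" "f' \<in> gen_span Y P"
 shows "(\<lambda>z. f z + f' z) \<in> gen_span Y P"
 using assms(2)
proof induction
 case zero
 thus ?case using assms(1) by simp
next
 case (add_gen f' g h)
 thus ?case using gen_span.add_gen[OF add_gen.IH add_gen.hyps(2-4)] by (simp add: add.assoc)
qed

lemma gen_scale: "gen Y g (\<lambda>w. c * h w) z = c * gen Y g h z"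
 by (simp add: gen_def)

lemma gen_span_scale:
 assumes "f \<in> gen_span Y P"
 shows "(\<lambda>z. c * f z) \<in> gen_span Y P"
 using assms
proof induction
 case zero
 thus ?case using gen_span.zero by simp
next
 case (add_gen f g h)
 have "(\<lambda>z. c * f z + gen Y g (\<lambda>w. c * h w) z) \<in> gen_span Y P"
  by (rule gen_span.add_gen[OF add_gen.IH add_gen.hyps(2)])
   (use add_gen.hyps in \<open>auto intro!: continuous_map_mult_complex\<close>)
 thus ?case by (simp add: gen_scale distrib_left)
qed

lemma gen_span_mono:
 assumes "f \<in> gen_span Y P" "\<And>w. P w ==> Q w"
 shows "f \<in> gen_span Y Q"
 using assms(1)
proof induction
 case (add_gen f g h)
 thus ?case using assms(2) by (intro gen_span.add_gen) auto
qed (rule gen_span.zero)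

lemma gen_span_sum:
 assumes "finite F" "\<And>f. f \<in> F ==> f \<in> gen_span Y P"
 shows "(\<lambda>z. \<Sum>f\<in>F. c f * f z) \<in> gen_span Y P"
 using assms
proof (induction F)
 case empty
 thus ?case using gen_span.zero by simp
next
 case (insert f F)
 have "(\<lambda>z. c f * f z + (\<Sum>f\<in>F. c f * f z)) \<in> gen_span Y P"
  using insert by (intro gen_span_add gen_span_scale) auto
 thus ?case using insert by simp
qed

text \<open>Compact open bisections inside \<open>V\<close>. Because \<open>Omega\<close> has a
  basis of clopen sets they cover \<open>V\<close>, and they take over the role of a partition of
  unity.\<close>

definition good_bisection :: "('a::left_cancel_monoid set => bool) set => 'a germ set => 'a germ set => bool" where
 "good_bisection Y V D \<longleftrightarrow> D \<subseteq> V \<and> openin (top_on Y) D \<and> compactin (top_on Y) D \<and>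
  (\<exists>g\<in>\<I>. \<exists>U. openin (subtopology \<O> Y) U \<and> closedin (subtopology \<O> Y) U \<and>
   U \<subseteq> dom_chars Y g \<and> D = germ g ` U)"

lemma good_bisection_ex:
 assumes Y: "closedin \<O> Y" and V: "openin (top_on Y) V" and z: "z \<in> V"
 shows "\<exists>D. good_bisection Y V D \<and> z \<in> D"
proof -
 have YO: "Y \<subseteq> Omega" using closedin_subset[OF Y] by simp
 note R = iffD1[OF openin_groupoid_on_iff[OF YO] V]
 have A: "z \<in> arrows \<G>" "char_of z \<in> Y" using R z by auto
 obtain g w where g: "(g, w) \<in> germ_pairs" "z = germ g w" using arrowE[OF A(1)] .
 have wY: "w \<in> Y" using A(2) g char_of_germ by auto
 have gh: "g \<in> \<I>" "w (dom g)" using g by simp_all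
 have "openin (subtopology \<O> Y) {w \<in> Y. w (dom g) \<and> germ g w \<in> V}" using R gh by blast
 then obtain U' where U': "openin \<O> U'" "{w \<in> Y. w (dom g) \<and> germ g w \<in> V} = U' \<inter> Y"
  unfolding openin_subtopology by blast
 have "w \<in> U'" using U'(2) wY gh z g by blast
 then obtain X \<X> where X: "X \<in> \<J>" "finite \<X>" "\<X> \<subseteq> \<J>" "w \<in> basic_open X \<X>" "basic_open X \<X> \<subseteq> U'"
  using Omega_neighbourhood[OF U'(1)] by metis
 note b = basic_open_clopen[OF X(1-3)]
 let ?U = "basic_open X \<X> \<inter> Y"
 have sub: "?U \<subseteq> dom_chars Y g" using X(5) U'(2) by blast
 have o: "openin (subtopology \<O> Y) ?U" using b(1) unfolding openin_subtopology by blast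
 have c: "closedin (subtopology \<O> Y) ?U" using b(2) unfolding closedin_subtopology by blast
 have "closedin \<O> ?U" using b(2) Y by (rule closedin_Int)
 hence "compactin \<O> ?U" using closedin_compact_space[OF compact_space_Omega] by blast
 hence "compactin (dom_top Y g) ?U" using sub by (simp add: compactin_subtopology)
 hence k: "compactin (top_on Y) (germ g ` ?U)"
  by (rule image_compactin) (rule continuous_germ[OF YO gh(1)])
 have "germ g ` ?U \<subseteq> V" using X(5) U'(2) by blast
 moreover have "openin (top_on Y) (germ g ` ?U)"
  by (rule openin_bisection[OF YO gh(1) o]) (use sub in blast)
 moreover have "z \<in> germ g ` ?U" using X(4) wY g by blast
 ultimately have "good_bisection Y V (germ g ` ?U) \<and> z \<in> germ g ` ?U"
  unfolding good_bisection_def using k gh(1) o c sub by blast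
 thus ?thesis by blast
qed

text \<open>One bisection \<open>D\<close> is split off at a time. In a non-Hausdorff groupoid a
  compact set need not be closed, but inside the Hausdorff set \<open>V\<close> it is, so
  \<open>D\<close> is clopen in \<open>V\<close> and cutting \<open>f\<close> along \<open>D\<close>
  keeps both pieces continuous. The piece on \<open>D\<close> is a \<open>gen\<close> function, and
  the rest is covered by the remaining bisections.\<close>

lemma gen_span_cover:
 assumes Y: "Y \<subseteq> Omega"
  and V: "openin (top_on Y) V" "Hausdorff_space (subtopology (top_on Y) V)"
  and P: "\<forall>z\<in>V. P (char_of z)"
  and "finite \<D>" "\<forall>D\<in>\<D>. good_bisection Y V D"
  and "continuous_map (subtopology (top_on Y) V) euclidean f" "\<forall>z. z \<notin> \<Union>\<D> \<longrightarrow> f z = 0"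
 shows "f \<in> gen_span Y P"
 using assms(5-8)
proof (induction \<D> arbitrary: f)
 case empty
 hence "f = (\<lambda>_. 0)" by auto
 thus ?case using gen_span.zero by simp
next
 case (insert D \<D>)
 let ?T = "arrow_topology (groupoid_on Y)"
 have good: "good_bisection Y V D" using insert.prems(1) by blast
 hence D: "D \<subseteq> V" "openin ?T D" "compactin ?T D" by (simp_all only: good_bisection_def)
 obtain g U where g: "g \<in> \<I>" "openin (subtopology \<O> Y) U" "closedin (subtopology \<O> Y) U"
   "U \<subseteq> dom_chars Y g" "D = germ g ` U" using good unfolding good_bisection_def by blast
 have Do: "openin (subtopology ?T V) D" using D(1,2) openin_open_subtopology[OF V(1)] by blast
 have "compactin (subtopology ?T V) D" using D(1,3) by (simp add: compactin_subtopology)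
 hence Dc: "closedin (subtopology ?T V) D" using V(2) compactin_imp_closedin by blast
 have p: "(g, w) \<in> germ_pairs" if "w \<in> dom_chars Y g" for w using that Y g(1) by auto
 have mem: "germ g w \<in> D \<longleftrightarrow> w \<in> U" if w: "w \<in> dom_chars Y g" for w
 proof
  assume "germ g w \<in> D"
  hence "germ g w \<in> germ g ` U" using g(5) by simp
  then obtain v where ps: "v \<in> U" "germ g w = germ g v" by (rule imageE)
  from ps(2) have "char_of (germ g w) = char_of (germ g v)" by (rule arg_cong)
  hence "w = v" unfolding char_of_germ[OF p[OF w]] char_of_germ[OF p[OF subsetD[OF g(4) ps(1)]]] .
  thus "w \<in> U" using ps by simp
 qed (use g(5) in blast)
 let ?h = "\<lambda>w. if w \<in> U then f (germ g w) else 0"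
 let ?f2 = "\<lambda>z. if z \<in> topspace (subtopology ?T V) - D then f z else 0"
 have cf2: "continuous_map (subtopology ?T V) euclidean ?f2"
 proof (rule continuous_map_clopen_piece)
  show "openin (subtopology ?T V) (topspace (subtopology ?T V) - D)" using Dc unfolding closedin_def by blast
  show "closedin (subtopology ?T V) (topspace (subtopology ?T V) - D)"
   by (rule closedin_diff[OF closedin_topspace Do])
  show "continuous_map (subtopology (subtopology ?T V) (topspace (subtopology ?T V) - D)) euclidean f"
   by (rule continuous_map_from_subtopology[OF insert.prems(2)])
 qed
 have off: "f z = 0" if "z \<notin> V" for z
 proof -
  have "D' \<subseteq> V" if "D' \<in> insert D \<D>" for D' using insert.prems(1) that unfolding good_bisection_def by blast
  thus ?thesis using that insert.prems(3) by blast
 qed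
 have tsV: "topspace (subtopology ?T V) = V" using openin_subset[OF V(1)] by auto
 have f2: "?f2 \<in> gen_span Y P"
 proof (rule insert.IH[OF _ cf2])
  show "\<forall>D\<in>\<D>. good_bisection Y V D" using insert.prems(1) by blast
  show "\<forall>z. z \<notin> \<Union>\<D> \<longrightarrow> ?f2 z = 0" using insert.prems(3) by (simp del: topspace_subtopology)
 qed
 have ch: "continuous_map (dom_top Y g) euclidean ?h"
 proof (rule continuous_map_clopen_piece)
  have e: "dom_top Y g = subtopology (subtopology \<O> Y) (dom_chars Y g)"
   unfolding subtopology_subtopology by (rule arg_cong[where f = "subtopology \<O>"]) blast
  have "U = U \<inter> dom_chars Y g" using g(4) by blast
  thus "openin (dom_top Y g) U" "closedin (dom_top Y g) U"
   unfolding e openin_subtopology[of _ "dom_chars Y g"] closedin_subtopology[of _ "dom_chars Y g"] using g(2,3) by blast+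
  have "continuous_map (subtopology \<O> U) (subtopology ?T V) (germ g)"
   using continuous_map_from_subtopology_mono[OF continuous_germ[OF Y g(1)] g(4)] D(1) g(5)
   by (auto simp: continuous_map_in_subtopology)
  hence "continuous_map (subtopology \<O> U) euclidean (f \<circ> germ g)"
   using insert.prems(2) by (rule continuous_map_compose)
  moreover have "subtopology (dom_top Y g) U = subtopology \<O> U"
   using g(4) by (simp add: subtopology_subtopology inf.absorb2)
  ultimately show "continuous_map (subtopology (dom_top Y g) U) euclidean (\<lambda>w. f (germ g w))"
   by (simp add: comp_def)
 qed
 have Ph: "\<forall>w\<in>dom_chars Y g. ?h w \<noteq> 0 \<longrightarrow> P w"
 proof (intro ballI impI)
  fix w assume w: "w \<in> dom_chars Y g" "?h w \<noteq> 0"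
  hence "germ g w \<in> V" using off by (auto split: if_splits)
  thus "P w" using P char_of_germ[OF p[OF w(1)]] by metis
 qed
 have "f z = ?f2 z + gen Y g ?h z" for z
 proof (cases "z \<in> D")
  case True
  then obtain w where w: "w \<in> U" "z = germ g w" using g(5) by blast
  hence w': "w \<in> dom_chars Y g" using g(4) by blast
  have "gen Y g ?h z = ?h w" using gen_germ[OF Y g(1) p[OF w']] w' w(2) by simp
  thus ?thesis using True w by simp
 next
  case False
  have "gen Y g ?h z = 0"
  proof (rule ccontr)
   assume "gen Y g ?h z \<noteq> 0"
   then obtain w where w: "w \<in> dom_chars Y g" "z = germ g w" "?h (char_of z) \<noteq> 0"
    unfolding gen_def by (auto split: if_splits)
   hence "w \<in> U" using char_of_germ[OF p[OF w(1)]] by (auto split: if_splits)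
   thus False using False w mem by blast
  qed
  thus ?thesis using False off tsV by auto
 qed
 hence "f = (\<lambda>z. ?f2 z + gen Y g ?h z)" by (rule ext)
 thus ?case using gen_span.add_gen[OF f2 g(1) ch Ph] by simp
qed

lemma Cc_on_gen_span:
 assumes Y: "closedin \<O> Y"
  and V: "openin (top_on Y) V" "Hausdorff_space (subtopology (top_on Y) V)"
  and P: "\<forall>z\<in>V. P (char_of z)" and f: "f \<in> Cc_on (groupoid_on Y) V"
 shows "f \<in> gen_span Y P"
proof -
 let ?T = "subtopology (top_on Y) V"
 let ?K = "?T closure_of {z \<in> V. f z \<noteq> 0}"
 have YO: "Y \<subseteq> Omega" using closedin_subset[OF Y] by simp
 have f': "\<forall>z. z \<notin> V \<longrightarrow> f z = 0" "continuous_map ?T euclidean f" "compactin ?T ?K" using f by (auto simp: Cc_on_def)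
 have tsV: "topspace ?T = V" using openin_subset[OF V(1)] by auto
 have sub: "{z \<in> V. f z \<noteq> 0} \<subseteq> ?K" by (rule closure_of_subset) (use tsV in auto)
 have KV: "?K \<subseteq> V" using closure_of_subset_topspace[of ?T] tsV by auto
 let ?U = "{D. good_bisection Y V D}"
 have "\<forall>D\<in>?U. openin ?T D"
 proof
  fix D assume "D \<in> ?U"
  hence "D \<subseteq> V" "openin (top_on Y) D" by (simp_all add: good_bisection_def)
  thus "openin ?T D" using V(1) by (simp add: openin_open_subtopology)
 qed
 moreover have "?K \<subseteq> \<Union>?U" using good_bisection_ex[OF Y V(1)] KV by blast
 ultimately obtain \<D> where D: "finite \<D>" "\<D> \<subseteq> ?U" "?K \<subseteq> \<Union>\<D>"
  using f'(3) unfolding compactin_def by meson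
 show ?thesis
 proof (rule gen_span_cover[OF YO V P D(1) _ f'(2)])
  show "\<forall>D\<in>\<D>. good_bisection Y V D" using D(2) by blast
  show "\<forall>z. z \<notin> \<Union>\<D> \<longrightarrow> f z = 0" using D(3) sub f'(1) by blast
 qed
qed

text \<open>For closed \<open>Y\<close> the characters in \<open>Y\<close> that take
  \<open>dom g\<close> form a compact set, and taking germs of \<open>g\<close> maps it bijectively,
  continuously and openly onto the carrier of \<open>gen Y g h\<close>. The carrier is thus compact,
  open and Hausdorff, and the support condition holds for every continuous \<open>h\<close>.\<close>

lemma Cc_on_gen:
 assumes Y: "closedin \<O> Y" and g: "g \<in> \<I>"
  and h: "continuous_map (dom_top Y g) euclidean h"
 shows "openin (top_on Y) (germ g ` dom_chars Y g)"
  "Hausdorff_space (subtopology (top_on Y) (germ g ` dom_chars Y g))"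
  "gen Y g h \<in> Cc_on (groupoid_on Y) (germ g ` dom_chars Y g)"
proof -
 let ?T = "arrow_topology (groupoid_on Y)" and ?Z = "dom_chars Y g" and ?D = "germ g ` dom_chars Y g"
 have YO: "Y \<subseteq> Omega" using closedin_subset[OF Y] by simp
 have Zo: "openin (subtopology \<O> Y) ?Z" by (rule openin_dom_chars[OF YO g])
 show o: "openin ?T ?D" by (rule openin_bisection[OF YO g Zo]) simp
 have p: "(g, w) \<in> germ_pairs" if "w \<in> ?Z" for w using that YO g by auto
 have ts: "topspace (subtopology ?T ?D) = ?D" using openin_subset[OF o] by auto
 have open_image: "openin (subtopology ?T ?D) (germ g ` U)" if U: "openin (subtopology \<O> Y) U" "U \<subseteq> ?Z" for U
 proof -
  have "openin ?T (germ g ` U)" by (rule openin_bisection[OF YO g U(1)]) (use U(2) in blast)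
  thus ?thesis using openin_open_subtopology[OF o] U(2) by blast
 qed
 show "Hausdorff_space (subtopology ?T ?D)"
  unfolding Hausdorff_space_def
 proof (intro allI impI)
  fix x y assume a: "x \<in> topspace (subtopology ?T ?D) \<and> y \<in> topspace (subtopology ?T ?D) \<and> x \<noteq> y"
  hence "x \<in> ?D" "y \<in> ?D" using ts by (metis, metis)
  then obtain w v where w: "w \<in> ?Z" "x = germ g w" "v \<in> ?Z" "y = germ g v" by (elim imageE)
  have "w \<noteq> v" using a w by blast
  moreover have "w \<in> topspace \<O>" "v \<in> topspace \<O>" using w YO by auto
  ultimately obtain U1 U2 where U: "openin \<O> U1" "openin \<O> U2" "w \<in> U1" "v \<in> U2" "disjnt U1 U2"
   using Hausdorff_space_Omega unfolding Hausdorff_space_def by meson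
  let ?V = "\<lambda>U. germ g ` (U \<inter> ?Z)"
  have "openin (subtopology \<O> Y) (U \<inter> ?Z)" if "openin \<O> U" for U
  proof -
   have "openin (subtopology \<O> Y) (U \<inter> Y)" using that unfolding openin_subtopology by blast
   hence "openin (subtopology \<O> Y) ((U \<inter> Y) \<inter> ?Z)" using Zo by (rule openin_Int)
   moreover have "(U \<inter> Y) \<inter> ?Z = U \<inter> ?Z" by blast
   ultimately show ?thesis by metis
  qed
  hence "openin (subtopology ?T ?D) (?V U1)" "openin (subtopology ?T ?D) (?V U2)" using open_image U by blast+
  moreover have "disjnt (?V U1) (?V U2)"
  proof (unfold disjnt_iff, intro allI notI, elim conjE)
   fix z assume "z \<in> ?V U1" "z \<in> ?V U2"
   then obtain \<alpha> b where ab: "\<alpha> \<in> U1 \<inter> ?Z" "z = germ g \<alpha>" "b \<in> U2 \<inter> ?Z" "z = germ g b" by (elim imageE)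
   have "\<alpha> \<in> ?Z" "b \<in> ?Z" using ab by blast+
   note c = char_of_germ[OF p[OF this(1)]] char_of_germ[OF p[OF this(2)]]
   have "\<alpha> = b" using c unfolding ab(2)[symmetric] ab(4)[symmetric] by simp
   thus False using ab(1,3) U(5) unfolding disjnt_iff by blast
  qed
  ultimately show "\<exists>U V. openin (subtopology ?T ?D) U \<and> openin (subtopology ?T ?D) V \<and> x \<in> U \<and> y \<in> V \<and> disjnt U V"
   using U w by (intro exI[of _ "?V U1"] exI[of _ "?V U2"] conjI) simp_all
 qed
 have comp: "compact_space (subtopology ?T ?D)"
 proof -
  have "compactin \<O> ?Z"
   by (rule closedin_compact_space[OF compact_space_Omega closedin_dom_chars[OF Y g]])
  hence "compactin (subtopology \<O> ?Z) ?Z" by (simp add: compactin_subtopology)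
  hence "compactin ?T ?D" by (rule image_compactin) (rule continuous_germ[OF YO g])
  thus ?thesis by (rule compact_space_subtopology)
 qed
 have cont: "continuous_map (subtopology ?T ?D) euclidean (gen Y g h)"
  unfolding continuous_map_def
 proof (intro conjI allI impI)
  fix W :: "complex set" assume W: "openin euclidean W"
  let ?U = "{w \<in> ?Z. h w \<in> W}"
  have tsZ: "topspace (subtopology \<O> ?Z) = ?Z" using YO by auto
  have e: "subtopology \<O> ?Z = subtopology (subtopology \<O> Y) ?Z"
   unfolding subtopology_subtopology by (rule arg_cong[where f = "subtopology \<O>"]) blast
  have "openin (subtopology \<O> ?Z) {w \<in> topspace (subtopology \<O> ?Z). h w \<in> W}"
   by (rule openin_continuous_map_preimage[OF h W])
  hence "openin (subtopology \<O> ?Z) ?U" unfolding tsZ .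
  hence "openin (subtopology \<O> Y) ?U"
   unfolding e by (rule openin_trans_full[OF _ Zo])
  hence "openin (subtopology ?T ?D) (germ g ` ?U)" by (rule open_image) blast
  moreover have "{x \<in> topspace (subtopology ?T ?D). gen Y g h x \<in> W} = germ g ` ?U"
  proof -
   have "gen Y g h (germ g w) = h w" if "w \<in> ?Z" for w
    using gen_germ[OF YO g p[OF that]] that by simp
   thus ?thesis unfolding ts by auto
  qed
  ultimately show "openin (subtopology ?T ?D) {x \<in> topspace (subtopology ?T ?D). gen Y g h x \<in> W}" by (simp del: topspace_subtopology groupoid_on_simps)
 qed simp
 have "compactin (subtopology ?T ?D) (subtopology ?T ?D closure_of {\<gamma> \<in> ?D. gen Y g h \<gamma> \<noteq> 0})"
  by (rule closedin_compact_space[OF comp]) simp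
 moreover have "gen Y g h \<gamma> = 0" if "\<gamma> \<notin> ?D" for \<gamma> using that by (simp add: gen_def)
 ultimately show "gen Y g h \<in> Cc_on (groupoid_on Y) ?D" using cont unfolding Cc_on_def by blast
qed

abbreviation (input) "Cc_gens G \<equiv> (\<Union>V\<in>{V. openin (arrow_topology G) V \<and>
         Hausdorff_space (subtopology (arrow_topology G) V)}. Cc_on G V)"

lemma Cc_eq_gen_span:
 assumes Y: "closedin \<O> Y"
 shows "Cc (groupoid_on Y) = gen_span Y (\<lambda>_. True)"
proof (intro subset_antisym subsetI)
 fix f assume "f \<in> Cc (groupoid_on Y)"
 then obtain F c where F: "finite F" "F \<subseteq> Cc_gens (groupoid_on Y)" "f = (\<lambda>z. \<Sum>f\<in>F. c f * f z)" unfolding Cc_def by blast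
 show "f \<in> gen_span Y (\<lambda>_. True)" unfolding F(3)
 proof (rule gen_span_sum[OF F(1)])
  fix f assume "f \<in> F"
  hence "f \<in> Cc_gens (groupoid_on Y)" using F(2) by (rule subsetD[rotated])
  then obtain V where "openin (top_on Y) V" "Hausdorff_space (subtopology (top_on Y) V)"
   "f \<in> Cc_on (groupoid_on Y) V" by blast
  thus "f \<in> gen_span Y (\<lambda>_. True)" using Cc_on_gen_span[OF Y, of V "\<lambda>_. True" f] by blast
 qed
next
 fix f assume "f \<in> gen_span Y (\<lambda>_. True)"
 thus "f \<in> Cc (groupoid_on Y)"
 proof induction
  case zero
  have "(\<lambda>_. 0) = (\<lambda>z. \<Sum>f\<in>{}. (\<lambda>_. 0) f * f z :: complex)" by simp
  thus ?case unfolding Cc_def by (intro CollectI exI[of _ "{}"] exI[of _ "\<lambda>_. 0"]) simp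
 next
  case (add_gen f g h)
  let ?u = "gen Y g h"
  obtain F c where F: "finite F" "F \<subseteq> Cc_gens (groupoid_on Y)" "f = (\<lambda>z. \<Sum>f\<in>F. c f * f z)"
   using add_gen.IH unfolding Cc_def by blast
  have u: "?u \<in> Cc_gens (groupoid_on Y)" using Cc_on_gen[OF Y add_gen.hyps(2,3)] by blast
  \<comment> \<open>The new generator may already occur in \<open>F\<close>; its coefficient is then
    raised by one.\<close>
  define c' where "c' x = (if x \<in> F then c x else 0) + (if x = ?u then 1 else 0)" for x
  have "f z + ?u z = (\<Sum>f\<in>insert ?u F. c' f * f z)" for z
  proof -
   have "(\<Sum>x\<in>insert ?u F. c' x * x z) = (\<Sum>x\<in>insert ?u F. (if x \<in> F then c x * x z else 0)) + (\<Sum>x\<in>insert ?u F. (if x = ?u then x z else 0))"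
    unfolding sum.distrib[symmetric] by (rule sum.cong) (auto simp: c'_def distrib_right)
   also have "(\<Sum>x\<in>insert ?u F. (if x \<in> F then c x * x z else 0)) = (\<Sum>x\<in>F. c x * x z)"
    by (rule sum.mono_neutral_cong_right) (use F(1) in auto)
   also have "(\<Sum>x\<in>insert ?u F. (if x = ?u then x z else 0)) = ?u z"
    using F(1) by (subst sum.delta) auto
   finally show ?thesis using F(3) by simp
  qed
  hence "(\<lambda>z. f z + ?u z) = (\<lambda>z. \<Sum>f\<in>insert ?u F. c' f * f z)" by (rule ext)
  thus ?case unfolding Cc_def
   by (intro CollectI exI[of _ "insert ?u F"] exI[of _ c'] conjI) (use F u in simp_all)
 qed
qed

text \<open>\<open>Cc_eq_gen_span\<close> concerns closed sets of characters and says nothing over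
  the open set \<open>Omega - Y\<close>. But the arrows over an open set of characters form an open
  subspace, so a set \<open>V\<close> open there is open in the whole groupoid with the same
  subspace topology, and \<open>Cc_on_gen_span\<close> can be applied over \<open>Omega\<close> with
  a condition on the support.\<close>

lemma Cc_off_boundary:
 assumes Y: "closedin \<O> Y" "Y \<subseteq> Omega" and f: "f \<in> Cc (groupoid_on (Omega - Y))"
 shows "f \<in> gen_span Omega (\<lambda>w. w \<notin> Y)"
proof -
 let ?W = "Omega - Y"
 have cl: "closedin \<O> Omega" using closedin_topspace[of \<O>] by simp
 have Wo: "openin \<O> ?W" using Y(1) by (simp add: closedin_def)
 let ?A = "{z \<in> arrows \<G>. char_of z \<in> ?W}"
 have Ao: "openin (arrow_topology \<G>) ?A"
  unfolding openin_arrow_topology_iff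
 proof (intro conjI ballI)
  fix g assume g: "(g :: 'a \<rightharpoonup> 'a) \<in> \<I>"
  have "{w \<in> Omega. w (dom g) \<and> germ g w \<in> ?A} = {w \<in> Omega. w (dom g)} \<inter> ?W"
  proof -
   have "germ g w \<in> ?A \<longleftrightarrow> w \<in> ?W" if "w \<in> Omega" "w (dom g)" for w
   proof -
    have p: "(g, w) \<in> germ_pairs" using that g by simp
    show ?thesis using germ_arrow[OF p] char_of_germ[OF p] by simp
   qed
   thus ?thesis by blast
  qed
  thus "openin \<O> {w \<in> Omega. w (dom g) \<and> germ g w \<in> ?A}"
   using openin_Int[OF openin_Omega_ideal[OF dom_hull[OF g]] Wo] by simp
 qed blast
 obtain F c where F: "finite F" "F \<subseteq> Cc_gens (groupoid_on ?W)" "f = (\<lambda>z. \<Sum>f\<in>F. c f * f z)"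
  using f unfolding Cc_def by blast
 show ?thesis unfolding F(3)
 proof (rule gen_span_sum[OF F(1)])
  fix f assume "f \<in> F"
  hence "f \<in> Cc_gens (groupoid_on ?W)" using F(2) by (rule subsetD[rotated])
  then obtain V where V: "openin (arrow_topology (groupoid_on ?W)) V" "Hausdorff_space (subtopology (arrow_topology (groupoid_on ?W)) V)"
   "f \<in> Cc_on (groupoid_on ?W) V" by blast
  have VA: "V \<subseteq> ?A" "openin (arrow_topology \<G>) V" using V(1) openin_open_subtopology[OF Ao] by simp_all
  have sub: "subtopology (arrow_topology (groupoid_on ?W)) V = subtopology (arrow_topology \<G>) V"
   using VA(1) by (simp add: subtopology_subtopology inf.absorb2)
  have "f \<in> Cc_on \<G> V" using V(3) unfolding Cc_on_def sub .
  moreover have "\<forall>z\<in>V. char_of z \<notin> Y" using VA(1) by blast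
  ultimately show "f \<in> gen_span Omega (\<lambda>w. w \<notin> Y)"
   using Cc_on_gen_span[OF cl, of V "\<lambda>w. w \<notin> Y" f] VA V(2) unfolding groupoid_on_Omega sub by blast
 qed
qed

lemma gen_restrict:
 assumes Y: "Y \<subseteq> Omega" and g: "g \<in> \<I>" and z: "z \<in> arrows \<G>"
 shows "(if char_of z \<in> Y then gen Omega g h z else 0) = gen Y g h z"
proof -
 obtain k w where k: "(k, w) \<in> germ_pairs" "z = germ k w" using arrowE[OF z] .
 have "w \<in> Omega" using k by simp
 show ?thesis
 proof (cases "w \<in> Y")
  case True
  thus ?thesis unfolding k(2) char_of_germ[OF k(1)]
   using gen_germ[OF Y g k(1) True] gen_germ[OF subset_refl g k(1)] \<open>w \<in> Omega\<close> by simp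
 next
  case False
  have "gen Y g h z = 0" using gen_nonzeroD(3)[OF Y g, of h z] False k char_of_germ[OF k(1)] by auto
  thus ?thesis unfolding k(2) char_of_germ[OF k(1)] using False by simp
 qed
qed

lemma gen_outside:
 assumes "Y \<subseteq> Omega" "g \<in> \<I>" "z \<notin> arrows \<G>"
 shows "gen Y g h z = 0"
 using gen_nonzeroD[OF assms(1,2), of h z] germ_arrow[of g "char_of z"] assms(3) by metis

lemma gen_outside_on:
 assumes "Y \<subseteq> Omega" "g \<in> \<I>" "z \<notin> arrows (groupoid_on Y)"
 shows "gen Y g h z = 0"
proof (rule ccontr)
 assume nz: "gen Y g h z \<noteq> 0"
 note d = gen_nonzeroD[OF assms(1,2) nz]
 show False using germ_arrow[OF d(2)] d(3) assms(3) unfolding d(1)[symmetric] by simp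
qed

lemma gen_span_restrict:
 assumes Y: "Y \<subseteq> Omega" and f: "f \<in> gen_span Omega P"
 shows "(\<lambda>z. if z \<in> arrows (groupoid_on Y) then f z else 0) \<in> gen_span Y P"
 using f
proof induction
 case zero
 have "(\<lambda>z::'a germ. if z \<in> arrows (groupoid_on Y) then 0 else 0 :: complex) = (\<lambda>_. 0)" by simp
 thus ?case using gen_span.zero by metis
next
 case (add_gen f g h)
 have "(\<lambda>z. (if z \<in> arrows (groupoid_on Y) then f z else 0) + gen Y g h z) \<in> gen_span Y P"
 proof (rule gen_span.add_gen[OF add_gen.IH add_gen.hyps(2)])
  show "continuous_map (dom_top Y g) euclidean h"
   by (rule continuous_map_from_subtopology_mono[OF add_gen.hyps(3)]) (use Y in blast)
  show "\<forall>w\<in>dom_chars Y g. h w \<noteq> 0 \<longrightarrow> P w" using add_gen.hyps(4) Y by blast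
 qed
 moreover have "(if z \<in> arrows (groupoid_on Y) then f z + gen Omega g h z else 0) =
  (if z \<in> arrows (groupoid_on Y) then f z else 0) + gen Y g h z" for z
  using gen_restrict[OF Y add_gen.hyps(2), of z h] gen_outside[OF Y add_gen.hyps(2), of z h]
  by (cases "z \<in> arrows \<G>"; cases "char_of z \<in> Y") simp_all
 ultimately show ?case by simp
qed

lemma gen_span_rep:
 assumes "f \<in> gen_span Y P"
 obtains n :: nat and g h where
  "\<And>i. i < n ==> g i \<in> \<I>"
  "\<And>i. i < n ==> continuous_map (dom_top Y (g i)) euclidean (h i)"
  "\<And>z. f z = (\<Sum>i<n. gen Y (g i) (h i) z)"
proof -
 have "\<exists>(n::nat) g h. (\<forall>i<n. g i \<in> \<I> \<and> continuous_map (dom_top Y (g i)) euclidean (h i)) \<and>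
   (\<forall>z. f z = (\<Sum>i<n. gen Y (g i) (h i) z))"
  using assms
 proof induction
  case zero
  thus ?case by (intro exI[of _ 0]) simp
 next
  case (add_gen f g h)
  then obtain n :: nat and g' h' where n: "\<forall>i<n. g' i \<in> \<I> \<and> continuous_map (dom_top Y (g' i)) euclidean (h' i)"
   "\<forall>z. f z = (\<Sum>i<n. gen Y (g' i) (h' i) z)" by blast
  have "\<forall>i<Suc n. (g'(n := g)) i \<in> \<I> \<and>
   continuous_map (dom_top Y ((g'(n := g)) i)) euclidean ((h'(n := h)) i)"
   using n(1) add_gen.hyps by (simp add: less_Suc_eq)
  moreover have "\<forall>z. f z + gen Y g h z = (\<Sum>i<Suc n. gen Y ((g'(n := g)) i) ((h'(n := h)) i) z)"
   using n(2) by simp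
  ultimately show ?case by blast
 qed
 thus ?thesis using that by blast
qed

subsection \<open>Convolution on the span\<close>

text \<open>Finite support on range fibres turns the infinite sums in \<open>lconv\<close> into
  finite ones; otherwise \<open>infsum\<close> could not be split along sums of functions.\<close>

lemma gen_span_finite_support:
 assumes Y: "Y \<subseteq> Omega" and f: "f \<in> gen_span Y P" and p: "v \<in> Omega"
 shows "finite {y \<in> range_fibre \<G> (unit_germ v). f y \<noteq> 0}"
 using f
proof induction
 case (add_gen f g h)
 have "{y \<in> range_fibre \<G> (unit_germ v). f y + gen Y g h y \<noteq> 0} \<subseteq>
  {y \<in> range_fibre \<G> (unit_germ v). f y \<noteq> 0} \<union> {y \<in> range_fibre \<G> (unit_germ v). gen Y g h y \<noteq> 0}"
  by auto
 thus ?case using finite_subset add_gen.IH finite_gen_range_fibre[OF Y add_gen.hyps(2) p, of h] by blast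
qed simp

lemma lconv_finite:
 assumes "finite S" "S \<subseteq> range_fibre \<G> (rng \<G> z)"
  "\<And>y. y \<in> range_fibre \<G> (rng \<G> z) - S ==> f y = 0"
 shows "lconv f q z = (\<Sum>y\<in>S. f y * q (gmul \<G> (ginv \<G> y) z))"
proof -
 have "lconv f q z = (\<Sum>\<^sub>\<infinity>y\<in>S. f y * q (gmul \<G> (ginv \<G> y) z))"
  unfolding lconv_def by (rule infsum_cong_neutral) (use assms in auto)
 thus ?thesis using assms(1) by simp
qed

lemma gen_span_support:
 assumes "Y \<subseteq> Omega" "f \<in> gen_span Y P" "z \<in> arrows \<G>"
 shows "finite {y \<in> range_fibre \<G> (rng \<G> z). f y \<noteq> 0}"
 using gen_span_finite_support[OF assms(1,2) range_char_Omega[OF assms(3)]] rng_arrow[OF assms(3)] by simp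

lemma lconv_add_left:
 assumes "Y \<subseteq> Omega" "f \<in> gen_span Y P" "f' \<in> gen_span Y P" "z \<in> arrows \<G>"
 shows "lconv (\<lambda>z. f z + f' z) q z = lconv f q z + lconv f' q z"
proof -
 let ?R = "range_fibre \<G> (rng \<G> z)"
 let ?S = "{y \<in> ?R. f y \<noteq> 0} \<union> {y \<in> ?R. f' y \<noteq> 0}"
 have S: "finite ?S" "?S \<subseteq> ?R" using gen_span_support[OF assms(1) _ assms(4)] assms(2,3) by blast+
 have "lconv f q z = (\<Sum>y\<in>?S. f y * q (gmul \<G> (ginv \<G> y) z))"
  "lconv f' q z = (\<Sum>y\<in>?S. f' y * q (gmul \<G> (ginv \<G> y) z))"
  "lconv (\<lambda>z. f z + f' z) q z = (\<Sum>y\<in>?S. (f y + f' y) * q (gmul \<G> (ginv \<G> y) z))"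
  by (rule lconv_finite[OF S]; fastforce)+
 thus ?thesis by (simp add: distrib_right sum.distrib)
qed

lemma lconv_linear:
 assumes "Y \<subseteq> Omega" "f \<in> gen_span Y P" "z \<in> arrows \<G>"
 shows lconv_scale_left: "lconv (\<lambda>z. c * f z) q z = c * lconv f q z"
  and lconv_scale_right: "lconv f (\<lambda>z. c * q z) z = c * lconv f q z"
  and lconv_add_right: "lconv f (\<lambda>z. q z + q' z) z = lconv f q z + lconv f q' z"
proof -
 let ?R = "range_fibre \<G> (rng \<G> z)"
 let ?S = "{y \<in> ?R. f y \<noteq> 0}"
 have S: "finite ?S" "?S \<subseteq> ?R" using gen_span_support[OF assms] by blast+
 have *: "lconv f q z = (\<Sum>y\<in>?S. f y * q (gmul \<G> (ginv \<G> y) z))" for q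
  by (rule lconv_finite[OF S]) auto
 have "lconv (\<lambda>z. c * f z) q z = (\<Sum>y\<in>?S. (c * f y) * q (gmul \<G> (ginv \<G> y) z))"
  by (rule lconv_finite[OF S]) auto
 thus "lconv (\<lambda>z. c * f z) q z = c * lconv f q z" unfolding * by (simp add: sum_distrib_left mult.assoc)
 show "lconv f (\<lambda>z. c * q z) z = c * lconv f q z" unfolding * by (simp add: sum_distrib_left mult.left_commute)
 show "lconv f (\<lambda>z. q z + q' z) z = lconv f q z + lconv f q' z" unfolding * by (simp add: distrib_left sum.distrib)
qed

lemma lconv_zero: "lconv (\<lambda>_. 0) q z = 0" "lconv f (\<lambda>_. 0) z = 0"
 by (simp_all add: lconv_def)

lemma lconv_gen_add:
 assumes "invariant_chars Y" "f \<in> gen_span Y P" "g \<in> \<I>"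
  "continuous_map (dom_top Y g) euclidean h"
  "z \<in> arrows \<G>"
 shows "lconv (\<lambda>z. f z + gen Y g h z) q z = lconv f q z + lconv (gen Y g h) q z"
 by (rule lconv_add_left[OF invariant_charsD(1)[OF assms(1)] gen_span_mono[OF assms(2)] gen_span_gen[OF assms(3,4), of "\<lambda>_. True"] assms(5)]) simp_all

section \<open>Convolution, source fibres and reduced norm of a reduction\<close>

lemma range_fibre_groupoid_on:
 assumes Y: "invariant_chars Y" and z: "z \<in> arrows (groupoid_on Y)"
 shows "range_fibre (groupoid_on Y) (rng \<G> z) = range_fibre \<G> (rng \<G> z)"
proof -
 have g: "z \<in> arrows \<G>" "char_of z \<in> Y" using z by simp_all
 have "char_of y \<in> Y" if e: "y \<in> arrows \<G>" "rng \<G> y = rng \<G> z" for y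
 proof -
  have "range_char y = range_char z"
   using e(2) unit_germ_inj[OF range_char_Omega[OF e(1)] range_char_Omega[OF g(1)]] rng_arrow[OF e(1)] rng_arrow[OF g(1)] by simp
  thus ?thesis using range_char_invariant_iff[OF Y e(1)] range_char_invariant_iff[OF Y g(1)] g(2) by simp
 qed
 thus ?thesis unfolding range_fibre_def by auto
qed

lemma convolution_groupoid_on:
 assumes Y: "invariant_chars Y"
 shows "conv_on Y f f' z = (if z \<in> arrows (groupoid_on Y) then lconv f f' z else 0)"
 unfolding convolution_def lconv_def using range_fibre_groupoid_on[OF Y] by simp

definition fibre :: "('a::left_cancel_monoid set => bool) => 'a germ set" where
 "fibre w = {z \<in> arrows \<G>. char_of z = w}"

lemma source_fibre_groupoid_on:
 assumes "Y \<subseteq> Omega" "w \<in> Y"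
 shows "source_fibre (groupoid_on Y) (unit_germ w) = fibre w"
proof -
 have "src \<G> z = unit_germ w \<longleftrightarrow> char_of z = w" if "z \<in> arrows \<G>" for z
  using src_arrow[OF that] unit_germ_inj[OF char_of_Omega[OF that], of w] assms by auto
 thus ?thesis using assms unfolding source_fibre_def fibre_def by auto
qed

definition fibre_rep :: "('a::left_cancel_monoid set => bool) => 'a germ_fun => 'a germ op" where
 "fibre_rep w f = (\<lambda>x\<in>ell2 (fibre w). \<lambda>z. if z \<in> fibre w then lconv f x z else 0)"

abbreviation "fnorm w f \<equiv> op_norm (fibre w) (fibre_rep w f)"

lemma regular_rep_groupoid_on:
 assumes Y: "invariant_chars Y" and w: "w \<in> Y"
 shows "regular_rep (groupoid_on Y) (unit_germ w) f = fibre_rep w f"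
proof -
 have YO: "Y \<subseteq> Omega" by (rule invariant_charsD[OF Y])
 have "range_fibre (groupoid_on Y) (rng \<G> z) = range_fibre \<G> (rng \<G> z)" if "z \<in> fibre w" for z
  by (rule range_fibre_groupoid_on[OF Y]) (use that w in \<open>simp add: fibre_def\<close>)
 thus ?thesis
  unfolding regular_rep_def fibre_rep_def lconv_def source_fibre_groupoid_on[OF YO w]
  by (intro restrict_ext ext) simp
qed

lemma units_groupoid_on:
 assumes "Y \<subseteq> Omega"
 shows "units (groupoid_on Y) = unit_germ ` Y"
proof (intro subset_antisym subsetI)
 fix x assume "x \<in> units (groupoid_on Y)"
 then obtain z where "z \<in> arrows \<G>" "char_of z \<in> Y" "x = src \<G> z" unfolding units_def by auto
 thus "x \<in> unit_germ ` Y" using src_arrow by blast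
next
 fix x assume "x \<in> unit_germ ` Y"
 then obtain w where w: "w \<in> Y" "x = unit_germ w" by blast
 hence p: "(Some, w) \<in> germ_pairs" using assms unit_germ_pair by blast
 have "germ Some w \<in> arrows (groupoid_on Y)" using germ_arrow[OF p] char_of_germ[OF p] w by simp
 moreover have "src \<G> (germ Some w) = x" using src_germ[OF p] w by simp
 ultimately show "x \<in> units (groupoid_on Y)" unfolding units_def by (metis groupoid_on_simps(1) imageI)
qed

lemma reduced_norm_groupoid_on:
 assumes Y: "invariant_chars Y"
 shows "reduced_norm (groupoid_on Y) f = Sup (insert 0 ((\<lambda>w. fnorm w f) ` Y))"
proof -
 have YO: "Y \<subseteq> Omega" by (rule invariant_charsD[OF Y])
 let ?F = "\<lambda>x. op_norm (source_fibre (groupoid_on Y) x) (regular_rep (groupoid_on Y) x f)"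
 have "{?F x | x. x \<in> units (groupoid_on Y)} = ?F ` unit_germ ` Y"
  unfolding units_groupoid_on[OF YO] by (rule Setcompr_eq_image)
 also have "\<dots> = (\<lambda>w. fnorm w f) ` Y"
  unfolding image_image
  by (rule image_cong[OF refl]) (simp only: source_fibre_groupoid_on[OF YO] regular_rep_groupoid_on[OF Y])
 finally have "{?F x | x. x \<in> units (groupoid_on Y)} = (\<lambda>w. fnorm w f) ` Y" .
 thus ?thesis unfolding reduced_norm_def by simp
qed

text \<open>The germ of \<open>g\<close> at the push-forward of \<open>w\<close> by
  \<open>g'\<close>, multiplied by the germ of \<open>g'\<close> at \<open>w\<close>, is the germ of
  the composition at \<open>w\<close>. The left coefficient is therefore read at the range of the
  right factor.\<close>

lemma gen_span_conv_gen_gen: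
 assumes Y: "invariant_chars Y" and g: "g \<in> \<I>" and g': "g' \<in> \<I>"
 shows "conv_on Y (gen Y g h) (gen Y g' h') = gen Y (g \<circ>\<^sub>m g') (\<lambda>w. h (push g' w) * h' w)"
proof
 fix z :: "'a germ"
 have YO: "Y \<subseteq> Omega" by (rule invariant_charsD[OF Y])
 have gg: "g \<circ>\<^sub>m g' \<in> \<I>" using g g' by (rule comp_hull)
 have gi: "pinv g \<in> \<I>" using g by (rule inv_hull)
 show "conv_on Y (gen Y g h) (gen Y g' h') z = gen Y (g \<circ>\<^sub>m g') (\<lambda>w. h (push g' w) * h' w) z"
 proof (cases "z \<in> arrows (groupoid_on Y)")
  case False
  hence "gen Y (g \<circ>\<^sub>m g') (\<lambda>w. h (push g' w) * h' w) z = 0"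
   by (rule gen_outside_on[OF YO gg])
  thus ?thesis unfolding convolution_groupoid_on[OF Y] using False by auto
 next
  case True
  hence A: "z \<in> arrows \<G>" "char_of z \<in> Y" by simp_all
  obtain k w where k: "(k, w) \<in> germ_pairs" "z = germ k w" using arrowE[OF A(1)] .
  have w: "w \<in> Y" "w \<in> Omega" using A k char_of_germ[OF k(1)] YO by auto
  have lhs: "conv_on Y (gen Y g h) (gen Y g' h') z =
   (case act (pinv g) z of None => 0 | Some d => h (range_char d) * gen Y g' h' d)"
   unfolding convolution_groupoid_on[OF Y] using True lconv_gen[OF Y g A] by simp
  note rhs = gen_germ[OF YO gg k(1) w(1)]
  show ?thesis
  proof (cases "w (dom (g \<circ>\<^sub>m g')) \<and> germ k w = germ (g \<circ>\<^sub>m g') w")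
   case T: True
   have "dom (g \<circ>\<^sub>m g') \<subseteq> dom g'" by (auto simp: dom_def map_comp_Some_iff)
   hence d: "w (dom g')" using char_mono[OF Omega_char[OF w(2)] dom_hull[OF gg] dom_hull[OF g']] T by blast
   have p: "(g', w) \<in> germ_pairs" using d w g' by simp
   have "act g (germ g' w) = Some z" using act_germ[OF g p] T k(2) by simp
   hence "act (pinv g) z = Some (germ g' w)" using act_inverse_iff[OF g germ_arrow[OF p] A(1)] by simp
   thus ?thesis using lhs rhs T range_char_germ[OF p] gen_germ[OF YO g' p w(1)] d k(2) by simp
  next
   case F: False
   have "gen Y g' h' d = 0" if a: "act (pinv g) z = Some d" for d
   proof (rule ccontr)
    assume nz: "gen Y g' h' d \<noteq> 0"
    note d = act_SomeD[OF gi A(1) a]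
    have cd: "char_of d = w" using d(2) k char_of_germ[OF k(1)] by simp
    note n = gen_nonzeroD[OF YO g' nz, unfolded cd]
    have "act g (germ g' w) = Some z" using d(4) n(1) partial_inverse_partial_inverse[OF g] by simp
    hence "w (dom (g \<circ>\<^sub>m g')) \<and> germ k w = germ (g \<circ>\<^sub>m g') w"
     using act_germ[OF g n(2)] k(2) by (auto split: if_splits)
    thus False using F by blast
   qed
   thus ?thesis using lhs rhs F k(2) by (auto split: option.splits)
  qed
 qed
qed

lemma continuous_push_on:
 assumes Y: "invariant_chars Y" and g: "g \<in> \<I>" and g': "g' \<in> \<I>"
 shows "continuous_map (dom_top Y (g \<circ>\<^sub>m g')) (dom_top Y g) (push g')"
proof -
 have YO: "Y \<subseteq> Omega" by (rule invariant_charsD[OF Y])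
 have d: "w (dom g')" if "w \<in> Omega" "w (dom (g \<circ>\<^sub>m g'))" for w
 proof -
  have "dom (g \<circ>\<^sub>m g') \<subseteq> dom g'" by (auto simp: dom_def map_comp_Some_iff)
  thus ?thesis
   using char_mono[OF Omega_char[OF that(1)] dom_hull[OF comp_hull[OF g g']] dom_hull[OF g'] that(2)] by blast
 qed
 have 1: "continuous_map (dom_top Y (g \<circ>\<^sub>m g')) \<O> (push g')"
  by (rule continuous_map_from_subtopology_mono[OF continuous_push_character[OF g']]) (use d YO in blast)
 have 2: "push g' w \<in> dom_chars Y g" if "w \<in> dom_chars Y (g \<circ>\<^sub>m g')" for w
  using that invariant_charsD(2)[OF Y g'] d YO push_character_dom_comp[OF g g', of w] by blast
 have "push g' \<in> topspace (dom_top Y (g \<circ>\<^sub>m g')) \<rightarrow> dom_chars Y g"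
  by (rule Pi_I) (rule 2, simp)
 thus ?thesis unfolding continuous_map_in_subtopology using 1 by blast
qed

lemma gen_span_conv:
 assumes Y: "invariant_chars Y" and f: "f \<in> gen_span Y (\<lambda>_. True)" and f': "f' \<in> gen_span Y (\<lambda>_. True)"
 shows "conv_on Y f f' \<in> gen_span Y (\<lambda>_. True)"
proof -
 have YO: "Y \<subseteq> Omega" by (rule invariant_charsD[OF Y])
 have 1: "conv_on Y (gen Y g h) f' \<in> gen_span Y (\<lambda>_. True)"
  if g: "g \<in> \<I>" "continuous_map (dom_top Y g) euclidean h" for g h
  using f'
 proof induction
  case zero
  have "conv_on Y (gen Y g h) (\<lambda>_. 0) = (\<lambda>_. 0)"
   unfolding convolution_groupoid_on[OF Y] lconv_zero by simp
  thus ?case using gen_span.zero by metis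
 next
  case (add_gen f' g' h')
  have "conv_on Y (gen Y g h) (\<lambda>z. f' z + gen Y g' h' z) =
   (\<lambda>z. conv_on Y (gen Y g h) f' z + conv_on Y (gen Y g h) (gen Y g' h') z)"
   unfolding convolution_groupoid_on[OF Y]
   using lconv_add_right[OF YO gen_span_gen[OF g, of "\<lambda>_. True"]] by auto
  moreover have "conv_on Y (gen Y g h) (gen Y g' h') \<in> gen_span Y (\<lambda>_. True)"
   unfolding gen_span_conv_gen_gen[OF Y g(1) add_gen.hyps(2)]
  proof (rule gen_span_gen[OF comp_hull[OF g(1) add_gen.hyps(2)]])
   have "continuous_map (dom_top Y (g \<circ>\<^sub>m g')) euclidean (h \<circ> push g')"
    by (rule continuous_map_compose[OF continuous_push_on[OF Y g(1) add_gen.hyps(2)] g(2)])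
   moreover have "continuous_map (dom_top Y (g \<circ>\<^sub>m g')) euclidean h'"
   proof (rule continuous_map_from_subtopology_mono[OF add_gen.hyps(3)])
    have "dom (g \<circ>\<^sub>m g') \<subseteq> dom g'" by (auto simp: dom_def map_comp_Some_iff)
    thus "dom_chars Y (g \<circ>\<^sub>m g') \<subseteq> dom_chars Y g'"
     using char_mono[OF Omega_char dom_hull[OF comp_hull[OF g(1) add_gen.hyps(2)]] dom_hull[OF add_gen.hyps(2)]] YO by blast
   qed
   ultimately show "continuous_map (dom_top Y (g \<circ>\<^sub>m g')) euclidean (\<lambda>w. h (push g' w) * h' w)"
    using continuous_map_mult_complex by (fastforce simp: comp_def)
  qed simp
  ultimately show ?case using gen_span_add[OF add_gen.IH] by simp
 qed
 show ?thesis
  using f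
 proof induction
  case zero
  have "conv_on Y (\<lambda>_. 0) f' = (\<lambda>_. 0)"
   unfolding convolution_groupoid_on[OF Y] lconv_zero by simp
  thus ?case using gen_span.zero by metis
 next
  case (add_gen f g h)
  have "conv_on Y (\<lambda>z. f z + gen Y g h z) f' =
   (\<lambda>z. conv_on Y f f' z + conv_on Y (gen Y g h) f' z)"
   unfolding convolution_groupoid_on[OF Y]
   using lconv_gen_add[OF Y add_gen.hyps(1-3)] by auto
  thus ?case using gen_span_add[OF add_gen.IH 1[OF add_gen.hyps(2,3)]] by simp
 qed
qed

text \<open>Inverting an arrow exchanges source and range, so the coefficient is evaluated at the
  push-forward of the new source along the inverse of \<open>g\<close>.\<close>

lemma involution_gen:
 assumes Y: "invariant_chars Y" and g: "g \<in> \<I>"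
 shows "involution (groupoid_on Y) (gen Y g h) = gen Y (pinv g) (\<lambda>w. cnj (h (push (pinv g) w)))"
proof
 fix z :: "'a germ"
 have YO: "Y \<subseteq> Omega" by (rule invariant_charsD[OF Y])
 let ?gi = "pinv g"
 have gi: "?gi \<in> \<I>" using g by (rule inv_hull)
 show "involution (groupoid_on Y) (gen Y g h) z = gen Y ?gi (\<lambda>w. cnj (h (push ?gi w))) z"
 proof (cases "z \<in> arrows (groupoid_on Y)")
  case False
  hence "gen Y ?gi (\<lambda>w. cnj (h (push ?gi w))) z = 0"
   by (rule gen_outside_on[OF YO gi])
  thus ?thesis unfolding involution_def using False by auto
 next
  case True
  hence A: "z \<in> arrows \<G>" "char_of z \<in> Y" by simp_all
  obtain k w where k: "(k, w) \<in> germ_pairs" "z = germ k w" using arrowE[OF A(1)] .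
  have w: "w \<in> Y" "w \<in> Omega" using A k char_of_germ[OF k(1)] YO by auto
  have kh: "k \<in> \<I>" "w (dom k)" using k(1) by simp_all
  let ?v = "push k w" and ?ki = "pinv k"
  have pY: "?v \<in> Y" by (rule invariant_charsD(2)[OF Y kh(1) w(1) kh(2)])
  note kp = germ_inverse_pair[OF k(1)]
  have bk: "push ?ki ?v = w" by (rule push_character_inverse[OF kh(1) Omega_char[OF w(2)] kh(2)])
  have lhs: "involution (groupoid_on Y) (gen Y g h) z = (if ?v (dom g) \<and> germ ?ki ?v = germ g ?v then cnj (h ?v) else 0)"
   unfolding involution_def using True ginv_germ[OF k(1)] gen_germ[OF YO g kp pY] k(2) by simp
  have rhs: "gen Y ?gi (\<lambda>w. cnj (h (push ?gi w))) z =
   (if w (dom ?gi) \<and> germ k w = germ ?gi w then cnj (h (push ?gi w)) else 0)"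
   using gen_germ[OF YO gi k(1) w(1)] k(2) by simp
  show ?thesis
  proof (cases "w (dom ?gi) \<and> germ k w = germ ?gi w")
   case T: True
   have p: "(?gi, w) \<in> germ_pairs" using T gi w by simp
   have e: "?v = push ?gi w" by (rule push_character_germ_cong[OF k(1) p]) (use T in blast)
   have "germ ?ki ?v = germ (pinv ?gi) (push ?gi w)"
    by (rule germ_inverse_cong[OF k(1) p]) (use T in blast)
   hence "germ ?ki ?v = germ g ?v" unfolding partial_inverse_partial_inverse[OF g] e .
   moreover have "?v (dom g)" using germ_inverse_pair[OF p] unfolding partial_inverse_partial_inverse[OF g] e by simp
   ultimately show ?thesis unfolding lhs rhs using T e by simp
  next
   case F: False
   have "\<not> (?v (dom g) \<and> germ ?ki ?v = germ g ?v)"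
   proof
    assume a: "?v (dom g) \<and> germ ?ki ?v = germ g ?v"
    have p: "(g, ?v) \<in> germ_pairs" using a g pY YO by auto
    have e: "w = push g ?v" using push_character_germ_cong[OF kp p] a bk by simp
    have "germ (pinv ?ki) (push ?ki ?v) = germ ?gi (push g ?v)"
     by (rule germ_inverse_cong[OF kp p]) (use a in blast)
    hence "germ k w = germ ?gi w" unfolding partial_inverse_partial_inverse[OF kh(1)] bk e[symmetric] .
    moreover have "w (dom ?gi)" using germ_inverse_pair[OF p] e[symmetric] by simp
    ultimately show False using F by blast
   qed
   thus ?thesis unfolding lhs rhs using F by auto
  qed
 qed
qed

lemma gen_span_involution:
 assumes Y: "invariant_chars Y" and f: "f \<in> gen_span Y (\<lambda>_. True)"
 shows "involution (groupoid_on Y) f \<in> gen_span Y (\<lambda>_. True)"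
 using f
proof induction
 case zero
 have "involution (groupoid_on Y) (\<lambda>_. 0) = (\<lambda>_. 0)" by (rule ext) (auto simp: involution_def)
 thus ?case using gen_span.zero by metis
next
 case (add_gen f g h)
 have gi: "pinv g \<in> \<I>" using add_gen.hyps(2) by (rule inv_hull)
 have e: "involution (groupoid_on Y) (\<lambda>z. f z + gen Y g h z) =
  (\<lambda>z. involution (groupoid_on Y) f z + involution (groupoid_on Y) (gen Y g h) z)"
  by (auto simp: involution_def)
 have YO: "Y \<subseteq> Omega" by (rule invariant_charsD[OF Y])
 have "continuous_map (dom_top Y (pinv g)) (dom_top Y g) (push (pinv g))"
 proof -
  have "dom (g \<circ>\<^sub>m pinv g) = dom (pinv g)"
   using add_gen.hyps(2) by (auto simp: dom_def map_comp_Some_iff)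
  thus ?thesis using continuous_push_on[OF Y add_gen.hyps(2) gi] by simp
 qed
 hence "continuous_map (dom_top Y (pinv g)) euclidean (h \<circ> push (pinv g))"
  using add_gen.hyps(3) by (rule continuous_map_compose)
 hence "continuous_map (dom_top Y (pinv g)) euclidean (cnj \<circ> (h \<circ> push (pinv g)))"
  by (rule continuous_map_compose) (simp add: continuous_on_cnj continuous_on_id)
 hence "gen Y (pinv g) (\<lambda>w. cnj (h (push (pinv g) w))) \<in> gen_span Y (\<lambda>_. True)"
  by (intro gen_span_gen[OF gi]) (simp_all add: comp_def)
 thus ?case unfolding e involution_gen[OF Y add_gen.hyps(2)] using gen_span_add[OF add_gen.IH] by simp
qed

section \<open>The Hilbert spaces \<open>ell2 I\<close>\<close>

lemma ell2_zero_outside: "x \<in> ell2 I ==> i \<notin> I ==> x i = 0"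
 by (simp add: ell2_def)

lemma ell2_summable:
 assumes "x \<in> ell2 I" shows "(\<lambda>i. (cmod (x i))\<^sup>2) summable_on UNIV"
proof -
 have "(\<lambda>i. (cmod (x i))\<^sup>2) summable_on I" using assms by (simp add: ell2_def)
 thus ?thesis
  by (rule summable_on_cong_neutral[THEN iffD1, rotated -1]) (use assms in \<open>auto simp: ell2_def\<close>)
qed

lemma ell2_norm_nonneg [simp]: "0 \<le> ell2_norm x"
 by (simp add: ell2_norm_def infsum_nonneg)

lemma ell2_norm_power2: "(ell2_norm x)\<^sup>2 = (\<Sum>\<^sub>\<infinity>i. (cmod (x i))\<^sup>2)"
 by (simp add: ell2_norm_def infsum_nonneg)

lemma L2_set_le_ell2_norm:
 assumes "x \<in> ell2 I" "finite F" shows "L2_set (\<lambda>i. cmod (x i)) F \<le> ell2_norm x"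
 unfolding L2_set_def ell2_norm_def
 by (intro real_sqrt_le_mono finite_sum_le_infsum[OF ell2_summable[OF assms(1)] assms(2)]) auto

text \<open>Membership and the norm bound are both tested on finite sets of coordinates, where
  \<open>L2_set\<close> supplies the triangle inequality and Cauchy-Schwarz. The same reduction
  serves the comparison of representations, since only finitely many coordinates can be copied at
  once.\<close>

lemma ell2_if_L2_set_bounded:
 assumes "\<And>i. i \<notin> I ==> x i = 0" "\<And>F. finite F ==> L2_set (\<lambda>i. cmod (x i)) F \<le> K"
 shows "x \<in> ell2 I" "ell2_norm x \<le> K"
proof -
 have K: "0 \<le> K" using assms(2)[of "{}"] by simp
 have b: "(\<Sum>i\<in>F. (cmod (x i))\<^sup>2) \<le> K\<^sup>2" if "finite F" for F
  using assms(2)[OF that] K unfolding L2_set_def by (metis real_sqrt_le_iff real_sqrt_unique sqrt_le_D)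
 have s: "(\<lambda>i. (cmod (x i))\<^sup>2) summable_on J" for J
  by (rule nonneg_bdd_above_summable_on) (auto intro!: bdd_aboveI[of _ "K\<^sup>2"] b)
 show "x \<in> ell2 I" using assms(1) s by (simp add: ell2_def)
 have "(\<Sum>\<^sub>\<infinity>i. (cmod (x i))\<^sup>2) \<le> K\<^sup>2"
  by (rule infsum_le_finite_sums[OF s]) (use b in auto)
 thus "ell2_norm x \<le> K" unfolding ell2_norm_def using K by (rule real_le_lsqrt[rotated])
qed

lemma ell2_pos:
 assumes "x \<in> ell2 I" shows "cmod (x i) \<le> ell2_norm x"
 using L2_set_le_ell2_norm[OF assms, of "{i}"] by simp

lemma ell2_norm_zero_iff:
 assumes "x \<in> ell2 I" shows "ell2_norm x = 0 \<longleftrightarrow> x = (\<lambda>_. 0)"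
proof
 assume "ell2_norm x = 0"
 thus "x = (\<lambda>_. 0)" using ell2_pos[OF assms] by (intro ext) (metis norm_le_zero_iff)
qed (simp add: ell2_norm_def)

lemma ell2_0 [simp]: "(\<lambda>_. 0) \<in> ell2 I" "ell2_norm (\<lambda>_. 0) = 0"
 by (simp_all add: ell2_def ell2_norm_def)

lemma ell2_add:
 assumes "x \<in> ell2 I" "y \<in> ell2 I"
 shows "(\<lambda>i. x i + y i) \<in> ell2 I" "ell2_norm (\<lambda>i. x i + y i) \<le> ell2_norm x + ell2_norm y"
proof -
 have "L2_set (\<lambda>i. cmod (x i + y i)) F \<le> ell2_norm x + ell2_norm y" if F: "finite F" for F
 proof -
  have "L2_set (\<lambda>i. cmod (x i + y i)) F \<le> L2_set (\<lambda>i. cmod (x i) + cmod (y i)) F"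
   by (rule L2_set_mono) (auto intro: norm_triangle_ineq)
  also have "\<dots> \<le> L2_set (\<lambda>i. cmod (x i)) F + L2_set (\<lambda>i. cmod (y i)) F" by (rule L2_set_triangle_ineq)
  finally show ?thesis using L2_set_le_ell2_norm[OF assms(1) F] L2_set_le_ell2_norm[OF assms(2) F] by linarith
 qed
 moreover have "x i + y i = 0" if "i \<notin> I" for i using assms that by (simp add: ell2_zero_outside)
 ultimately show "(\<lambda>i. x i + y i) \<in> ell2 I" "ell2_norm (\<lambda>i. x i + y i) \<le> ell2_norm x + ell2_norm y"
  using ell2_if_L2_set_bounded[of I "\<lambda>i. x i + y i"] by blast+
qed

lemma ell2_scale:
 assumes "x \<in> ell2 I"
 shows "(\<lambda>i. c * x i) \<in> ell2 I" "ell2_norm (\<lambda>i. c * x i) = cmod c * ell2_norm x"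
proof -
 show "(\<lambda>i. c * x i) \<in> ell2 I" using assms by (auto simp: ell2_def norm_mult power_mult_distrib intro!: summable_on_cmult_right)
 show "ell2_norm (\<lambda>i. c * x i) = cmod c * ell2_norm x"
  by (simp add: ell2_norm_def norm_mult power_mult_distrib infsum_cmult_right' real_sqrt_mult)
qed

lemma ell2_diff:
 assumes "x \<in> ell2 I" "y \<in> ell2 I"
 shows "(\<lambda>i. x i - y i) \<in> ell2 I" "ell2_norm (\<lambda>i. x i - y i) \<le> ell2_norm x + ell2_norm y"
 using ell2_add[OF assms(1) ell2_scale(1)[OF assms(2), of "-1"]] ell2_scale(2)[OF assms(2), of "-1"] by simp_all

lemma ell2_delta: "i \<in> I ==> (\<lambda>j. if j = i then 1 else 0) \<in> ell2 I"
 by (auto simp: ell2_def intro!: finite_nonzero_values_imp_summable_on finite_subset[of _ "{i}"] split: if_splits)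

text \<open>The limit is described by the Cauchy estimates it inherits, not by convergence alone. In
  \<open>op_complete\<close> this turns estimates relative to the norm of the vector into estimates
  for the limit operator with the same constants.\<close>

lemma ell2_complete:
 fixes F :: "nat => 'i => complex"
 assumes F: "\<And>n. F n \<in> ell2 I"
  and C: "\<And>e. e > 0 ==> \<exists>N. \<forall>m\<ge>N. \<forall>n\<ge>N. ell2_norm (\<lambda>i. F m i - F n i) \<le> e"
 obtains x where "x \<in> ell2 I"
  "\<And>e N. \<forall>m\<ge>N. \<forall>n\<ge>N. ell2_norm (\<lambda>i. F m i - F n i) \<le> e ==> \<forall>m\<ge>N. ell2_norm (\<lambda>i. F m i - x i) \<le> e"
proof -
 have d: "(\<lambda>i. F m i - F n i) \<in> ell2 I" for m n using ell2_diff F by blast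
 have "Cauchy (\<lambda>n. F n i)" for i
  unfolding Cauchy_altdef2 dist_norm
 proof (intro allI impI)
  fix e :: real assume e: "0 < e"
  obtain N where N: "\<forall>m\<ge>N. \<forall>n\<ge>N. ell2_norm (\<lambda>i. F m i - F n i) \<le> e / 2" using C[of "e/2"] e by auto
  have "cmod (F n i - F N i) < e" if "n \<ge> N" for n
  proof -
   have "cmod (F n i - F N i) \<le> e / 2" using ell2_pos[OF d[of n N], of i] N that by (meson order_refl order_trans)
   thus ?thesis using e by linarith
  qed
  thus "\<exists>N. \<forall>n\<ge>N. cmod (F n i - F N i) < e" by blast
 qed
 hence "\<exists>l. (\<lambda>n. F n i) \<longlonglongrightarrow> l" for i using Cauchy_convergent_iff convergent_def by blast
 then obtain x where x: "\<And>i. (\<lambda>n. F n i) \<longlonglongrightarrow> x i" by metis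
 have z: "x i = 0" if "i \<notin> I" for i
  using x[of i] ell2_zero_outside[OF F that] by (simp add: LIMSEQ_const_iff)
 have *: "(\<lambda>i. F m i - x i) \<in> ell2 I \<and> ell2_norm (\<lambda>i. F m i - x i) \<le> e"
  if N: "\<forall>m\<ge>N. \<forall>n\<ge>N. ell2_norm (\<lambda>i. F m i - F n i) \<le> e" "m \<ge> N" for e N m
 proof -
  have "L2_set (\<lambda>i. cmod (F m i - x i)) S \<le> e" if S: "finite S" for S
  proof (rule LIMSEQ_le_const2)
   show "(\<lambda>n. L2_set (\<lambda>i. cmod (F m i - F n i)) S) \<longlonglongrightarrow> L2_set (\<lambda>i. cmod (F m i - x i)) S"
    unfolding L2_set_def by (intro tendsto_intros x)
   have "L2_set (\<lambda>i. cmod (F m i - F n i)) S \<le> e" if "n \<ge> N" for n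
    using L2_set_le_ell2_norm[OF d[of m n] S] N that by (meson order_trans)
   thus "\<exists>M. \<forall>n\<ge>M. L2_set (\<lambda>i. cmod (F m i - F n i)) S \<le> e" by blast
  qed
  moreover have "F m i - x i = 0" if "i \<notin> I" for i using z ell2_zero_outside[OF F] that by simp
  ultimately show ?thesis using ell2_if_L2_set_bounded[of I "\<lambda>i. F m i - x i" e] by blast
 qed
 obtain N where N: "\<forall>m\<ge>N. \<forall>n\<ge>N. ell2_norm (\<lambda>i. F m i - F n i) \<le> 1" using C[of 1] by auto
 have "(\<lambda>i. F N i - (F N i - x i)) \<in> ell2 I" using ell2_diff(1)[OF F] *[OF N order_refl] by blast
 hence "x \<in> ell2 I" by simp
 thus ?thesis using * that by blast
qed

subsection \<open>The inner product\<close>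

lemma ell2_inner_summable:
 assumes "x \<in> ell2 I" "y \<in> ell2 I"
 shows "(\<lambda>i. cmod (x i * cnj (y i))) summable_on UNIV" "cmod (ell2_inner x y) \<le> ell2_norm x * ell2_norm y"
proof -
 have b: "(\<Sum>i\<in>F. cmod (x i * cnj (y i))) \<le> ell2_norm x * ell2_norm y" if F: "finite F" for F
 proof -
  have "(\<Sum>i\<in>F. cmod (x i * cnj (y i))) = (\<Sum>i\<in>F. \<bar>cmod (x i)\<bar> * \<bar>cmod (y i)\<bar>)" by (simp add: norm_mult)
  also have "\<dots> \<le> L2_set (\<lambda>i. cmod (x i)) F * L2_set (\<lambda>i. cmod (y i)) F" by (rule L2_set_mult_ineq)
  also have "\<dots> \<le> ell2_norm x * ell2_norm y"
   by (intro mult_mono L2_set_le_ell2_norm[OF assms(1) F] L2_set_le_ell2_norm[OF assms(2) F]) simp_all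
  finally show ?thesis .
 qed
 show s: "(\<lambda>i. cmod (x i * cnj (y i))) summable_on UNIV"
  by (rule nonneg_bdd_above_summable_on) (auto intro!: bdd_aboveI[of _ "ell2_norm x * ell2_norm y"] b)
 have "cmod (ell2_inner x y) \<le> (\<Sum>\<^sub>\<infinity>i. cmod (x i * cnj (y i)))" unfolding ell2_inner_def by (rule norm_infsum_bound[OF s])
 also have "\<dots> \<le> ell2_norm x * ell2_norm y" by (rule infsum_le_finite_sums[OF s]) (use b in auto)
 finally show "cmod (ell2_inner x y) \<le> ell2_norm x * ell2_norm y" .
qed

lemma ell2_inner_summable_on:
 assumes "x \<in> ell2 I" "y \<in> ell2 I"
 shows "(\<lambda>i. x i * cnj (y i)) summable_on UNIV"
 by (rule Infinite_Sum.abs_summable_summable[OF ell2_inner_summable(1)[OF assms]])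

lemma ell2_inner_add_left:
 assumes "x \<in> ell2 I" "x' \<in> ell2 I" "y \<in> ell2 I"
 shows "ell2_inner (\<lambda>i. x i + x' i) y = ell2_inner x y + ell2_inner x' y"
 unfolding ell2_inner_def distrib_right
 by (rule infsum_add) (use ell2_inner_summable_on assms in blast)+

lemma ell2_inner_scale_left: "ell2_inner (\<lambda>i. c * x i) y = c * ell2_inner x y"
 by (simp add: ell2_inner_def mult.assoc infsum_cmult_right')

lemma ell2_inner_commute: "ell2_inner y x = cnj (ell2_inner x y)"
 unfolding ell2_inner_def infsum_cnj[symmetric] by (simp add: mult.commute)

lemma ell2_inner_add_right:
 assumes "x \<in> ell2 I" "x' \<in> ell2 I" "y \<in> ell2 I"
 shows "ell2_inner y (\<lambda>i. x i + x' i) = ell2_inner y x + ell2_inner y x'"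
proof -
 have "ell2_inner y (\<lambda>i. x i + x' i) = cnj (ell2_inner (\<lambda>i. x i + x' i) y)" by (rule ell2_inner_commute)
 also have "\<dots> = cnj (ell2_inner x y) + cnj (ell2_inner x' y)" unfolding ell2_inner_add_left[OF assms] by simp
 finally show ?thesis unfolding ell2_inner_commute[symmetric] .
qed

lemma ell2_inner_scale_right: "ell2_inner y (\<lambda>i. c * x i) = cnj c * ell2_inner y x"
proof -
 have "ell2_inner y (\<lambda>i. c * x i) = cnj (ell2_inner (\<lambda>i. c * x i) y)" by (rule ell2_inner_commute)
 also have "\<dots> = cnj c * cnj (ell2_inner x y)" unfolding ell2_inner_scale_left by simp
 finally show ?thesis unfolding ell2_inner_commute[symmetric] .
qed

lemma ell2_inner_self:
 assumes "x \<in> ell2 I"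
 shows "ell2_inner x x = of_real ((ell2_norm x)\<^sup>2)"
proof -
 have "((\<lambda>i. complex_of_real ((cmod (x i))\<^sup>2)) has_sum complex_of_real ((ell2_norm x)\<^sup>2)) UNIV"
  unfolding has_sum_of_real_iff ell2_norm_power2 by (rule has_sum_infsum[OF ell2_summable[OF assms]])
 thus ?thesis unfolding ell2_inner_def complex_norm_square by (rule infsumI)
qed

lemma ell2_norm_diff_power2:
 assumes "x \<in> ell2 I" "y \<in> ell2 I"
 shows "(ell2_norm (\<lambda>i. x i - y i))\<^sup>2 = (ell2_norm x)\<^sup>2 - 2 * Re (ell2_inner x y) + (ell2_norm y)\<^sup>2"
proof -
 let ?m = "\<lambda>i. (-1) * y i"
 have m: "?m \<in> ell2 I" by (rule ell2_scale(1)[OF assms(2)])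
 have s: "(\<lambda>i. x i + ?m i) \<in> ell2 I" by (rule ell2_add(1)[OF assms(1) m])
 have "complex_of_real ((ell2_norm (\<lambda>i. x i + ?m i))\<^sup>2) = ell2_inner (\<lambda>i. x i + ?m i) (\<lambda>i. x i + ?m i)"
  by (rule ell2_inner_self[OF s, symmetric])
 also have "\<dots> = ell2_inner x x - ell2_inner x y - cnj (ell2_inner x y) + ell2_inner y y"
  unfolding ell2_inner_add_left[OF assms(1) m s] ell2_inner_add_right[OF assms(1) m assms(1)]
   ell2_inner_add_right[OF assms(1) m m] ell2_inner_scale_right ell2_inner_scale_left ell2_inner_commute[of y x] by simp
 finally have "(ell2_norm (\<lambda>i. x i + ?m i))\<^sup>2 = Re (ell2_inner x x - ell2_inner x y - cnj (ell2_inner x y) + ell2_inner y y)"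
  by (metis Re_complex_of_real)
 thus ?thesis by (simp add: ell2_inner_self[OF assms(1)] ell2_inner_self[OF assms(2)])
qed

subsection \<open>Bounded operators\<close>

lemma bounded_opsI:
 assumes "\<And>x. x \<in> ell2 I ==> T x \<in> ell2 I" "\<And>x. x \<notin> ell2 I ==> T x = undefined"
  "\<And>x y. x \<in> ell2 I ==> y \<in> ell2 I ==> T (\<lambda>i. x i + y i) = (\<lambda>i. T x i + T y i)"
  "\<And>c x. x \<in> ell2 I ==> T (\<lambda>i. c * x i) = (\<lambda>i. c * T x i)"
  "\<And>x. x \<in> ell2 I ==> ell2_norm (T x) \<le> K * ell2_norm x"
 shows "T \<in> bounded_ops I"
 unfolding bounded_ops_def
proof (intro CollectI conjI ballI allI)
 show "T \<in> ell2 I \<rightarrow>\<^sub>E ell2 I" by (rule PiE_I) (rule assms, assumption)+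
 show "\<exists>K. \<forall>x\<in>ell2 I. ell2_norm (T x) \<le> K * ell2_norm x" using assms(5) by blast
qed (rule assms; assumption)+

lemma bounded_opsD:
 assumes "T \<in> bounded_ops I"
 shows bounded_ops_maps: "\<And>x. x \<in> ell2 I ==> T x \<in> ell2 I"
  and bounded_ops_undefined: "\<And>x. x \<notin> ell2 I ==> T x = undefined"
  and bounded_ops_add: "\<And>x y. x \<in> ell2 I ==> y \<in> ell2 I ==> T (\<lambda>i. x i + y i) = (\<lambda>i. T x i + T y i)"
  and bounded_ops_scale: "\<And>c x. x \<in> ell2 I ==> T (\<lambda>i. c * x i) = (\<lambda>i. c * T x i)"
  and bounded_ops_bounded: "\<exists>K. \<forall>x\<in>ell2 I. ell2_norm (T x) \<le> K * ell2_norm x"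
 using assms unfolding bounded_ops_def by (auto dest: PiE_arb)

lemma op_norm_bdd:
 assumes "T \<in> bounded_ops I"
 shows "bdd_above {ell2_norm (T x) | x. x \<in> ell2 I \<and> ell2_norm x \<le> 1}"
proof -
 obtain K where K: "\<forall>x\<in>ell2 I. ell2_norm (T x) \<le> K * ell2_norm x" using bounded_ops_bounded[OF assms] by blast
 have "ell2_norm (T x) \<le> \<bar>K\<bar>" if "x \<in> ell2 I" "ell2_norm x \<le> 1" for x
 proof -
  have "ell2_norm (T x) \<le> \<bar>K\<bar> * ell2_norm x" using K that(1)
   by (meson abs_ge_self ell2_norm_nonneg mult_right_mono order_trans)
  also have "\<dots> \<le> \<bar>K\<bar> * 1" using that(2) by (intro mult_left_mono) auto
  finally show ?thesis by simp
 qed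
 thus ?thesis by (auto intro!: bdd_aboveI[of _ "\<bar>K\<bar>"])
qed

lemma op_norm_nonneg:
 assumes "T \<in> bounded_ops I" shows "0 \<le> op_norm I T"
proof -
 have "ell2_norm (T (\<lambda>_. 0)) \<le> op_norm I T"
  unfolding op_norm_def by (rule cSup_upper[OF _ op_norm_bdd[OF assms]]) (rule CollectI, rule exI[of _ "\<lambda>_. 0"], simp)
 thus ?thesis using ell2_norm_nonneg order_trans by blast
qed

lemma op_norm_bound:
 assumes T: "T \<in> bounded_ops I" and x: "x \<in> ell2 I"
 shows "ell2_norm (T x) \<le> op_norm I T * ell2_norm x"
proof (cases "ell2_norm x = 0")
 case True
 hence "x = (\<lambda>_. 0)" using ell2_norm_zero_iff[OF x] by simp
 hence "T x = (\<lambda>i. 0 * T x i)" using bounded_ops_scale[OF T x, of 0] by simp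
 hence "T x = (\<lambda>_. 0)" by simp
 thus ?thesis using True by simp
next
 case False
 define c where "c = complex_of_real (1 / ell2_norm x)"
 have n: "ell2_norm (\<lambda>i. c * x i) = 1" using ell2_scale(2)[OF x, of c] False by (simp add: c_def norm_divide)
 have "ell2_norm (T (\<lambda>i. c * x i)) \<le> op_norm I T"
  unfolding op_norm_def
  by (rule cSup_upper[OF _ op_norm_bdd[OF T]]) (rule CollectI, rule exI[of _ "\<lambda>i. c * x i"], use n ell2_scale(1)[OF x] in simp)
 hence "cmod c * ell2_norm (T x) \<le> op_norm I T"
  unfolding bounded_ops_scale[OF T x] ell2_scale(2)[OF bounded_ops_maps[OF T x]] .
 thus ?thesis using False by (simp add: c_def norm_divide divide_le_eq less_le)
qed

lemma op_norm_le:
 assumes "\<And>\<xi>. \<xi> \<in> ell2 I ==> ell2_norm (T \<xi>) \<le> K * ell2_norm \<xi>" "0 \<le> K"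
 shows "op_norm I T \<le> K"
 unfolding op_norm_def
proof (rule cSup_least)
 show "{ell2_norm (T \<xi>) | \<xi>. \<xi> \<in> ell2 I \<and> ell2_norm \<xi> \<le> 1} \<noteq> {}" by (auto intro!: exI[of _ "\<lambda>_. 0"])
 fix x assume "x \<in> {ell2_norm (T \<xi>) | \<xi>. \<xi> \<in> ell2 I \<and> ell2_norm \<xi> \<le> 1}"
 then obtain \<xi> where x: "x = ell2_norm (T \<xi>)" "\<xi> \<in> ell2 I" "ell2_norm \<xi> \<le> 1" by blast
 have "ell2_norm (T \<xi>) \<le> K * ell2_norm \<xi>" using assms(1) x by blast
 also have "\<dots> \<le> K * 1" using x assms(2) by (intro mult_left_mono) auto
 finally show "x \<le> K" using x by simp
qed

lemma op_algebra_simps [simp]: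
 "elems (op_algebra I) = bounded_ops I"
 "zer (op_algebra I) = (\<lambda>x\<in>ell2 I. \<lambda>i. 0)"
 "add (op_algebra I) T T' = (\<lambda>x\<in>ell2 I. \<lambda>i. T x i + T' x i)"
 "scl (op_algebra I) c T = (\<lambda>x\<in>ell2 I. \<lambda>i. c * T x i)"
 "mul (op_algebra I) T T' = (\<lambda>x\<in>ell2 I. T (T' x))"
 "nrm (op_algebra I) = op_norm I"
 by (simp_all add: op_algebra_def)

lemma op_zero_bounded: "(\<lambda>x\<in>ell2 I. \<lambda>i. 0) \<in> bounded_ops I"
 by (rule bounded_opsI[where K = 0]) (auto simp: ell2_add ell2_scale)

lemma op_norm_zero [simp]: "op_norm I (\<lambda>x\<in>ell2 I. \<lambda>i. 0) = 0"
 by (rule antisym[OF op_norm_le[where K = 0] op_norm_nonneg[OF op_zero_bounded]]) auto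

lemma op_norm_eq_0:
 assumes T: "T \<in> bounded_ops I" and z: "op_norm I T = 0"
 shows "T = (\<lambda>x\<in>ell2 I. \<lambda>i. 0)"
proof
 fix x show "T x = (\<lambda>x\<in>ell2 I. \<lambda>i. 0) x"
 proof (cases "x \<in> ell2 I")
  case True
  have "ell2_norm (T x) \<le> 0" using op_norm_bound[OF T True] z by simp
  hence "ell2_norm (T x) = 0" using ell2_norm_nonneg[of "T x"] by linarith
  thus ?thesis using ell2_norm_zero_iff[OF bounded_ops_maps[OF T True]] True by simp
 qed (simp add: bounded_ops_undefined[OF T])
qed

lemma op_add:
 assumes T: "T \<in> bounded_ops I" and T': "T' \<in> bounded_ops I"
 shows "(\<lambda>x\<in>ell2 I. \<lambda>i. T x i + T' x i) \<in> bounded_ops I"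
  "op_norm I (\<lambda>x\<in>ell2 I. \<lambda>i. T x i + T' x i) \<le> op_norm I T + op_norm I T'"
proof -
 have b: "ell2_norm (\<lambda>i. T x i + T' x i) \<le> (op_norm I T + op_norm I T') * ell2_norm x" if "x \<in> ell2 I" for x
  using ell2_add(2)[OF bounded_ops_maps[OF T that] bounded_ops_maps[OF T' that]] op_norm_bound[OF T that] op_norm_bound[OF T' that]
  by (simp add: distrib_right)
 show "(\<lambda>x\<in>ell2 I. \<lambda>i. T x i + T' x i) \<in> bounded_ops I"
  by (rule bounded_opsI[where K = "op_norm I T + op_norm I T'"])
   (use b in \<open>auto simp: ell2_add ell2_scale bounded_ops_maps[OF T] bounded_ops_maps[OF T'] bounded_ops_add[OF T] bounded_ops_add[OF T']
    bounded_ops_scale[OF T] bounded_ops_scale[OF T'] algebra_simps\<close>)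
 show "op_norm I (\<lambda>x\<in>ell2 I. \<lambda>i. T x i + T' x i) \<le> op_norm I T + op_norm I T'"
  by (rule op_norm_le) (use b op_norm_nonneg[OF T] op_norm_nonneg[OF T'] in auto)
qed

lemma op_scale:
 assumes T: "T \<in> bounded_ops I"
 shows "(\<lambda>x\<in>ell2 I. \<lambda>i. c * T x i) \<in> bounded_ops I"
  "op_norm I (\<lambda>x\<in>ell2 I. \<lambda>i. c * T x i) = cmod c * op_norm I T"
proof -
 have b: "ell2_norm (\<lambda>i. c * T x i) \<le> (cmod c * op_norm I T) * ell2_norm x" if "x \<in> ell2 I" "T \<in> bounded_ops I" for x T c
  unfolding ell2_scale(2)[OF bounded_ops_maps[OF that(2,1)]] using op_norm_bound[OF that(2,1)] by (simp add: mult.assoc mult_left_mono)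
 have bo: "(\<lambda>x\<in>ell2 I. \<lambda>i. c * T x i) \<in> bounded_ops I" if T: "T \<in> bounded_ops I" for T c
  by (rule bounded_opsI[where K = "cmod c * op_norm I T"])
   (use b[OF _ T] in \<open>auto simp: ell2_add ell2_scale bounded_ops_maps[OF T] bounded_ops_add[OF T] bounded_ops_scale[OF T] algebra_simps\<close>)
 thus "(\<lambda>x\<in>ell2 I. \<lambda>i. c * T x i) \<in> bounded_ops I" using T by blast
 have le: "op_norm I (\<lambda>x\<in>ell2 I. \<lambda>i. c * T x i) \<le> cmod c * op_norm I T" if "T \<in> bounded_ops I" for T c
  by (rule op_norm_le) (use b[OF _ that] op_norm_nonneg[OF that] in auto)
 show "op_norm I (\<lambda>x\<in>ell2 I. \<lambda>i. c * T x i) = cmod c * op_norm I T"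
 proof (cases "c = 0")
  case True
  thus ?thesis by simp
 next
  case False
  let ?T = "\<lambda>x\<in>ell2 I. \<lambda>i. c * T x i"
  have "(\<lambda>x\<in>ell2 I. \<lambda>i. inverse c * ?T x i) = T"
   using False bounded_ops_undefined[OF T] by (auto simp: fun_eq_iff restrict_def mult.assoc[symmetric])
  hence "op_norm I T \<le> cmod (inverse c) * op_norm I ?T" using le[OF bo[OF T], of "inverse c" c] by simp
  hence "cmod c * op_norm I T \<le> cmod c * (cmod (inverse c) * op_norm I ?T)" by (rule mult_left_mono) simp
  moreover have "cmod c * cmod (inverse c) = 1" using False by (simp add: norm_mult[symmetric])
  ultimately have "cmod c * op_norm I T \<le> op_norm I ?T" by (simp only: mult.assoc[symmetric] mult_1)
  thus ?thesis using le[OF T, of c] by linarith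
 qed
qed

lemma op_mul:
 assumes T: "T \<in> bounded_ops I" and T': "T' \<in> bounded_ops I"
 shows "(\<lambda>x\<in>ell2 I. T (T' x)) \<in> bounded_ops I"
  "op_norm I (\<lambda>x\<in>ell2 I. T (T' x)) \<le> op_norm I T * op_norm I T'"
proof -
 have b: "ell2_norm (T (T' x)) \<le> (op_norm I T * op_norm I T') * ell2_norm x" if "x \<in> ell2 I" for x
  using op_norm_bound[OF T bounded_ops_maps[OF T' that]] mult_left_mono[OF op_norm_bound[OF T' that] op_norm_nonneg[OF T]]
  by (simp add: mult.assoc)
 show "(\<lambda>x\<in>ell2 I. T (T' x)) \<in> bounded_ops I"
  by (rule bounded_opsI[where K = "op_norm I T * op_norm I T'"])
   (use b in \<open>auto simp: ell2_add ell2_scale bounded_ops_maps[OF T] bounded_ops_maps[OF T'] bounded_ops_add[OF T] bounded_ops_add[OF T']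
    bounded_ops_scale[OF T] bounded_ops_scale[OF T']\<close>)
 show "op_norm I (\<lambda>x\<in>ell2 I. T (T' x)) \<le> op_norm I T * op_norm I T'"
  by (rule op_norm_le) (use b op_norm_nonneg[OF T] op_norm_nonneg[OF T'] in auto)
qed

definition op_diff :: "'i set => 'i op => 'i op => 'i op" where
 "op_diff I T T' = (\<lambda>x\<in>ell2 I. \<lambda>i. T x i - T' x i)"

lemma dst_op_algebra: "dst (op_algebra I) T T' = op_norm I (op_diff I T T')"
proof -
 have "add (op_algebra I) T (scl (op_algebra I) (-1) T') = op_diff I T T'"
  by (simp add: op_diff_def restrict_def fun_eq_iff)
 thus ?thesis by (simp add: dst_def del: op_algebra_simps(3,4))
qed

lemma op_diff_bounded:
 assumes T: "T \<in> bounded_ops I" and T': "T' \<in> bounded_ops I"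
 shows "op_diff I T T' \<in> bounded_ops I"
proof -
 have "op_diff I T T' = (\<lambda>x\<in>ell2 I. \<lambda>i. T x i + (\<lambda>x\<in>ell2 I. \<lambda>i. -1 * T' x i) x i)"
  by (simp add: op_diff_def restrict_def fun_eq_iff)
 thus ?thesis using op_add(1)[OF T op_scale(1)[OF T', of "-1"]] by simp
qed

lemma op_complete:
 fixes T :: "nat => 'i op"
 assumes T: "\<And>n. T n \<in> bounded_ops I"
  and C: "\<And>e. e > 0 ==> \<exists>N. \<forall>m\<ge>N. \<forall>n\<ge>N. op_norm I (op_diff I (T m) (T n)) \<le> e"
 obtains S where "S \<in> bounded_ops I" "vanishes (\<lambda>n. op_norm I (op_diff I (T n) S))"
proof -
 have d: "ell2_norm (\<lambda>i. T m x i - T n x i) \<le> op_norm I (op_diff I (T m) (T n)) * ell2_norm x" if "x \<in> ell2 I" for m n x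
  using op_norm_bound[OF op_diff_bounded[OF T[of m] T[of n]] that] that by (simp add: op_diff_def)
 have "\<exists>\<zeta>. \<zeta> \<in> ell2 I \<and> (\<forall>e N. (\<forall>m\<ge>N. \<forall>n\<ge>N. ell2_norm (\<lambda>i. T m x i - T n x i) \<le> e) \<longrightarrow> (\<forall>m\<ge>N. ell2_norm (\<lambda>i. T m x i - \<zeta> i) \<le> e))"
  if x: "x \<in> ell2 I" for x
 proof -
  have "\<exists>N. \<forall>m\<ge>N. \<forall>n\<ge>N. ell2_norm (\<lambda>i. T m x i - T n x i) \<le> e" if e: "e > 0" for e
  proof -
   \<comment> \<open>The summand \<open>1\<close> keeps the denominator positive for the zero
     vector.\<close>
   let ?e = "e / (1 + ell2_norm x)"
   have p: "0 < 1 + ell2_norm x" using ell2_norm_nonneg[of x] by linarith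
   obtain N where N: "\<forall>m\<ge>N. \<forall>n\<ge>N. op_norm I (op_diff I (T m) (T n)) \<le> ?e" using C[of ?e] e p by auto
   have "ell2_norm (\<lambda>i. T m x i - T n x i) \<le> e" if "m \<ge> N" "n \<ge> N" for m n
   proof -
    have "ell2_norm (\<lambda>i. T m x i - T n x i) \<le> ?e * ell2_norm x"
     using d[OF x, of m n] N that mult_right_mono[OF _ ell2_norm_nonneg] by (meson order_trans)
    also have "\<dots> \<le> e" using e p by (simp add: field_simps)
    finally show ?thesis .
   qed
   thus ?thesis by blast
  qed
  note C' = this
  show ?thesis
  proof (rule ell2_complete[of "\<lambda>n. T n x" I, OF bounded_ops_maps[OF T x] C'])
   fix \<zeta> assume z: "\<zeta> \<in> ell2 I" "\<And>e N. \<forall>m\<ge>N. \<forall>n\<ge>N. ell2_norm (\<lambda>i. T m x i - T n x i) \<le> e ==> \<forall>m\<ge>N. ell2_norm (\<lambda>i. T m x i - \<zeta> i) \<le> e"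
   show ?thesis by (intro exI[of _ \<zeta>] conjI z(1)) (use z(2) in blast)
  qed
 qed
 hence "\<forall>x\<in>ell2 I. \<exists>\<zeta>. \<zeta> \<in> ell2 I \<and> (\<forall>e N. (\<forall>m\<ge>N. \<forall>n\<ge>N. ell2_norm (\<lambda>i. T m x i - T n x i) \<le> e) \<longrightarrow> (\<forall>m\<ge>N. ell2_norm (\<lambda>i. T m x i - \<zeta> i) \<le> e))"
  by (rule ballI)
 from bchoice[OF this] obtain S0 where
  S0': "\<forall>x\<in>ell2 I. S0 x \<in> ell2 I \<and> (\<forall>e N. (\<forall>m\<ge>N. \<forall>n\<ge>N. ell2_norm (\<lambda>i. T m x i - T n x i) \<le> e) \<longrightarrow> (\<forall>m\<ge>N. ell2_norm (\<lambda>i. T m x i - S0 x i) \<le> e))"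
  by blast
 have S0: "\<And>x. x \<in> ell2 I ==> S0 x \<in> ell2 I"
  "\<And>x e N m. x \<in> ell2 I ==> \<forall>m\<ge>N. \<forall>n\<ge>N. ell2_norm (\<lambda>i. T m x i - T n x i) \<le> e ==> m \<ge> N ==> ell2_norm (\<lambda>i. T m x i - S0 x i) \<le> e"
  using S0' by blast+
 define S where "S = (\<lambda>x\<in>ell2 I. S0 x)"
 have S: "S x = S0 x" if "x \<in> ell2 I" for x using that by (simp add: S_def)
 have b: "ell2_norm (\<lambda>i. T m x i - S0 x i) \<le> e * ell2_norm x"
  if "x \<in> ell2 I" "\<forall>m\<ge>N. \<forall>n\<ge>N. op_norm I (op_diff I (T m) (T n)) \<le> e" "m \<ge> N" for x e N m
  using S0(2)[OF that(1), of N "e * ell2_norm x" m] d[OF that(1)] that(2,3) mult_right_mono[OF _ ell2_norm_nonneg]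
  by (meson order_trans)
 have lim: "(\<lambda>n. T n x i) \<longlonglongrightarrow> S0 x i" if x: "x \<in> ell2 I" for x i
  unfolding LIMSEQ_iff
 proof (intro allI impI)
  fix r :: real assume r: "0 < r"
  have p: "0 < 1 + ell2_norm x" using ell2_norm_nonneg[of x] by linarith
  let ?e = "(r / 2) / (1 + ell2_norm x)"
  obtain N where N: "\<forall>m\<ge>N. \<forall>n\<ge>N. op_norm I (op_diff I (T m) (T n)) \<le> ?e" using C[of ?e] r p by auto
  have "cmod (T n x i - S0 x i) < r" if "n \<ge> N" for n
  proof -
   have "cmod (T n x i - S0 x i) \<le> ?e * ell2_norm x"
    using ell2_pos[OF ell2_diff(1)[OF bounded_ops_maps[OF T[of n] x] S0(1)[OF x]], of i] b[OF x N that] by (meson order_trans)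
   also have "\<dots> < r" using r p by (simp add: field_simps add_strict_increasing)
   finally show ?thesis .
  qed
  thus "\<exists>N. \<forall>n\<ge>N. cmod (T n x i - S0 x i) < r" by blast
 qed
 obtain N where N: "\<forall>m\<ge>N. \<forall>n\<ge>N. op_norm I (op_diff I (T m) (T n)) \<le> 1" using C[of 1] by auto
 have "S \<in> bounded_ops I"
 proof (rule bounded_opsI[where K = "op_norm I (T N) + 1"])
  fix x assume x: "x \<in> ell2 I"
  show "S x \<in> ell2 I" using S0(1) S x by simp
  have "ell2_norm (\<lambda>i. T N x i - (T N x i - S0 x i)) \<le> ell2_norm (T N x) + ell2_norm (\<lambda>i. T N x i - S0 x i)"
   by (rule ell2_diff(2)[OF bounded_ops_maps[OF T x] ell2_diff(1)[OF bounded_ops_maps[OF T x] S0(1)[OF x]]])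
  thus "ell2_norm (S x) \<le> (op_norm I (T N) + 1) * ell2_norm x"
   using S[OF x] op_norm_bound[OF T[of N] x] b[OF x N order_refl] by (simp add: distrib_right)
  show "S (\<lambda>i. c * x i) = (\<lambda>i. c * S x i)" for c
  proof
   fix i
   have "(\<lambda>n. T n (\<lambda>i. c * x i) i) \<longlonglongrightarrow> c * S0 x i"
    unfolding bounded_ops_scale[OF T x] by (intro tendsto_intros lim x)
   thus "S (\<lambda>i. c * x i) i = c * S x i"
    using lim[OF ell2_scale(1)[OF x], of c i] S[OF x] S[OF ell2_scale(1)[OF x]] LIMSEQ_unique by metis
  qed
  fix y assume y: "y \<in> ell2 I"
  show "S (\<lambda>i. x i + y i) = (\<lambda>i. S x i + S y i)"
  proof
   fix i
   have "(\<lambda>n. T n (\<lambda>i. x i + y i) i) \<longlonglongrightarrow> S0 x i + S0 y i"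
    unfolding bounded_ops_add[OF T x y] by (intro tendsto_intros lim x y)
   thus "S (\<lambda>i. x i + y i) i = S x i + S y i"
    using lim[OF ell2_add(1)[OF x y], of i] S[OF x] S[OF y] S[OF ell2_add(1)[OF x y]] LIMSEQ_unique by metis
  qed
 qed (simp add: S_def)
 moreover have "vanishes (\<lambda>n. op_norm I (op_diff I (T n) S))"
  unfolding LIMSEQ_iff
 proof (intro allI impI)
  fix r :: real assume r: "0 < r"
  obtain N where N: "\<forall>m\<ge>N. \<forall>n\<ge>N. op_norm I (op_diff I (T m) (T n)) \<le> r/2" using C[of "r/2"] r by auto
  have "op_norm I (op_diff I (T n) S) \<le> r / 2" if "n \<ge> N" for n
   by (rule op_norm_le) (use b[OF _ N that] S r in \<open>auto simp: op_diff_def\<close>)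
  thus "\<exists>N. \<forall>n\<ge>N. norm (op_norm I (op_diff I (T n) S) - 0) < r"
   using op_norm_nonneg[OF op_diff_bounded[OF T \<open>S \<in> bounded_ops I\<close>]] r
   by (intro exI[of _ N]) (auto intro: le_less_trans[of _ "r/2"])
 qed
 ultimately show ?thesis using that by blast
qed

subsection \<open>Adjoints\<close>

text \<open>\<open>adj\<close> is a definite description and says something only when an adjoint
  exists. Every operator to which it is applied comes with an explicit adjoint or is a limit of such
  operators; this relation carries the adjoint along through sums, products and limits.\<close>

definition adjoint_pair :: "'i set => 'i op => 'i op => bool" where
 "adjoint_pair I T T' \<longleftrightarrow> T \<in> bounded_ops I \<and> T' \<in> bounded_ops I \<and>
  (\<forall>x\<in>ell2 I. \<forall>y\<in>ell2 I. ell2_inner (T x) y = ell2_inner x (T' y))"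

lemma adjoint_pairD:
 assumes "adjoint_pair I T T'"
 shows "T \<in> bounded_ops I" "T' \<in> bounded_ops I"
  "\<And>x y. x \<in> ell2 I ==> y \<in> ell2 I ==> ell2_inner (T x) y = ell2_inner x (T' y)"
 using assms by (simp_all add: adjoint_pair_def)

lemma adjoint_pair_sym: "adjoint_pair I T T' ==> adjoint_pair I T' T"
 unfolding adjoint_pair_def by (metis ell2_inner_commute)

lemma ell2_inner_delta: "ell2_inner (\<lambda>j. if j = i then 1 else 0) x = cnj (x i)"
 unfolding ell2_inner_def by (subst infsum_single[of i]) auto

lemma adjoint_pair_unique:
 assumes "adjoint_pair I T T'" "adjoint_pair I T T''"
 shows "T' = T''"
proof
 fix y show "T' y = T'' y"
 proof (cases "y \<in> ell2 I")
  case True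
  show ?thesis
  proof
   fix i show "T' y i = T'' y i"
   proof (cases "i \<in> I")
    case i: True
    have "cnj (T' y i) = cnj (T'' y i)"
     using adjoint_pairD(3)[OF assms(1) ell2_delta[OF i] True] adjoint_pairD(3)[OF assms(2) ell2_delta[OF i] True]
     unfolding ell2_inner_delta by simp
    thus ?thesis by simp
   next
    case False
    thus ?thesis using ell2_zero_outside bounded_ops_maps[OF adjoint_pairD(2)[OF assms(1)] True]
      bounded_ops_maps[OF adjoint_pairD(2)[OF assms(2)] True] by metis
   qed
  qed
 next
  case False
  thus ?thesis using bounded_ops_undefined adjoint_pairD(2) assms by metis
 qed
qed

lemma adj_op_algebra:
 assumes "adjoint_pair I T T'" shows "adj (op_algebra I) T = T'"
proof -
 have "adj (op_algebra I) T = (THE T'. T' \<in> bounded_ops I \<and>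
       (\<forall>x\<in>ell2 I. \<forall>y\<in>ell2 I. ell2_inner (T x) y = ell2_inner x (T' y)))" by (simp add: op_algebra_def)
 also have "\<dots> = T'"
 proof (rule the_equality)
  show "T' \<in> bounded_ops I \<and> (\<forall>x\<in>ell2 I. \<forall>y\<in>ell2 I. ell2_inner (T x) y = ell2_inner x (T' y))"
   using assms by (simp add: adjoint_pair_def)
  fix T'' assume "T'' \<in> bounded_ops I \<and> (\<forall>x\<in>ell2 I. \<forall>y\<in>ell2 I. ell2_inner (T x) y = ell2_inner x (T'' y))"
  hence "adjoint_pair I T T''" using adjoint_pairD(1)[OF assms] by (simp add: adjoint_pair_def)
  thus "T'' = T'" using adjoint_pair_unique[OF assms] by metis
 qed
 finally show ?thesis .
qed

text \<open>Cauchy-Schwarz for \<open>ell2_inner (T (T' y)) y\<close>, which is the squared norm of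
  \<open>T' y\<close>; one factor is then cancelled.\<close>

lemma adjoint_pair_norm_le:
 assumes "adjoint_pair I T T'" shows "op_norm I T' \<le> op_norm I T"
proof (rule op_norm_le)
 note D = adjoint_pairD[OF assms]
 show "0 \<le> op_norm I T" by (rule op_norm_nonneg[OF D(1)])
 fix y assume y: "y \<in> ell2 I"
 have m: "T' y \<in> ell2 I" by (rule bounded_ops_maps[OF D(2) y])
 have "(ell2_norm (T' y))\<^sup>2 = cmod (ell2_inner (T (T' y)) y)"
  using D(3)[OF m y] ell2_inner_self[OF m] by (simp add: norm_power)
 also have "\<dots> \<le> ell2_norm (T (T' y)) * ell2_norm y" by (rule ell2_inner_summable(2)[OF bounded_ops_maps[OF D(1) m] y])
 also have "\<dots> \<le> (op_norm I T * ell2_norm (T' y)) * ell2_norm y"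
  by (intro mult_right_mono op_norm_bound[OF D(1) m]) simp
 finally have *: "ell2_norm (T' y) * ell2_norm (T' y) \<le> (op_norm I T * ell2_norm y) * ell2_norm (T' y)"
  by (simp add: power2_eq_square mult_ac)
 show "ell2_norm (T' y) \<le> op_norm I T * ell2_norm y"
 proof (cases "ell2_norm (T' y) = 0")
  case True
  thus ?thesis using op_norm_nonneg[OF D(1)] by simp
 next
  case False
  hence "0 < ell2_norm (T' y)" using ell2_norm_nonneg[of "T' y"] by linarith
  thus ?thesis using * mult_le_cancel_right by (metis less_asym')
 qed
qed

lemma adjoint_pair_norm: "adjoint_pair I T T' ==> op_norm I T' = op_norm I T"
 using adjoint_pair_norm_le adjoint_pair_sym by (metis antisym)

lemma adjoint_pair_zero: "adjoint_pair I (\<lambda>x\<in>ell2 I. \<lambda>i. 0) (\<lambda>x\<in>ell2 I. \<lambda>i. 0)"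
 unfolding adjoint_pair_def using op_zero_bounded by (auto simp: ell2_inner_def)

lemma adjoint_pair_add:
 assumes "adjoint_pair I T T'" "adjoint_pair I S S'"
 shows "adjoint_pair I (\<lambda>x\<in>ell2 I. \<lambda>i. T x i + S x i) (\<lambda>x\<in>ell2 I. \<lambda>i. T' x i + S' x i)"
proof -
 note D = adjoint_pairD[OF assms(1)] adjoint_pairD[OF assms(2)]
 have "ell2_inner (\<lambda>i. T x i + S x i) y = ell2_inner x (\<lambda>i. T' y i + S' y i)" if x: "x \<in> ell2 I" and y: "y \<in> ell2 I" for x y
  using ell2_inner_add_left[OF bounded_ops_maps[OF D(1) x] bounded_ops_maps[OF D(4) x] y]
   ell2_inner_add_right[OF bounded_ops_maps[OF D(2) y] bounded_ops_maps[OF D(5) y] x] D(3)[OF x y] D(6)[OF x y] by simp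
 thus ?thesis unfolding adjoint_pair_def using op_add(1)[OF D(1) D(4)] op_add(1)[OF D(2) D(5)] by simp
qed

lemma adjoint_pair_scale:
 assumes "adjoint_pair I T T'"
 shows "adjoint_pair I (\<lambda>x\<in>ell2 I. \<lambda>i. c * T x i) (\<lambda>x\<in>ell2 I. \<lambda>i. cnj c * T' x i)"
proof -
 note D = adjoint_pairD[OF assms(1)]
 have "ell2_inner (\<lambda>i. c * T x i) y = ell2_inner x (\<lambda>i. cnj c * T' y i)" if x: "x \<in> ell2 I" and y: "y \<in> ell2 I" for x y
  unfolding ell2_inner_scale_left ell2_inner_scale_right D(3)[OF x y] by simp
 thus ?thesis unfolding adjoint_pair_def using op_scale(1)[OF D(1)] op_scale(1)[OF D(2)] by simp
qed

lemma adjoint_pair_mul: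
 assumes "adjoint_pair I T T'" "adjoint_pair I S S'"
 shows "adjoint_pair I (\<lambda>x\<in>ell2 I. T (S x)) (\<lambda>x\<in>ell2 I. S' (T' x))"
proof -
 note D = adjoint_pairD[OF assms(1)] adjoint_pairD[OF assms(2)]
 have "ell2_inner (T (S x)) y = ell2_inner x (S' (T' y))" if x: "x \<in> ell2 I" and y: "y \<in> ell2 I" for x y
  using D(3)[OF bounded_ops_maps[OF D(4) x] y] D(6)[OF x bounded_ops_maps[OF D(2) y]] by simp
 thus ?thesis unfolding adjoint_pair_def using op_mul(1)[OF D(1) D(4)] op_mul(1)[OF D(5) D(2)] by simp
qed

lemma op_limit_pointwise:
 assumes T: "\<And>n. T n \<in> bounded_ops I" and S: "S \<in> bounded_ops I" and l: "vanishes (\<lambda>n. op_norm I (op_diff I (T n) S))"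
  and x: "x \<in> ell2 I" and y: "y \<in> ell2 I"
 shows "(\<lambda>n. ell2_inner (T n x) y) \<longlonglongrightarrow> ell2_inner (S x) y"
proof -
 have b: "norm (ell2_inner (T n x) y - ell2_inner (S x) y) \<le> op_norm I (op_diff I (T n) S) * (ell2_norm x * ell2_norm y)" for n
 proof -
  have d: "(\<lambda>i. T n x i + (-1) * S x i) = op_diff I (T n) S x" using x by (simp add: op_diff_def)
  have "ell2_inner (T n x) y - ell2_inner (S x) y = ell2_inner (op_diff I (T n) S x) y"
   unfolding d[symmetric] ell2_inner_add_left[OF bounded_ops_maps[OF T x] ell2_scale(1)[OF bounded_ops_maps[OF S x]] y]
    ell2_inner_scale_left by simp
  hence "norm (ell2_inner (T n x) y - ell2_inner (S x) y) \<le> ell2_norm (op_diff I (T n) S x) * ell2_norm y"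
   using ell2_inner_summable(2)[OF bounded_ops_maps[OF op_diff_bounded[OF T S] x] y] by simp
  also have "\<dots> \<le> (op_norm I (op_diff I (T n) S) * ell2_norm x) * ell2_norm y"
   by (intro mult_right_mono op_norm_bound[OF op_diff_bounded[OF T S] x]) simp
  finally show ?thesis by (simp add: mult_ac)
 qed
 have "vanishes (\<lambda>n. op_norm I (op_diff I (T n) S) * (ell2_norm x * ell2_norm y))" using tendsto_mult_left_zero[OF l] .
 hence "vanishes (\<lambda>n. ell2_inner (T n x) y - ell2_inner (S x) y)"
  by (rule Lim_null_comparison[rotated]) (use b in auto)
 thus ?thesis by (simp add: LIM_zero_iff)
qed

lemma adjoint_pair_limit:
 assumes P: "\<And>n. adjoint_pair I (T n) (T' n)" and S: "S \<in> bounded_ops I" "S' \<in> bounded_ops I"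
  and l: "vanishes (\<lambda>n. op_norm I (op_diff I (T n) S))" "vanishes (\<lambda>n. op_norm I (op_diff I (T' n) S'))"
 shows "adjoint_pair I S S'"
 unfolding adjoint_pair_def
proof (intro conjI ballI S)
 fix x y assume x: "x \<in> ell2 I" and y: "y \<in> ell2 I"
 have 1: "(\<lambda>n. ell2_inner (T n x) y) \<longlonglongrightarrow> ell2_inner (S x) y"
  by (rule op_limit_pointwise[OF adjoint_pairD(1)[OF P] S(1) l(1) x y])
 have "(\<lambda>n. cnj (ell2_inner (T' n y) x)) \<longlonglongrightarrow> cnj (ell2_inner (S' y) x)"
  by (intro tendsto_cnj op_limit_pointwise[OF adjoint_pairD(2)[OF P] S(2) l(2) y x])
 hence "(\<lambda>n. ell2_inner (T n x) y) \<longlonglongrightarrow> ell2_inner x (S' y)"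
  unfolding ell2_inner_commute[symmetric] adjoint_pairD(3)[OF P x y, symmetric] .
 thus "ell2_inner (S x) y = ell2_inner x (S' y)" using 1 LIMSEQ_unique by blast
qed

subsection \<open>Weighted partial permutations\<close>

text \<open>The operator that moves the coordinate \<open>j\<close> to \<open>i\<close> with weight
  \<open>w j\<close> whenever \<open>s i = Some j\<close>. The map \<open>s\<close> runs from
  targets to sources, because the value of a convolution at an arrow is read at another arrow,
  obtained by applying an inverse. Functions carried by one bisection and elements of the hull both
  act in this way.\<close>

definition wvec :: "('i \<rightharpoonup> 'j) => ('j => complex) => ('j => complex) => 'i => complex" where
 "wvec s w x i = (case s i of None => 0 | Some j => w j * x j)"

lemma wvec_ell2:
 assumes dom: "dom s \<subseteq> I" and inj: "\<And>i i' j. s i = Some j ==> s i' = Some j ==> i = i'"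
  and w: "\<And>i j. s i = Some j ==> cmod (w j) \<le> M" and M: "0 \<le> M" and x: "x \<in> ell2 J"
 shows "wvec s w x \<in> ell2 I" "ell2_norm (wvec s w x) \<le> M * ell2_norm x"
proof -
 have "L2_set (\<lambda>i. cmod (wvec s w x i)) F \<le> M * ell2_norm x" if F: "finite F" for F
 proof -
  let ?F = "F \<inter> dom s" and ?s = "\<lambda>i. the (s i)"
  have injs: "inj_on ?s ?F" by (rule inj_onI) (use inj in fastforce)
  have "L2_set (\<lambda>i. cmod (wvec s w x i)) F = sqrt (\<Sum>i\<in>?F. (cmod (wvec s w x i))\<^sup>2)"
   unfolding L2_set_def
   by (intro arg_cong[where f = sqrt] sum.mono_neutral_right F) (auto simp: wvec_def split: option.splits)
  also have "\<dots> \<le> sqrt (\<Sum>i\<in>?F. M\<^sup>2 * (cmod (x (?s i)))\<^sup>2)"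
  proof (intro real_sqrt_le_mono sum_mono)
   fix i assume "i \<in> ?F"
   then obtain j where j: "s i = Some j" by auto
   have "(cmod (w j))\<^sup>2 \<le> M\<^sup>2" using w[OF j] by (intro power_mono) auto
   thus "(cmod (wvec s w x i))\<^sup>2 \<le> M\<^sup>2 * (cmod (x (?s i)))\<^sup>2"
    using j by (simp add: wvec_def norm_mult power_mult_distrib mult_right_mono)
  qed
  also have "\<dots> = sqrt (M\<^sup>2 * (\<Sum>j\<in>?s ` ?F. (cmod (x j))\<^sup>2))"
   by (simp add: sum_distrib_left[symmetric] sum.reindex[OF injs] comp_def)
  also have "\<dots> = M * L2_set (\<lambda>i. cmod (x i)) (?s ` ?F)"
   using M by (simp add: L2_set_def real_sqrt_mult)
  also have "\<dots> \<le> M * ell2_norm x" using F M by (intro mult_left_mono L2_set_le_ell2_norm[OF x]) auto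
  finally show ?thesis .
 qed
 moreover have "wvec s w x i = 0" if "i \<notin> I" for i using that dom by (auto simp: wvec_def split: option.splits)
 ultimately show "wvec s w x \<in> ell2 I" "ell2_norm (wvec s w x) \<le> M * ell2_norm x"
  using ell2_if_L2_set_bounded[of I "wvec s w x"] by blast+
qed

lemma wvec_inner:
 assumes st: "\<And>i j. s i = Some j \<longleftrightarrow> t j = Some i" and w': "\<And>i j. s i = Some j ==> w' i = cnj (w j)"
 shows "ell2_inner (wvec s w x) y = ell2_inner x (wvec t w' y)"
proof -
 let ?s = "\<lambda>i. the (s i)"
 have bij: "bij_betw ?s (dom s) (dom t)"
 proof (rule bij_betw_byWitness[where f' = "\<lambda>j. the (t j)"])
  have 1: "the (t (the (s i))) = i \<and> the (s i) \<in> dom t" if di: "i \<in> dom s" for i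
  proof -
   obtain j where j: "s i = Some j" using di by auto
   hence "t j = Some i" using st by blast
   thus ?thesis using j by auto
  qed
  have 2: "the (s (the (t j))) = j \<and> the (t j) \<in> dom s" if dj: "j \<in> dom t" for j
  proof -
   obtain i where i: "t j = Some i" using dj by auto
   hence "s i = Some j" using st by blast
   thus ?thesis using i by auto
  qed
  show "\<forall>i\<in>dom s. the (t (the (s i))) = i" "\<forall>j\<in>dom t. the (s (the (t j))) = j"
   "(\<lambda>i. the (s i)) ` dom s \<subseteq> dom t" "(\<lambda>j. the (t j)) ` dom t \<subseteq> dom s"
   using 1 2 by blast+
 qed
 have "ell2_inner (wvec s w x) y = (\<Sum>\<^sub>\<infinity>i\<in>dom s. wvec s w x i * cnj (y i))"
  unfolding ell2_inner_def by (rule infsum_cong_neutral) (auto simp: wvec_def split: option.splits)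
 also have "\<dots> = (\<Sum>\<^sub>\<infinity>i\<in>dom s. x (?s i) * cnj (wvec t w' y (?s i)))"
 proof (rule infsum_cong)
  fix i assume "i \<in> dom s"
  then obtain j where j: "s i = Some j" by auto
  hence "t j = Some i" using st by simp
  thus "wvec s w x i * cnj (y i) = x (?s i) * cnj (wvec t w' y (?s i))"
   using j w'[OF j] by (simp add: wvec_def)
 qed
 also have "\<dots> = (\<Sum>\<^sub>\<infinity>j\<in>dom t. x j * cnj (wvec t w' y j))"
  by (rule infsum_reindex_bij_betw[OF bij])
 also have "\<dots> = ell2_inner x (wvec t w' y)"
  unfolding ell2_inner_def by (rule infsum_cong_neutral) (auto simp: wvec_def split: option.splits)
 finally show ?thesis .
qed

lemma wvec_linear:
 "wvec s w (\<lambda>i. x i + y i) = (\<lambda>i. wvec s w x i + wvec s w y i)"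
 "wvec s w (\<lambda>i. c * x i) = (\<lambda>i. c * wvec s w x i)"
 by (auto simp: wvec_def fun_eq_iff distrib_left split: option.splits)

lemma wvec_bounded_ops:
 assumes dom: "dom s \<subseteq> I" and inj: "\<And>i i' j. s i = Some j ==> s i' = Some j ==> i = i'"
  and w: "\<And>i j. s i = Some j ==> cmod (w j) \<le> M" and M: "0 \<le> M"
 shows "(\<lambda>x\<in>ell2 I. wvec s w x) \<in> bounded_ops I" "op_norm I (\<lambda>x\<in>ell2 I. wvec s w x) \<le> M"
proof -
 note e = wvec_ell2[OF dom inj w M]
 show "(\<lambda>x\<in>ell2 I. wvec s w x) \<in> bounded_ops I"
  by (rule bounded_opsI[where K = M]) (use e in \<open>auto simp: wvec_linear ell2_add ell2_scale\<close>)
 show "op_norm I (\<lambda>x\<in>ell2 I. wvec s w x) \<le> M"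
  by (rule op_norm_le) (use e M in auto)
qed

section \<open>Boundedness and multiplicativity of the fibre representations\<close>

lemma continuous_bounded_dom_chars:
 fixes h :: "('a::left_cancel_monoid set => bool) => complex"
 assumes Y: "closedin \<O> Y" and g: "g \<in> \<I>"
  and h: "continuous_map (dom_top Y g) euclidean h"
 obtains M where "0 \<le> M" "\<And>w. w \<in> dom_chars Y g ==> cmod (h w) \<le> M"
proof -
 have "compactin \<O> (dom_chars Y g)"
  by (rule closedin_compact_space[OF compact_space_Omega closedin_dom_chars[OF Y g]])
 hence "compactin (dom_top Y g) (dom_chars Y g)" by (simp add: compactin_subtopology)
 hence "compactin euclidean (h ` dom_chars Y g)" by (rule image_compactin[OF _ h])
 hence "bounded (h ` dom_chars Y g)" by (simp add: compact_imp_bounded)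
 then obtain M where M: "\<forall>x\<in>h ` dom_chars Y g. norm x \<le> M" unfolding bounded_iff by blast
 hence "cmod (h w) \<le> \<bar>M\<bar>" if "w \<in> dom_chars Y g" for w using that by force
 thus ?thesis using that[of "\<bar>M\<bar>"] by simp
qed

lemma act_fibre:
 assumes "z \<in> fibre w" "g \<in> \<I>" "act g z = Some d"
 shows "d \<in> fibre w"
 using act_SomeD(1,2)[OF assms(2) _ assms(3)] assms(1) by (simp add: fibre_def)

definition fibre_act :: "('a::left_cancel_monoid set => bool) => ('a \<rightharpoonup> 'a) => 'a germ => 'a germ option" where
 "fibre_act w g z = (if z \<in> fibre w then act (pinv g) z else None)"

lemma fibre_act_iff:
 assumes g: "g \<in> \<I>"
 shows "fibre_act w g z = Some d \<longleftrightarrow> fibre_act w (pinv g) d = Some z"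
proof -
 have gi: "pinv g \<in> \<I>" using g by (rule inv_hull)
 have *: "fibre_act w (pinv g) d = Some z" if g: "g \<in> \<I>" and a: "fibre_act w g z = Some d" for g z d
 proof -
  have gi: "pinv g \<in> \<I>" using g by (rule inv_hull)
  have f: "z \<in> fibre w" "act (pinv g) z = Some d" using a unfolding fibre_act_def by (auto split: if_splits)
  have d: "d \<in> fibre w" by (rule act_fibre[OF f(1) gi f(2)])
  have "act (pinv (pinv g)) d = Some z" by (rule act_SomeD(4)[OF gi _ f(2)]) (use f(1) in \<open>simp add: fibre_def\<close>)
  thus ?thesis using d by (simp add: fibre_act_def)
 qed
 show ?thesis using *[OF g, of z d] *[OF gi, of d z] partial_inverse_partial_inverse[OF g] by auto
qed

lemma fibre_act_SomeD:
 assumes g: "g \<in> \<I>" and a: "fibre_act w g z = Some d"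
 shows "z \<in> fibre w" "d \<in> fibre w" "range_char d (dom g)" "range_char d = push (pinv g) (range_char z)"
  "act g d = Some z"
proof -
 have gi: "pinv g \<in> \<I>" using g by (rule inv_hull)
 show f: "z \<in> fibre w" using a unfolding fibre_act_def by (auto split: if_splits)
 have a': "act (pinv g) z = Some d" using a f unfolding fibre_act_def by simp
 show d: "d \<in> fibre w" by (rule act_fibre[OF f gi a'])
 have A: "z \<in> arrows \<G>" "d \<in> arrows \<G>" using f d by (simp_all add: fibre_def)
 note D = act_SomeD[OF gi A(1) a']
 show "act g d = Some z" using D(4) partial_inverse_partial_inverse[OF g] by simp
 thus "range_char d (dom g)" using act_defined_iff[OF g A(2)] by simp
 show "range_char d = push (pinv g) (range_char z)" by (rule D(3))
qed

lemma range_char_fibre: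
 assumes "invariant_chars Y" "w \<in> Y" "z \<in> fibre w"
 shows "range_char z \<in> Y"
 using range_char_invariant_iff[OF assms(1), of z] assms by (simp add: fibre_def)

lemma fibre_rep_gen:
 assumes Y: "invariant_chars Y" and w: "w \<in> Y" and g: "g \<in> \<I>"
 shows "fibre_rep w (gen Y g h) = (\<lambda>x\<in>ell2 (fibre w). wvec (fibre_act w g) (\<lambda>d. h (range_char d)) x)"
 unfolding fibre_rep_def
proof (intro restrict_ext ext)
 fix x :: "'a germ_fun" and z assume x: "x \<in> ell2 (fibre w)"
 show "(if z \<in> fibre w then lconv (gen Y g h) x z else 0) = wvec (fibre_act w g) (\<lambda>d. h (range_char d)) x z"
 proof (cases "z \<in> fibre w")
  case True
  hence "z \<in> arrows \<G>" "char_of z \<in> Y" using w by (simp_all add: fibre_def)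
  thus ?thesis using True lconv_gen[OF Y g, of z h x] by (simp add: wvec_def fibre_act_def)
 qed (simp add: wvec_def fibre_act_def)
qed

lemma fibre_act_dom: "dom (fibre_act w g) \<subseteq> fibre w"
 by (auto simp: fibre_act_def split: if_splits)

lemma fibre_rep_gen_bounded:
 assumes Y: "invariant_chars Y" and w: "w \<in> Y" and g: "g \<in> \<I>"
  and M: "0 \<le> M" "\<And>w. w \<in> dom_chars Y g ==> cmod (h w) \<le> M"
 shows "fibre_rep w (gen Y g h) \<in> bounded_ops (fibre w)" "fnorm w (gen Y g h) \<le> M"
proof -
 have inj: "i = i'" if "fibre_act w g i = Some j" "fibre_act w g i' = Some j" for i i' j
  using fibre_act_iff[OF g] that by (metis option.inject)
 have b: "cmod (h (range_char j)) \<le> M" if "fibre_act w g i = Some j" for i j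
  using fibre_act_SomeD[OF g that] range_char_fibre[OF Y w] M(2) by blast
 note * = wvec_bounded_ops[of "fibre_act w g" _ "\<lambda>d. h (range_char d)" M, OF fibre_act_dom[of w g]]
 show "fibre_rep w (gen Y g h) \<in> bounded_ops (fibre w)" unfolding fibre_rep_gen[OF Y w g]
  by (rule *(1)) (use inj b M(1) in blast)+
 show "fnorm w (gen Y g h) \<le> M" unfolding fibre_rep_gen[OF Y w g]
  by (rule *(2)) (use inj b M(1) in blast)+
qed

lemma fibre_arrow: "z \<in> fibre w ==> z \<in> arrows \<G>"
 by (simp add: fibre_def)

lemma fibre_rep_add:
 assumes "Y \<subseteq> Omega" "f \<in> gen_span Y P" "f' \<in> gen_span Y P"
 shows "fibre_rep w (\<lambda>z. f z + f' z) = (\<lambda>x\<in>ell2 (fibre w). \<lambda>z. fibre_rep w f x z + fibre_rep w f' x z)"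
 unfolding fibre_rep_def
proof (intro restrict_ext ext)
 fix x :: "'a germ_fun" and z assume x: "x \<in> ell2 (fibre w)"
 show "(if z \<in> fibre w then lconv (\<lambda>z. f z + f' z) x z else 0) =
  (\<lambda>x\<in>ell2 (fibre w). \<lambda>z. if z \<in> fibre w then lconv f x z else 0) x z +
  (\<lambda>x\<in>ell2 (fibre w). \<lambda>z. if z \<in> fibre w then lconv f' x z else 0) x z"
  using x lconv_add_left[OF assms fibre_arrow, of z w x] by simp
qed

lemma fibre_rep_scale:
 assumes "Y \<subseteq> Omega" "f \<in> gen_span Y P"
 shows "fibre_rep w (\<lambda>z. c * f z) = (\<lambda>x\<in>ell2 (fibre w). \<lambda>z. c * fibre_rep w f x z)"
 unfolding fibre_rep_def
proof (intro restrict_ext ext)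
 fix x :: "'a germ_fun" and z assume x: "x \<in> ell2 (fibre w)"
 show "(if z \<in> fibre w then lconv (\<lambda>z. c * f z) x z else 0) =
  c * (\<lambda>x\<in>ell2 (fibre w). \<lambda>z. if z \<in> fibre w then lconv f x z else 0) x z"
  using x lconv_scale_left[OF assms fibre_arrow, of z w c x] by simp
qed

lemma fibre_rep_zero: "fibre_rep w (\<lambda>_. 0) = (\<lambda>x\<in>ell2 (fibre w). \<lambda>_. 0)"
 unfolding fibre_rep_def lconv_zero by simp

lemma gen_span_True_add_gen:
 assumes "f \<in> gen_span Y P" "g \<in> \<I>" "continuous_map (dom_top Y g) euclidean h"
 shows "f \<in> gen_span Y (\<lambda>_. True)" "gen Y g h \<in> gen_span Y (\<lambda>_. True)"
 by (rule gen_span_mono[OF assms(1)], simp) (rule gen_span_gen[OF assms(2,3)], simp)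

text \<open>Each coefficient function is continuous on a compact set, compactness being provided by
  the closedness of \<open>Y\<close>, and the resulting bound does not involve \<open>w\<close>.
  This uniformity keeps the supremum in the reduced norm finite.\<close>

lemma fibre_rep_bounded_uniform:
 assumes Yc: "closedin \<O> Y" and Y: "invariant_chars Y" and f: "f \<in> gen_span Y P"
 obtains M where "0 \<le> M" "\<And>w. w \<in> Y ==> fibre_rep w f \<in> bounded_ops (fibre w)"
  "\<And>w. w \<in> Y ==> fnorm w f \<le> M"
proof -
 have YO: "Y \<subseteq> Omega" by (rule invariant_charsD[OF Y])
 have "\<exists>M\<ge>0. \<forall>w\<in>Y. fibre_rep w f \<in> bounded_ops (fibre w) \<and> fnorm w f \<le> M"
  using f
 proof induction
  case zero
  show ?case unfolding fibre_rep_zero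
   by (intro exI[of _ 0] conjI ballI op_zero_bounded eq_refl[OF op_norm_zero]) simp
 next
  case (add_gen f g h)
  then obtain M where M: "M \<ge> 0" "\<And>w. w \<in> Y ==> fibre_rep w f \<in> bounded_ops (fibre w)"
   "\<And>w. w \<in> Y ==> fnorm w f \<le> M" by blast
  obtain M' where M': "0 \<le> M'" "\<And>w. w \<in> dom_chars Y g ==> cmod (h w) \<le> M'"
   using continuous_bounded_dom_chars[OF Yc add_gen.hyps(2,3)] by blast
  have b: "fibre_rep w (gen Y g h) \<in> bounded_ops (fibre w)" "fnorm w (gen Y g h) \<le> M'"
   if "w \<in> Y" for w
   using fibre_rep_gen_bounded[where h = h and M = M', OF Y that add_gen.hyps(2) M'(1)] M'(2) by blast+
  note t = gen_span_True_add_gen[OF add_gen.hyps(1-3)]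
  show ?case
  proof (intro exI[of _ "M + M'"] conjI ballI)
   show "M + M' \<ge> 0" using M M' by simp
   fix w assume w: "w \<in> Y"
   show "fibre_rep w (\<lambda>z. f z + gen Y g h z) \<in> bounded_ops (fibre w)"
    unfolding fibre_rep_add[OF YO t] by (rule op_add(1)[OF M(2)[OF w] b(1)[OF w]])
   show "fnorm w (\<lambda>z. f z + gen Y g h z) \<le> M + M'"
    unfolding fibre_rep_add[OF YO t] using op_add(2)[OF M(2)[OF w] b(1)[OF w]] M(3)[OF w] b(2)[OF w] by linarith
  qed
 qed
 thus ?thesis using that by blast
qed

lemma convolution_add_right:
 assumes Y: "invariant_chars Y" and "f \<in> gen_span Y P"
 shows "conv_on Y f (\<lambda>z. q z + q' z) =
  (\<lambda>z. conv_on Y f q z + conv_on Y f q' z)"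
proof
 fix z show "conv_on Y f (\<lambda>z. q z + q' z) z =
  conv_on Y f q z + conv_on Y f q' z"
  unfolding convolution_groupoid_on[OF Y] using lconv_add_right[OF invariant_charsD(1)[OF Y] assms(2), of z q q'] by auto
qed

lemma convolution_add_left:
 assumes Y: "invariant_chars Y" and "f \<in> gen_span Y P" "f' \<in> gen_span Y P"
 shows "conv_on Y (\<lambda>z. f z + f' z) q =
  (\<lambda>z. conv_on Y f q z + conv_on Y f' q z)"
proof
 fix z show "conv_on Y (\<lambda>z. f z + f' z) q z =
  conv_on Y f q z + conv_on Y f' q z"
  unfolding convolution_groupoid_on[OF Y] using lconv_add_left[OF invariant_charsD(1)[OF Y] assms(2,3), of z q] by auto
qed

lemma convolution_scale:
 assumes Y: "invariant_chars Y" and "f \<in> gen_span Y P"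
 shows "conv_on Y (\<lambda>z. c * f z) q = (\<lambda>z. c * conv_on Y f q z)"
  "conv_on Y f (\<lambda>z. c * q z) = (\<lambda>z. c * conv_on Y f q z)"
proof (safe intro!: ext)
 fix z
 note YO = invariant_charsD(1)[OF Y]
 show "conv_on Y (\<lambda>z. c * f z) q z = c * conv_on Y f q z"
  "conv_on Y f (\<lambda>z. c * q z) z = c * conv_on Y f q z"
  unfolding convolution_groupoid_on[OF Y]
  using lconv_scale_left[OF YO assms(2), of z c q] lconv_scale_right[OF YO assms(2), of z c q] by auto
qed

lemma convolution_zero:
 assumes Y: "invariant_chars Y"
 shows "conv_on Y (\<lambda>_. 0) q = (\<lambda>_. 0)" "conv_on Y f (\<lambda>_. 0) = (\<lambda>_. 0)"
 unfolding convolution_groupoid_on[OF Y] lconv_zero by simp_all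

text \<open>Both sides are weighted partial permutations. The weights match because the range of the
  intermediate arrow \<open>d\<close> is the push-forward by \<open>g'\<close> of the range of
  \<open>\<epsilon>\<close>.\<close>

lemma fibre_rep_conv_gen_gen:
 assumes Y: "invariant_chars Y" and w: "w \<in> Y" and g: "g \<in> \<I>" and g': "g' \<in> \<I>"
  and x: "x \<in> ell2 (fibre w)" and x': "fibre_rep w (gen Y g' h') x \<in> ell2 (fibre w)"
 shows "fibre_rep w (conv_on Y (gen Y g h) (gen Y g' h')) x =
  fibre_rep w (gen Y g h) (fibre_rep w (gen Y g' h') x)"
proof
 fix z
 have gg: "g \<circ>\<^sub>m g' \<in> \<I>" using g g' by (rule comp_hull)
 have gi: "pinv g \<in> \<I>" "pinv g' \<in> \<I>" using g g' inv_hull by blast+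
 have L: "fibre_rep w (conv_on Y (gen Y g h) (gen Y g' h')) x z =
  wvec (fibre_act w (g \<circ>\<^sub>m g')) (\<lambda>d. h (push g' (range_char d)) * h' (range_char d)) x z"
  unfolding gen_span_conv_gen_gen[OF Y g g'] fibre_rep_gen[OF Y w gg] using x by simp
 have R: "fibre_rep w (gen Y g h) (fibre_rep w (gen Y g' h') x) z =
  wvec (fibre_act w g) (\<lambda>d. h (range_char d)) (wvec (fibre_act w g') (\<lambda>d. h' (range_char d)) x) z"
  using x x' unfolding fibre_rep_gen[OF Y w g] fibre_rep_gen[OF Y w g'] by simp
 show "fibre_rep w (conv_on Y (gen Y g h) (gen Y g' h')) x z =
  fibre_rep w (gen Y g h) (fibre_rep w (gen Y g' h') x) z"
 proof (cases "z \<in> fibre w")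
  case False
  thus ?thesis unfolding L R by (simp add: wvec_def fibre_act_def)
 next
  case True
  have c: "act (pinv (g \<circ>\<^sub>m g')) z = (case act (pinv g) z of None => None | Some d => act (pinv g') d)"
   unfolding partial_inverse_comp[OF g g'] by (rule act_comp[OF gi(2,1) fibre_arrow[OF True]])
  show ?thesis
  proof (cases "act (pinv g) z")
   case None
   thus ?thesis unfolding L R using c by (simp add: wvec_def fibre_act_def)
  next
   case (Some d)
   have a: "fibre_act w g z = Some d" using Some True by (simp add: fibre_act_def)
   have d: "d \<in> fibre w" by (rule fibre_act_SomeD(2)[OF g a])
   have fa: "fibre_act w (g \<circ>\<^sub>m g') z = fibre_act w g' d" using c Some True d by (simp add: fibre_act_def)
   show ?thesis
   proof (cases "fibre_act w g' d")
    case None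
    thus ?thesis unfolding L R wvec_def fa a by simp
   next
    case (Some \<epsilon>)
    have e: "\<epsilon> \<in> arrows \<G>" using fibre_act_SomeD(2)[OF g' Some] by (rule fibre_arrow)
    have "range_char d = push g' (range_char \<epsilon>)"
     by (rule act_SomeD(3)[OF g' e fibre_act_SomeD(5)[OF g' Some]])
    thus ?thesis unfolding L R wvec_def fa a using Some by simp
   qed
  qed
 qed
qed

lemma fibre_rep_conv:
 assumes Yc: "closedin \<O> Y" and Y: "invariant_chars Y" and w: "w \<in> Y"
  and f: "f \<in> gen_span Y (\<lambda>_. True)" and f': "f' \<in> gen_span Y (\<lambda>_. True)" and x: "x \<in> ell2 (fibre w)"
 shows "fibre_rep w (conv_on Y f f') x = fibre_rep w f (fibre_rep w f' x)"
proof -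
 have YO: "Y \<subseteq> Omega" by (rule invariant_charsD[OF Y])
 have bd: "fibre_rep w f \<in> bounded_ops (fibre w)" if "f \<in> gen_span Y (\<lambda>_. True)" for f
  using fibre_rep_bounded_uniform[OF Yc Y that] w by metis
 have add: "fibre_rep w (\<lambda>z. f1 z + f2 z) x = (\<lambda>z. fibre_rep w f1 x z + fibre_rep w f2 x z)"
  if "f1 \<in> gen_span Y (\<lambda>_. True)" "f2 \<in> gen_span Y (\<lambda>_. True)" "x \<in> ell2 (fibre w)" for f1 f2 x
  unfolding fibre_rep_add[OF YO that(1,2)] using that(3) by simp
 have 1: "fibre_rep w (conv_on Y (gen Y g h) f') x = fibre_rep w (gen Y g h) (fibre_rep w f' x)"
  if g: "g \<in> \<I>" "continuous_map (dom_top Y g) euclidean h" for g h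
  using f'
 proof induction
  case zero
  have z: "fibre_rep w (\<lambda>_. 0) x = (\<lambda>_. 0)" unfolding fibre_rep_zero using x by simp
  have "fibre_rep w (gen Y g h) (\<lambda>_. 0) = (\<lambda>_. 0)"
   using bounded_ops_scale[OF bd[OF gen_span_True_add_gen(2)[OF gen_span.zero g]] ell2_0(1), of 0] by simp
  thus ?case unfolding convolution_zero[OF Y] z by simp
 next
  case (add_gen f' g' h')
  note tg = gen_span_True_add_gen(2)[OF add_gen.hyps(1) g]
  note t = gen_span_True_add_gen[OF add_gen.hyps(1-3)]
  have m: "fibre_rep w f' x \<in> ell2 (fibre w)" "fibre_rep w (gen Y g' h') x \<in> ell2 (fibre w)"
   using bounded_ops_maps[OF bd] t x by blast+
  show ?case
   unfolding convolution_add_right[OF Y tg] add[OF gen_span_conv[OF Y tg t(1)] gen_span_conv[OF Y tg t(2)] x]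
    add[OF t x] bounded_ops_add[OF bd[OF tg] m] add_gen.IH fibre_rep_conv_gen_gen[OF Y w g(1) add_gen.hyps(2) x m(2)] ..
 qed
 show ?thesis
  using f
 proof induction
  case zero
  have m: "fibre_rep w f' x \<in> ell2 (fibre w)" using bounded_ops_maps[OF bd[OF f'] x] .
  show ?case unfolding convolution_zero[OF Y] fibre_rep_zero using x m by simp
 next
  case (add_gen f g h)
  note t = gen_span_True_add_gen[OF add_gen.hyps(1-3)]
  have m: "fibre_rep w f' x \<in> ell2 (fibre w)" using bounded_ops_maps[OF bd[OF f'] x] .
  show ?case
   unfolding convolution_add_left[OF Y t] add[OF gen_span_conv[OF Y t(1) f'] gen_span_conv[OF Y t(2) f'] x]
    add[OF t m] add_gen.IH 1[OF add_gen.hyps(2,3)] ..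
 qed
qed

lemma involution_add:
 "involution G (\<lambda>z. f z + f' z) = (\<lambda>z. involution G f z + involution G f' z)"
 "involution G (\<lambda>z. c * f z) = (\<lambda>z. cnj c * involution G f z)"
 "involution G (\<lambda>z. 0) = (\<lambda>z. 0)"
 by (auto simp: involution_def fun_eq_iff)

lemma fibre_rep_adjoint:
 assumes Yc: "closedin \<O> Y" and Y: "invariant_chars Y" and w: "w \<in> Y"
  and f: "f \<in> gen_span Y (\<lambda>_. True)"
 shows "adjoint_pair (fibre w) (fibre_rep w f) (fibre_rep w (involution (groupoid_on Y) f))"
 using f
proof induction
 case zero
 show ?case unfolding involution_add fibre_rep_zero by (rule adjoint_pair_zero)
next
 case (add_gen f g h)
 have YO: "Y \<subseteq> Omega" by (rule invariant_charsD[OF Y])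
 note t = gen_span_True_add_gen[OF add_gen.hyps(1-3)]
 have bd: "fibre_rep w f \<in> bounded_ops (fibre w)" if "f \<in> gen_span Y (\<lambda>_. True)" for f
  using fibre_rep_bounded_uniform[OF Yc Y that] w by metis
 have gi: "pinv g \<in> \<I>" using add_gen.hyps(2) by (rule inv_hull)
 let ?h = "\<lambda>w. cnj (h (push (pinv g) w))"
 have "adjoint_pair (fibre w) (fibre_rep w (gen Y g h)) (fibre_rep w (involution (groupoid_on Y) (gen Y g h)))"
  unfolding adjoint_pair_def
 proof (intro conjI ballI bd t(2) gen_span_involution[OF Y t(2)])
  fix x y assume x: "x \<in> ell2 (fibre w)" "y \<in> ell2 (fibre w)"
  have "ell2_inner (wvec (fibre_act w g) (\<lambda>d. h (range_char d)) x) y =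
   ell2_inner x (wvec (fibre_act w (pinv g)) (\<lambda>d. ?h (range_char d)) y)"
  proof (rule wvec_inner)
   show "fibre_act w g i = Some j \<longleftrightarrow> fibre_act w (pinv g) j = Some i" for i j
    by (rule fibre_act_iff[OF add_gen.hyps(2)])
   show "?h (range_char i) = cnj (h (range_char j))" if "fibre_act w g i = Some j" for i j
    using fibre_act_SomeD(4)[OF add_gen.hyps(2) that] by simp
  qed
  thus "ell2_inner (fibre_rep w (gen Y g h) x) y = ell2_inner x (fibre_rep w (involution (groupoid_on Y) (gen Y g h)) y)"
   unfolding involution_gen[OF Y add_gen.hyps(2)] fibre_rep_gen[OF Y w add_gen.hyps(2)] fibre_rep_gen[OF Y w gi] using x by simp
 qed
 thus ?case
  unfolding involution_add fibre_rep_add[OF YO t] fibre_rep_add[OF YO gen_span_involution[OF Y t(1)] gen_span_involution[OF Y t(2)]]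
  by (rule adjoint_pair_add[OF add_gen.IH])
qed

subsection \<open>The reduced norm\<close>

text \<open>Closedness gives compact carriers and hence finite norms; invariance makes the fibres of
  the reduction fibres of the whole groupoid. The instances are \<open>Omega\<close> and
  \<open>boundary_Omega\<close>; the complement of the boundary is only known to be open and is
  treated by comparison with \<open>Omega\<close>.\<close>

locale closed_invariant =
 fixes Y :: "('a::left_cancel_monoid set => bool) set"
 assumes closed: "closedin \<O> Y" and invariant: "invariant_chars Y"
begin

lemma subset_Omega: "Y \<subseteq> Omega"
 by (rule invariant_charsD[OF invariant])

abbreviation "CcY \<equiv> gen_span Y (\<lambda>_. True)"
abbreviation "rnorm \<equiv> reduced_norm (groupoid_on Y)"

lemma Cc_eq: "Cc (groupoid_on Y) = CcY"
 by (rule Cc_eq_gen_span[OF closed])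

lemma fibre_rep_bounded: "f \<in> CcY ==> w \<in> Y ==> fibre_rep w f \<in> bounded_ops (fibre w)"
 using fibre_rep_bounded_uniform[OF closed invariant] by metis

lemma rnorm_bdd: "f \<in> CcY ==> bdd_above (insert 0 ((\<lambda>w. fnorm w f) ` Y))"
proof -
 assume f: "f \<in> CcY"
 obtain M where "0 \<le> M" "\<And>w. w \<in> Y ==> fnorm w f \<le> M"
  using fibre_rep_bounded_uniform[OF closed invariant f] by metis
 thus ?thesis by (auto intro!: bdd_aboveI[of _ M])
qed

lemma rnorm_ge: "f \<in> CcY ==> w \<in> Y ==> fnorm w f \<le> rnorm f"
 unfolding reduced_norm_groupoid_on[OF invariant] by (rule cSup_upper[OF _ rnorm_bdd]) auto

lemma rnorm_nonneg: "f \<in> CcY ==> 0 \<le> rnorm f"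
 unfolding reduced_norm_groupoid_on[OF invariant] by (rule cSup_upper[OF _ rnorm_bdd]) auto

lemma rnorm_le:
 assumes "0 \<le> K" "\<And>w. w \<in> Y ==> fnorm w f \<le> K"
 shows "rnorm f \<le> K"
 unfolding reduced_norm_groupoid_on[OF invariant] by (rule cSup_least) (use assms in auto)

lemma rnorm_add:
 assumes "f \<in> CcY" "f' \<in> CcY" shows "rnorm (\<lambda>z. f z + f' z) \<le> rnorm f + rnorm f'"
proof (rule rnorm_le)
 show "0 \<le> rnorm f + rnorm f'" using rnorm_nonneg assms by (metis add_nonneg_nonneg)
 fix w assume w: "w \<in> Y"
 show "fnorm w (\<lambda>z. f z + f' z) \<le> rnorm f + rnorm f'"
  unfolding fibre_rep_add[OF subset_Omega assms]
  using op_add(2)[OF fibre_rep_bounded[OF assms(1) w] fibre_rep_bounded[OF assms(2) w]] rnorm_ge[OF assms(1) w] rnorm_ge[OF assms(2) w]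
  by linarith
qed

lemma rnorm_scale_le:
 assumes "f \<in> CcY" shows "rnorm (\<lambda>z. c * f z) \<le> cmod c * rnorm f"
proof (rule rnorm_le)
 show "0 \<le> cmod c * rnorm f" using rnorm_nonneg[OF assms] by simp
 fix w assume w: "w \<in> Y"
 show "fnorm w (\<lambda>z. c * f z) \<le> cmod c * rnorm f"
  unfolding fibre_rep_scale[OF subset_Omega assms] op_scale(2)[OF fibre_rep_bounded[OF assms w]]
  by (intro mult_left_mono rnorm_ge[OF assms w]) simp
qed

lemma rnorm_zero: "rnorm (\<lambda>_. 0) = 0"
 using rnorm_scale_le[OF gen_span.zero, of 0] rnorm_nonneg[OF gen_span.zero] by simp

lemma rnorm_scale:
 assumes "f \<in> CcY" shows "rnorm (\<lambda>z. c * f z) = cmod c * rnorm f"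
proof (cases "c = 0")
 case True
 thus ?thesis using rnorm_zero by simp
next
 case False
 have "rnorm (\<lambda>z. inverse c * (c * f z)) \<le> cmod (inverse c) * rnorm (\<lambda>z. c * f z)"
  by (rule rnorm_scale_le[OF gen_span_scale[OF assms]])
 moreover have "(\<lambda>z. inverse c * (c * f z)) = f" using False by (simp add: mult.assoc[symmetric])
 ultimately have "cmod c * rnorm f \<le> cmod c * (cmod (inverse c) * rnorm (\<lambda>z. c * f z))"
  by (intro mult_left_mono) simp_all
 moreover have "cmod c * cmod (inverse c) = 1" using False by (simp add: norm_mult[symmetric])
 ultimately have "cmod c * rnorm f \<le> rnorm (\<lambda>z. c * f z)" by (simp only: mult.assoc[symmetric] mult_1)
 thus ?thesis using rnorm_scale_le[OF assms, of c] by linarith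
qed

abbreviation "conv \<equiv> conv_on Y"
abbreviation "inv_star \<equiv> involution (groupoid_on Y)"

lemma fibre_rep_conv_op:
 assumes "f \<in> CcY" "f' \<in> CcY" "w \<in> Y"
 shows "fibre_rep w (conv f f') = (\<lambda>x\<in>ell2 (fibre w). fibre_rep w f (fibre_rep w f' x))"
proof
 fix x show "fibre_rep w (conv f f') x = (\<lambda>x\<in>ell2 (fibre w). fibre_rep w f (fibre_rep w f' x)) x"
  using fibre_rep_conv[OF closed invariant assms(3,1,2), of x] by (cases "x \<in> ell2 (fibre w)") (simp_all add: fibre_rep_def)
qed

lemma rnorm_conv:
 assumes "f \<in> CcY" "f' \<in> CcY" shows "rnorm (conv f f') \<le> rnorm f * rnorm f'"
proof (rule rnorm_le)
 show "0 \<le> rnorm f * rnorm f'" using rnorm_nonneg assms by (metis mult_nonneg_nonneg)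
 fix w assume w: "w \<in> Y"
 have "fnorm w (conv f f') \<le> fnorm w f * fnorm w f'"
  unfolding fibre_rep_conv_op[OF assms w] by (rule op_mul(2)[OF fibre_rep_bounded[OF assms(1) w] fibre_rep_bounded[OF assms(2) w]])
 also have "\<dots> \<le> rnorm f * rnorm f'"
  by (intro mult_mono rnorm_ge assms w rnorm_nonneg op_norm_nonneg fibre_rep_bounded)
 finally show "fnorm w (conv f f') \<le> rnorm f * rnorm f'" .
qed

lemma rnorm_involution:
 assumes "f \<in> CcY" shows "rnorm (inv_star f) = rnorm f"
proof -
 have "fnorm w (inv_star f) = fnorm w f" if "w \<in> Y" for w
  by (rule adjoint_pair_norm[OF fibre_rep_adjoint[OF closed invariant that assms]])
 thus ?thesis unfolding reduced_norm_groupoid_on[OF invariant] by (metis (no_types, lifting) image_cong)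
qed

end

interpretation Omega_ci: closed_invariant Omega
 by unfold_locales (use closedin_topspace[of \<O>] invariant_Omega in simp_all)

interpretation boundary_ci: closed_invariant boundary_Omega
 by unfold_locales (rule closedin_boundary invariant_boundary)+

section \<open>Seminormed algebras, their completions and quotients\<close>

lemma UN_const:
 assumes "a \<in> A" "\<And>x. x \<in> A ==> f x = c"
 shows "(\<Union>x\<in>A. f x) = c"
 using assms by (intro UN_constant_eq) blast+

text \<open>Algebras are records with a carrier, so all laws are relative to \<open>elems A\<close>.
  The norm is only a seminorm, because completion identifies elements at distance zero; this covers
  the reduced norm on C_c as well as operator norms.\<close>

locale seminormed =
 fixes A :: "'b star_algebra"
 assumes zer_in [simp]: "zer A \<in> elems A"
  and add_in [simp]: "a \<in> elems A ==> b \<in> elems A ==> add A a b \<in> elems A"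
  and scl_in [simp]: "a \<in> elems A ==> scl A c a \<in> elems A"
  and add_assoc: "a \<in> elems A ==> b \<in> elems A ==> d \<in> elems A ==> add A (add A a b) d = add A a (add A b d)"
  and add_commute: "a \<in> elems A ==> b \<in> elems A ==> add A a b = add A b a"
  and add_zer [simp]: "a \<in> elems A ==> add A a (zer A) = a"
  and add_neg [simp]: "a \<in> elems A ==> add A a (scl A (-1) a) = zer A"
  and scl_add: "a \<in> elems A ==> b \<in> elems A ==> scl A c (add A a b) = add A (scl A c a) (scl A c b)"
  and scl_scl: "a \<in> elems A ==> scl A c (scl A c' a) = scl A (c * c') a"
  and scl_one [simp]: "a \<in> elems A ==> scl A 1 a = a"
  and scl_zero: "a \<in> elems A ==> scl A 0 a = zer A"
  and nrm_nonneg [simp]: "a \<in> elems A ==> 0 \<le> nrm A a"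
  and nrm_triangle: "a \<in> elems A ==> b \<in> elems A ==> nrm A (add A a b) \<le> nrm A a + nrm A b"
  and nrm_scl: "a \<in> elems A ==> nrm A (scl A c a) = cmod c * nrm A a"
begin

abbreviation "dif a b \<equiv> add A a (scl A (-1) b)"

lemma dif_in [simp]: "a \<in> elems A ==> b \<in> elems A ==> dif a b \<in> elems A" by simp

lemma nrm_zer [simp]: "nrm A (zer A) = 0"
 using nrm_scl[OF zer_in, of 0] scl_zero[OF zer_in] by simp

lemma scl_zer [simp]: "scl A c (zer A) = zer A"
 using scl_scl[OF zer_in, of c 0] scl_zero[OF zer_in] by simp

lemma zer_add [simp]: "a \<in> elems A ==> add A (zer A) a = a"
 using add_commute[of a "zer A"] by simp

lemma neg_add [simp]: "a \<in> elems A ==> add A (scl A (-1) a) a = zer A"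
 using add_commute[of a "scl A (-1) a"] by simp

lemma add_left_commute: "a \<in> elems A ==> b \<in> elems A ==> d \<in> elems A ==> add A a (add A b d) = add A b (add A a d)"
 using add_assoc[of a b d] add_assoc[of b a d] add_commute[of a b] by simp

lemma neg_dif: "a \<in> elems A ==> b \<in> elems A ==> scl A (-1) (dif a b) = dif b a"
 using add_commute[of b "scl A (-1) a"] by (simp add: scl_add scl_scl)

lemma dif_add_dif:
 assumes "a \<in> elems A" "b \<in> elems A" "d \<in> elems A"
 shows "add A (dif a b) (dif b d) = dif a d"
proof -
 have "add A (dif a b) (dif b d) = add A a (add A (scl A (-1) b) (add A b (scl A (-1) d)))"
  using assms by (simp add: add_assoc)
 also have "add A (scl A (-1) b) (add A b (scl A (-1) d)) = scl A (-1) d"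
  using assms by (simp add: add_assoc[symmetric])
 finally show ?thesis .
qed

lemma dif_add:
 assumes "a \<in> elems A" "b \<in> elems A" "a' \<in> elems A" "b' \<in> elems A"
 shows "dif (add A a b) (add A a' b') = add A (dif a a') (dif b b')"
 using assms by (simp add: scl_add add_assoc add_left_commute[of b])

lemma dif_scl: "a \<in> elems A ==> b \<in> elems A ==> dif (scl A c a) (scl A c b) = scl A c (dif a b)"
 by (simp add: scl_add scl_scl)

lemma dif_cancel: "a \<in> elems A ==> b \<in> elems A ==> add A (dif a b) b = a"
 by (simp add: add_assoc)

lemma add_dif: "a \<in> elems A ==> b \<in> elems A ==> add A b (dif a b) = a"
 by (simp add: add_left_commute[of b])

lemma dst_nonneg [simp]: "a \<in> elems A ==> b \<in> elems A ==> 0 \<le> dst A a b"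
 by (simp add: dst_def)

lemma dst_self [simp]: "a \<in> elems A ==> dst A a a = 0"
 by (simp add: dst_def)

lemma dst_sym: "a \<in> elems A ==> b \<in> elems A ==> dst A a b = dst A b a"
 using nrm_scl[of "dif a b" "-1"] by (simp add: dst_def neg_dif)

lemma dst_triangle: "a \<in> elems A ==> b \<in> elems A ==> d \<in> elems A ==> dst A a d \<le> dst A a b + dst A b d"
 using nrm_triangle[of "dif a b" "dif b d"] by (simp add: dst_def dif_add_dif)

lemma dst_add: "a \<in> elems A ==> b \<in> elems A ==> a' \<in> elems A ==> b' \<in> elems A ==>
  dst A (add A a b) (add A a' b') \<le> dst A a a' + dst A b b'"
 using nrm_triangle[of "dif a a'" "dif b b'"] by (simp add: dst_def dif_add)

lemma dst_scl: "a \<in> elems A ==> b \<in> elems A ==> dst A (scl A c a) (scl A c b) = cmod c * dst A a b"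
 by (simp add: dst_def dif_scl nrm_scl)

lemma dst_zer: "a \<in> elems A ==> dst A a (zer A) = nrm A a"
 by (simp add: dst_def)

lemma nrm_le_dst: "a \<in> elems A ==> b \<in> elems A ==> nrm A a \<le> dst A a b + nrm A b"
 using nrm_triangle[of "dif a b" b] by (simp add: dst_def dif_cancel)

lemma nrm_diff_le_dst: "a \<in> elems A ==> b \<in> elems A ==> \<bar>nrm A a - nrm A b\<bar> \<le> dst A a b"
 using nrm_le_dst[of a b] nrm_le_dst[of b a] dst_sym[of a b] by linarith

lemma cauchy_seqsD:
 assumes "F \<in> cseqs A"
 shows "\<And>n. F n \<in> elems A" "\<And>e. e > 0 ==> \<exists>N. \<forall>m\<ge>N. \<forall>n\<ge>N. dst A (F m) (F n) < e"
 using assms by (simp_all add: cauchy_seqs_def)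

lemma tendsto_dst_0:
 assumes "\<And>n. F n \<in> elems A" "\<And>n. F' n \<in> elems A" "\<And>n. dst A (F n) (F' n) \<le> u n" "u \<longlonglongrightarrow> 0"
 shows "vanishes (\<lambda>n. dst A (F n) (F' n))"
 by (rule tendsto_sandwich[OF _ _ tendsto_const assms(4)]) (use assms in auto)

lemma cauchy_if_le:
 assumes F: "F \<in> cseqs A" and G: "\<And>n. G n \<in> elems A" and le: "\<And>m n. dst A (G m) (G n) \<le> K * dst A (F m) (F n)" and K: "0 \<le> K"
 shows "G \<in> cseqs A"
 unfolding cauchy_seqs_def
proof (intro CollectI conjI allI impI G)
 fix e :: real assume e: "e > 0"
 obtain N where N: "\<forall>m\<ge>N. \<forall>n\<ge>N. dst A (F m) (F n) < e / (K + 1)" using cauchy_seqsD(2)[OF F, of "e / (K+1)"] e K by auto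
 have "dst A (G m) (G n) < e" if "m \<ge> N" "n \<ge> N" for m n
 proof -
  have "dst A (G m) (G n) \<le> (K + 1) * dst A (F m) (F n)" using le[of m n] dst_nonneg[OF cauchy_seqsD(1)[OF F, of m] cauchy_seqsD(1)[OF F, of n]]
   by (simp add: distrib_right)
  also have "\<dots> < (K + 1) * (e / (K + 1))" using N that K by (intro mult_strict_left_mono) auto
  finally show ?thesis using K by simp
 qed
 thus "\<exists>N. \<forall>m\<ge>N. \<forall>n\<ge>N. dst A (G m) (G n) < e" by blast
qed

lemma cauchy_add:
 assumes "F \<in> cseqs A" "F' \<in> cseqs A"
 shows "(\<lambda>n. add A (F n) (F' n)) \<in> cseqs A"
 unfolding cauchy_seqs_def
proof (intro CollectI conjI allI impI)
 show "add A (F n) (F' n) \<in> elems A" for n using cauchy_seqsD(1) assms by simp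
 fix e :: real assume e: "e > 0"
 obtain N where N: "\<forall>m\<ge>N. \<forall>n\<ge>N. dst A (F m) (F n) < e / 2" using cauchy_seqsD(2)[OF assms(1), of "e/2"] e by auto
 obtain N' where N': "\<forall>m\<ge>N'. \<forall>n\<ge>N'. dst A (F' m) (F' n) < e / 2" using cauchy_seqsD(2)[OF assms(2), of "e/2"] e by auto
 have "dst A (add A (F m) (F' m)) (add A (F n) (F' n)) < e" if "m \<ge> max N N'" "n \<ge> max N N'" for m n
 proof -
  have "dst A (F m) (F n) < e / 2" "dst A (F' m) (F' n) < e / 2" using N N' that by auto
  thus ?thesis using dst_add[of "F m" "F' m" "F n" "F' n"] cauchy_seqsD(1) assms by fastforce
 qed
 thus "\<exists>N. \<forall>m\<ge>N. \<forall>n\<ge>N. dst A (add A (F m) (F' m)) (add A (F n) (F' n)) < e" by blast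
qed

lemma cauchy_scl:
 assumes "F \<in> cseqs A" shows "(\<lambda>n. scl A c (F n)) \<in> cseqs A"
 by (rule cauchy_if_le[OF assms, of _ "cmod c"]) (use cauchy_seqsD(1)[OF assms] in \<open>simp_all add: dst_scl\<close>)

lemma cauchy_const: "a \<in> elems A ==> (\<lambda>_. a) \<in> cseqs A"
 by (simp add: cauchy_seqs_def)

lemma cauchy_class_iff:
 "F' \<in> cls A F \<longleftrightarrow> F' \<in> cseqs A \<and> vanishes (\<lambda>n. dst A (F n) (F' n))"
 by (simp add: cauchy_class_def)

lemma cauchy_class_self: "F \<in> cseqs A ==> F \<in> cls A F"
 using cauchy_seqsD(1)[of F] by (simp add: cauchy_class_iff)

lemma dst_lim_trans:
 assumes "\<And>n. F n \<in> elems A" "\<And>n. G n \<in> elems A" "\<And>n. H n \<in> elems A"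
  "vanishes (\<lambda>n. dst A (F n) (G n))" "vanishes (\<lambda>n. dst A (G n) (H n))"
 shows "vanishes (\<lambda>n. dst A (F n) (H n))"
 by (rule tendsto_dst_0[where u = "\<lambda>n. dst A (F n) (G n) + dst A (G n) (H n)"])
  (use assms dst_triangle tendsto_add[OF assms(4,5)] in auto)

lemma dst_lim_sym:
 assumes "\<And>n. F n \<in> elems A" "\<And>n. G n \<in> elems A" "vanishes (\<lambda>n. dst A (F n) (G n))"
 shows "vanishes (\<lambda>n. dst A (G n) (F n))"
 using assms(3) dst_sym[OF assms(1,2)] by simp

lemma cauchy_class_eq_iff:
 assumes F: "F \<in> cseqs A" and F': "F' \<in> cseqs A"
 shows "cls A F = cls A F' \<longleftrightarrow> vanishes (\<lambda>n. dst A (F n) (F' n))"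
proof
 assume "cls A F = cls A F'"
 hence "F' \<in> cls A F" using cauchy_class_self[OF F'] by simp
 thus "vanishes (\<lambda>n. dst A (F n) (F' n))" by (simp add: cauchy_class_iff)
next
 note e = cauchy_seqsD(1)[OF F] cauchy_seqsD(1)[OF F']
 assume d: "vanishes (\<lambda>n. dst A (F n) (F' n))"
 have "vanishes (\<lambda>n. dst A (F n) (G n)) \<longleftrightarrow> vanishes (\<lambda>n. dst A (F' n) (G n))" if "G \<in> cseqs A" for G
 proof -
  note g = cauchy_seqsD(1)[OF that]
  show ?thesis
   using dst_lim_trans[of F' F G, OF e(2) e(1) g dst_lim_sym[OF e d]] dst_lim_trans[of F F' G, OF e(1) e(2) g d] by blast
 qed
 thus "cls A F = cls A F'" unfolding cauchy_class_def by blast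
qed

lemma mem_cauchy_classD:
 assumes "F \<in> cseqs A" "G \<in> cls A F"
 shows "G \<in> cseqs A" "vanishes (\<lambda>n. dst A (F n) (G n))" "cls A G = cls A F"
proof -
 show 1: "G \<in> cseqs A" "vanishes (\<lambda>n. dst A (F n) (G n))" using assms(2) by (simp_all add: cauchy_class_iff)
 show "cls A G = cls A F" using cauchy_class_eq_iff[OF assms(1) 1(1)] 1(2) by simp
qed

lemma completion_elems: "elems (completion A) = cls A ` cseqs A"
 by (simp add: completion_def)

lemma completion_add:
 assumes F: "F \<in> cseqs A" and F': "F' \<in> cseqs A"
 shows "add (completion A) (cls A F) (cls A F') = cls A (\<lambda>n. add A (F n) (F' n))"
proof -
 have *: "cls A (\<lambda>n. add A (G n) (G' n)) = cls A (\<lambda>n. add A (F n) (F' n))"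
  if g: "G \<in> cls A F" "G' \<in> cls A F'" for G G'
 proof -
  note G = mem_cauchy_classD[OF F g(1)] and G' = mem_cauchy_classD[OF F' g(2)]
  note e = cauchy_seqsD(1)[OF F] cauchy_seqsD(1)[OF F'] cauchy_seqsD(1)[OF G(1)] cauchy_seqsD(1)[OF G'(1)]
  have "vanishes (\<lambda>n. dst A (add A (F n) (F' n)) (add A (G n) (G' n)))"
   by (rule tendsto_dst_0[where u = "\<lambda>n. dst A (F n) (G n) + dst A (F' n) (G' n)"])
    (use e dst_add tendsto_add[OF G(2) G'(2)] in auto)
  thus ?thesis using cauchy_class_eq_iff[OF cauchy_add[OF F F'] cauchy_add[OF G(1) G'(1)]] by simp
 qed
 have "add (completion A) (cls A F) (cls A F') =
  (\<Union>G\<in>cls A F. \<Union>G'\<in>cls A F'. cls A (\<lambda>n. add A (G n) (G' n)))"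
  by (simp add: completion_def)
 also have "\<dots> = cls A (\<lambda>n. add A (F n) (F' n))"
  by (rule UN_const[OF cauchy_class_self[OF F]], rule UN_const[OF cauchy_class_self[OF F']]) (rule *)
 finally show ?thesis .
qed

lemma completion_scl:
 assumes F: "F \<in> cseqs A"
 shows "scl (completion A) c (cls A F) = cls A (\<lambda>n. scl A c (F n))"
proof -
 have *: "cls A (\<lambda>n. scl A c (G n)) = cls A (\<lambda>n. scl A c (F n))" if g: "G \<in> cls A F" for G
 proof -
  note G = mem_cauchy_classD[OF F g]
  have "vanishes (\<lambda>n. dst A (scl A c (F n)) (scl A c (G n)))"
   using cauchy_seqsD(1)[OF F] cauchy_seqsD(1)[OF G(1)] tendsto_mult_right_zero[OF G(2), of "cmod c"] by (simp add: dst_scl)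
  thus ?thesis using cauchy_class_eq_iff[OF cauchy_scl[OF F, of c] cauchy_scl[OF G(1), of c]] by simp
 qed
 have "scl (completion A) c (cls A F) = (\<Union>G\<in>cls A F. cls A (\<lambda>n. scl A c (G n)))"
  by (simp add: completion_def)
 also have "\<dots> = cls A (\<lambda>n. scl A c (F n))" by (rule UN_const[OF cauchy_class_self[OF F]]) (rule *)
 finally show ?thesis .
qed

lemma nrm_convergent:
 assumes F: "F \<in> cseqs A" shows "\<exists>r. (\<lambda>n. nrm A (F n)) \<longlonglongrightarrow> r"
proof -
 have "Cauchy (\<lambda>n. nrm A (F n))"
  unfolding Cauchy_def dist_real_def
 proof (intro allI impI)
  fix e :: real assume "0 < e"
  then obtain N where N: "\<forall>m\<ge>N. \<forall>n\<ge>N. dst A (F m) (F n) < e" using cauchy_seqsD(2)[OF F] by blast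
  have "\<bar>nrm A (F m) - nrm A (F n)\<bar> < e" if "m \<ge> N" "n \<ge> N" for m n
   using N that nrm_diff_le_dst[OF cauchy_seqsD(1)[OF F, of m] cauchy_seqsD(1)[OF F, of n]] by (meson le_less_trans)
  thus "\<exists>N. \<forall>m\<ge>N. \<forall>n\<ge>N. \<bar>nrm A (F m) - nrm A (F n)\<bar> < e" by blast
 qed
 thus ?thesis using Cauchy_convergent convergent_def by blast
qed

lemma completion_nrm:
 assumes F: "F \<in> cseqs A"
 shows "(\<lambda>n. nrm A (F n)) \<longlonglongrightarrow> nrm (completion A) (cls A F)"
proof -
 obtain r where r: "(\<lambda>n. nrm A (F n)) \<longlonglongrightarrow> r" using nrm_convergent[OF F] by blast
 have *: "(\<lambda>n. nrm A (G n)) \<longlonglongrightarrow> r" if g: "G \<in> cls A F" for G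
 proof -
  note G = mem_cauchy_classD[OF F g]
  have "vanishes (\<lambda>n. nrm A (G n) - nrm A (F n))"
   by (rule Lim_null_comparison[OF _ G(2)])
    (use nrm_diff_le_dst[OF cauchy_seqsD(1)[OF F] cauchy_seqsD(1)[OF G(1)]] in \<open>simp add: abs_minus_commute\<close>)
  thus ?thesis using tendsto_add[OF _ r, of "\<lambda>n. nrm A (G n) - nrm A (F n)" 0] by simp
 qed
 have "nrm (completion A) (cls A F) = (THE r. \<forall>G\<in>cls A F. (\<lambda>n. nrm A (G n)) \<longlonglongrightarrow> r)" by (simp add: completion_def)
 also have "\<dots> = r"
 proof (rule the_equality)
  show "\<forall>G\<in>cls A F. (\<lambda>n. nrm A (G n)) \<longlonglongrightarrow> r" using * by blast
  show "r' = r" if "\<forall>G\<in>cls A F. (\<lambda>n. nrm A (G n)) \<longlonglongrightarrow> r'" for r'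
   using that cauchy_class_self[OF F] LIMSEQ_unique r by blast
 qed
 finally show ?thesis using r by simp
qed

lemma completion_dst:
 assumes F: "F \<in> cseqs A" and F': "F' \<in> cseqs A"
 shows "(\<lambda>n. dst A (F n) (F' n)) \<longlonglongrightarrow> dst (completion A) (cls A F) (cls A F')"
 unfolding dst_def completion_scl[OF F'] completion_add[OF F cauchy_scl[OF F']]
 by (rule completion_nrm[OF cauchy_add[OF F cauchy_scl[OF F']]])

lemma completion_zer: "zer (completion A) = cls A (\<lambda>_. zer A)"
 by (simp add: completion_def)

lemma class_eq_zer_iff:
 assumes F: "F \<in> cseqs A"
 shows "cls A F = zer (completion A) \<longleftrightarrow> vanishes (\<lambda>n. nrm A (F n))"
 unfolding completion_zer cauchy_class_eq_iff[OF F cauchy_const[OF zer_in]] using dst_zer[OF cauchy_seqsD(1)[OF F]] by simp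

text \<open>A contractive map extends to the completion by applying it to each term of a Cauchy
  sequence. The condition \<open>dst A0 a a = 0\<close> makes a Cauchy sequence a member of its own
  class; in this form the lemma also covers the algebra of the off-boundary groupoid, for which the
  locale is not instantiated.\<close>

lemma extension_completion:
 assumes A0: "\<And>a. a \<in> elems A0 ==> dst A0 a a = 0"
  and p: "\<And>a. a \<in> elems A0 ==> \<pi> a \<in> elems A"
  and le: "\<And>a b. a \<in> elems A0 ==> b \<in> elems A0 ==> dst A (\<pi> a) (\<pi> b) \<le> dst A0 a b"
  and F: "F \<in> cseqs A0"
 shows "(\<lambda>n. \<pi> (F n)) \<in> cseqs A"
  "extension A0 (completion A) (\<lambda>a. embed A (\<pi> a)) (cls A0 F) = cls A (\<lambda>n. \<pi> (F n))"
proof -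
 have c: "(\<lambda>n. \<pi> (G n)) \<in> cseqs A" if "G \<in> cseqs A0" for G
  unfolding cauchy_seqs_def
 proof (intro CollectI conjI allI impI)
  have g: "G n \<in> elems A0" for n using that by (simp add: cauchy_seqs_def)
  show "\<pi> (G n) \<in> elems A" for n using p g by blast
  fix e :: real assume e: "e > 0"
  have "\<forall>e>0. \<exists>N. \<forall>m\<ge>N. \<forall>n\<ge>N. dst A0 (G m) (G n) < e" using that by (simp add: cauchy_seqs_def)
  then obtain N where "\<forall>m\<ge>N. \<forall>n\<ge>N. dst A0 (G m) (G n) < e" using e by meson
  thus "\<exists>N. \<forall>m\<ge>N. \<forall>n\<ge>N. dst A (\<pi> (G m)) (\<pi> (G n)) < e" using le g by (meson le_less_trans)
 qed
 show cF: "(\<lambda>n. \<pi> (F n)) \<in> cseqs A" by (rule c[OF F])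
 have Fe: "F n \<in> elems A0" for n using F by (simp add: cauchy_seqs_def)
 have self: "F \<in> cls A0 F" using F A0[OF Fe] by (simp add: cauchy_class_def)
 let ?b = "cls A (\<lambda>n. \<pi> (F n))"
 show "extension A0 (completion A) (\<lambda>a. embed A (\<pi> a)) (cls A0 F) = ?b"
  unfolding extension_def
 proof (rule the_equality)
  show "?b \<in> elems (completion A) \<and> (\<forall>G\<in>cls A0 F. vanishes (\<lambda>n. dst (completion A) (embed A (\<pi> (G n))) ?b))"
  proof (intro conjI ballI)
   show "?b \<in> elems (completion A)" using cF by (simp add: completion_elems)
   fix G assume g: "G \<in> cls A0 F"
   hence G: "G \<in> cseqs A0" "vanishes (\<lambda>n. dst A0 (F n) (G n))" by (simp_all add: cauchy_class_def)
   have Ge: "G n \<in> elems A0" for n using G by (simp add: cauchy_seqs_def)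
   have lim: "(\<lambda>m. dst A (\<pi> (G n)) (\<pi> (F m))) \<longlonglongrightarrow> dst (completion A) (embed A (\<pi> (G n))) ?b" for n
    unfolding embed_def by (rule completion_dst[OF cauchy_const[OF p[OF Ge]] cF])
   show "vanishes (\<lambda>n. dst (completion A) (embed A (\<pi> (G n))) ?b)"
    unfolding LIMSEQ_iff
   proof (intro allI impI)
    fix r :: real assume r: "0 < r"
    obtain N where N: "\<forall>m\<ge>N. \<forall>n\<ge>N. dst A (\<pi> (F m)) (\<pi> (F n)) < r / 3" using cauchy_seqsD(2)[OF cF, of "r/3"] r by auto
    have "\<forall>\<^sub>F n in sequentially. dst A0 (F n) (G n) < r / 3" using order_tendstoD(2)[OF G(2), of "r/3"] r by simp
    then obtain N' where N': "\<forall>n\<ge>N'. dst A0 (F n) (G n) < r / 3" unfolding eventually_sequentially by blast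
    have "norm (dst (completion A) (embed A (\<pi> (G n))) ?b - 0) < r" if n: "n \<ge> max N N'" for n
    proof -
     have "dst A (\<pi> (G n)) (\<pi> (F m)) \<le> r / 3 + r / 3" if "m \<ge> N" for m
     proof -
      have "dst A (\<pi> (G n)) (\<pi> (F m)) \<le> dst A (\<pi> (F n)) (\<pi> (G n)) + dst A (\<pi> (F n)) (\<pi> (F m))"
       using dst_triangle[OF p[OF Ge[of n]] p[OF Fe[of n]] p[OF Fe[of m]]] dst_sym[OF p[OF Ge] p[OF Fe], of n n] by simp
      moreover have "dst A (\<pi> (F n)) (\<pi> (F m)) < r / 3" using N n that by simp
      moreover have "dst A (\<pi> (F n)) (\<pi> (G n)) < r / 3" using le[OF Fe Ge, of n n] N' n by (meson le_less_trans max.boundedE)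
      ultimately show ?thesis by linarith
     qed
     hence "dst (completion A) (embed A (\<pi> (G n))) ?b \<le> r / 3 + r / 3"
      by (intro LIMSEQ_le_const2[OF lim]) blast
     moreover have "0 \<le> dst (completion A) (embed A (\<pi> (G n))) ?b"
      by (rule LIMSEQ_le_const[OF lim]) (use p Ge Fe in auto)
     ultimately show ?thesis using r by simp
    qed
    thus "\<exists>N. \<forall>n\<ge>N. norm (dst (completion A) (embed A (\<pi> (G n))) ?b - 0) < r" by blast
   qed
  qed
 next
  fix b assume b: "b \<in> elems (completion A) \<and> (\<forall>G\<in>cls A0 F. vanishes (\<lambda>n. dst (completion A) (embed A (\<pi> (G n))) b))"
  then obtain G where G: "G \<in> cseqs A" "b = cls A G" unfolding completion_elems by blast
  have l: "vanishes (\<lambda>n. dst (completion A) (embed A (\<pi> (F n))) b)" using b self by blast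
  have lim: "(\<lambda>m. dst A (\<pi> (F n)) (G m)) \<longlonglongrightarrow> dst (completion A) (embed A (\<pi> (F n))) b" for n
   unfolding embed_def G(2) by (rule completion_dst[OF cauchy_const[OF p[OF Fe]] G(1)])
  have "vanishes (\<lambda>n. dst A (G n) (\<pi> (F n)))"
   unfolding LIMSEQ_iff
  proof (intro allI impI)
   fix r :: real assume r: "0 < r"
   obtain N where N: "\<forall>m\<ge>N. \<forall>n\<ge>N. dst A (G m) (G n) < r / 2" using cauchy_seqsD(2)[OF G(1), of "r/2"] r by auto
   have "\<forall>\<^sub>F n in sequentially. dst (completion A) (embed A (\<pi> (F n))) b < r / 2" using order_tendstoD(2)[OF l, of "r/2"] r by simp
   then obtain N' where N': "\<forall>n\<ge>N'. dst (completion A) (embed A (\<pi> (F n))) b < r / 2" unfolding eventually_sequentially by blast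
   have "norm (dst A (G n) (\<pi> (F n)) - 0) < r" if n: "n \<ge> max N N'" for n
   proof -
    have "\<forall>\<^sub>F m in sequentially. dst A (\<pi> (F n)) (G m) < r / 2" using order_tendstoD(2)[OF lim, of n "r/2"] N' n by simp
    then obtain m where m: "m \<ge> N" "dst A (\<pi> (F n)) (G m) < r / 2" unfolding eventually_sequentially
     by (meson nle_le)
    have "dst A (G n) (G m) < r / 2" using N n m by simp
    moreover have "dst A (G n) (\<pi> (F n)) \<le> dst A (G n) (G m) + dst A (G m) (\<pi> (F n))"
     by (rule dst_triangle) (use cauchy_seqsD(1)[OF G(1)] p Fe in auto)
    moreover have "dst A (G m) (\<pi> (F n)) = dst A (\<pi> (F n)) (G m)"
     by (rule dst_sym) (use cauchy_seqsD(1)[OF G(1)] p Fe in auto)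
    moreover have "0 \<le> dst A (G n) (\<pi> (F n))" using cauchy_seqsD(1)[OF G(1)] p Fe by simp
    ultimately show ?thesis using m(2) by simp
   qed
   thus "\<exists>N. \<forall>n\<ge>N. norm (dst A (G n) (\<pi> (F n)) - 0) < r" by blast
  qed
  thus "b = ?b" using cauchy_class_eq_iff[OF G(1) cF] G(2) by simp
 qed
qed

end

text \<open>Kept apart from the involution: the laws for adjoints are established for C_c and for
  the algebra of the monoid, the laws collected here for all bounded operators.\<close>

locale seminormed_mul = seminormed +
 assumes mul_in [simp]: "a \<in> elems A ==> b \<in> elems A ==> mul A a b \<in> elems A"
  and mul_add_right: "a \<in> elems A ==> b \<in> elems A ==> d \<in> elems A ==> mul A a (add A b d) = add A (mul A a b) (mul A a d)"
  and mul_add_left: "a \<in> elems A ==> b \<in> elems A ==> d \<in> elems A ==> mul A (add A a b) d = add A (mul A a d) (mul A b d)"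
  and mul_scl_right: "a \<in> elems A ==> b \<in> elems A ==> mul A a (scl A c b) = scl A c (mul A a b)"
  and mul_scl_left: "a \<in> elems A ==> b \<in> elems A ==> mul A (scl A c a) b = scl A c (mul A a b)"
  and nrm_mul: "a \<in> elems A ==> b \<in> elems A ==> nrm A (mul A a b) \<le> nrm A a * nrm A b"
begin

lemma dst_mul:
 assumes "a \<in> elems A" "b \<in> elems A" "a' \<in> elems A" "b' \<in> elems A"
 shows "dst A (mul A a b) (mul A a' b') \<le> nrm A a * dst A b b' + dst A a a' * nrm A b'"
proof -
 have "dst A (mul A a b) (mul A a' b') \<le> dst A (mul A a b) (mul A a b') + dst A (mul A a b') (mul A a' b')"
  using assms by (intro dst_triangle) auto
 also have "dst A (mul A a b) (mul A a b') = nrm A (mul A a (dif b b'))"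
  using assms by (simp add: dst_def mul_add_right mul_scl_right)
 also have "\<dots> \<le> nrm A a * dst A b b'" unfolding dst_def using assms by (intro nrm_mul) auto
 also have "dst A (mul A a b') (mul A a' b') = nrm A (mul A (dif a a') b')"
  using assms by (simp add: dst_def mul_add_left mul_scl_left)
 also have "\<dots> \<le> dst A a a' * nrm A b'" unfolding dst_def using assms by (intro nrm_mul) auto
 finally show ?thesis by simp
qed

lemma nrm_bounded:
 assumes "F \<in> cseqs A" obtains K where "0 < K" "\<And>n. nrm A (F n) \<le> K"
proof -
 obtain r where "(\<lambda>n. nrm A (F n)) \<longlonglongrightarrow> r" using nrm_convergent[OF assms] by blast
 hence "Bseq (\<lambda>n. nrm A (F n))" using convergent_imp_Bseq convergent_def by blast
 then obtain K where K: "0 < K" "\<forall>n. norm (nrm A (F n)) \<le> K" by (auto elim: BseqE)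
 hence "nrm A (F n) \<le> K" for n by (metis abs_le_D1 real_norm_def)
 thus ?thesis using K(1) that by blast
qed

lemma cauchy_mul:
 assumes F: "F \<in> cseqs A" and F': "F' \<in> cseqs A"
 shows "(\<lambda>n. mul A (F n) (F' n)) \<in> cseqs A"
 unfolding cauchy_seqs_def
proof (intro CollectI conjI allI impI)
 note e = cauchy_seqsD(1)[OF F] cauchy_seqsD(1)[OF F']
 show "mul A (F n) (F' n) \<in> elems A" for n using e by simp
 fix r :: real assume r: "r > 0"
 obtain K where K: "0 < K" "\<And>n. nrm A (F n) \<le> K" using nrm_bounded[OF F] by blast
 obtain K' where K': "0 < K'" "\<And>n. nrm A (F' n) \<le> K'" using nrm_bounded[OF F'] by blast
 obtain N where N: "\<forall>m\<ge>N. \<forall>n\<ge>N. dst A (F m) (F n) < r / (2 * K')" using cauchy_seqsD(2)[OF F, of "r / (2 * K')"] r K' by auto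
 obtain N' where N': "\<forall>m\<ge>N'. \<forall>n\<ge>N'. dst A (F' m) (F' n) < r / (2 * K)" using cauchy_seqsD(2)[OF F', of "r / (2 * K)"] r K by auto
 have "dst A (mul A (F m) (F' m)) (mul A (F n) (F' n)) < r" if "m \<ge> max N N'" "n \<ge> max N N'" for m n
 proof -
  have "nrm A (F m) * dst A (F' m) (F' n) \<le> K * dst A (F' m) (F' n)" using K e by (intro mult_right_mono) auto
  also have "\<dots> < K * (r / (2 * K))" using N' that K by (intro mult_strict_left_mono) auto
  also have "\<dots> = r / 2" using K by simp
  finally have 1: "nrm A (F m) * dst A (F' m) (F' n) < r / 2" .
  have "dst A (F m) (F n) * nrm A (F' n) \<le> dst A (F m) (F n) * K'" using K' e by (intro mult_left_mono) auto
  also have "\<dots> < (r / (2 * K')) * K'" using N that K' by (intro mult_strict_right_mono) auto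
  also have "\<dots> = r / 2" using K' by simp
  finally have 2: "dst A (F m) (F n) * nrm A (F' n) < r / 2" .
  show ?thesis using dst_mul[OF e(1) e(2) e(1) e(2), of m m n n] 1 2 by linarith
 qed
 thus "\<exists>N. \<forall>m\<ge>N. \<forall>n\<ge>N. dst A (mul A (F m) (F' m)) (mul A (F n) (F' n)) < r" by blast
qed

lemma mul_lim:
 assumes F: "F \<in> cseqs A" and F': "F' \<in> cseqs A" and G: "G \<in> cseqs A" and G': "G' \<in> cseqs A"
  and l: "vanishes (\<lambda>n. dst A (F n) (G n))" "vanishes (\<lambda>n. dst A (F' n) (G' n))"
 shows "vanishes (\<lambda>n. dst A (mul A (F n) (F' n)) (mul A (G n) (G' n)))"
proof -
 note e = cauchy_seqsD(1)[OF F] cauchy_seqsD(1)[OF F'] cauchy_seqsD(1)[OF G] cauchy_seqsD(1)[OF G']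
 obtain r r' where r: "(\<lambda>n. nrm A (F n)) \<longlonglongrightarrow> r" "(\<lambda>n. nrm A (G' n)) \<longlonglongrightarrow> r'" using nrm_convergent F G' by blast
 have "(\<lambda>n. nrm A (F n) * dst A (F' n) (G' n) + dst A (F n) (G n) * nrm A (G' n)) \<longlonglongrightarrow> r * 0 + 0 * r'"
  by (intro tendsto_intros r l)
 thus ?thesis by (intro tendsto_dst_0[where u = "\<lambda>n. nrm A (F n) * dst A (F' n) (G' n) + dst A (F n) (G n) * nrm A (G' n)"])
   (use e dst_mul in auto)
qed

lemma completion_mul:
 assumes F: "F \<in> cseqs A" and F': "F' \<in> cseqs A"
 shows "mul (completion A) (cls A F) (cls A F') = cls A (\<lambda>n. mul A (F n) (F' n))"
proof -
 have *: "cls A (\<lambda>n. mul A (G n) (G' n)) = cls A (\<lambda>n. mul A (F n) (F' n))"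
  if g: "G \<in> cls A F" "G' \<in> cls A F'" for G G'
 proof -
  note G = mem_cauchy_classD[OF F g(1)] and G' = mem_cauchy_classD[OF F' g(2)]
  show ?thesis using cauchy_class_eq_iff[OF cauchy_mul[OF F F'] cauchy_mul[OF G(1) G'(1)]] mul_lim[OF F F' G(1) G'(1) G(2) G'(2)] by simp
 qed
 have "mul (completion A) (cls A F) (cls A F') =
  (\<Union>G\<in>cls A F. \<Union>G'\<in>cls A F'. cls A (\<lambda>n. mul A (G n) (G' n)))"
  by (simp add: completion_def)
 also have "\<dots> = cls A (\<lambda>n. mul A (F n) (F' n))"
  by (rule UN_const[OF cauchy_class_self[OF F]], rule UN_const[OF cauchy_class_self[OF F']]) (rule *)
 finally show ?thesis .
qed

end

locale seminormed_algebra = seminormed_mul +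
 assumes adj_in [simp]: "a \<in> elems A ==> adj A a \<in> elems A"
  and adj_add: "a \<in> elems A ==> b \<in> elems A ==> adj A (add A a b) = add A (adj A a) (adj A b)"
  and adj_scl: "a \<in> elems A ==> adj A (scl A c a) = scl A (cnj c) (adj A a)"
  and nrm_adj: "a \<in> elems A ==> nrm A (adj A a) = nrm A a"
begin

lemma dst_adj: "a \<in> elems A ==> b \<in> elems A ==> dst A (adj A a) (adj A b) = dst A a b"
 using nrm_adj[of "dif a b"] by (simp add: dst_def adj_add adj_scl)

lemma cauchy_adj:
 assumes "F \<in> cseqs A" shows "(\<lambda>n. adj A (F n)) \<in> cseqs A"
 by (rule cauchy_if_le[OF assms, of _ 1]) (use cauchy_seqsD(1)[OF assms] in \<open>simp_all add: dst_adj\<close>)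

lemma completion_adj:
 assumes F: "F \<in> cseqs A"
 shows "adj (completion A) (cls A F) = cls A (\<lambda>n. adj A (F n))"
proof -
 have *: "cls A (\<lambda>n. adj A (G n)) = cls A (\<lambda>n. adj A (F n))" if g: "G \<in> cls A F" for G
 proof -
  note G = mem_cauchy_classD[OF F g]
  have "vanishes (\<lambda>n. dst A (adj A (F n)) (adj A (G n)))"
   using G(2) cauchy_seqsD(1)[OF F] cauchy_seqsD(1)[OF G(1)] by (simp add: dst_adj)
  thus ?thesis using cauchy_class_eq_iff[OF cauchy_adj[OF F] cauchy_adj[OF G(1)]] by simp
 qed
 have "adj (completion A) (cls A F) = (\<Union>G\<in>cls A F. cls A (\<lambda>n. adj A (G n)))"
  by (simp add: completion_def)
 also have "\<dots> = cls A (\<lambda>n. adj A (F n))" by (rule UN_const[OF cauchy_class_self[OF F]]) (rule *)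
 finally show ?thesis .
qed

end

text \<open>The quotient inherits the involution only from a self-adjoint ideal; for the boundary
  ideal this is \<open>boundary_ideal_adj\<close>.\<close>

locale seminormed_quotient = seminormed_algebra +
 fixes J
 assumes ideal: "closed_ideal A J" and adj_J: "\<And>a. a \<in> J ==> adj A a \<in> J"
begin

lemma J_simps:
 shows J_in: "\<And>a. a \<in> J ==> a \<in> elems A" and zer_J: "zer A \<in> J"
  and add_J: "\<And>a b. a \<in> J ==> b \<in> J ==> add A a b \<in> J"
  and scl_J: "\<And>c a. a \<in> J ==> scl A c a \<in> J"
  and mul_J: "\<And>a b. a \<in> J ==> b \<in> elems A ==> mul A a b \<in> J" "\<And>a b. a \<in> J ==> b \<in> elems A ==> mul A b a \<in> J"
 using ideal unfolding closed_ideal_def by blast+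

lemma coset_self: "a \<in> elems A ==> a \<in> coset A J a"
 unfolding coset_def by (rule image_eqI[OF _ zer_J]) simp

lemma coset_eq_iff:
 assumes a: "a \<in> elems A" and b: "b \<in> elems A"
 shows "coset A J a = coset A J b \<longleftrightarrow> dif a b \<in> J"
proof
 assume "coset A J a = coset A J b"
 then obtain j where j: "j \<in> J" "a = add A b j" using coset_self[OF a] unfolding coset_def by blast
 note jin = J_in[OF j(1)]
 have "add A b j = add A j b" by (rule add_commute[OF b jin])
 hence "dif a b = add A j (add A b (scl A (-1) b))" using j b jin add_assoc[of j b "scl A (-1) b"] by simp
 thus "dif a b \<in> J" using j(1) b jin by simp
next
 have *: "coset A J a \<subseteq> coset A J b" if a: "a \<in> elems A" and b: "b \<in> elems A" and d: "dif a b \<in> J" for a b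
 proof
  fix x assume "x \<in> coset A J a"
  then obtain j where j: "j \<in> J" "x = add A a j" unfolding coset_def by blast
  have "x = add A b (add A (dif a b) j)" using j a b J_in[OF j(1)] add_dif[OF a b] add_assoc[of b "dif a b" j] by simp
  thus "x \<in> coset A J b" using add_J[OF d j(1)] unfolding coset_def by blast
 qed
 assume d: "dif a b \<in> J"
 hence "dif b a \<in> J" using scl_J[OF d, of "-1"] neg_dif[OF a b] by simp
 thus "coset A J a = coset A J b" using * a b d by blast
qed

lemma coset_memD:
 assumes a: "a \<in> elems A" and x: "x \<in> coset A J a"
 shows "x \<in> elems A" "dif x a \<in> J"
proof -
 obtain j where j: "j \<in> J" "x = add A a j" using x unfolding coset_def by blast
 note jin = J_in[OF j(1)]
 show "x \<in> elems A" using j a jin by simp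
 have "dif x a = add A j (add A a (scl A (-1) a))" using j a jin add_commute[OF a jin] add_assoc[of j a "scl A (-1) a"] by simp
 thus "dif x a \<in> J" using j a jin by simp
qed

lemma quotient_simps:
 "elems (quotient_algebra A J) = coset A J ` elems A" "zer (quotient_algebra A J) = coset A J (zer A)"
 by (simp_all add: quotient_algebra_def)

lemma quotient_add:
 assumes a: "a \<in> elems A" and b: "b \<in> elems A"
 shows "add (quotient_algebra A J) (coset A J a) (coset A J b) = coset A J (add A a b)"
proof -
 have *: "coset A J (add A x y) = coset A J (add A a b)" if x: "x \<in> coset A J a" and y: "y \<in> coset A J b" for x y
  using coset_eq_iff[of "add A x y" "add A a b"] coset_memD[OF a x] coset_memD[OF b y] a b
   dif_add[OF coset_memD(1)[OF a x] coset_memD(1)[OF b y] a b] add_J by simp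
 have "add (quotient_algebra A J) (coset A J a) (coset A J b) = (\<Union>x\<in>coset A J a. \<Union>y\<in>coset A J b. coset A J (add A x y))"
  by (simp add: quotient_algebra_def)
 also have "\<dots> = coset A J (add A a b)"
  by (rule UN_const[OF coset_self[OF a]], rule UN_const[OF coset_self[OF b]]) (rule *)
 finally show ?thesis .
qed

lemma quotient_mul:
 assumes a: "a \<in> elems A" and b: "b \<in> elems A"
 shows "mul (quotient_algebra A J) (coset A J a) (coset A J b) = coset A J (mul A a b)"
proof -
 have *: "coset A J (mul A x y) = coset A J (mul A a b)" if x: "x \<in> coset A J a" and y: "y \<in> coset A J b" for x y
 proof -
  note X = coset_memD[OF a x] and Y = coset_memD[OF b y]
  have "dif (mul A x y) (mul A a b) = add A (dif (mul A x y) (mul A a y)) (dif (mul A a y) (mul A a b))"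
   using a b X(1) Y(1) by (intro dif_add_dif[symmetric]) auto
  also have "\<dots> = add A (mul A (dif x a) y) (mul A a (dif y b))"
   using a b X(1) Y(1) by (simp add: mul_add_left mul_add_right mul_scl_left mul_scl_right)
  also have "\<dots> \<in> J" by (intro add_J mul_J(1)[OF X(2) Y(1)] mul_J(2)[OF Y(2) a])
  finally show ?thesis using coset_eq_iff[of "mul A x y" "mul A a b"] a b X(1) Y(1) by simp
 qed
 have "mul (quotient_algebra A J) (coset A J a) (coset A J b) = (\<Union>x\<in>coset A J a. \<Union>y\<in>coset A J b. coset A J (mul A x y))"
  by (simp add: quotient_algebra_def)
 also have "\<dots> = coset A J (mul A a b)"
  by (rule UN_const[OF coset_self[OF a]], rule UN_const[OF coset_self[OF b]]) (rule *)
 finally show ?thesis .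
qed

lemma quotient_scl:
 assumes a: "a \<in> elems A"
 shows "scl (quotient_algebra A J) c (coset A J a) = coset A J (scl A c a)"
proof -
 have *: "coset A J (scl A c x) = coset A J (scl A c a)" if x: "x \<in> coset A J a" for x
  using coset_eq_iff[of "scl A c x" "scl A c a"] coset_memD[OF a x] a dif_scl[OF coset_memD(1)[OF a x] a, of c] scl_J by simp
 have "scl (quotient_algebra A J) c (coset A J a) = (\<Union>x\<in>coset A J a. coset A J (scl A c x))"
  by (simp add: quotient_algebra_def)
 also have "\<dots> = coset A J (scl A c a)" by (rule UN_const[OF coset_self[OF a]]) (rule *)
 finally show ?thesis .
qed

lemma quotient_adj:
 assumes a: "a \<in> elems A"
 shows "adj (quotient_algebra A J) (coset A J a) = coset A J (adj A a)"
proof -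
 have *: "coset A J (adj A x) = coset A J (adj A a)" if x: "x \<in> coset A J a" for x
 proof -
  note X = coset_memD[OF a x]
  have "dif (adj A x) (adj A a) = adj A (dif x a)" using X(1) a by (simp add: adj_add adj_scl)
  thus ?thesis using coset_eq_iff[of "adj A x" "adj A a"] adj_J[OF X(2)] X(1) a by simp
 qed
 have "adj (quotient_algebra A J) (coset A J a) = (\<Union>x\<in>coset A J a. coset A J (adj A x))"
  by (simp add: quotient_algebra_def)
 also have "\<dots> = coset A J (adj A a)" by (rule UN_const[OF coset_self[OF a]]) (rule *)
 finally show ?thesis .
qed

end

subsection \<open>Transport of operators along an injection\<close>

definition lift_vec :: "('s => 'g) => ('s => complex) => 'g => complex" where
 "lift_vec b x = (\<lambda>z. if z \<in> range b then x (inv b z) else 0)"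

lemma lift_vec_apply [simp]: "inj b ==> lift_vec b x (b s) = x s"
 by (simp add: lift_vec_def)

lemma lift_vec_outside: "z \<notin> range b ==> lift_vec b x z = 0"
 by (simp add: lift_vec_def)

lemma lift_vec_eqI:
 assumes "inj b" "\<And>z. z \<notin> range b ==> y z = 0" "\<And>s. y (b s) = x s"
 shows "y = lift_vec b x"
 using assms by (auto simp: lift_vec_def fun_eq_iff)

lemma lift_vec_infsum:
 fixes F :: "'g => 'c::{comm_monoid_add, t2_space}"
 assumes b: "inj b" and z: "\<And>z. z \<notin> range b ==> F z = 0"
 shows "infsum F UNIV = infsum (\<lambda>s. F (b s)) UNIV"
proof -
 have "infsum F UNIV = infsum F (range b)" by (rule infsum_cong_neutral) (use z in auto)
 also have "\<dots> = infsum (F \<circ> b) UNIV" by (rule infsum_reindex[OF b])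
 finally show ?thesis by (simp add: comp_def)
qed

lemma lift_vec_norm: "inj b ==> ell2_norm (lift_vec b x) = ell2_norm x"
 unfolding ell2_norm_def
 by (subst lift_vec_infsum[of b "\<lambda>z. (cmod (lift_vec b x z))\<^sup>2"]) (simp_all add: lift_vec_outside)

lemma lift_vec_inner: "inj b ==> ell2_inner (lift_vec b x) (lift_vec b y) = ell2_inner x y"
 unfolding ell2_inner_def
 by (subst lift_vec_infsum[of b "\<lambda>z. lift_vec b x z * cnj (lift_vec b y z)"]) (simp_all add: lift_vec_outside)

lemma lift_vec_ell2_iff: "inj b ==> lift_vec b x \<in> ell2 (range b) \<longleftrightarrow> x \<in> ell2 UNIV"
 unfolding ell2_def using summable_on_reindex[of b UNIV "\<lambda>z. (cmod (lift_vec b x z))\<^sup>2"]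
 by (simp add: lift_vec_outside comp_def)

lemma lift_vec_linear:
 "lift_vec b (\<lambda>i. x i + y i) = (\<lambda>i. lift_vec b x i + lift_vec b y i)"
 "lift_vec b (\<lambda>i. c * x i) = (\<lambda>i. c * lift_vec b x i)"
 by (auto simp: lift_vec_def fun_eq_iff)

lemma lift_vec_unlift:
 assumes b: "inj b" and e: "y \<in> ell2 (range b)"
 shows "lift_vec b (\<lambda>s. y (b s)) = y" "(\<lambda>s. y (b s)) \<in> ell2 UNIV"
proof -
 show 1: "lift_vec b (\<lambda>s. y (b s)) = y"
  by (rule lift_vec_eqI[OF b, symmetric]) (use ell2_zero_outside[OF e] in auto)
 show "(\<lambda>s. y (b s)) \<in> ell2 UNIV" using lift_vec_ell2_iff[OF b, of "\<lambda>s. y (b s)"] 1 e by simp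
qed

definition transport :: "('s => 'g) => 'g op => 's op" where
 "transport b T = (\<lambda>x\<in>ell2 UNIV. \<lambda>s. T (lift_vec b x) (b s))"

lemma lift_transport:
 assumes b: "inj b" and T: "T \<in> bounded_ops (range b)" and x: "x \<in> ell2 UNIV"
 shows "lift_vec b (transport b T x) = T (lift_vec b x)" "transport b T x \<in> ell2 UNIV"
proof -
 have "T (lift_vec b x) \<in> ell2 (range b)" using bounded_ops_maps[OF T] lift_vec_ell2_iff[OF b] x by blast
 thus "lift_vec b (transport b T x) = T (lift_vec b x)" "transport b T x \<in> ell2 UNIV"
  using lift_vec_unlift[OF b] x by (simp_all add: transport_def)
qed

lemma transport_bounded:
 fixes b :: "'s => 'g"
 assumes b: "inj b" and T: "T \<in> bounded_ops (range b)"
 shows "transport b T \<in> bounded_ops UNIV" "op_norm UNIV (transport b T) \<le> op_norm (range b) T"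
proof -
 have l: "lift_vec b x \<in> ell2 (range b)" if "x \<in> ell2 UNIV" for x :: "'s => complex" using lift_vec_ell2_iff[OF b] that by blast
 have n: "ell2_norm (transport b T x) \<le> op_norm (range b) T * ell2_norm x" if x: "x \<in> ell2 UNIV" for x
  using op_norm_bound[OF T l[OF x]] unfolding lift_transport(1)[OF b T x, symmetric] lift_vec_norm[OF b] .
 show "transport b T \<in> bounded_ops UNIV"
 proof (rule bounded_opsI[where K = "op_norm (range b) T"])
  fix x y :: "'s => complex" assume x: "x \<in> ell2 UNIV" "y \<in> ell2 UNIV"
  show "transport b T (\<lambda>i. x i + y i) = (\<lambda>i. transport b T x i + transport b T y i)"
   using x ell2_add(1)[OF x] bounded_ops_add[OF T l[OF x(1)] l[OF x(2)]] by (simp add: transport_def lift_vec_linear)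
 next
  fix x :: "'s => complex" and c assume x: "x \<in> ell2 UNIV"
  show "transport b T (\<lambda>i. c * x i) = (\<lambda>i. c * transport b T x i)"
   using x ell2_scale(1)[OF x, of c] bounded_ops_scale[OF T l[OF x]] by (simp add: transport_def lift_vec_linear)
 qed (use n lift_transport(2)[OF b T] in \<open>auto simp: transport_def\<close>)
 show "op_norm UNIV (transport b T) \<le> op_norm (range b) T"
  by (rule op_norm_le[OF n op_norm_nonneg[OF T]])
qed

lemma transport_adjoint:
 assumes b: "inj b" and T: "adjoint_pair (range b) T T'"
 shows "adjoint_pair UNIV (transport b T) (transport b T')"
proof -
 note D = adjoint_pairD[OF T]
 have "ell2_inner (transport b T x) y = ell2_inner x (transport b T' y)" if x: "x \<in> ell2 UNIV" "y \<in> ell2 UNIV" for x y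
 proof -
  have "ell2_inner (transport b T x) y = ell2_inner (T (lift_vec b x)) (lift_vec b y)"
   unfolding lift_transport(1)[OF b D(1) x(1), symmetric] lift_vec_inner[OF b] ..
  also have "\<dots> = ell2_inner (lift_vec b x) (T' (lift_vec b y))"
   by (rule D(3)) (use lift_vec_ell2_iff[OF b] x in blast)+
  finally show ?thesis unfolding lift_transport(1)[OF b D(2) x(2), symmetric] lift_vec_inner[OF b] .
 qed
 thus ?thesis unfolding adjoint_pair_def using transport_bounded(1)[OF b] D by blast
qed

subsection \<open>The fibre over the character of the identity\<close>

abbreviation (input) chi_e :: "'a::left_cancel_monoid set => bool" where "chi_e \<equiv> pt 1"

lemma dom_left_translation [simp]: "dom (left_translation s) = UNIV"
 by (auto simp: left_translation_def)

lemma left_translation_pair: "(left_translation s, chi_e) \<in> germ_pairs"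
 using trans_hull[of s] by simp

lemma char_of_fibre_germ [simp]: "char_of (fibre_germ s) = chi_e"
 unfolding fibre_germ_def by (rule char_of_germ[OF left_translation_pair])

lemma inj_fibre_germ: "inj (fibre_germ :: 'a::left_cancel_monoid => _)"
proof (rule injI)
 fix s t :: 'a assume "fibre_germ s = fibre_germ t"
 then obtain A where "A \<in> \<J>" "(chi_e :: 'a set => bool) A" "\<And>x. x \<in> A ==> left_translation s x = left_translation t x"
  unfolding fibre_germ_def using germ_eqE[OF left_translation_pair left_translation_pair] by blast
 thus "s = t" using \<open>\<And>x. x \<in> A ==> left_translation s x = left_translation t x\<close>[of 1] by (simp add: left_translation_def)
qed

text \<open>By equivariance the value at \<open>1\<close> fixes all values. Consequently every germ
  at the character of the identity, whose representatives are defined at \<open>1\<close>, is the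
  germ of a left translation, and the source fibre there is a copy of \<open>S\<close>.\<close>

lemma hull_at_one:
 assumes "k \<in> \<I>" "k 1 = Some s"
 shows "k = left_translation s"
 using hull_equivariant[OF assms] by (auto simp: left_translation_def fun_eq_iff)

lemma range_fibre_germ: "range fibre_germ = fibre chi_e"
proof (intro subset_antisym subsetI)
 fix z :: "'a germ" assume "z \<in> range fibre_germ"
 thus "z \<in> fibre chi_e" unfolding fibre_def using germ_arrow[OF left_translation_pair]
  by (auto simp: fibre_germ_def char_of_germ[OF left_translation_pair])
next
 fix z :: "'a germ" assume g: "z \<in> fibre chi_e"
 obtain k w where k: "(k, w) \<in> germ_pairs" "z = germ k w" using arrowE fibre_arrow[OF g] by blast
 have w: "w = chi_e" using g k char_of_germ[OF k(1)] by (simp add: fibre_def)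
 have kh: "k \<in> \<I>" "w (dom k)" using k(1) by simp_all
 hence "1 \<in> dom k" unfolding w by simp
 then obtain s where "k 1 = Some s" by blast
 hence "k = left_translation s" by (rule hull_at_one[OF kh(1)])
 thus "z \<in> range fibre_germ" unfolding k(2) w fibre_germ_def by blast
qed

lemma range_char_fibre_germ: "range_char (fibre_germ s) = pt s"
proof -
 have "push (left_translation s) chi_e = pt s"
  by (rule push_point_character[OF trans_hull]) (simp add: left_translation_def)
 thus ?thesis unfolding fibre_germ_def range_char_germ[OF left_translation_pair] .
qed

lemma act_fibre_germ:
 assumes g: "g \<in> \<I>"
 shows "act g (fibre_germ s) = map_option fibre_germ (g s)"
proof -
 have d: "chi_e (dom (g \<circ>\<^sub>m left_translation s)) \<longleftrightarrow> s \<in> dom g"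
 proof -
  have "chi_e (dom (g \<circ>\<^sub>m left_translation s)) \<longleftrightarrow> 1 \<in> dom (g \<circ>\<^sub>m left_translation s)"
   by (rule point_character_eq[OF dom_hull[OF comp_hull[OF g trans_hull]]])
  thus ?thesis by (simp add: dom_def left_translation_def)
 qed
 show ?thesis
 proof (cases "g s")
  case None
  hence "s \<notin> dom g" by auto
  thus ?thesis unfolding fibre_germ_def act_germ[OF g left_translation_pair] using d None by simp
 next
  case (Some t)
  have "g \<circ>\<^sub>m left_translation s = left_translation t"
   by (rule hull_at_one[OF comp_hull[OF g trans_hull]]) (simp add: left_translation_def Some)
  moreover have "s \<in> dom g" using Some by blast
  ultimately show ?thesis unfolding fibre_germ_def act_germ[OF g left_translation_pair] using Some by (simp add: left_translation_def dom_def)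
 qed
qed

lemma rho_Cc_eq: "rho_Cc f = transport fibre_germ (fibre_rep chi_e f)"
 unfolding rho_Cc_def transport_def lift_vec_def
 using regular_rep_groupoid_on[OF invariant_Omega point_character_Omega, of 1 f] unfolding groupoid_on_Omega by simp

text \<open>Transported to \<open>S\<close>, the action of the hull on the arrows of this fibre is
  its action on points, and the arrow of \<open>t\<close> has range \<open>pt t\<close>.\<close>

lemma rho_gen:
 fixes g :: "'a::left_cancel_monoid \<rightharpoonup> 'a"
 assumes g: "g \<in> \<I>"
 shows "rho_Cc (gen Omega g h) = (\<lambda>x\<in>ell2 UNIV. wvec (pinv g) (\<lambda>t. h (pt t)) x)"
 unfolding rho_Cc_eq transport_def
proof (intro restrict_ext ext)
 fix x :: "'a => complex" and s :: 'a assume x: "x \<in> ell2 UNIV"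
 have l: "lift_vec fibre_germ x \<in> ell2 (fibre chi_e)" using lift_vec_ell2_iff[OF inj_fibre_germ, of x] x range_fibre_germ by metis
 have f: "fibre_germ s \<in> fibre chi_e" using range_fibre_germ by blast
 show "fibre_rep chi_e (gen Omega g h) (lift_vec fibre_germ x) (fibre_germ s) = wvec (pinv g) (\<lambda>t. h (pt t)) x s"
  unfolding fibre_rep_gen[OF invariant_Omega point_character_Omega g] wvec_def fibre_act_def
  using l f act_fibre_germ[OF inv_hull[OF g], of s] lift_vec_apply[OF inj_fibre_germ]
  by (auto simp: range_char_fibre_germ split: option.splits)
qed

abbreviation "rho_nrm f \<equiv> op_norm UNIV (rho_Cc f)"

lemma rho_bounded: "f \<in> CcP ==> rho_Cc f \<in> bounded_ops UNIV"
 unfolding rho_Cc_eq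
 by (rule transport_bounded(1)[OF inj_fibre_germ]) (simp add: range_fibre_germ Omega_ci.fibre_rep_bounded)

lemma rho_norm_le: "f \<in> CcP ==> rho_nrm f \<le> reduced_norm \<G> f"
 unfolding rho_Cc_eq
 using transport_bounded(2)[OF inj_fibre_germ, of "fibre_rep chi_e f"] Omega_ci.rnorm_ge[of f chi_e] Omega_ci.fibre_rep_bounded[of f chi_e]
 by (simp add: range_fibre_germ groupoid_on_Omega)

lemma rho_add:
 fixes f :: "'a::left_cancel_monoid germ_fun"
 assumes "f \<in> gen_span Omega P" "f' \<in> gen_span Omega P"
 shows "rho_Cc (\<lambda>z. f z + f' z) = (\<lambda>x\<in>ell2 UNIV. \<lambda>s. rho_Cc f x s + rho_Cc f' x s)"
 unfolding rho_Cc_eq fibre_rep_add[OF subset_refl assms] transport_def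
proof (intro restrict_ext ext)
 fix x :: "'a => complex" and s :: 'a assume x: "x \<in> ell2 UNIV"
 have l: "lift_vec fibre_germ x \<in> ell2 (fibre chi_e)" using lift_vec_ell2_iff[OF inj_fibre_germ, of x] x range_fibre_germ by metis
 show "(\<lambda>x\<in>ell2 (fibre chi_e). \<lambda>z. fibre_rep chi_e f x z + fibre_rep chi_e f' x z) (lift_vec fibre_germ x) (fibre_germ s) =
  (\<lambda>x\<in>ell2 UNIV. \<lambda>s. fibre_rep chi_e f (lift_vec fibre_germ x) (fibre_germ s)) x s +
  (\<lambda>x\<in>ell2 UNIV. \<lambda>s. fibre_rep chi_e f' (lift_vec fibre_germ x) (fibre_germ s)) x s" using l x by simp
qed

lemma rho_scale:
 fixes f :: "'a::left_cancel_monoid germ_fun"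
 assumes "f \<in> gen_span Omega P"
 shows "rho_Cc (\<lambda>z. c * f z) = (\<lambda>x\<in>ell2 UNIV. \<lambda>s. c * rho_Cc f x s)"
 unfolding rho_Cc_eq fibre_rep_scale[OF subset_refl assms] transport_def
proof (intro restrict_ext ext)
 fix x :: "'a => complex" and s :: 'a assume x: "x \<in> ell2 UNIV"
 have l: "lift_vec fibre_germ x \<in> ell2 (fibre chi_e)" using lift_vec_ell2_iff[OF inj_fibre_germ, of x] x range_fibre_germ by metis
 show "(\<lambda>x\<in>ell2 (fibre chi_e). \<lambda>z. c * fibre_rep chi_e f x z) (lift_vec fibre_germ x) (fibre_germ s) =
  c * (\<lambda>x\<in>ell2 UNIV. \<lambda>s. fibre_rep chi_e f (lift_vec fibre_germ x) (fibre_germ s)) x s" using l x by simp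
qed

lemma rho_zero: "rho_Cc (\<lambda>_. 0) = (\<lambda>x\<in>ell2 UNIV. \<lambda>_. 0)"
 using rho_scale[OF gen_span.zero, of 0] by simp

lemma rho_conv:
 fixes f :: "'a::left_cancel_monoid germ_fun"
 assumes f: "f \<in> CcP" "f' \<in> CcP"
 shows "rho_Cc (convolution \<G> f f') = (\<lambda>x\<in>ell2 UNIV. rho_Cc f (rho_Cc f' x))"
proof (rule ext, goal_cases)
 case (1 x)
 show ?case
 proof (cases "x \<in> ell2 UNIV")
  case x: True
  have b: "fibre_rep chi_e f' \<in> bounded_ops (range fibre_germ)" unfolding range_fibre_germ by (rule Omega_ci.fibre_rep_bounded[OF f(2) point_character_Omega])
  have l: "lift_vec fibre_germ x \<in> ell2 (fibre chi_e)" using lift_vec_ell2_iff[OF inj_fibre_germ, of x] x range_fibre_germ by metis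
  have c: "fibre_rep chi_e (convolution \<G> f f') (lift_vec fibre_germ x) = fibre_rep chi_e f (fibre_rep chi_e f' (lift_vec fibre_germ x))"
   using fibre_rep_conv[OF Omega_ci.closed invariant_Omega point_character_Omega f l] unfolding groupoid_on_Omega .
  have "rho_Cc (convolution \<G> f f') x = (\<lambda>s. fibre_rep chi_e f (lift_vec fibre_germ (rho_Cc f' x)) (fibre_germ s))"
   unfolding rho_Cc_eq lift_transport(1)[OF inj_fibre_germ b x] unfolding transport_def using x c by simp
  also have "\<dots> = rho_Cc f (rho_Cc f' x)"
   using lift_transport(2)[OF inj_fibre_germ b x] unfolding rho_Cc_eq by (simp add: transport_def[of _ "fibre_rep chi_e f"])
  finally show ?thesis using x by simp
 qed (simp add: rho_Cc_def)
qed

lemma rho_adjoint: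
 assumes f: "f \<in> CcP"
 shows "adjoint_pair UNIV (rho_Cc f) (rho_Cc (involution \<G> f))"
 unfolding rho_Cc_eq
 by (rule transport_adjoint[OF inj_fibre_germ])
  (use fibre_rep_adjoint[OF Omega_ci.closed invariant_Omega point_character_Omega f] in \<open>simp add: range_fibre_germ groupoid_on_Omega\<close>)

subsection \<open>Operators of the inverse hull\<close>

lemma seminormed_mul_op_algebra: "seminormed_mul (op_algebra I)"
proof unfold_locales
 note ext_simps = fun_eq_iff restrict_def
 show "zer (op_algebra I) \<in> elems (op_algebra I)" using op_zero_bounded by simp
 show "add (op_algebra I) a b \<in> elems (op_algebra I)" if "a \<in> elems (op_algebra I)" "b \<in> elems (op_algebra I)" for a b
  using op_add(1) that by simp
 show "scl (op_algebra I) c a \<in> elems (op_algebra I)" if "a \<in> elems (op_algebra I)" for a c using op_scale(1) that by simp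
 show "mul (op_algebra I) a b \<in> elems (op_algebra I)" if "a \<in> elems (op_algebra I)" "b \<in> elems (op_algebra I)" for a b
  using op_mul(1) that by simp
 show "add (op_algebra I) (add (op_algebra I) a b) d = add (op_algebra I) a (add (op_algebra I) b d)" for a b d
  by (auto simp: ext_simps)
 show "add (op_algebra I) a b = add (op_algebra I) b a" for a b by (auto simp: ext_simps)
 show "add (op_algebra I) a (zer (op_algebra I)) = a" "scl (op_algebra I) 1 a = a" if "a \<in> elems (op_algebra I)" for a
  using bounded_ops_undefined[of a I] that by (auto simp: ext_simps)
 show "add (op_algebra I) a (scl (op_algebra I) (- 1) a) = zer (op_algebra I)" "scl (op_algebra I) 0 a = zer (op_algebra I)" for a
  by (auto simp: ext_simps)
 show "scl (op_algebra I) c (add (op_algebra I) a b) = add (op_algebra I) (scl (op_algebra I) c a) (scl (op_algebra I) c b)" for a b c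
  by (auto simp: ext_simps distrib_left)
 show "scl (op_algebra I) c (scl (op_algebra I) c' a) = scl (op_algebra I) (c * c') a" for a c c' by (auto simp: ext_simps)
 show "0 \<le> nrm (op_algebra I) a" if "a \<in> elems (op_algebra I)" for a using op_norm_nonneg that by simp
 show "nrm (op_algebra I) (add (op_algebra I) a b) \<le> nrm (op_algebra I) a + nrm (op_algebra I) b"
  if "a \<in> elems (op_algebra I)" "b \<in> elems (op_algebra I)" for a b using op_add(2) that by simp
 show "nrm (op_algebra I) (scl (op_algebra I) c a) = cmod c * nrm (op_algebra I) a" if "a \<in> elems (op_algebra I)" for a c
  using op_scale(2) that by simp
 show "nrm (op_algebra I) (mul (op_algebra I) a b) \<le> nrm (op_algebra I) a * nrm (op_algebra I) b"
  if "a \<in> elems (op_algebra I)" "b \<in> elems (op_algebra I)" for a b using op_mul(2) that by simp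
 fix a b d c
 show "mul (op_algebra I) a (add (op_algebra I) b d) = add (op_algebra I) (mul (op_algebra I) a b) (mul (op_algebra I) a d)"
  if "a \<in> elems (op_algebra I)" "b \<in> elems (op_algebra I)" "d \<in> elems (op_algebra I)"
  using that bounded_ops_add[of a I] bounded_ops_maps[of b I] bounded_ops_maps[of d I] by (auto simp: ext_simps)
 show "mul (op_algebra I) (add (op_algebra I) a b) d = add (op_algebra I) (mul (op_algebra I) a d) (mul (op_algebra I) b d)"
  if "d \<in> elems (op_algebra I)"
  using that bounded_ops_maps[of d I] by (auto simp: ext_simps)
 show "mul (op_algebra I) a (scl (op_algebra I) c b) = scl (op_algebra I) c (mul (op_algebra I) a b)"
  if "a \<in> elems (op_algebra I)" "b \<in> elems (op_algebra I)"
  using that bounded_ops_scale[of a I] bounded_ops_maps[of b I] by (auto simp: ext_simps)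
 show "mul (op_algebra I) (scl (op_algebra I) c a) b = scl (op_algebra I) c (mul (op_algebra I) a b)"
  if "b \<in> elems (op_algebra I)"
  using that bounded_ops_maps[of b I] by (auto simp: ext_simps)
qed

definition hull_op :: "('a::left_cancel_monoid \<rightharpoonup> 'a) => 'a op" where
 "hull_op g = (\<lambda>x\<in>ell2 UNIV. wvec (pinv g) (\<lambda>_. 1) x)"

lemma wop_hull_bounded:
 assumes g: "g \<in> \<I>" and w: "\<And>t. t \<in> dom g ==> cmod (w t) \<le> M" and M: "0 \<le> M"
 shows "(\<lambda>x\<in>ell2 UNIV. wvec (pinv g) w x) \<in> bounded_ops UNIV"
  "op_norm UNIV (\<lambda>x\<in>ell2 UNIV. wvec (pinv g) w x) \<le> M"
proof -
 have inj: "i = i'" if "pinv g i = Some j" "pinv g i' = Some j" for i i' j using that g by simp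
 have b: "cmod (w j) \<le> M" if "pinv g i = Some j" for i j
  by (rule w) (use that g in auto)
 show "(\<lambda>x\<in>ell2 UNIV. wvec (pinv g) w x) \<in> bounded_ops UNIV"
  "op_norm UNIV (\<lambda>x\<in>ell2 UNIV. wvec (pinv g) w x) \<le> M"
  using wvec_bounded_ops[of "pinv g" UNIV w M] inj b M by blast+
qed

lemma hull_op_bounded: "g \<in> \<I> ==> hull_op g \<in> bounded_ops UNIV"
 unfolding hull_op_def by (rule wop_hull_bounded(1)[where M = 1]) auto

lemma hull_op_adjoint:
 assumes g: "g \<in> \<I>"
 shows "adjoint_pair UNIV (hull_op g) (hull_op (pinv g))"
 unfolding adjoint_pair_def
proof (intro conjI ballI hull_op_bounded g inv_hull)
 fix x y :: "'a => complex" assume x: "x \<in> ell2 UNIV" "y \<in> ell2 UNIV"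
 have "ell2_inner (wvec (pinv g) (\<lambda>_. 1) x) y = ell2_inner x (wvec (pinv (pinv g)) (\<lambda>_. 1) y)"
  by (rule wvec_inner) (use g in \<open>simp_all add: partial_inverse_partial_inverse\<close>)
 thus "ell2_inner (hull_op g x) y = ell2_inner x (hull_op (pinv g) y)" using x by (simp add: hull_op_def)
qed

lemma hull_op_comp:
 assumes g: "g \<in> \<I>" and h: "h \<in> \<I>"
 shows "hull_op (g \<circ>\<^sub>m h) = (\<lambda>x\<in>ell2 UNIV. hull_op g (hull_op h x))"
proof
 fix x show "hull_op (g \<circ>\<^sub>m h) x = (\<lambda>x\<in>ell2 UNIV. hull_op g (hull_op h x)) x"
 proof (cases "x \<in> ell2 UNIV")
  case True
  have "hull_op h x \<in> ell2 UNIV" by (rule bounded_ops_maps[OF hull_op_bounded[OF h] True])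
  moreover have "wvec (pinv h \<circ>\<^sub>m pinv g) (\<lambda>_. 1) x = wvec (pinv g) (\<lambda>_. 1) (wvec (pinv h) (\<lambda>_. 1) x)"
   by (auto simp: wvec_def fun_eq_iff map_comp_def split: option.splits)
  ultimately show ?thesis using True unfolding hull_op_def partial_inverse_comp[OF g h] by simp
 qed (simp add: hull_op_def)
qed

lemma hull_op_translation: "hull_op (left_translation s) = translation_op s"
 unfolding hull_op_def translation_op_def
proof (intro restrict_ext ext)
 fix x :: "'a => complex" and u
 have iff: "pinv (left_translation s) u = Some t \<longleftrightarrow> s * t = u" for t
  using partial_inverse_iff[OF trans_hull[of s]] by (simp add: left_translation_def)
 show "wvec (pinv (left_translation s)) (\<lambda>_. 1) x u = (\<Sum>t | s * t = u. x t)"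
 proof (cases "pinv (left_translation s) u")
  case None
  hence e: "{t. s * t = u} = {}" using iff by auto
  show ?thesis unfolding e using None by (simp add: wvec_def)
 next
  case (Some t)
  have "{t. s * t = u} = {t}" unfolding iff[symmetric] Some by auto
  thus ?thesis using Some by (simp add: wvec_def)
 qed
qed

lemma partial_inverse_identity:
 assumes X: "X \<in> \<J>"
 shows "pinv (Some |` X) = Some |` X"
proof
 fix x
 have "pinv (Some |` X) x = Some y \<longleftrightarrow> (Some |` X) x = Some y" for y
  unfolding partial_inverse_iff[OF partial_identity_hull[OF X]] by (auto simp: restrict_map_def split: if_splits)
 thus "pinv (Some |` X) x = (Some |` X) x" by (metis not_Some_eq)
qed

lemma hull_op_identity: "X \<in> \<J> ==> hull_op (Some |` X) = projection_op X"
 unfolding hull_op_def projection_op_def partial_inverse_identity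
 by (auto simp: fun_eq_iff restrict_def wvec_def restrict_map_def)

text \<open>The operators of the hull arise from the isometries in the way the hull arises from the
  translations, with adjoints in place of inverses.\<close>

lemma closed_star_subalgebra_hull_op:
 assumes D: "closed_star_subalgebra Bop D" "range translation_op \<subseteq> D" and g: "g \<in> \<I>"
 shows "hull_op g \<in> D"
 using g
proof induction
 case (translation s)
 thus ?case using D(2) by (auto simp: hull_op_translation)
next
 case (inverse g)
 have "adj Bop (hull_op g) = hull_op (pinv g)" by (rule adj_op_algebra[OF hull_op_adjoint[OF inverse.hyps]])
 thus ?case using D(1) inverse.IH unfolding closed_star_subalgebra_def by metis
next
 case (comp g h)
 have "mul Bop (hull_op g) (hull_op h) \<in> D" using D(1) comp.IH unfolding closed_star_subalgebra_def by blast
 thus ?case unfolding hull_op_comp[OF comp.hyps] op_algebra_simps .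
qed

subsection \<open>The reduced C*-algebra of the monoid\<close>

abbreviation Bel :: "'a::left_cancel_monoid op set" where "Bel \<equiv> elems \<M>"

lemma monoid_cstar_algebra_simps [simp]:
 "zer \<M> = zer Bop" "add \<M> = add Bop"
 "scl \<M> = scl Bop" "mul \<M> = mul Bop"
 "adj \<M> = adj Bop" "nrm \<M> = nrm Bop"
 by (simp_all add: monoid_cstar_algebra_def generated_cstar_algebra_def)

lemma dst_monoid: "dst \<M> = dst Bop"
 by (simp add: dst_def fun_eq_iff)

lemma monoid_elems: "elems \<M> = \<Inter>{D. closed_star_subalgebra Bop D \<and> range translation_op \<subseteq> D}"
 by (simp add: monoid_cstar_algebra_def generated_cstar_algebra_def)

lemma monoid_elemsI:
 assumes "\<And>D. closed_star_subalgebra Bop D ==> range translation_op \<subseteq> D ==> T \<in> D"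
 shows "T \<in> Bel"
 unfolding monoid_elems using assms by blast

lemma monoid_elemsD:
 assumes "T \<in> Bel" "closed_star_subalgebra Bop D" "range translation_op \<subseteq> D"
 shows "T \<in> D"
 using assms unfolding monoid_elems by blast

lemma monoid_elems_ops:
 shows monoid_add: "T \<in> Bel ==> S \<in> Bel ==> add Bop T S \<in> Bel"
  and monoid_mul: "T \<in> Bel ==> S \<in> Bel ==> mul Bop T S \<in> Bel"
  and monoid_scl: "T \<in> Bel ==> scl Bop c T \<in> Bel"
  and monoid_adj: "T \<in> Bel ==> adj Bop T \<in> Bel"
  and monoid_zer: "zer Bop \<in> Bel"
proof -
 have *: "T \<in> D" if "T \<in> Bel" "closed_star_subalgebra Bop D" "range translation_op \<subseteq> D" for T :: "'a op" and D
  using monoid_elemsD that by blast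
 show "T \<in> Bel ==> S \<in> Bel ==> add Bop T S \<in> Bel"
  by (rule monoid_elemsI) (metis * closed_star_subalgebra_def)
 show "T \<in> Bel ==> S \<in> Bel ==> mul Bop T S \<in> Bel"
  by (rule monoid_elemsI) (metis * closed_star_subalgebra_def)
 show "T \<in> Bel ==> scl Bop c T \<in> Bel"
  by (rule monoid_elemsI) (metis * closed_star_subalgebra_def)
 show "T \<in> Bel ==> adj Bop T \<in> Bel"
  by (rule monoid_elemsI) (metis * closed_star_subalgebra_def)
 show "zer Bop \<in> Bel"
  by (rule monoid_elemsI) (metis closed_star_subalgebra_def)
qed

lemma monoid_limit:
 assumes "\<And>n. F n \<in> Bel" "T \<in> bounded_ops UNIV" "vanishes (\<lambda>n. dst Bop (F n) T)"
 shows "T \<in> Bel"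
proof (rule monoid_elemsI)
 fix D :: "'a op set" assume D: "closed_star_subalgebra Bop D" "range translation_op \<subseteq> D"
 have "F n \<in> D" for n using monoid_elemsD[OF assms(1) D] .
 moreover have "norm_closed Bop D" using D(1) unfolding closed_star_subalgebra_def by blast
 ultimately show "T \<in> D" using assms(2,3) unfolding norm_closed_def by auto
qed

lemma monoid_approx:
 assumes T: "T \<in> bounded_ops UNIV"
  and a: "\<And>e. e > 0 ==> \<exists>S. S \<in> Bel \<and> S \<in> bounded_ops UNIV \<and> op_norm UNIV (op_diff UNIV S T) \<le> e"
 shows "T \<in> Bel"
proof -
 have "\<forall>n::nat. \<exists>S. S \<in> Bel \<and> S \<in> bounded_ops UNIV \<and> op_norm UNIV (op_diff UNIV S T) \<le> 1 / (real n + 1)"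
  by (rule allI, rule a) simp
 then obtain F where F: "\<And>n. F n \<in> Bel" "\<And>n. F n \<in> bounded_ops UNIV" "\<And>n::nat. op_norm UNIV (op_diff UNIV (F n) T) \<le> 1 / (real n + 1)"
  by metis
 have "vanishes (\<lambda>n. 1 / (real n + 1))" using LIMSEQ_inverse_real_of_nat by (simp add: inverse_eq_divide add.commute)
 hence "vanishes (\<lambda>n. op_norm UNIV (op_diff UNIV (F n) T))"
  by (rule tendsto_sandwich[OF _ _ tendsto_const, rotated 2]) (use F(3) op_norm_nonneg[OF op_diff_bounded[OF F(2) T]] in auto)
 thus ?thesis using monoid_limit[OF F(1) T] by (simp add: dst_op_algebra)
qed

lemma hull_op_in_monoid: "g \<in> \<I> ==> hull_op g \<in> Bel"
 by (rule monoid_elemsI) (rule closed_star_subalgebra_hull_op)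

subsection \<open>Multiplication operators\<close>

definition mult_op :: "('a::left_cancel_monoid => complex) => 'a op" where
 "mult_op k = (\<lambda>x\<in>ell2 UNIV. \<lambda>t. k t * x t)"

lemma projection_op_mult: "projection_op X = mult_op (\<lambda>t. if t \<in> X then 1 else 0)"
 by (auto simp: projection_op_def mult_op_def fun_eq_iff restrict_def)

lemma mult_op_bounded:
 assumes "\<And>t. cmod (k t) \<le> M" "0 \<le> M"
 shows "mult_op k \<in> bounded_ops UNIV" "op_norm UNIV (mult_op k) \<le> M"
proof -
 have "mult_op k = (\<lambda>x\<in>ell2 UNIV. wvec Some k x)" by (auto simp: mult_op_def wvec_def fun_eq_iff restrict_def)
 thus "mult_op k \<in> bounded_ops UNIV" "op_norm UNIV (mult_op k) \<le> M"
  using wvec_bounded_ops[of Some UNIV k M] assms by auto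
qed

lemma projection_bounded: "projection_op (X :: 'a::left_cancel_monoid set) \<in> bounded_ops UNIV"
 unfolding projection_op_mult by (rule mult_op_bounded(1)[where M = 1]) auto

lemma mult_op_mul:
 assumes "mult_op k' \<in> bounded_ops UNIV"
 shows "mul Bop (mult_op k) (mult_op k') = mult_op (\<lambda>t. k t * k' t)"
proof
 fix x show "mul Bop (mult_op k) (mult_op k') x = mult_op (\<lambda>t. k t * k' t) x"
  using bounded_ops_maps[OF assms, of x] by (cases "x \<in> ell2 UNIV") (simp_all add: mult_op_def mult.assoc)
qed

lemma mult_op_add: "add Bop (mult_op k) (mult_op k') = mult_op (\<lambda>t. k t + k' t)"
 by (auto simp: mult_op_def fun_eq_iff restrict_def distrib_right)

lemma mult_op_scl: "scl Bop c (mult_op k) = mult_op (\<lambda>t. c * k t)"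
 by (auto simp: mult_op_def fun_eq_iff restrict_def)

text \<open>A Boolean algebra of subsets of \<open>S\<close> that contains the constructible ideals,
  and therefore the traces of all basic clopen sets.\<close>

definition proj_sets :: "'a::left_cancel_monoid set set" where
 "proj_sets = {P. projection_op P \<in> Bel}"

lemma proj_sets_ideal:
 assumes "X \<in> \<J>" shows "X \<in> proj_sets"
 using hull_op_in_monoid[OF partial_identity_hull[OF assms]] unfolding hull_op_identity[OF assms] proj_sets_def by blast

lemma proj_sets_Int:
 assumes "P \<in> proj_sets" "Q \<in> proj_sets" shows "P \<inter> Q \<in> proj_sets"
proof -
 have "mul Bop (projection_op P) (projection_op Q) = projection_op (P \<inter> Q)"
  using mult_op_mul[OF projection_bounded[of Q, unfolded projection_op_mult], of "\<lambda>t. if t \<in> P then 1 else 0"]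
  unfolding projection_op_mult by (auto intro!: arg_cong[where f = mult_op])
 thus ?thesis using monoid_mul[of "projection_op P" "projection_op Q"] assms unfolding proj_sets_def by simp
qed

lemma proj_sets_Compl:
 assumes "P \<in> proj_sets" shows "- P \<in> proj_sets"
proof -
 have "add Bop (projection_op UNIV) (scl Bop (-1) (projection_op P)) = projection_op (- P)"
  unfolding projection_op_mult mult_op_scl mult_op_add by (auto intro!: arg_cong[where f = mult_op])
 moreover have "projection_op UNIV \<in> Bel" using proj_sets_ideal[OF UNIV_ideal] by (simp add: proj_sets_def)
 ultimately show ?thesis using monoid_add[OF _ monoid_scl, of "projection_op UNIV" "projection_op P" "-1"] assms unfolding proj_sets_def
  by (metis mem_Collect_eq)
qed

lemma proj_sets_Union:
 assumes "finite \<X>" "\<X> \<subseteq> proj_sets" shows "\<Union>\<X> \<in> proj_sets"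
 using assms
proof (induction)
 case empty
 have "- UNIV \<in> proj_sets" by (intro proj_sets_Compl proj_sets_ideal UNIV_ideal)
 thus ?case by simp
next
 case (insert X \<X>)
 have "- (- X \<inter> - \<Union>\<X>) \<in> proj_sets" using insert by (intro proj_sets_Compl proj_sets_Int) auto
 thus ?case by simp
qed

definition trace :: "('a::left_cancel_monoid set => bool) set => 'a set" where
 "trace U = {t. pt t \<in> U}"

lemma trace_basic_open:
 assumes "X \<in> \<J>" "\<X> \<subseteq> \<J>"
 shows "trace (basic_open X \<X>) = X - \<Union>\<X>"
proof -
 have "\<forall>X'\<in>\<X>. pt t X' \<longleftrightarrow> t \<in> X'" for t using assms(2) by (auto simp: subset_iff)
 thus ?thesis using assms(1) unfolding trace_def basic_open_def by auto
qed

lemma trace_basic_open_proj: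
 assumes "X \<in> \<J>" "finite \<X>" "\<X> \<subseteq> \<J>"
 shows "trace (basic_open X \<X>) \<in> proj_sets"
proof -
 have "X \<inter> - \<Union>\<X> \<in> proj_sets"
  by (intro proj_sets_Int proj_sets_Compl proj_sets_Union proj_sets_ideal assms subsetI) (use assms(3) in blast)
 thus ?thesis unfolding trace_basic_open[OF assms(1,3)] by (simp add: Diff_eq)
qed

text \<open>Approximation of \<open>k\<close> by step functions. The sets of the cover may overlap,
  so in each step the new constant takes over on \<open>P\<close> and the earlier values are kept
  only off \<open>P\<close>.\<close>

lemma mult_op_approx:
 assumes "finite \<P>" "\<forall>P\<in>\<P>. P \<in> proj_sets \<and> (\<exists>c. \<forall>t\<in>P. cmod (k t - c) \<le> e)"
 shows "\<exists>k'. mult_op k' \<in> Bel \<and> mult_op k' \<in> bounded_ops UNIV \<and> (\<forall>t\<in>\<Union>\<P>. cmod (k t - k' t) \<le> e)"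
 using assms
proof (induction)
 case empty
 have e: "mult_op (\<lambda>_. 0) = zer Bop" by (simp add: mult_op_def)
 have "mult_op (\<lambda>_. 0) \<in> Bel" unfolding e by (rule monoid_zer)
 moreover have "mult_op (\<lambda>_. 0) \<in> bounded_ops UNIV" by (rule mult_op_bounded(1)[where M = 0]) auto
 ultimately show ?case by (intro exI[of _ "\<lambda>_. 0"] conjI) simp_all
next
 case (insert P \<P>)
 then obtain k' where k': "mult_op k' \<in> Bel" "mult_op k' \<in> bounded_ops UNIV" "\<forall>t\<in>\<Union>\<P>. cmod (k t - k' t) \<le> e" by auto
 obtain c where c: "\<forall>t\<in>P. cmod (k t - c) \<le> e" using insert.prems by auto
 have P: "P \<in> proj_sets" using insert.prems by auto
 let ?p = "\<lambda>P t. if t \<in> P then 1 else (0::complex)"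
 let ?k = "\<lambda>t. c * ?p P t + k' t * ?p (- P) t"
 have pb: "mult_op (?p (- P)) \<in> bounded_ops UNIV" "mult_op (?p P) \<in> bounded_ops UNIV"
  using projection_bounded unfolding projection_op_mult by blast+
 have pB: "mult_op (?p (- P)) \<in> Bel" "mult_op (?p P) \<in> Bel"
  using proj_sets_Compl[OF P] P unfolding proj_sets_def projection_op_mult by blast+
 have e: "add Bop (scl Bop c (mult_op (?p P))) (mul Bop (mult_op k') (mult_op (?p (- P)))) = mult_op ?k"
  unfolding mult_op_scl mult_op_mul[OF pb(1)] mult_op_add ..
 have "mult_op ?k \<in> Bel" unfolding e[symmetric] by (intro monoid_add monoid_scl monoid_mul pB k')
 moreover have "mult_op ?k \<in> bounded_ops UNIV" unfolding e[symmetric] op_algebra_simps by (intro op_add op_scale op_mul pb k')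
 moreover have "\<forall>t\<in>\<Union>(insert P \<P>). cmod (k t - ?k t) \<le> e" using c k'(3) by auto
 ultimately show ?case by blast
qed

text \<open>Compactness, with basic sets that inherit a property from neighbourhoods of points. It
  is applied to near-constancy of a coefficient and to disjointness from the boundary.\<close>

lemma basic_cover:
 assumes K: "closedin \<O> K" and cover: "\<And>w. w \<in> K ==> \<exists>U. openin \<O> U \<and> w \<in> U \<and> Q U"
  and mono: "\<And>U V. Q U ==> V \<subseteq> U ==> Q V"
 shows "\<exists>\<B>. finite \<B> \<and> K \<subseteq> \<Union>\<B> \<and> (\<forall>V\<in>\<B>. Q V \<and> (\<exists>X \<X>. X \<in> \<J> \<and> finite \<X> \<and>
  \<X> \<subseteq> \<J> \<and> (\<forall>X'\<in>\<X>. X' \<subseteq> X) \<and> V = basic_open X \<X>))"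
proof -
 let ?C = "{V. Q V \<and> (\<exists>X \<X>. X \<in> \<J> \<and> finite \<X> \<and> \<X> \<subseteq> \<J> \<and> (\<forall>X'\<in>\<X>. X' \<subseteq> X) \<and> V = basic_open X \<X>)}"
 have comp: "compactin \<O> K" by (rule closedin_compact_space[OF compact_space_Omega K])
 have op: "\<forall>V\<in>?C. openin \<O> V" using basic_open_clopen(1) by fastforce
 have "K \<subseteq> \<Union>?C"
 proof
  fix w assume "w \<in> K"
  then obtain U where U: "openin \<O> U" "w \<in> U" "Q U" using cover by blast
  obtain X \<X> where X: "X \<in> \<J>" "finite \<X>" "\<X> \<subseteq> \<J>"
  "\<forall>X'\<in>\<X>. X' \<subseteq> X" "w \<in> basic_open X \<X>" "basic_open X \<X> \<subseteq> U" using Omega_neighbourhood[OF U(1,2)] by blast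
  have "Q (basic_open X \<X>)" by (rule mono[OF U(3) X(6)])
  hence "basic_open X \<X> \<in> ?C" using X by blast
  thus "w \<in> \<Union>?C" using X(5) by blast
 qed
 then obtain \<B> where "finite \<B>" "\<B> \<subseteq> ?C" "K \<subseteq> \<Union>\<B>"
  using comp op unfolding compactin_def by meson
 thus ?thesis by blast
qed

text \<open>The operator is \<open>hull_op g\<close> after multiplication by \<open>h (pt t)\<close>
  on \<open>dom g\<close>. Compactness covers the domain by finitely many basic clopen sets on which
  \<open>h\<close> is nearly constant, so that \<open>mult_op_approx\<close> supplies a
  multiplication operator in the algebra that is uniformly close there.\<close>

lemma rho_gen_in_monoid:
 fixes g :: "'a::left_cancel_monoid \<rightharpoonup> 'a"
 assumes g: "g \<in> \<I>" and h: "continuous_map (dom_top Omega g) euclidean h"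
 shows "rho_Cc (gen Omega g h) \<in> Bel"
proof (rule monoid_approx)
 let ?k = "\<lambda>t. h (pt t)"
 have gs: "gen Omega g h \<in> CcP" by (rule gen_span_gen[OF g h]) simp
 show b: "rho_Cc (gen Omega g h) \<in> bounded_ops UNIV" by (rule rho_bounded[OF gs])
 fix e :: real assume e: "e > 0"
 let ?Z = "dom_chars Omega g"
 let ?Q = "\<lambda>U. \<exists>c. \<forall>w\<in>U. cmod (h w - c) \<le> e"
 have Zo: "openin \<O> ?Z" by (rule openin_Omega_ideal[OF dom_hull[OF g]])
 have Zc: "closedin \<O> ?Z" by (rule closedin_Omega_ideal[OF dom_hull[OF g]])
 have "\<exists>U. openin \<O> U \<and> w \<in> U \<and> ?Q U" if w: "w \<in> ?Z" for w
 proof -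
  have tsZ: "topspace (subtopology \<O> ?Z) = ?Z" by auto
  let ?U = "{v \<in> topspace (subtopology \<O> ?Z). h v \<in> ball (h w) e}"
  have "openin (subtopology \<O> ?Z) ?U" by (rule openin_continuous_map_preimage[OF h]) simp
  hence "openin \<O> ?U" by (rule openin_trans_full[OF _ Zo])
  moreover have "w \<in> ?U" using w e unfolding tsZ by simp
  moreover have "?Q ?U"
   by (intro exI[of _ "h w"] ballI) (simp add: dist_norm norm_minus_commute)
  ultimately show ?thesis by blast
 qed
 note cov = this
 have mono: "?Q V" if "?Q U" "V \<subseteq> U" for U V using that by (meson subsetD)
 have "\<exists>\<B>. finite \<B> \<and> ?Z \<subseteq> \<Union>\<B> \<and> (\<forall>V\<in>\<B>. ?Q V \<and> (\<exists>X \<X>. X \<in> \<J> \<and> finite \<X> \<and>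
   \<X> \<subseteq> \<J> \<and> (\<forall>X'\<in>\<X>. X' \<subseteq> X) \<and> V = basic_open X \<X>))"
  by (rule basic_cover[where Q = ?Q, OF Zc cov mono])
 then obtain \<B> where B: "finite \<B>" "?Z \<subseteq> \<Union>\<B>" "\<forall>V\<in>\<B>. ?Q V \<and> (\<exists>X \<X>. X \<in> \<J> \<and> finite \<X> \<and>
   \<X> \<subseteq> \<J> \<and> (\<forall>X'\<in>\<X>. X' \<subseteq> X) \<and> V = basic_open X \<X>)"
  by (elim exE conjE)
 have "\<forall>P\<in>trace ` \<B>. P \<in> proj_sets \<and> (\<exists>c. \<forall>t\<in>P. cmod (?k t - c) \<le> e)"
 proof
  fix P assume "P \<in> trace ` \<B>"
  then obtain V where V: "V \<in> \<B>" "P = trace V" by blast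
  then obtain X \<X> where X: "X \<in> \<J>" "finite \<X>" "\<X> \<subseteq> \<J>" "V = basic_open X \<X>" using B(3) by meson
  have "trace (basic_open X \<X>) \<in> proj_sets" by (rule trace_basic_open_proj[OF X(1-3)])
  hence "P \<in> proj_sets" using V(2) X(4) by simp
  moreover have "\<exists>c. \<forall>t\<in>P. cmod (?k t - c) \<le> e"
  proof -
   have "?Q V" using B(3) V(1) by (meson bspec)
   then obtain c where "\<forall>w\<in>V. cmod (h w - c) \<le> e" by (elim exE)
   thus ?thesis unfolding V(2) trace_def by (intro exI[of _ c]) simp
  qed
  ultimately show "P \<in> proj_sets \<and> (\<exists>c. \<forall>t\<in>P. cmod (?k t - c) \<le> e)" by blast
 qed
 then obtain k' where k': "mult_op k' \<in> Bel" "mult_op k' \<in> bounded_ops UNIV" "\<forall>t\<in>\<Union>(trace ` \<B>). cmod (?k t - k' t) \<le> e"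
  using mult_op_approx[of "trace ` \<B>" ?k e] B(1) by blast
 have dom: "cmod (k' t - ?k t) \<le> e" if "t \<in> dom g" for t
 proof -
  have "pt t \<in> ?Z" using that g by simp
  hence "t \<in> \<Union>(trace ` \<B>)" using B(2) unfolding trace_def by blast
  thus ?thesis using k'(3) by (metis norm_minus_commute)
 qed
 \<comment> \<open>The values of \<open>k'\<close> off \<open>dom g\<close> are not controlled, but
   \<open>hull_op g\<close> discards them.\<close>
 let ?S = "mul Bop (hull_op g) (mult_op k')"
 have "op_diff UNIV ?S (rho_Cc (gen Omega g h)) = (\<lambda>x\<in>ell2 UNIV. wvec (pinv g) (\<lambda>t. k' t - ?k t) x)"
 proof
  fix x show "op_diff UNIV ?S (rho_Cc (gen Omega g h)) x = (\<lambda>x\<in>ell2 UNIV. wvec (pinv g) (\<lambda>t. k' t - ?k t) x) x"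
  proof (cases "x \<in> ell2 UNIV")
   case True
   have "mult_op k' x \<in> ell2 UNIV" by (rule bounded_ops_maps[OF k'(2) True])
   thus ?thesis using True unfolding rho_gen[OF g] hull_op_def op_diff_def
    by (auto simp: wvec_def mult_op_def fun_eq_iff left_diff_distrib split: option.splits)
  qed (simp add: op_diff_def)
 qed
 hence "op_norm UNIV (op_diff UNIV ?S (rho_Cc (gen Omega g h))) \<le> e"
  using wop_hull_bounded(2)[OF g dom] e by simp
 moreover have "?S \<in> Bel" by (intro monoid_mul hull_op_in_monoid g k'(1))
 moreover have "?S \<in> bounded_ops UNIV" unfolding op_algebra_simps by (intro op_mul(1) hull_op_bounded g k'(2))
 ultimately show "\<exists>S. S \<in> Bel \<and> S \<in> bounded_ops UNIV \<and> op_norm UNIV (op_diff UNIV S (rho_Cc (gen Omega g h))) \<le> e" by blast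
qed

lemma rho_in_monoid:
 assumes "f \<in> gen_span Omega P" shows "rho_Cc f \<in> Bel"
 using assms
proof induction
 case zero
 show ?case unfolding rho_zero op_algebra_simps(2)[symmetric] by (rule monoid_zer)
next
 case (add_gen f g h)
 show ?case unfolding rho_add[OF gen_span_True_add_gen[OF add_gen.hyps(1-3)]] op_algebra_simps(3)[symmetric]
  by (rule monoid_add[OF add_gen.IH rho_gen_in_monoid[OF add_gen.hyps(2,3)]])
qed

section \<open>Limits of the operators \<open>rho_Cc f\<close>\<close>

interpretation op: seminormed_mul "op_algebra (UNIV :: 'a::left_cancel_monoid set)"
 by (rule seminormed_mul_op_algebra)

lemma rho_ops:
 fixes f :: "'a::left_cancel_monoid germ_fun"
 shows rho_op_add: "f \<in> gen_span Omega P ==> f' \<in> gen_span Omega P ==> rho_Cc (\<lambda>z. f z + f' z) = add Bop (rho_Cc f) (rho_Cc f')"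
  and rho_op_scl: "f \<in> gen_span Omega P ==> rho_Cc (\<lambda>z. c * f z) = scl Bop c (rho_Cc f)"
  and rho_op_mul: "f \<in> CcP ==> f' \<in> CcP ==>
   rho_Cc (convolution \<G> f f') = mul Bop (rho_Cc f) (rho_Cc f')"
  and rho_op_adj: "f \<in> CcP ==> rho_Cc (involution \<G> f) = adj Bop (rho_Cc f)"
  and rho_op_in: "f \<in> CcP ==> rho_Cc f \<in> elems Bop"
 by (simp_all add: rho_add rho_scale rho_conv rho_bounded) (rule sym, rule adj_op_algebra, rule rho_adjoint)

abbreviation fdiff :: "('b => complex) => ('b => complex) => 'b => complex" where
 "fdiff f f' \<equiv> (\<lambda>z. f z + (-1) * f' z)"

lemma fdiff_gen_span: "f \<in> gen_span Y P ==> f' \<in> gen_span Y P ==> fdiff f f' \<in> gen_span Y P"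
 by (intro gen_span_add gen_span_scale)

lemma dst_rho:
 assumes "f \<in> CcP" "f' \<in> CcP"
 shows "dst Bop (rho_Cc f) (rho_Cc f') = rho_nrm (fdiff f f')"
 unfolding dst_def rho_op_add[OF assms(1) gen_span_scale[OF assms(2)]] rho_op_scl[OF assms(2)] by simp

text \<open>Approximation in operator norm only: the sequence \<open>f\<close> need not be Cauchy
  for the reduced norm, so it need not define an element of the reduced algebra of the groupoid.
  This weaker notion reaches every element of C*_r(S) by a closure argument, and regularity later
  turns it into convergence on the boundary.\<close>

definition rho_lim :: "(nat => 'a::left_cancel_monoid germ_fun) => 'a op => bool" where
 "rho_lim f T \<longleftrightarrow> (\<forall>n. f n \<in> CcP) \<and> T \<in> bounded_ops UNIV \<and>
  vanishes (\<lambda>n. dst Bop (rho_Cc (f n)) T)"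

lemma rho_limD:
 assumes "rho_lim f T"
 shows "\<And>n. f n \<in> CcP" "T \<in> elems Bop" "vanishes (\<lambda>n. dst Bop (rho_Cc (f n)) T)"
  "\<And>n. rho_Cc (f n) \<in> elems Bop"
proof -
 show *: "f n \<in> CcP" for n using assms unfolding rho_lim_def by blast
 show "rho_Cc (f n) \<in> elems Bop" for n by (rule rho_op_in[OF *])
qed (use assms in \<open>simp_all add: rho_lim_def\<close>)

lemma rho_limI:
 assumes "\<And>n. f n \<in> CcP" "T \<in> bounded_ops UNIV" "\<And>n. dst Bop (rho_Cc (f n)) T \<le> u n" "u \<longlonglongrightarrow> 0"
 shows "rho_lim f T"
 unfolding rho_lim_def using assms(1,2) op.tendsto_dst_0[OF rho_op_in[OF assms(1)] _ assms(3,4)] by simp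

lemma rho_lim_const: "f \<in> CcP ==> rho_lim (\<lambda>_. f) (rho_Cc f)"
 using op.dst_self[OF rho_op_in, of f] rho_bounded by (simp add: rho_lim_def)

lemma rho_lim_add:
 assumes "rho_lim f T" "rho_lim f' T'"
 shows "rho_lim (\<lambda>n z. f n z + f' n z) (add Bop T T')"
proof (rule rho_limI[where u = "\<lambda>n. dst Bop (rho_Cc (f n)) T + dst Bop (rho_Cc (f' n)) T'"])
 note D = rho_limD[OF assms(1)] rho_limD[OF assms(2)]
 show "(\<lambda>z. f n z + f' n z) \<in> CcP" for n by (rule gen_span_add[OF D(1) D(5)])
 show "add Bop T T' \<in> bounded_ops UNIV" using op.add_in[OF D(2) D(6)] by simp
 show "dst Bop (rho_Cc (\<lambda>z. f n z + f' n z)) (add Bop T T') \<le>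
  dst Bop (rho_Cc (f n)) T + dst Bop (rho_Cc (f' n)) T'" for n
  unfolding rho_op_add[OF D(1) D(5)] by (rule op.dst_add[OF D(4) D(8) D(2) D(6)])
 show "vanishes (\<lambda>n. dst Bop (rho_Cc (f n)) T + dst Bop (rho_Cc (f' n)) T')"
  using tendsto_add[OF D(3) D(7)] by simp
qed

lemma rho_lim_scl:
 assumes "rho_lim f T"
 shows "rho_lim (\<lambda>n z. c * f n z) (scl Bop c T)"
proof (rule rho_limI[where u = "\<lambda>n. cmod c * dst Bop (rho_Cc (f n)) T"])
 note D = rho_limD[OF assms(1)]
 show "(\<lambda>z. c * f n z) \<in> CcP" for n by (rule gen_span_scale[OF D(1)])
 show "scl Bop c T \<in> bounded_ops UNIV" using op.scl_in[OF D(2)] by simp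
 show "dst Bop (rho_Cc (\<lambda>z. c * f n z)) (scl Bop c T) \<le> cmod c * dst Bop (rho_Cc (f n)) T" for n
  unfolding rho_op_scl[OF D(1)] op.dst_scl[OF D(4) D(2)] ..
 show "vanishes (\<lambda>n. cmod c * dst Bop (rho_Cc (f n)) T)"
  using tendsto_mult_right_zero[OF D(3)] .
qed

lemma rho_lim_nrm:
 assumes "rho_lim f T" shows "(\<lambda>n. rho_nrm (f n)) \<longlonglongrightarrow> op_norm UNIV T"
proof -
 note D = rho_limD[OF assms(1)]
 have "vanishes (\<lambda>n. rho_nrm (f n) - op_norm UNIV T)"
  by (rule Lim_null_comparison[OF _ D(3)]) (use op.nrm_diff_le_dst[OF D(4) D(2)] in simp)
 thus ?thesis by (simp add: LIM_zero_iff)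
qed

lemma rho_lim_mul:
 assumes "rho_lim f T" "rho_lim f' T'"
 shows "rho_lim (\<lambda>n. convolution \<G> (f n) (f' n)) (mul Bop T T')"
proof (rule rho_limI[where u = "\<lambda>n. rho_nrm (f n) * dst Bop (rho_Cc (f' n)) T' + dst Bop (rho_Cc (f n)) T * op_norm UNIV T'"])
 note D = rho_limD[OF assms(1)] rho_limD[OF assms(2)]
 show "convolution \<G> (f n) (f' n) \<in> CcP" for n
  using gen_span_conv[OF invariant_Omega D(1) D(5)] unfolding groupoid_on_Omega .
 show "mul Bop T T' \<in> bounded_ops UNIV" using op.mul_in[OF D(2) D(6)] by simp
 show "dst Bop (rho_Cc (convolution \<G> (f n) (f' n))) (mul Bop T T') \<le>
  rho_nrm (f n) * dst Bop (rho_Cc (f' n)) T' + dst Bop (rho_Cc (f n)) T * op_norm UNIV T'" for n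
  unfolding rho_op_mul[OF D(1) D(5)] using op.dst_mul[OF D(4) D(8) D(2) D(6)] by simp
 show "vanishes (\<lambda>n. rho_nrm (f n) * dst Bop (rho_Cc (f' n)) T' + dst Bop (rho_Cc (f n)) T * op_norm UNIV T')"
  using tendsto_add[OF tendsto_mult[OF rho_lim_nrm[OF assms(1)] D(7)] tendsto_mult[OF D(3) tendsto_const[of "op_norm UNIV T'"]]] by simp
qed

lemma rho_lim_complete:
 assumes f: "\<And>n. f n \<in> CcP"
  and C: "\<And>e. e > 0 ==> \<exists>N. \<forall>m\<ge>N. \<forall>n\<ge>N. rho_nrm (fdiff (f m) (f n)) \<le> e"
 shows "\<exists>T. rho_lim f T"
proof -
 have e: "op_norm UNIV (op_diff UNIV (rho_Cc (f m)) (rho_Cc (f n))) = rho_nrm (fdiff (f m) (f n))" for m n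
  using dst_rho[OF f f, of m n] unfolding dst_op_algebra .
 have "\<exists>S. S \<in> bounded_ops UNIV \<and> vanishes (\<lambda>n. op_norm UNIV (op_diff UNIV (rho_Cc (f n)) S))"
  by (rule op_complete[of "\<lambda>n. rho_Cc (f n)" UNIV, OF rho_bounded[OF f]]) (use C e in auto)
 thus ?thesis using f unfolding rho_lim_def dst_op_algebra by blast
qed

lemma rho_lim_cauchy:
 assumes "rho_lim f T" "e > 0"
 shows "\<exists>N. \<forall>m\<ge>N. \<forall>n\<ge>N. rho_nrm (fdiff (f m) (f n)) < e"
proof -
 note D = rho_limD[OF assms(1)]
 have "\<forall>\<^sub>F n in sequentially. dst Bop (rho_Cc (f n)) T < e / 2" using order_tendstoD(2)[OF D(3), of "e/2"] assms(2) by simp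
 then obtain N where N: "\<forall>n\<ge>N. dst Bop (rho_Cc (f n)) T < e / 2" unfolding eventually_sequentially by blast
 have "rho_nrm (fdiff (f m) (f n)) < e" if "m \<ge> N" "n \<ge> N" for m n
 proof -
  have "dst Bop (rho_Cc (f m)) (rho_Cc (f n)) \<le> dst Bop (rho_Cc (f m)) T + dst Bop (rho_Cc (f n)) T"
   using op.dst_triangle[OF D(4)[of m] D(2) D(4)[of n]] op.dst_sym[OF D(2) D(4)[of n]] by simp
  moreover have "dst Bop (rho_Cc (f m)) T < e / 2" "dst Bop (rho_Cc (f n)) T < e / 2" using N that by blast+
  ultimately show ?thesis unfolding dst_rho[OF D(1) D(1)] by linarith
 qed
 thus ?thesis by blast
qed

lemma rho_norm_involution:
 assumes "f \<in> CcP"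
 shows "rho_nrm (involution \<G> f) = rho_nrm f"
 by (rule adjoint_pair_norm[OF rho_adjoint[OF assms]])

lemma involution_P_gen_span: "f \<in> CcP ==> involution \<G> f \<in> CcP"
 using gen_span_involution[OF invariant_Omega, of f] unfolding groupoid_on_Omega .

lemma involution_fdiff: "fdiff (involution G f) (involution G f') = involution G (fdiff f f')"
 unfolding involution_add by simp

lemma rho_lim_adj:
 assumes "rho_lim f T"
 obtains T' where "adjoint_pair UNIV T T'" "rho_lim (\<lambda>n. involution \<G> (f n)) T'"
proof -
 note D = rho_limD[OF assms(1)]
 have "\<exists>T'. rho_lim (\<lambda>n. involution \<G> (f n)) T'"
 proof (rule rho_lim_complete[OF involution_P_gen_span[OF D(1)]])
  fix e :: real assume "e > 0"
  then obtain N where "\<forall>m\<ge>N. \<forall>n\<ge>N. rho_nrm (fdiff (f m) (f n)) < e" using rho_lim_cauchy[OF assms] by blast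
  hence "\<forall>m\<ge>N. \<forall>n\<ge>N. rho_nrm (fdiff (involution \<G> (f m)) (involution \<G> (f n))) \<le> e"
   unfolding involution_fdiff rho_norm_involution[OF fdiff_gen_span[OF D(1) D(1)]] by (meson less_imp_le)
  thus "\<exists>N. \<forall>m\<ge>N. \<forall>n\<ge>N. rho_nrm (fdiff (involution \<G> (f m)) (involution \<G> (f n))) \<le> e" by blast
 qed
 then obtain T' where T': "rho_lim (\<lambda>n. involution \<G> (f n)) T'" by blast
 note D' = rho_limD[OF T']
 have "adjoint_pair UNIV T T'"
  by (rule adjoint_pair_limit[OF rho_adjoint[OF D(1)]]) (use D(2,3) D'(2,3) in \<open>simp_all add: dst_op_algebra\<close>)
 thus ?thesis using that T' by blast
qed

text \<open>From the approximating sequence of each \<open>F n\<close> one late term is taken. The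
  extra quantity \<open>q\<close> stays under control along the diagonal; it is trivial in the
  application to the algebra itself and is the boundary norm in the application to the
  ideal.\<close>

lemma rho_lim_diagonal:
 assumes F: "\<And>n. \<exists>f. rho_lim f (F n) \<and> Q f" and T: "T \<in> bounded_ops UNIV" and l: "vanishes (\<lambda>n. dst Bop (F n) T)"
  and Q: "\<And>f e. Q f ==> e > 0 ==> \<forall>\<^sub>F n in sequentially. q (f n) < (e::real)"
 shows "\<exists>f. rho_lim f T \<and> (\<forall>n. q (f n) < 1 / (real n + 1))"
proof -
 have "\<exists>u. u \<in> CcP \<and> dst Bop (rho_Cc u) (F n) < 1 / (real n + 1) \<and> q u < 1 / (real n + 1)" for n
 proof -
  obtain f where f: "rho_lim f (F n)" "Q f" using F by blast
  note D = rho_limD[OF f(1)]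
  have p: "0 < 1 / (real n + 1)" by simp
  have "\<forall>\<^sub>F m in sequentially. dst Bop (rho_Cc (f m)) (F n) < 1 / (real n + 1)" by (rule order_tendstoD(2)[OF D(3) p])
  moreover have "\<forall>\<^sub>F m in sequentially. q (f m) < 1 / (real n + 1)" by (rule Q[OF f(2) p])
  ultimately have "\<forall>\<^sub>F m in sequentially. dst Bop (rho_Cc (f m)) (F n) < 1 / (real n + 1) \<and> q (f m) < 1 / (real n + 1)"
   by (rule eventually_conj)
  then obtain m where "dst Bop (rho_Cc (f m)) (F n) < 1 / (real n + 1) \<and> q (f m) < 1 / (real n + 1)"
   unfolding eventually_sequentially by blast
  thus ?thesis using D(1) by blast
 qed
 then obtain u where u: "\<And>n. u n \<in> CcP" "\<And>n. dst Bop (rho_Cc (u n)) (F n) < 1 / (real n + 1)" "\<And>n. q (u n) < 1 / (real n + 1)"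
  by metis
 have Fe: "F n \<in> elems Bop" for n using F rho_limD(2) by metis
 have "rho_lim u T"
 proof (rule rho_limI[where u = "\<lambda>n. 1 / (real n + 1) + dst Bop (F n) T", OF u(1) T])
  show "dst Bop (rho_Cc (u n)) T \<le> 1 / (real n + 1) + dst Bop (F n) T" for n
   using op.dst_triangle[OF rho_op_in[OF u(1)[of n]] Fe[of n], of T] u(2)[of n] T by simp
  have "vanishes (\<lambda>n. 1 / (real n + 1))" using LIMSEQ_inverse_real_of_nat by (simp add: inverse_eq_divide add.commute)
  thus "vanishes (\<lambda>n. 1 / (real n + 1) + dst Bop (F n) T)" using tendsto_add[OF _ l] by fastforce
 qed
 thus ?thesis using u(3) by blast
qed

lemma translation_op_rho: "\<exists>f\<in>CcP. translation_op s = rho_Cc f"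
proof
 let ?g = "left_translation s"
 have c: "continuous_map (dom_top Omega ?g) euclidean (\<lambda>_. 1 :: complex)" by simp
 show "gen Omega ?g (\<lambda>_. 1) \<in> CcP"
  by (rule gen_span_gen[OF trans_hull c]) simp
 show "translation_op s = rho_Cc (gen Omega ?g (\<lambda>_. 1))"
  unfolding rho_gen[OF trans_hull] hull_op_translation[symmetric] hull_op_def ..
qed

text \<open>The operators that admit such a sequence form a norm closed *-subalgebra containing the
  translations, and C*_r(S) is the smallest one.\<close>

lemma monoid_rho_lim:
 fixes T :: "'a::left_cancel_monoid op"
 assumes T: "T \<in> Bel" shows "\<exists>f. rho_lim f T"
proof -
 let ?D = "{T :: 'a op. \<exists>f. rho_lim f T}"
 have "closed_star_subalgebra Bop ?D"
  unfolding closed_star_subalgebra_def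
 proof (intro conjI ballI allI)
  show "?D \<subseteq> elems Bop" using rho_limD(2) by blast
  have "rho_lim (\<lambda>_. (\<lambda>_. 0)) (zer Bop)" using rho_lim_const[OF gen_span.zero] unfolding rho_zero by simp
  thus "zer Bop \<in> ?D" by blast
  show "add Bop a b \<in> ?D" "mul Bop a b \<in> ?D" if "a \<in> ?D" "b \<in> ?D" for a b :: "'a op"
   using that rho_lim_add rho_lim_mul by blast+
  show "scl Bop c a \<in> ?D" if "a \<in> ?D" for c and a :: "'a op" using that rho_lim_scl by blast
  show "adj Bop a \<in> ?D" if a: "a \<in> ?D" for a :: "'a op"
  proof -
   obtain f where "rho_lim f a" using a by blast
   then obtain T' where "adjoint_pair UNIV a T'" "rho_lim (\<lambda>n. involution \<G> (f n)) T'" using rho_lim_adj by blast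
   thus ?thesis using adj_op_algebra by blast
  qed
  show "norm_closed Bop ?D"
   unfolding norm_closed_def
  proof (intro allI ballI impI)
   fix F :: "nat => 'a op" and a assume a: "a \<in> elems Bop" and F: "(\<forall>n. F n \<in> ?D) \<and> vanishes (\<lambda>n. dst Bop (F n) a)"
   have "\<exists>f. rho_lim f a \<and> (\<forall>n. (\<lambda>_. 0) (f n) < 1 / (real n + 1))"
    by (rule rho_lim_diagonal[where F = F and Q = "\<lambda>_. True"]) (use a F in auto)
   thus "a \<in> ?D" by blast
  qed
 qed
 moreover have "range translation_op \<subseteq> ?D"
 proof (rule image_subsetI, rule CollectI)
  fix s :: 'a
  obtain f where "f \<in> CcP" "translation_op s = rho_Cc f" using translation_op_rho by blast
  thus "\<exists>f. rho_lim f (translation_op s)" using rho_lim_const by metis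
 qed
 ultimately have "T \<in> ?D" by (rule monoid_elemsD[OF T])
 thus ?thesis by blast
qed

lemma rho_lim_monoid:
 assumes "rho_lim f T" shows "T \<in> Bel"
 by (rule monoid_limit[OF rho_in_monoid[OF rho_limD(1)[OF assms]]]) (use rho_limD(2,3)[OF assms] in simp_all)

lemma monoid_bounded: "T \<in> Bel ==> T \<in> bounded_ops UNIV"
 using monoid_rho_lim rho_limD(2) by fastforce

lemma monoid_adjoint_pair:
 assumes "T \<in> Bel" shows "adjoint_pair UNIV T (adj Bop T)"
proof -
 obtain f where "rho_lim f T" using monoid_rho_lim[OF assms] by blast
 then obtain T' where "adjoint_pair UNIV T T'" using rho_lim_adj by blast
 thus ?thesis using adj_op_algebra by metis
qed

lemma seminormed_algebra_monoid: "seminormed_algebra (\<M> :: 'a::left_cancel_monoid op star_algebra)"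
proof -
 have b: "T \<in> elems Bop" if "T \<in> Bel" for T :: "'a op" using monoid_bounded[OF that] by simp
 have adj_add: "adj Bop (add Bop S T) = add Bop (adj Bop S) (adj Bop T)"
  if "S \<in> Bel" "T \<in> Bel" for S T :: "'a op"
  using adj_op_algebra[OF adjoint_pair_add[OF monoid_adjoint_pair[OF that(1)] monoid_adjoint_pair[OF that(2)]]] by simp
 have adj_scl: "adj Bop (scl Bop c T) = scl Bop (cnj c) (adj Bop T)"
  if "T \<in> Bel" for T :: "'a op" and c
  using adj_op_algebra[OF adjoint_pair_scale[OF monoid_adjoint_pair[OF that], of c]] by simp
 have nrm_adj: "nrm Bop (adj Bop T) = nrm Bop T" if "T \<in> Bel" for T :: "'a op"
  using adjoint_pair_norm[OF monoid_adjoint_pair[OF that]] by simp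
 show ?thesis
  apply unfold_locales
  unfolding monoid_cstar_algebra_simps
  by (fact monoid_zer | rule monoid_add monoid_scl monoid_mul monoid_adj; assumption | rule op.add_assoc op.add_commute op.add_zer op.add_neg op.scl_add op.scl_scl op.scl_one op.scl_zero op.nrm_nonneg
   op.nrm_triangle op.nrm_scl op.mul_add_right op.mul_add_left op.mul_scl_right op.mul_scl_left op.nrm_mul; rule b; assumption
   | rule adj_add adj_scl nrm_adj; assumption)+
qed

subsection \<open>Regularity and the boundary fibres\<close>

definition near :: "('a::left_cancel_monoid set => bool) => (('a set => bool) => bool) => bool" where
 "near w Q \<longleftrightarrow> (\<exists>U. openin \<O> U \<and> w \<in> U \<and> (\<forall>v\<in>U. Q v))"

lemma near_conj: "near w Q ==> near w R ==> near w (\<lambda>v. Q v \<and> R v)"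
 unfolding near_def by (meson IntD1 IntD2 IntI openin_Int)

lemma near_ball:
 assumes "finite S" "w \<in> Omega" "\<And>x. x \<in> S ==> near w (Q x)"
 shows "near w (\<lambda>v. \<forall>x\<in>S. Q x v)"
 using assms(1,3)
proof (induction S)
 case empty
 have "openin \<O> Omega" using openin_topspace[of \<O>] by simp
 thus ?case unfolding near_def using assms(2) by blast
next
 case (insert x S)
 have "near w (\<lambda>v. Q x v \<and> (\<forall>x\<in>S. Q x v))" by (rule near_conj) (use insert in auto)
 thus ?case by simp
qed

lemma near_ideal: "w \<in> Omega ==> X \<in> \<J> ==> near w (\<lambda>v. v X = w X)"
 unfolding near_def using openin_Omega_cylinder[of X "w X"] by (intro exI[of _ "{v \<in> Omega. v X = w X}"]) simp

lemma near_mono: "near w Q ==> (\<And>v. Q v ==> R v) ==> near w R"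
 unfolding near_def by blast

text \<open>Strong regularity enters here: if every point near \<open>w\<close> identified one of the finitely many pairs, a
 foundation set would force \<open>w\<close> to contain an ideal on which two of the distinct germs agree.\<close>

lemma regular_separation:
 fixes w :: "'a::left_cancel_monoid set => bool"
 assumes reg: "strongly_cstar_regular_on_boundary TYPE('a)" and w: "w \<in> boundary_Omega" and fin: "finite Q"
  and Q: "\<And>k k'. (k, k') \<in> Q ==> (k, w) \<in> germ_pairs \<and> (k', w) \<in> germ_pairs \<and> germ k w \<noteq> germ k' w"
  and n: "near w R"
 shows "\<exists>s. R (pt s) \<and> (\<forall>(k, k')\<in>Q. k s \<noteq> k' s)"
proof (rule ccontr)
 assume neg: "\<not> ?thesis"
 have wO: "w \<in> Omega" using w boundary_subset_Omega by blast
 \<comment> \<open>Definedness of \<open>k\<close> near \<open>w\<close> is secured first, because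
   two undefined values agree without producing a fixed point of
   \<open>pinv k' \<circ>\<^sub>m k\<close>.\<close>
 have "near w (\<lambda>v. \<forall>p\<in>Q. v (dom (fst p)))"
 proof (rule near_ball[OF fin wO])
  fix p assume p: "p \<in> Q"
  hence "fst p \<in> \<I>" "w (dom (fst p))" using Q[of "fst p" "snd p"] by simp_all
  thus "near w (\<lambda>v. v (dom (fst p)))" using near_ideal[OF wO dom_hull[of "fst p"]] by simp
 qed
 hence "near w (\<lambda>v. R v \<and> (\<forall>p\<in>Q. v (dom (fst p))))" by (rule near_conj[OF n])
 then obtain U where U: "openin \<O> U" "w \<in> U" "\<forall>v\<in>U. R v \<and> (\<forall>p\<in>Q. v (dom (fst p)))" unfolding near_def by blast
 obtain X \<X> where X: "X \<in> \<J>" "finite \<X>" "\<X> \<subseteq> \<J>"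
  "\<forall>X'\<in>\<X>. X' \<subseteq> X" "w \<in> basic_open X \<X>" "basic_open X \<X> \<subseteq> U" using Omega_neighbourhood[OF U(1,2)] by blast
 have wX: "w X" "\<forall>X'\<in>\<X>. \<not> w X'" using X(5) by (simp_all add: basic_open_def)
 \<comment> \<open>The fixed points of \<open>k'\<close> inverse after \<open>k\<close> are the
   points where \<open>k\<close> is defined and agrees with \<open>k'\<close>. If no suitable
   \<open>s\<close> existed, these sets would cover \<open>X - \<Union>\<X>\<close>, which is the
   premise of strong regularity.\<close>
 let ?H = "(\<lambda>p. pinv (snd p) \<circ>\<^sub>m fst p) ` Q"
 have ne: "X - \<Union>\<X> \<noteq> {}" by (rule Omega_cylinder_nonempty[OF wO X(1-3) wX])
 have sub: "X - \<Union>\<X> \<subseteq> (\<Union>h\<in>?H. {s. h s = Some s})"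
 proof
  fix s assume "s \<in> X - \<Union>\<X>"
  hence "pt s \<in> basic_open X \<X>" using trace_basic_open[OF X(1,3)] unfolding trace_def by blast
  hence "pt s \<in> U" using X(6) by blast
  hence R: "R (pt s)" "\<forall>p\<in>Q. pt s (dom (fst p))" using U(3) by blast+
  then obtain k k' where k: "(k, k') \<in> Q" "k s = k' s" using neg by blast
  have kh: "k \<in> \<I>" "k' \<in> \<I>" using Q[OF k(1)] by simp_all
  have "pt s (dom k)" using R(2) k(1) by force
  then obtain t where "k s = Some t" using kh by auto
  hence "(pinv k' \<circ>\<^sub>m k) s = Some s" using k(2) kh by simp
  thus "s \<in> (\<Union>h\<in>?H. {s. h s = Some s})" using k(1) by force
 qed
 have Hh: "?H \<subseteq> \<I>"
 proof
  fix h assume "h \<in> ?H"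
  then obtain k k' where "(k, k') \<in> Q" "h = pinv k' \<circ>\<^sub>m k" by auto
  thus "h \<in> \<I>" using Q[of k k'] by (simp add: comp_hull inv_hull)
 qed
 have "finite ?H" using fin by simp
 hence "\<exists>\<Y>. finite \<Y> \<and> \<Y> \<subseteq> \<J> \<and> (\<forall>Y\<in>\<Y>. \<exists>h\<in>?H. \<forall>y\<in>Y. h y = Some y) \<and> foundation_set (\<X> \<union> \<Y>) X"
  using reg[unfolded strongly_cstar_regular_on_boundary_def, rule_format, of ?H X \<X>] Hh X(1-4) ne sub by blast
 then obtain \<Y> where Y: "\<Y> \<subseteq> \<J>" "\<forall>Y\<in>\<Y>. \<exists>h\<in>?H. \<forall>y\<in>Y. h y = Some y" "foundation_set (\<X> \<union> \<Y>) X" by blast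
 \<comment> \<open>A boundary character that takes \<open>X\<close> takes a member of every
   foundation set of \<open>X\<close>; since \<open>w\<close> omits all of \<open>\<X>\<close>, this
   is one of the ideals supplied by regularity.\<close>
 obtain Y where y: "Y \<in> \<X> \<union> \<Y>" "w Y" using foundation_set_boundary[OF Y(3) w wX(1)] by blast
 hence YY: "Y \<in> \<Y>" using wX(2) by blast
 then obtain h where h: "h \<in> ?H" "\<forall>y\<in>Y. h y = Some y" using Y(2) by blast
 then obtain k k' where k: "(k, k') \<in> Q" "h = pinv k' \<circ>\<^sub>m k" by auto
 have kh: "(k, w) \<in> germ_pairs" "(k', w) \<in> germ_pairs" "germ k w \<noteq> germ k' w" using Q[OF k(1)] by blast+
 have k'h: "k' \<in> \<I>" using kh by simp
 have "k x = k' x" if "x \<in> Y" for x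
 proof -
  have "(pinv k' \<circ>\<^sub>m k) x = Some x" using h(2) that unfolding k(2) by blast
  then obtain t where "k x = Some t" "pinv k' t = Some x" by (auto simp: map_comp_Some_iff)
  thus ?thesis using k'h by simp
 qed
 hence "germ k w = germ k' w" by (intro germ_eqI[OF kh(1,2) _ y(2)]) (use Y(1) YY in auto)
 thus False using kh(3) by blast
qed

text \<open>The same partial bijections \<open>g i\<close> and coefficients \<open>h i\<close>
  describe the operator at \<open>w\<close> and the operator on \<open>ell2 UNIV\<close>, which
  allows the two to be compared summand by summand.\<close>

lemma rep_sum_gen:
 fixes w :: "'a::left_cancel_monoid set => bool" and n :: nat
 assumes "w \<in> Omega" "\<And>i. i < n ==> g i \<in> \<I>"
  "\<And>i. i < n ==> continuous_map (dom_top Omega (g i)) euclidean (h i)"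
 shows "(\<lambda>z. \<Sum>i<n. gen Omega (g i) (h i) z) \<in> CcP \<and>
  (\<forall>x\<in>ell2 (fibre w). \<forall>z. fibre_rep w (\<lambda>z. \<Sum>i<n. gen Omega (g i) (h i) z) x z = (\<Sum>i<n. wvec (fibre_act w (g i)) (\<lambda>d. h i (range_char d)) x z)) \<and>
  (\<forall>x\<in>ell2 UNIV. \<forall>t. rho_Cc (\<lambda>z. \<Sum>i<n. gen Omega (g i) (h i) z) x t = (\<Sum>i<n. wvec (pinv (g i)) (\<lambda>t. h i (pt t)) x t))"
 using assms(2,3)
proof (induction n)
 case 0
 show ?case by (simp add: fibre_rep_zero rho_zero gen_span.zero)
next
 case (Suc n)
 let ?f = "\<lambda>z. \<Sum>i<n. gen Omega (g i) (h i) z" and ?e = "gen Omega (g n) (h n)"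
 have f: "?f \<in> CcP" using Suc by simp
 have gn: "g n \<in> \<I>" and "continuous_map (dom_top Omega (g n)) euclidean (h n)" using Suc.prems by simp_all
 hence e: "?e \<in> CcP" by (rule gen_span_gen) simp
 have s: "(\<lambda>z. \<Sum>i<Suc n. gen Omega (g i) (h i) z) = (\<lambda>z. ?f z + ?e z)" by simp
 show ?case unfolding s
 proof (intro conjI ballI allI)
  show "(\<lambda>z. ?f z + ?e z) \<in> CcP" by (rule gen_span_add[OF f e])
  show "fibre_rep w (\<lambda>z. ?f z + ?e z) x z = (\<Sum>i<Suc n. wvec (fibre_act w (g i)) (\<lambda>d. h i (range_char d)) x z)"
   if "x \<in> ell2 (fibre w)" for x z
   unfolding fibre_rep_add[OF subset_refl f e] fibre_rep_gen[OF invariant_Omega assms(1) gn] using that Suc by simp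
  show "rho_Cc (\<lambda>z. ?f z + ?e z) x t = (\<Sum>i<Suc n. wvec (pinv (g i)) (\<lambda>t. h i (pt t)) x t)"
   if "x \<in> ell2 UNIV" for x t
   unfolding rho_add[OF f e] rho_gen[OF gn] using that Suc by simp
 qed
qed

lemma near_continuous:
 assumes g: "g \<in> \<I>" and k: "(k, w) \<in> germ_pairs" "w (dom (g \<circ>\<^sub>m k))"
  and h: "continuous_map (dom_top Omega g) euclidean (h :: _ => complex)" and e: "0 < y"
 shows "near w (\<lambda>v. cmod (h (push k v) - h (push k w)) < y)"
proof -
 let ?D = "dom_chars Omega (g \<circ>\<^sub>m k)"
 have kh: "k \<in> \<I>" "w \<in> Omega" using k(1) by simp_all
 have D: "openin \<O> ?D" using openin_Omega_ideal[OF dom_hull[OF comp_hull[OF g kh(1)]]] by simp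
 have "continuous_map (subtopology \<O> ?D) euclidean (h \<circ> push k)"
  by (rule continuous_map_compose[OF continuous_push_on[OF invariant_Omega g kh(1)] h])
 hence "openin (subtopology \<O> ?D) {v \<in> topspace (subtopology \<O> ?D). (h \<circ> push k) v \<in> ball (h (push k w)) y}"
  by (rule openin_continuous_map_preimage) simp
 hence op: "openin \<O> {v \<in> topspace (subtopology \<O> ?D). (h \<circ> push k) v \<in> ball (h (push k w)) y}"
  by (rule openin_trans_full[OF _ D])
 show ?thesis unfolding near_def
  by (rule exI[of _ "{v \<in> topspace (subtopology \<O> ?D). (h \<circ> push k) v \<in> ball (h (push k w)) y}"])
   (use op kh k(2) e in \<open>auto simp: dist_norm norm_minus_commute\<close>)
qed

lemma L2_set_approx:
 fixes a b :: "'b => complex"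
 assumes "finite E" "\<And>i. i \<in> E ==> cmod (a i - b i) \<le> y"
 shows "L2_set (\<lambda>i. cmod (a i)) E \<le> L2_set (\<lambda>i. cmod (b i)) E + real (card E) * y"
proof -
 have "L2_set (\<lambda>i. cmod (a i)) E \<le> L2_set (\<lambda>i. cmod (b i) + cmod (a i - b i)) E"
  by (rule L2_set_mono) (use norm_triangle_sub in auto)
 also have "\<dots> \<le> L2_set (\<lambda>i. cmod (b i)) E + L2_set (\<lambda>i. cmod (a i - b i)) E" by (rule L2_set_triangle_ineq)
 also have "L2_set (\<lambda>i. cmod (a i - b i)) E \<le> (\<Sum>i\<in>E. cmod (a i - b i))" by (rule L2_set_le_sum) simp
 also have "\<dots> \<le> real (card E) * y" by (rule sum_bounded_above) (rule assms(2))
 finally show ?thesis by simp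
qed

text \<open>A finite piece of the representation at \<open>w\<close> is copied into \<open>\<ell>\<^sup>2(S)\<close> by evaluating representatives of the
 germs at a point \<open>s\<close> close to \<open>w\<close>; regularity keeps the copied points distinct.\<close>

lemma fibre_rep_le_rho_finite:
 fixes w :: "'a::left_cancel_monoid set => bool"
 assumes reg: "strongly_cstar_regular_on_boundary TYPE('a)" and w: "w \<in> boundary_Omega" and f: "f \<in> CcP"
  and x: "\<xi> \<in> ell2 (fibre w)" and E: "finite E" "E \<subseteq> fibre w" and e: "0 < \<epsilon>"
 shows "L2_set (\<lambda>z. cmod (fibre_rep w f \<xi> z)) E \<le> rho_nrm f * ell2_norm \<xi> + \<epsilon>"
proof -
 have wO: "w \<in> Omega" using w boundary_subset_Omega by blast
 obtain n :: nat and g h where g: "\<And>i. i < n ==> g i \<in> \<I>"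
  and h: "\<And>i. i < n ==> continuous_map (dom_top Omega (g i)) euclidean (h i)"
  and fe: "\<And>z. f z = (\<Sum>i<n. gen Omega (g i) (h i) z)"
  by (rule gen_span_rep[OF f], rule that) simp_all
 have f': "f = (\<lambda>z. \<Sum>i<n. gen Omega (g i) (h i) z)" using fe by blast
 note R = rep_sum_gen[where g = g and h = h and n = n, OF wO g h, folded f']
 \<comment> \<open>The tolerance for one coefficient: the errors at the points of \<open>E\<close>,
   each made of \<open>n\<close> summands, add up to at most \<open>\<epsilon>\<close>. The
   \<open>1\<close> in the denominator covers the case of a vanishing product.\<close>
 define y where "y = \<epsilon> / (real (card E) * real n * ell2_norm \<xi> + 1)"
 have den: "0 < real (card E) * real n * ell2_norm \<xi> + 1" by (intro add_nonneg_pos mult_nonneg_nonneg) auto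
 have eta: "0 < y" "real (card E) * (real n * (y * ell2_norm \<xi>)) \<le> \<epsilon>"
 proof -
  show "0 < y" unfolding y_def using e den by simp
  have "real (card E) * (real n * (y * ell2_norm \<xi>)) = y * (real (card E) * real n * ell2_norm \<xi>)" by simp
  also have "\<dots> \<le> y * (real (card E) * real n * ell2_norm \<xi> + 1)" using \<open>0 < y\<close> by (intro mult_left_mono) auto
  also have "\<dots> = \<epsilon>" unfolding y_def using den by simp
  finally show "real (card E) * (real n * (y * ell2_norm \<xi>)) \<le> \<epsilon>" .
 qed
 \<comment> \<open>Besides \<open>E\<close> itself, all arrows whose coordinates in
   \<open>\<xi>\<close> influence the values of the image vector on \<open>E\<close>. They are
   finitely many, since for each \<open>i\<close> at most one arrow contributes to a given
   one.\<close>
 define P where "P = E \<union> (\<Union>z\<in>E. \<Union>i\<in>{..<n}. set_option (fibre_act w (g i) z))"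
 have Pf: "finite P" unfolding P_def using E(1) by auto
 have Pfib: "d \<in> fibre w" if "d \<in> P" for d
 proof -
  consider "d \<in> E" | z i where "i < n" "fibre_act w (g i) z = Some d" using \<open>d \<in> P\<close> unfolding P_def by auto
  thus ?thesis using E(2) fibre_act_SomeD(2)[OF g] by cases auto
 qed
 have EP: "E \<subseteq> P" unfolding P_def by blast
 have actP: "d \<in> P" if "z \<in> E" "i < n" "fibre_act w (g i) z = Some d" for z i d
  using that unfolding P_def by force
 have rep: "(rep_of d, w) \<in> germ_pairs" "germ (rep_of d) w = d" "range_char d = push (rep_of d) w" if "d \<in> fibre w" for d
 proof -
  have d: "d \<in> arrows \<G>" "char_of d = w" using that by (simp_all add: fibre_def)
  obtain k v where k: "(k, v) \<in> germ_pairs" "d = germ k v" using arrowE[OF d(1)] .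
  have "v = w" using d(2) k by simp
  thus "(rep_of d, w) \<in> germ_pairs" "germ (rep_of d) w = d" using rep_of_germ[OF k(1)] k(2) by simp_all
  show "range_char d = push (rep_of d) w" unfolding range_char_def d(2) ..
 qed
 \<comment> \<open>What has to persist near \<open>w\<close> for one summand at one arrow: an
   undefined product stays undefined; a defined one is still represented by \<open>rep_of d\<close>,
   with nearly the same coefficient.\<close>
 define C where "C = (\<lambda>(z, i) v. case fibre_act w (g i) z of None => \<not> v (dom (pinv (g i) \<circ>\<^sub>m rep_of z))
  | Some d => (\<exists>A\<in>\<J>. v A \<and> (\<forall>x\<in>A. (pinv (g i) \<circ>\<^sub>m rep_of z) x = rep_of d x)) \<and>
    cmod (h i (push (rep_of d) v) - h i (range_char d)) < y)"
 have nC: "near w (C p)" if pp: "p \<in> E \<times> {..<n}" for p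
 proof -
  obtain z i where p: "p = (z, i)" "z \<in> E" "i < n" using pp by auto
  have gf: "z \<in> fibre w" using p E(2) by blast
  note k = rep[OF gf]
  have gi: "pinv (g i) \<in> \<I>" by (rule inv_hull[OF g[OF p(3)]])
  have kh: "rep_of z \<in> \<I>" using k(1) by simp
  have a: "fibre_act w (g i) z = (if w (dom (pinv (g i) \<circ>\<^sub>m rep_of z)) then Some (germ (pinv (g i) \<circ>\<^sub>m rep_of z) w) else None)"
   using act_germ[OF gi k(1)] unfolding fibre_act_def k(2) using gf by simp
  show ?thesis
  proof (cases "fibre_act w (g i) z")
   case None
   hence "\<not> w (dom (pinv (g i) \<circ>\<^sub>m rep_of z))" using a by (auto split: if_splits)
   thus ?thesis using near_ideal[OF wO dom_hull[OF comp_hull[OF gi kh]]] None unfolding C_def p(1) by simp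
  next
   case (Some d)
   hence d: "w (dom (pinv (g i) \<circ>\<^sub>m rep_of z))" "d = germ (pinv (g i) \<circ>\<^sub>m rep_of z) w"
    using a by (auto split: if_splits)
   note D = fibre_act_SomeD[OF g[OF p(3)] Some]
   note kd = rep[OF D(2)]
   have cp: "(pinv (g i) \<circ>\<^sub>m rep_of z, w) \<in> germ_pairs" by (rule germ_comp_pair[OF gi k(1) d(1)])
   obtain A where A: "A \<in> \<J>" "w A" "\<And>x. x \<in> A ==> (pinv (g i) \<circ>\<^sub>m rep_of z) x = rep_of d x"
    using germ_eqE[OF cp kd(1)] kd(2) d(2) by metis
   have rd: "rep_of d \<in> \<I>" using kd(1) by simp
   have "w (dom (g i \<circ>\<^sub>m rep_of d))" using push_character_dom_comp[OF g[OF p(3)] rd, of w] D(3) unfolding kd(3) by simp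
   hence "near w (\<lambda>v. cmod (h i (push (rep_of d) v) - h i (push (rep_of d) w)) < y)"
    by (rule near_continuous[OF g[OF p(3)] kd(1) _ h[OF p(3)] eta(1)])
   hence "near w (\<lambda>v. v A = w A \<and> cmod (h i (push (rep_of d) v) - h i (push (rep_of d) w)) < y)"
    by (rule near_conj[OF near_ideal[OF wO A(1)]])
   thus ?thesis by (rule near_mono) (use Some A kd(3) in \<open>auto simp: C_def p(1)\<close>)
  qed
 qed
 have "near w (\<lambda>v. \<forall>p\<in>E \<times> {..<n}. C p v)" by (rule near_ball[OF _ wO nC]) (use E(1) in simp)
 moreover have "near w (\<lambda>v. \<forall>d\<in>P. v (dom (rep_of d)))"
 proof (rule near_ball[OF Pf wO])
  fix d assume "d \<in> P"
  hence "(rep_of d, w) \<in> germ_pairs" using rep(1) Pfib by blast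
  hence "rep_of d \<in> \<I>" "w (dom (rep_of d))" by simp_all
  thus "near w (\<lambda>v. v (dom (rep_of d)))" using near_ideal[OF wO dom_hull[of "rep_of d"]] by simp
 qed
 ultimately have N: "near w (\<lambda>v. (\<forall>p\<in>E \<times> {..<n}. C p v) \<and> (\<forall>d\<in>P. v (dom (rep_of d))))" by (rule near_conj)
 \<comment> \<open>Distinct arrows of the fibre have representatives with distinct germs at
   \<open>w\<close>, so the separation lemma can be applied to all pairs at once.\<close>
 let ?Q = "(\<lambda>(d, d'). (rep_of d, rep_of d')) ` {p \<in> P \<times> P. fst p \<noteq> snd p}"
 have "\<exists>s. ((\<forall>p\<in>E \<times> {..<n}. C p (pt s)) \<and> (\<forall>d\<in>P. pt s (dom (rep_of d)))) \<and> (\<forall>(k, k')\<in>?Q. k s \<noteq> k' s)"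
 proof (rule regular_separation[OF reg w _ _ N])
  show "finite ?Q" using Pf by simp
  fix k k' assume "(k, k') \<in> ?Q"
  then obtain p where "p \<in> P \<times> P" "fst p \<noteq> snd p" "(k, k') = (case p of (d, d') => (rep_of d, rep_of d'))" by blast
  hence "fst p \<in> P" "snd p \<in> P" "fst p \<noteq> snd p" "k = rep_of (fst p)" "k' = rep_of (snd p)" by (simp_all add: case_prod_unfold mem_Times_iff)
  thus "(k, w) \<in> germ_pairs \<and> (k', w) \<in> germ_pairs \<and> germ k w \<noteq> germ k' w"
   using rep(1,2)[OF Pfib] by metis
 qed
 then obtain s where s: "\<And>z i. z \<in> E ==> i < n ==> C (z, i) (pt s)"
  "\<And>d. d \<in> P ==> pt s (dom (rep_of d))" "\<forall>(k, k')\<in>?Q. k s \<noteq> k' s" by blast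
 define t where "t d = the (rep_of d s)" for d :: "'a germ"
 have t: "rep_of d s = Some (t d)" if "d \<in> P" for d
 proof -
  have "rep_of d \<in> \<I>" using rep(1)[OF Pfib[OF that]] by simp
  hence "s \<in> dom (rep_of d)" using s(2)[OF that] by simp
  thus ?thesis unfolding t_def by auto
 qed
 have inj: "inj_on t P"
 proof (rule inj_onI, rule ccontr)
  fix d d' assume d: "d \<in> P" "d' \<in> P" "t d = t d'" "d \<noteq> d'"
  hence "(rep_of d, rep_of d') \<in> ?Q" by (intro image_eqI[of _ _ "(d, d')"]) auto
  hence "rep_of d s \<noteq> rep_of d' s" using s(3) by blast
  thus False using t[OF d(1)] t[OF d(2)] d(3) by simp
 qed
 \<comment> \<open>The part of \<open>\<xi>\<close> on \<open>P\<close> is moved to the points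
   \<open>t d\<close>. Injectivity of \<open>t\<close>, which regularity supplied, keeps the
   coordinates from being merged, and the norm does not grow.\<close>
 define \<sigma> where "\<sigma> u = (if u \<in> t ` P then Some (inv_into P t u) else None)" for u
 define \<xi>' where "\<xi>' = wvec \<sigma> (\<lambda>_. 1) \<xi>"
 have st: "u = t d \<and> d \<in> P" if "\<sigma> u = Some d" for u d
  using that unfolding \<sigma>_def by (auto split: if_splits simp: f_inv_into_f inv_into_into)
 have x': "\<xi>' \<in> ell2 UNIV" "ell2_norm \<xi>' \<le> 1 * ell2_norm \<xi>"
 proof -
  have i: "u = u'" if "\<sigma> u = Some d" "\<sigma> u' = Some d" for u u' d using st[OF that(1)] st[OF that(2)] by simp
  note W = wvec_ell2[of \<sigma> UNIV "\<lambda>_. 1" 1 \<xi> "fibre w", OF _ _ _ _ x]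
  show "\<xi>' \<in> ell2 UNIV" unfolding \<xi>'_def by (rule W(1)) (simp_all, metis i)
  show "ell2_norm \<xi>' \<le> 1 * ell2_norm \<xi>" unfolding \<xi>'_def by (rule W(2)) (simp_all, metis i)
 qed
 have xt: "\<xi>' (t d) = \<xi> d" if "d \<in> P" for d
  using that inv_into_f_f[OF inj that] unfolding \<xi>'_def wvec_def \<sigma>_def by simp
 have trm: "cmod (wvec (fibre_act w (g i)) (\<lambda>d. h i (range_char d)) \<xi> z - wvec (pinv (g i)) (\<lambda>t. h i (pt t)) \<xi>' (t z)) \<le> y * ell2_norm \<xi>"
  if gi: "z \<in> E" "i < n" for z i
 proof -
  have gP: "z \<in> P" using gi(1) EP by blast
  have kg: "rep_of z \<in> \<I>" using rep(1)[OF Pfib[OF gP]] by simp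
  have gh: "pinv (g i) \<in> \<I>" by (rule inv_hull[OF g[OF gi(2)]])
  have c: "(pinv (g i) \<circ>\<^sub>m rep_of z) s = pinv (g i) (t z)" using t[OF gP] by (simp add: map_comp_def)
  show ?thesis
  proof (cases "fibre_act w (g i) z")
   case None
   hence "\<not> pt s (dom (pinv (g i) \<circ>\<^sub>m rep_of z))" using s(1)[OF gi] unfolding C_def by simp
   hence "s \<notin> dom (pinv (g i) \<circ>\<^sub>m rep_of z)" using dom_hull[OF comp_hull[OF gh kg]] by simp
   hence "pinv (g i) (t z) = None" using c by (simp add: domIff)
   thus ?thesis using None eta(1) by (simp add: wvec_def)
  next
   case (Some d)
   have dP: "d \<in> P" by (rule actP[OF gi Some])
   have kd: "rep_of d \<in> \<I>" using rep(1)[OF Pfib[OF dP]] by simp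
   have CC: "\<exists>A\<in>\<J>. pt s A \<and> (\<forall>x\<in>A. (pinv (g i) \<circ>\<^sub>m rep_of z) x = rep_of d x)"
    "cmod (h i (push (rep_of d) (pt s)) - h i (range_char d)) < y"
    using s(1)[OF gi] Some unfolding C_def by simp_all
   then obtain A where "A \<in> \<J>" "pt s A" "\<forall>x\<in>A. (pinv (g i) \<circ>\<^sub>m rep_of z) x = rep_of d x" by blast
   hence "pinv (g i) (t z) = Some (t d)" using c t[OF dP] by simp
   hence "wvec (fibre_act w (g i)) (\<lambda>d. h i (range_char d)) \<xi> z - wvec (pinv (g i)) (\<lambda>t. h i (pt t)) \<xi>' (t z)
     = (h i (range_char d) - h i (push (rep_of d) (pt s))) * \<xi> d"
    unfolding wvec_def Some push_point_character[OF kd t[OF dP]] using xt[OF dP] by (simp add: left_diff_distrib)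
   thus ?thesis using CC(2) ell2_pos[OF x, of d] eta(1)
    by (simp add: norm_mult norm_minus_commute mult_mono)
  qed
 qed
 have err: "cmod (fibre_rep w f \<xi> z - rho_Cc f \<xi>' (t z)) \<le> real n * (y * ell2_norm \<xi>)" if "z \<in> E" for z
 proof -
  have "fibre_rep w f \<xi> z - rho_Cc f \<xi>' (t z) = (\<Sum>i<n. wvec (fibre_act w (g i)) (\<lambda>d. h i (range_char d)) \<xi> z -
    wvec (pinv (g i)) (\<lambda>t. h i (pt t)) \<xi>' (t z))"
   using R x x'(1) by (simp add: sum_subtractf)
  also have "cmod \<dots> \<le> real (card {..<n}) * (y * ell2_norm \<xi>)" by (rule sum_norm_bound) (use trm that in simp)
  finally show ?thesis by simp
 qed
 have "L2_set (\<lambda>z. cmod (fibre_rep w f \<xi> z)) E \<le> L2_set (\<lambda>z. cmod (rho_Cc f \<xi>' (t z))) E + real (card E) * (real n * (y * ell2_norm \<xi>))"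
  by (rule L2_set_approx[OF E(1) err])
 also have "L2_set (\<lambda>z. cmod (rho_Cc f \<xi>' (t z))) E = L2_set (\<lambda>u. cmod (rho_Cc f \<xi>' u)) (t ` E)"
  unfolding L2_set_def using inj_on_subset[OF inj EP] by (simp add: sum.reindex)
 also have "\<dots> \<le> ell2_norm (rho_Cc f \<xi>')"
  by (rule L2_set_le_ell2_norm[OF bounded_ops_maps[OF rho_bounded[OF f] x'(1)]]) (use E(1) in simp)
 also have "\<dots> \<le> rho_nrm f * ell2_norm \<xi>'" by (rule op_norm_bound[OF rho_bounded[OF f] x'(1)])
 also have "\<dots> \<le> rho_nrm f * ell2_norm \<xi>" using x'(2) op_norm_nonneg[OF rho_bounded[OF f]] by (intro mult_left_mono) auto
 finally show ?thesis using eta(2) by linarith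
qed

lemma fibre_rep_le_rho:
 fixes w :: "'a::left_cancel_monoid set => bool"
 assumes reg: "strongly_cstar_regular_on_boundary TYPE('a)" and w: "w \<in> boundary_Omega" and f: "f \<in> CcP"
 shows "fnorm w f \<le> rho_nrm f"
proof (rule op_norm_le)
 show "0 \<le> rho_nrm f" by (rule op_norm_nonneg[OF rho_bounded[OF f]])
 fix x assume x: "x \<in> ell2 (fibre w)"
 have wO: "w \<in> Omega" using w boundary_subset_Omega by blast
 note fx = bounded_ops_maps[OF Omega_ci.fibre_rep_bounded[OF f wO] x]
 have *: "L2_set (\<lambda>z. cmod (fibre_rep w f x z)) F \<le> rho_nrm f * ell2_norm x" if F: "finite F" for F
 proof (rule field_le_epsilon)
  fix \<epsilon> :: real assume e: "0 < \<epsilon>"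
  have "L2_set (\<lambda>z. cmod (fibre_rep w f x z)) F = L2_set (\<lambda>z. cmod (fibre_rep w f x z)) (F \<inter> fibre w)"
   unfolding L2_set_def using F ell2_zero_outside[OF fx] by (intro arg_cong[where f = sqrt] sum.mono_neutral_right) auto
  also have "\<dots> \<le> rho_nrm f * ell2_norm x + \<epsilon>"
   by (rule fibre_rep_le_rho_finite[OF reg w f x _ _ e]) (use F in auto)
  finally show "L2_set (\<lambda>z. cmod (fibre_rep w f x z)) F \<le> rho_nrm f * ell2_norm x + \<epsilon>" .
 qed
 show "ell2_norm (fibre_rep w f x) \<le> rho_nrm f * ell2_norm x"
  by (rule ell2_if_L2_set_bounded(2)[OF ell2_zero_outside[OF fx] *])
qed

section \<open>Restriction to the boundary and the boundary norm\<close>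

lemma restrict_to_boundary_eq: "restr f = (\<lambda>z. if z \<in> arrows (groupoid_on boundary_Omega) then f z else 0)"
 unfolding restrict_to_boundary_def boundary_groupoid_eq ..

lemma restrict_add: "restr (\<lambda>z. f z + f' z) = (\<lambda>z. restr f z + restr f' z)"
 and restrict_scale: "restr (\<lambda>z. c * f z) = (\<lambda>z. c * restr f z)"
 by (auto simp: restrict_to_boundary_def)

lemma restrict_gen_span: "f \<in> gen_span Omega P ==> restr f \<in> gen_span boundary_Omega P"
 unfolding restrict_to_boundary_eq by (rule gen_span_restrict[OF boundary_subset_Omega])

lemma restrict_gen:
 assumes g: "g \<in> \<I>"
 shows "restr (gen Omega g h) = gen boundary_Omega g h"
proof
 fix z show "restr (gen Omega g h) z = gen boundary_Omega g h z"
  unfolding restrict_to_boundary_eq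
  using gen_restrict[OF boundary_subset_Omega g, of z h] gen_outside[OF boundary_subset_Omega g, of z h]
  by (cases "z \<in> arrows \<G>") auto
qed

text \<open>By invariance all arrows that enter the representation at a boundary character lie over
  the boundary. Representations at boundary characters can thus be evaluated on the unrestricted
  function, which makes them comparable with \<open>rho_Cc f\<close>.\<close>

lemma fibre_rep_restrict:
 fixes f :: "'a::left_cancel_monoid germ_fun"
 assumes w: "w \<in> boundary_Omega" and f: "f \<in> gen_span Omega P"
 shows "fibre_rep w (restr f) = fibre_rep w f"
 using f
proof induction
 case zero
 have "restr (\<lambda>_ :: 'a germ. 0) = (\<lambda>_. 0)" by (auto simp: restrict_to_boundary_def)
 thus ?case by simp
next
 case (add_gen f g h)
 have wO: "w \<in> Omega" using w boundary_subset_Omega by blast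
 note G = gen_span_True_add_gen[OF add_gen.hyps(1-3)]
 have e: "fibre_rep w (gen boundary_Omega g h) = fibre_rep w (gen Omega g h)"
  unfolding fibre_rep_gen[OF invariant_boundary w add_gen.hyps(2)] fibre_rep_gen[OF invariant_Omega wO add_gen.hyps(2)] ..
 show ?case unfolding restrict_add fibre_rep_add[OF subset_refl G] fibre_rep_add[OF boundary_subset_Omega restrict_gen_span[OF G(1)] restrict_gen_span[OF G(2)]]
  unfolding restrict_gen[OF add_gen.hyps(2)] e add_gen.IH ..
qed

text \<open>Regarded as a seminorm on functions on the whole groupoid, so that it can be compared
  with the reduced norm and with \<open>rho_nrm\<close> on one and the same function.\<close>

definition bnorm :: "'a::left_cancel_monoid germ_fun => real" where
 "bnorm f = reduced_norm boundary_groupoid (restr f)"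

lemma bnorm_ge: "f \<in> CcP ==> w \<in> boundary_Omega ==> fnorm w f \<le> bnorm f"
 using boundary_ci.rnorm_ge[OF restrict_gen_span] fibre_rep_restrict unfolding bnorm_def boundary_groupoid_eq by metis

lemma bnorm_le:
 "f \<in> CcP ==> 0 \<le> K ==> (\<And>w. w \<in> boundary_Omega ==> fnorm w f \<le> K) ==> bnorm f \<le> K"
 using boundary_ci.rnorm_le fibre_rep_restrict unfolding bnorm_def boundary_groupoid_eq by metis

lemma bnorm_nonneg: "f \<in> CcP ==> 0 \<le> bnorm f"
 using boundary_ci.rnorm_nonneg[OF restrict_gen_span] unfolding bnorm_def boundary_groupoid_eq .

lemma bnorm_add: "f \<in> CcP ==> f' \<in> CcP ==> bnorm (\<lambda>z. f z + f' z) \<le> bnorm f + bnorm f'"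
 unfolding bnorm_def boundary_groupoid_eq restrict_add by (intro boundary_ci.rnorm_add restrict_gen_span)

lemma bnorm_scale: "f \<in> CcP ==> bnorm (\<lambda>z. c * f z) = cmod c * bnorm f"
 unfolding bnorm_def boundary_groupoid_eq restrict_scale by (intro boundary_ci.rnorm_scale restrict_gen_span)

lemma bnorm_le_rnorm: "f \<in> CcP ==> bnorm f \<le> reduced_norm \<G> f"
 by (rule bnorm_le) (use Omega_ci.rnorm_nonneg Omega_ci.rnorm_ge boundary_subset_Omega in \<open>auto simp: groupoid_on_Omega\<close>)

lemma conv_P_gen_span: "f \<in> CcP ==> f' \<in> CcP ==> convolution \<G> f f' \<in> CcP"
 using gen_span_conv[OF invariant_Omega] unfolding groupoid_on_Omega .

lemma bnorm_conv:
 assumes "f \<in> CcP" "f' \<in> CcP" shows "bnorm (convolution \<G> f f') \<le> bnorm f * bnorm f'"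
proof (rule bnorm_le[OF conv_P_gen_span[OF assms]])
 show "0 \<le> bnorm f * bnorm f'" using bnorm_nonneg assms by (metis mult_nonneg_nonneg)
 fix w :: "'a set => bool" assume w: "w \<in> boundary_Omega"
 have wO: "w \<in> Omega" using w boundary_subset_Omega by blast
 have "fnorm w (convolution \<G> f f') \<le> fnorm w f * fnorm w f'"
  using Omega_ci.fibre_rep_conv_op[OF assms wO] op_mul(2)[OF Omega_ci.fibre_rep_bounded[OF assms(1) wO] Omega_ci.fibre_rep_bounded[OF assms(2) wO]]
  unfolding groupoid_on_Omega by simp
 also have "\<dots> \<le> bnorm f * bnorm f'"
  by (intro mult_mono bnorm_ge assms w bnorm_nonneg op_norm_nonneg Omega_ci.fibre_rep_bounded wO)
 finally show "fnorm w (convolution \<G> f f') \<le> bnorm f * bnorm f'" .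
qed

lemma off_boundary_span: "f \<in> CcOff ==> f \<in> CcP"
 by (rule gen_span_mono[where Q = "\<lambda>_. True"]) simp_all

lemma restrict_off_boundary:
 assumes "f \<in> CcOff"
 shows "restr f = (\<lambda>_. 0)" "bnorm f = 0"
proof -
 show *: "restr f = (\<lambda>_. 0)"
  using assms
 proof induction
  case (add_gen f g h)
  have "gen boundary_Omega g h = (\<lambda>_. 0)"
  proof
   fix z show "gen boundary_Omega g h z = 0"
   proof (rule ccontr)
    assume nz: "gen boundary_Omega g h z \<noteq> 0"
    note D = gen_nonzeroD[OF boundary_subset_Omega add_gen.hyps(2) nz]
    have "h (char_of z) \<noteq> 0" using nz by (auto simp: gen_def split: if_splits)
    thus False using add_gen.hyps(4) D(2,3) by simp
   qed
  qed
  thus ?case unfolding restrict_add restrict_gen[OF add_gen.hyps(2)] add_gen.IH by simp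
 qed (simp add: restrict_to_boundary_def fun_eq_iff)
 show "bnorm f = 0" unfolding bnorm_def boundary_groupoid_eq * by (rule boundary_ci.rnorm_zero)
qed

lemma bnorm_le_rho:
 assumes "strongly_cstar_regular_on_boundary TYPE('a::left_cancel_monoid)" "(f :: 'a germ_fun) \<in> CcP"
 shows "bnorm f \<le> rho_nrm f"
 by (rule bnorm_le[OF assms(2) op_norm_nonneg[OF rho_bounded[OF assms(2)]] fibre_rep_le_rho[OF assms(1) _ assms(2)]])

subsection \<open>The boundary ideal\<close>

lemma boundary_ideal_eq: "boundary_ideal = \<Inter>{J. closed_ideal \<M> J \<and>
  {projection_op (X - \<Union>\<X>) | X \<X>. \<X> \<noteq> {} \<and> foundation_set \<X> X} \<subseteq> J}"
 unfolding boundary_ideal_def generated_closed_ideal_def ..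

text \<open>The indicator of a basic clopen set, placed on the units, is mapped to the projection
  onto the trace of that set; by \<open>foundation_set_boundary\<close> the basic set misses the
  boundary.\<close>

lemma foundation_projection:
 fixes X :: "'a::left_cancel_monoid set"
 assumes fs: "foundation_set \<X> X"
 shows "\<exists>u\<in>CcOff. projection_op (X - \<Union>\<X>) = rho_Cc u"
proof -
 have X: "X \<in> \<J>" "finite \<X>" "\<X> \<subseteq> \<J>" using fs by (simp_all add: foundation_set_def)
 let ?B = "basic_open X \<X>"
 let ?h = "\<lambda>w. if w \<in> ?B then 1 else (0::complex)"
 have c: "continuous_map (dom_top Omega Some) euclidean ?h"
  by (rule continuous_map_from_subtopology, rule continuous_map_clopen_piece[OF basic_open_clopen[OF X]]) simp
 have d: "\<forall>w\<in>dom_chars Omega Some. ?h w \<noteq> 0 \<longrightarrow> w \<notin> boundary_Omega"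
  using foundation_set_boundary[OF fs] by (auto simp: basic_open_def)
 have p: "pinv Some = (Some :: 'a => _)"
 proof -
  have "Some |` UNIV = (Some :: 'a => _)" by (simp add: restrict_map_def)
  thus ?thesis using partial_inverse_identity[OF UNIV_ideal, where 'a = 'a] by (simp only:)
 qed
 have "pt t \<in> ?B \<longleftrightarrow> t \<in> X - \<Union>\<X>" for t using trace_basic_open[OF X(1,3)] unfolding trace_def by blast
 hence "rho_Cc (gen Omega Some ?h) = projection_op (X - \<Union>\<X>)"
  unfolding rho_gen[OF Some_hull] projection_op_def p by (intro restrict_ext ext) (simp add: wvec_def)
 thus ?thesis using gen_span_gen[OF Some_hull c d] by metis
qed

lemma closed_ideal_Inter:
 assumes "\<K> \<noteq> {}" "\<And>J. J \<in> \<K> ==> closed_ideal A J"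
 shows "closed_ideal A (\<Inter>\<K>)"
proof -
 note D = assms(2)[unfolded closed_ideal_def]
 show ?thesis
  unfolding closed_ideal_def
 proof (intro conjI ballI allI InterI)
  show "\<Inter>\<K> \<subseteq> elems A" using assms(1) D by fast
  show "zer A \<in> J" if "J \<in> \<K>" for J using D[OF that] by blast
  show "add A a b \<in> J" if "a \<in> \<Inter>\<K>" "b \<in> \<Inter>\<K>" "J \<in> \<K>" for a b J using D[OF that(3)] that by blast
  show "scl A c a \<in> J" if "a \<in> \<Inter>\<K>" "J \<in> \<K>" for c a J using D[OF that(2)] that by blast
  show "mul A a b \<in> J" "mul A b a \<in> J" if "a \<in> \<Inter>\<K>" "b \<in> elems A" "J \<in> \<K>" for a b J using D[OF that(3)] that by blast+
  show "norm_closed A (\<Inter>\<K>)"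
   unfolding norm_closed_def
  proof (intro allI ballI impI InterI)
   fix F a J assume a: "a \<in> elems A" "(\<forall>n. F n \<in> \<Inter>\<K>) \<and> vanishes (\<lambda>n. dst A (F n) a)" "J \<in> \<K>"
   have "norm_closed A J" using D[OF a(3)] by blast
   moreover have "\<forall>n. F n \<in> J" using a by blast
   ultimately show "a \<in> J" using a(1,2) unfolding norm_closed_def by blast
  qed
 qed
qed

lemma foundation_projection_Bel: "foundation_set \<X> X ==> projection_op (X - \<Union>\<X>) \<in> Bel"
 using foundation_projection[of \<X> X] rho_in_monoid by metis

lemma closed_ideal_elems:
 fixes A :: "'b star_algebra"
 assumes "seminormed_mul A" shows "closed_ideal A (elems A)"
proof -
 interpret seminormed_mul A by fact
 show ?thesis unfolding closed_ideal_def norm_closed_def by simp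
qed

text \<open>An intersection of closed ideals is one as long as the family is nonempty. The whole
  algebra belongs to the family, because the generating projections lie in C*_r(S).\<close>

lemma boundary_ideal_closed: "closed_ideal \<M> (boundary_ideal :: 'a::left_cancel_monoid op set)"
 unfolding boundary_ideal_eq
proof (rule closed_ideal_Inter)
 interpret B: seminormed_algebra "\<M> :: 'a op star_algebra" by (rule seminormed_algebra_monoid)
 have "Bel \<in> {J. closed_ideal \<M> J \<and>
  {projection_op (X - \<Union>\<X>) | X \<X>. \<X> \<noteq> {} \<and> foundation_set \<X> X} \<subseteq> (J :: 'a op set)}"
  using closed_ideal_elems[OF B.seminormed_mul_axioms] foundation_projection_Bel by blast
 thus "{J. closed_ideal \<M> J \<and>
  {projection_op (X - \<Union>\<X>) | X \<X>. \<X> \<noteq> {} \<and> foundation_set \<X> X} \<subseteq> (J :: 'a op set)} \<noteq> {}" by blast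
qed blast

lemma boundary_ideal_least:
 assumes "closed_ideal \<M> J" "\<And>X \<X>. \<X> \<noteq> {} ==> foundation_set \<X> X ==> projection_op (X - \<Union>\<X>) \<in> J"
 shows "boundary_ideal \<subseteq> J"
 unfolding boundary_ideal_eq using assms by blast

lemma boundary_idealD:
 fixes a b :: "'a::left_cancel_monoid op"
 shows "a \<in> boundary_ideal ==> a \<in> Bel" "zer Bop \<in> (boundary_ideal :: 'a op set)"
  "a \<in> boundary_ideal ==> b \<in> boundary_ideal ==> add Bop a b \<in> boundary_ideal"
  "a \<in> boundary_ideal ==> scl Bop c a \<in> boundary_ideal"
  "a \<in> boundary_ideal ==> b \<in> Bel ==> mul Bop a b \<in> boundary_ideal"
  "a \<in> boundary_ideal ==> b \<in> Bel ==> mul Bop b a \<in> boundary_ideal"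
 using boundary_ideal_closed[where 'a = 'a] unfolding closed_ideal_def monoid_cstar_algebra_simps by blast+

lemma boundary_ideal_limit:
 fixes F :: "nat => 'a::left_cancel_monoid op"
 assumes "\<And>n. F n \<in> boundary_ideal" "T \<in> Bel" "vanishes (\<lambda>n. dst Bop (F n) T)"
 shows "T \<in> boundary_ideal"
proof -
 have "norm_closed \<M> (boundary_ideal :: 'a op set)" using boundary_ideal_closed unfolding closed_ideal_def by blast
 thus ?thesis using assms unfolding norm_closed_def dst_monoid by blast
qed

text \<open>The generators are indexed by nonempty families. With the empty family \<open>X\<close>
  itself has to be empty, since otherwise \<open>X\<close> would be a nonempty ideal meeting no
  member; the projection is then zero.\<close>

lemma foundation_projection_ideal:
 assumes fs: "foundation_set \<X> X" shows "projection_op (X - \<Union>\<X>) \<in> boundary_ideal"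
proof (cases "\<X> = {}")
 case True
 have "X \<in> \<J>" "\<X> = {}" using fs True by (simp_all add: foundation_set_def)
 hence "X = {}" using fs unfolding foundation_set_def by (metis empty_iff order_refl)
 hence "projection_op (X - \<Union>\<X>) = zer Bop" by (simp add: projection_op_def)
 thus ?thesis using boundary_idealD(2) by simp
next
 case False
 thus ?thesis unfolding boundary_ideal_eq using fs by blast
qed

text \<open>The elements of the algebra whose adjoint lies in the ideal form a closed ideal, because
  taking adjoints is isometric and reverses products; it contains the generators, which are
  self-adjoint.\<close>

lemma boundary_ideal_adj:
 fixes T :: "'a::left_cancel_monoid op"
 assumes "T \<in> boundary_ideal" shows "adj Bop T \<in> boundary_ideal"
proof -
 interpret B: seminormed_algebra "\<M> :: 'a op star_algebra" by (rule seminormed_algebra_monoid)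
 let ?J = "{T \<in> Bel. adj Bop T \<in> (boundary_ideal :: 'a op set)}"
 note s = monoid_cstar_algebra_simps
 have "boundary_ideal \<subseteq> ?J"
 proof (rule boundary_ideal_least)
  show "closed_ideal \<M> ?J"
   unfolding closed_ideal_def s
  proof (intro conjI ballI allI)
   show "?J \<subseteq> Bel" by blast
   have "adj Bop (zer Bop) = zer (op_algebra (UNIV :: 'a set))"
    using adj_op_algebra[OF adjoint_pair_zero] by simp
   thus "zer Bop \<in> ?J" using monoid_zer boundary_idealD(2) by simp
   show "add Bop a b \<in> ?J" if "a \<in> ?J" "b \<in> ?J" for a b :: "'a op"
    using that by (simp only: mem_Collect_eq monoid_add boundary_idealD(3) B.adj_add[unfolded s])
   show "scl Bop c a \<in> ?J" if "a \<in> ?J" for c and a :: "'a op"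
    using that by (simp only: mem_Collect_eq monoid_scl boundary_idealD(4) B.adj_scl[unfolded s])
   show "mul Bop a b \<in> ?J" "mul Bop b a \<in> ?J" if "a \<in> ?J" "b \<in> Bel" for a b :: "'a op"
   proof -
    have e: "adj Bop (mul Bop x y) = mul Bop (adj Bop y) (adj Bop x)"
     if "x \<in> Bel" "y \<in> Bel" for x y :: "'a op"
     using adj_op_algebra[OF adjoint_pair_mul[OF monoid_adjoint_pair[OF that(1)] monoid_adjoint_pair[OF that(2)]]] by simp
    show "mul Bop a b \<in> ?J" "mul Bop b a \<in> ?J"
     using that by (simp_all only: mem_Collect_eq monoid_mul boundary_idealD(5,6) monoid_adj e)
   qed
   show "norm_closed \<M> ?J"
    unfolding norm_closed_def
   proof (intro allI ballI impI)
    fix F :: "nat => 'a op" and a assume a: "a \<in> Bel" and F: "(\<forall>n. F n \<in> ?J) \<and> vanishes (\<lambda>n. dst \<M> (F n) a)"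
    have FB: "F n \<in> Bel" "adj Bop (F n) \<in> boundary_ideal" for n using F by blast+
    have "dst Bop (adj Bop (F n)) (adj Bop a) = dst \<M> (F n) a" for n
     using B.dst_adj[OF FB(1) a] unfolding s dst_monoid .
    hence "adj Bop a \<in> boundary_ideal"
     using boundary_ideal_limit[where F = "\<lambda>n. adj Bop (F n)", OF FB(2) monoid_adj[OF a]] F by simp
    thus "a \<in> ?J" using a by blast
   qed
  qed
  fix X :: "'a set" and \<X> assume fs: "foundation_set \<X> X"
  let ?P = "projection_op (X - \<Union>\<X>)"
  have "X - \<Union>\<X> = X - \<Union>\<X> \<and> adjoint_pair UNIV ?P ?P"
   unfolding adjoint_pair_def
  proof (intro conjI ballI projection_bounded refl)
   fix \<xi> \<eta> :: "'a => complex" assume "\<xi> \<in> ell2 UNIV" "\<eta> \<in> ell2 UNIV"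
   thus "ell2_inner (?P \<xi>) \<eta> = ell2_inner \<xi> (?P \<eta>)"
    unfolding ell2_inner_def projection_op_def by (intro infsum_cong) simp
  qed
  hence "adj Bop ?P = ?P" using adj_op_algebra by blast
  thus "?P \<in> ?J" using foundation_projection_ideal[OF fs] boundary_idealD(1) by simp
 qed
 thus ?thesis using assms by blast
qed

text \<open>Limits of \<open>rho_Cc (u n)\<close> with \<open>bnorm (u n)\<close> tending to \<open>0\<close> form a closed ideal that contains the generators.\<close>

lemma boundary_ideal_rho_lim:
 fixes T :: "'a::left_cancel_monoid op"
 assumes reg: "strongly_cstar_regular_on_boundary TYPE('a)" and T: "T \<in> boundary_ideal"
 shows "\<exists>u. rho_lim u T \<and> vanishes (\<lambda>n. bnorm (u n))"
proof -
 let ?J = "{T :: 'a op. \<exists>u. rho_lim u T \<and> vanishes (\<lambda>n. bnorm (u n))}"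
 note s = monoid_cstar_algebra_simps
 \<comment> \<open>Only \<open>u\<close> is small on the boundary, while \<open>v\<close> merely
   converges under \<open>rho_Cc\<close>. Regularity bounds \<open>bnorm (v n)\<close> by the
   convergent sequence \<open>rho_nrm (v n)\<close>, so the products are small on the boundary as
   well.\<close>
 have conv0: "vanishes (\<lambda>n. bnorm (convolution \<G> (u n) (v n))) \<and> vanishes (\<lambda>n. bnorm (convolution \<G> (v n) (u n)))"
  if uv: "rho_lim u S" "rho_lim v S'" "vanishes (\<lambda>n. bnorm (u n))" for u v and S S' :: "'a op"
 proof -
  note D = rho_limD[OF uv(1)] rho_limD[OF uv(2)]
  have "vanishes (\<lambda>n. bnorm (u n) * rho_nrm (v n))" using tendsto_mult[OF uv(3) rho_lim_nrm[OF uv(2)]] by simp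
  moreover have "bnorm (convolution \<G> (u n) (v n)) \<le> bnorm (u n) * rho_nrm (v n)" for n
   using bnorm_conv[OF D(1)[of n] D(5)[of n]] mult_left_mono[OF bnorm_le_rho[OF reg D(5)[of n]] bnorm_nonneg[OF D(1)[of n]]] by linarith
  moreover have "bnorm (convolution \<G> (v n) (u n)) \<le> bnorm (u n) * rho_nrm (v n)" for n
   using bnorm_conv[OF D(5)[of n] D(1)[of n]] mult_right_mono[OF bnorm_le_rho[OF reg D(5)[of n]] bnorm_nonneg[OF D(1)[of n]]]
   by (simp add: mult.commute)
  moreover have "0 \<le> bnorm (convolution \<G> (u n) (v n))" "0 \<le> bnorm (convolution \<G> (v n) (u n))" for n
   by (rule bnorm_nonneg[OF conv_P_gen_span]; rule D)+
  ultimately show ?thesis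
   by (intro conjI) (rule tendsto_sandwich[OF _ _ tendsto_const], auto)+
 qed
 have "boundary_ideal \<subseteq> ?J"
 proof (rule boundary_ideal_least)
  show "closed_ideal \<M> ?J"
   unfolding closed_ideal_def s
  proof (intro conjI ballI allI)
   show "?J \<subseteq> Bel" using rho_lim_monoid by blast
   have "bnorm (\<lambda>_ :: 'a germ. 0) = 0" by (rule restrict_off_boundary(2)[OF gen_span.zero])
   thus "zer Bop \<in> ?J" using rho_lim_const[OF gen_span.zero] unfolding rho_zero
    by (intro CollectI exI[of _ "\<lambda>_ _. 0"]) simp
   show "add Bop a b \<in> ?J" if ab: "a \<in> ?J" "b \<in> ?J" for a b :: "'a op"
   proof -
    obtain u v where u: "rho_lim u a" "vanishes (\<lambda>n. bnorm (u n))" and v: "rho_lim v b" "vanishes (\<lambda>n. bnorm (v n))" using ab by blast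
    note D = rho_limD(1)[OF u(1)] rho_limD(1)[OF v(1)]
    have "vanishes (\<lambda>n. bnorm (\<lambda>z. u n z + v n z))"
    proof (rule tendsto_sandwich[OF _ _ tendsto_const])
     show "\<forall>\<^sub>F n in sequentially. 0 \<le> bnorm (\<lambda>z. u n z + v n z)" by (intro always_eventually allI bnorm_nonneg gen_span_add D)
     show "\<forall>\<^sub>F n in sequentially. bnorm (\<lambda>z. u n z + v n z) \<le> bnorm (u n) + bnorm (v n)" by (intro always_eventually allI bnorm_add D)
     show "vanishes (\<lambda>n. bnorm (u n) + bnorm (v n))" using tendsto_add[OF u(2) v(2)] by simp
    qed
    thus ?thesis using rho_lim_add[OF u(1) v(1)] by blast
   qed
   show "scl Bop c a \<in> ?J" if a: "a \<in> ?J" for c and a :: "'a op"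
   proof -
    obtain u where u: "rho_lim u a" "vanishes (\<lambda>n. bnorm (u n))" using a by blast
    have "vanishes (\<lambda>n. bnorm (\<lambda>z. c * u n z))" unfolding bnorm_scale[OF rho_limD(1)[OF u(1)]] by (rule tendsto_mult_right_zero[OF u(2)])
    thus ?thesis using rho_lim_scl[OF u(1), of c] by blast
   qed
   show "mul Bop a b \<in> ?J" "mul Bop b a \<in> ?J" if ab: "a \<in> ?J" "b \<in> Bel" for a b :: "'a op"
   proof -
    obtain u where u: "rho_lim u a" "vanishes (\<lambda>n. bnorm (u n))" using ab(1) by blast
    obtain v where v: "rho_lim v b" using monoid_rho_lim[OF ab(2)] by blast
    show "mul Bop a b \<in> ?J" "mul Bop b a \<in> ?J"
     using conv0[OF u(1) v u(2)] rho_lim_mul[OF u(1) v] rho_lim_mul[OF v u(1)] by blast+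
   qed
   show "norm_closed \<M> ?J"
    unfolding norm_closed_def dst_monoid
   proof (intro allI ballI impI)
    fix F :: "nat => 'a op" and a assume a: "a \<in> Bel" and F: "(\<forall>n. F n \<in> ?J) \<and> vanishes (\<lambda>n. dst Bop (F n) a)"
    have "\<exists>f. rho_lim f a \<and> (\<forall>n. bnorm (f n) < 1 / (real n + 1))"
    proof (rule rho_lim_diagonal[where F = F and Q = "\<lambda>f. vanishes (\<lambda>n. bnorm (f n))"])
     show "\<exists>f. rho_lim f (F n) \<and> vanishes (\<lambda>n. bnorm (f n))" for n using F by blast
     show "a \<in> bounded_ops UNIV" by (rule monoid_bounded[OF a])
     show "vanishes (\<lambda>n. dst Bop (F n) a)" using F by blast
     show "\<forall>\<^sub>F n in sequentially. bnorm (f n) < e" if "vanishes (\<lambda>n. bnorm (f n))" "e > 0" for f :: "nat => 'a germ_fun" and e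
      by (rule order_tendstoD(2)[OF that])
    qed
    then obtain f where f: "rho_lim f a" "\<forall>n. bnorm (f n) < 1 / (real n + 1)" by blast
    have "vanishes (\<lambda>n. bnorm (f n))"
    proof (rule tendsto_sandwich[OF _ _ tendsto_const])
     show "\<forall>\<^sub>F n in sequentially. 0 \<le> bnorm (f n)" by (intro always_eventually allI bnorm_nonneg rho_limD(1)[OF f(1)])
     show "\<forall>\<^sub>F n in sequentially. bnorm (f n) \<le> 1 / (real n + 1)" using f(2) by (simp add: less_imp_le)
     show "vanishes (\<lambda>n. 1 / (real n + 1))" using LIMSEQ_inverse_real_of_nat by (simp add: inverse_eq_divide add.commute)
    qed
    thus "a \<in> ?J" using f(1) by blast
   qed
  qed
  fix X :: "'a set" and \<X> assume fs: "foundation_set \<X> X"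
  obtain u where u: "u \<in> CcOff" "projection_op (X - \<Union>\<X>) = rho_Cc u"
   using foundation_projection[OF fs] by blast
  show "projection_op (X - \<Union>\<X>) \<in> ?J"
   unfolding u(2) using rho_lim_const[OF off_boundary_span[OF u(1)]] restrict_off_boundary(2)[OF u(1)]
   by (intro CollectI exI[of _ "\<lambda>_. u"]) simp
 qed
 thus ?thesis using T by blast
qed

text \<open>If \<open>u\<close> approximates \<open>T\<close>, then adding \<open>u n\<close> to
  \<open>f\<close> changes it by something negligible on the boundary, while the norm of the sum
  under \<open>rho_Cc\<close> tends to that of the perturbed operator. This is the lower bound for
  the quotient norm modulo the ideal.\<close>

lemma bnorm_le_ideal:
 fixes T :: "'a::left_cancel_monoid op"
 assumes reg: "strongly_cstar_regular_on_boundary TYPE('a)" and T: "T \<in> boundary_ideal" and f: "f \<in> CcP"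
 shows "bnorm f \<le> op_norm UNIV (add Bop (rho_Cc f) T)"
proof -
 obtain u where u: "rho_lim u T" "vanishes (\<lambda>n. bnorm (u n))" using boundary_ideal_rho_lim[OF reg T] by blast
 note D = rho_limD(1)[OF u(1)]
 let ?v = "\<lambda>n z. f z + u n z"
 have v: "rho_lim ?v (add Bop (rho_Cc f) T)" by (rule rho_lim_add[OF rho_lim_const[OF f] u(1)])
 have "bnorm f \<le> rho_nrm (?v n) + bnorm (u n)" for n
 proof -
  have vn: "?v n \<in> CcP" by (rule gen_span_add[OF f D])
  have "bnorm (\<lambda>z. ?v n z + (-1) * u n z) \<le> bnorm (?v n) + bnorm (\<lambda>z. (-1) * u n z)"
   by (rule bnorm_add[OF vn gen_span_scale[OF D]])
  hence "bnorm f \<le> bnorm (?v n) + bnorm (u n)" unfolding bnorm_scale[OF D] by simp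
  thus ?thesis using bnorm_le_rho[OF reg vn] by linarith
 qed
 thus ?thesis
  using tendsto_lowerbound[OF tendsto_add[OF rho_lim_nrm[OF v] u(2)], of "bnorm f"] by simp
qed

lemma projection_Union_ideal:
 assumes "finite \<P>" "\<forall>P\<in>\<P>. projection_op P \<in> boundary_ideal"
 shows "projection_op (\<Union>\<P>) \<in> (boundary_ideal :: 'a::left_cancel_monoid op set)"
 using assms
proof induction
 case empty
 have "projection_op (\<Union>{}) = zer (op_algebra (UNIV :: 'a set))" by (simp add: projection_op_def)
 thus ?case using boundary_idealD(2) by (simp only:)
next
 case (insert P \<P>)
 have i: "projection_op P \<in> boundary_ideal" "projection_op (\<Union>\<P>) \<in> boundary_ideal" using insert by simp_all
 let ?p = "\<lambda>P t. if t \<in> P then 1 else (0::complex)"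
 have pb: "mult_op (?p Q) \<in> bounded_ops UNIV" for Q :: "'a set" using projection_bounded unfolding projection_op_mult .
 \<comment> \<open>For the commuting projections P and Q onto two sets, P + Q - P Q projects onto
   the union.\<close>
 have "add Bop (add Bop (projection_op P) (projection_op (\<Union>\<P>)))
   (scl Bop (-1) (mul Bop (projection_op P) (projection_op (\<Union>\<P>)))) = projection_op (\<Union>(insert P \<P>))"
  unfolding projection_op_mult mult_op_mul[OF pb] mult_op_scl mult_op_add
  by (rule arg_cong[where f = mult_op]) auto
 thus ?case using boundary_idealD(3)[OF boundary_idealD(3)[OF i] boundary_idealD(4)[OF boundary_idealD(5)[OF i(1) boundary_idealD(1)[OF i(2)]]]] by metis
qed

text \<open>The set \<open>?K\<close>, where \<open>h\<close> has absolute value at least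
  \<open>e\<close>, is compact and misses the boundary, so finitely many basic sets off the boundary
  cover it. Each of them yields a foundation set, and the projection onto the union of their traces
  lies in the ideal. Multiplying the operator by this projection changes it only where
  \<open>h\<close> is smaller than \<open>e\<close>.\<close>

lemma rho_off_boundary_gen:
 fixes g :: "'a::left_cancel_monoid \<rightharpoonup> 'a"
 assumes g: "g \<in> \<I>" and h: "continuous_map (dom_top Omega g) euclidean h"
  and off: "\<forall>w\<in>dom_chars Omega g. h w \<noteq> 0 \<longrightarrow> w \<notin> boundary_Omega"
 shows "rho_Cc (gen Omega g h) \<in> boundary_ideal"
proof -
 let ?k = "\<lambda>t. h (pt t)" and ?Z = "dom_chars Omega g" and ?T = "rho_Cc (gen Omega g h)"
 have TB: "?T \<in> Bel" by (rule rho_gen_in_monoid[OF g h])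
 have Zc: "closedin \<O> ?Z" by (rule closedin_Omega_ideal[OF dom_hull[OF g]])
 have ap: "\<exists>S\<in>boundary_ideal. dst Bop S ?T \<le> e" if e: "e > 0" for e
 proof -
  let ?K = "{w \<in> topspace (subtopology \<O> ?Z). h w \<in> - ball 0 e}"
  have "closedin (subtopology \<O> ?Z) ?K" by (rule closedin_continuous_map_preimage[OF h]) (simp add: closed_Compl)
  hence K: "closedin \<O> ?K" by (rule closedin_trans_full[OF _ Zc])
  have Kd: "w \<notin> boundary_Omega" if "w \<in> ?K" for w using that off e by auto
  let ?Q = "\<lambda>U. U \<inter> boundary_Omega = {}"
  have "\<exists>\<B>. finite \<B> \<and> ?K \<subseteq> \<Union>\<B> \<and> (\<forall>V\<in>\<B>. ?Q V \<and> (\<exists>X \<X>. X \<in> \<J> \<and> finite \<X> \<and>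
    \<X> \<subseteq> \<J> \<and> (\<forall>X'\<in>\<X>. X' \<subseteq> X) \<and> V = basic_open X \<X>))"
  proof (rule basic_cover[where Q = ?Q, OF K])
   fix w assume w: "w \<in> ?K"
   have "openin \<O> (Omega - boundary_Omega :: ('a set => bool) set)" using closedin_boundary[where 'a = 'a] by (simp add: closedin_def)
   moreover have "w \<in> Omega" using w by simp
   ultimately show "\<exists>U. openin \<O> U \<and> w \<in> U \<and> ?Q U" using Kd[OF w] by (intro exI[of _ "Omega - boundary_Omega"]) blast
  qed blast
  then obtain \<B> where B: "finite \<B>" "?K \<subseteq> \<Union>\<B>" "\<forall>V\<in>\<B>. ?Q V \<and> (\<exists>X \<X>. X \<in> \<J> \<and> finite \<X> \<and>
    \<X> \<subseteq> \<J> \<and> (\<forall>X'\<in>\<X>. X' \<subseteq> X) \<and> V = basic_open X \<X>)" by (elim exE conjE)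
  let ?U = "\<Union>(trace ` \<B>)"
  have PI: "projection_op ?U \<in> boundary_ideal"
  proof (rule projection_Union_ideal)
   show "finite (trace ` \<B>)" using B(1) by simp
   show "\<forall>P\<in>trace ` \<B>. projection_op P \<in> boundary_ideal"
   proof (rule ballI, elim imageE)
    fix P V assume V: "P = trace V" "V \<in> \<B>"
    then obtain X \<X> where X: "X \<in> \<J>" "finite \<X>" "\<X> \<subseteq> \<J>" "\<forall>X'\<in>\<X>. X' \<subseteq> X" "V = basic_open X \<X>"
     using B(3) by meson
    have "?Q V" using B(3) V(2) by (meson bspec)
    hence "foundation_set \<X> X" using foundation_set_if_disjoint_boundary[OF X(1-4)] X(5) by simp
    thus "projection_op P \<in> boundary_ideal" using foundation_projection_ideal unfolding V(1) X(5) trace_basic_open[OF X(1,3)] by blast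
   qed
  qed
  let ?p = "\<lambda>t. if t \<in> ?U then 1 else (0::complex)"
  let ?S = "mul Bop ?T (projection_op ?U)"
  have "op_diff UNIV ?S ?T = (\<lambda>x\<in>ell2 UNIV. wvec (pinv g) (\<lambda>t. ?k t * (?p t - 1)) x)"
  proof
   fix x show "op_diff UNIV ?S ?T x = (\<lambda>x\<in>ell2 UNIV. wvec (pinv g) (\<lambda>t. ?k t * (?p t - 1)) x) x"
   proof (cases "x \<in> ell2 UNIV")
    case True
    have "projection_op ?U x \<in> ell2 UNIV" by (rule bounded_ops_maps[OF projection_bounded True])
    thus ?thesis using True unfolding rho_gen[OF g] op_diff_def projection_op_mult
     by (auto simp: wvec_def mult_op_def fun_eq_iff algebra_simps split: option.splits)
   qed (simp add: op_diff_def)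
  qed
  moreover have "cmod (?k t * (?p t - 1)) \<le> e" if t: "t \<in> dom g" for t
  proof (cases "t \<in> ?U")
   case False
   hence "pt t \<notin> ?K" using B(2) unfolding trace_def by blast
   hence "cmod (?k t) < e" using t g by simp
   thus ?thesis using False by simp
  qed (use e in simp)
  ultimately have "dst Bop ?S ?T \<le> e" unfolding dst_op_algebra using wop_hull_bounded(2)[OF g] e by simp
  moreover have "?S \<in> boundary_ideal" by (rule boundary_idealD(6)[OF PI TB])
  ultimately show ?thesis by blast
 qed
 have "\<forall>n::nat. \<exists>S\<in>boundary_ideal. dst Bop S ?T \<le> 1 / (real n + 1)" by (rule allI, rule ap) simp
 then obtain F where F: "\<And>n. F n \<in> boundary_ideal" "\<And>n::nat. dst Bop (F n) ?T \<le> 1 / (real n + 1)" by metis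
 have "vanishes (\<lambda>n. 1 / (real n + 1))" using LIMSEQ_inverse_real_of_nat by (simp add: inverse_eq_divide add.commute)
 hence "vanishes (\<lambda>n. dst Bop (F n) ?T)"
  using monoid_bounded[OF boundary_idealD(1)[OF F(1)]] monoid_bounded[OF TB] by (intro op.tendsto_dst_0[OF _ _ F(2)]) simp_all
 thus ?thesis by (rule boundary_ideal_limit[OF F(1) TB])
qed

lemma rho_off_boundary:
 fixes f :: "'a::left_cancel_monoid germ_fun"
 assumes "f \<in> CcOff"
 shows "rho_Cc f \<in> boundary_ideal"
 using assms
proof induction
 case zero
 show ?case unfolding rho_zero op_algebra_simps(2)[symmetric] by (rule boundary_idealD(2))
next
 case (add_gen f g h)
 show ?case unfolding rho_add[OF gen_span_True_add_gen[OF add_gen.hyps(1-3)]] op_algebra_simps(3)[symmetric]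
  by (rule boundary_idealD(3)[OF add_gen.IH rho_off_boundary_gen[OF add_gen.hyps(2-4)]])
qed

subsection \<open>An iteration that separates the boundary norm from the reduced norm\<close>

text \<open>In the expanded square the cross term contributes
  \<open>-2 * (ell2_norm (T' v))\<^sup>2 / M\<^sup>2\<close>, and the quadratic term gives back at
  most half of it because \<open>T\<close> has norm at most \<open>M\<close>.\<close>

lemma hilbert_step:
 assumes p: "adjoint_pair I T T'" and M: "op_norm I T \<le> M" "0 < M" and v: "v \<in> ell2 I"
 shows "(\<lambda>i. v i + complex_of_real (- (1 / M\<^sup>2)) * T (T' v) i) \<in> ell2 I"
  "(ell2_norm (\<lambda>i. v i + complex_of_real (- (1 / M\<^sup>2)) * T (T' v) i))\<^sup>2 \<le> (ell2_norm v)\<^sup>2 - (ell2_norm (T' v))\<^sup>2 / M\<^sup>2"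
proof -
 note D = adjoint_pairD[OF p]
 have T'v: "T' v \<in> ell2 I" by (rule bounded_ops_maps[OF D(2) v])
 have TTv: "T (T' v) \<in> ell2 I" by (rule bounded_ops_maps[OF D(1) T'v])
 let ?c = "complex_of_real (1 / M\<^sup>2)"
 have c: "(\<lambda>i. ?c * T (T' v) i) \<in> ell2 I" by (rule ell2_scale(1)[OF TTv])
 have e: "(\<lambda>i. v i + complex_of_real (- (1 / M\<^sup>2)) * T (T' v) i) = (\<lambda>i. v i - ?c * T (T' v) i)" by simp
 show "(\<lambda>i. v i + complex_of_real (- (1 / M\<^sup>2)) * T (T' v) i) \<in> ell2 I" unfolding e by (rule ell2_diff(1)[OF v c])
 have "ell2_inner v (T (T' v)) = cnj (ell2_inner (T (T' v)) v)" by (rule ell2_inner_commute)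
 also have "\<dots> = complex_of_real ((ell2_norm (T' v))\<^sup>2)" unfolding D(3)[OF T'v v] ell2_inner_self[OF T'v] by simp
 finally have i: "ell2_inner v (\<lambda>i. ?c * T (T' v) i) = complex_of_real ((ell2_norm (T' v))\<^sup>2 / M\<^sup>2)"
  unfolding ell2_inner_scale_right by simp
 have "ell2_norm (T (T' v)) \<le> M * ell2_norm (T' v)"
  using op_norm_bound[OF D(1) T'v] mult_right_mono[OF M(1), of "ell2_norm (T' v)"] by simp
 hence "(ell2_norm (T (T' v)))\<^sup>2 \<le> (M * ell2_norm (T' v))\<^sup>2" by (rule power_mono) simp
 hence "(ell2_norm (T (T' v)) / M\<^sup>2)\<^sup>2 \<le> (M * ell2_norm (T' v))\<^sup>2 / (M\<^sup>2)\<^sup>2"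
  unfolding power_divide by (rule divide_right_mono) simp
 also have "\<dots> = (ell2_norm (T' v))\<^sup>2 / M\<^sup>2" using M(2) by (simp add: power2_eq_square field_simps)
 finally have n: "(ell2_norm (\<lambda>i. ?c * T (T' v) i))\<^sup>2 \<le> (ell2_norm (T' v))\<^sup>2 / M\<^sup>2"
  unfolding ell2_scale(2)[OF TTv] by (simp add: norm_divide norm_power)
 show "(ell2_norm (\<lambda>i. v i + complex_of_real (- (1 / M\<^sup>2)) * T (T' v) i))\<^sup>2 \<le> (ell2_norm v)\<^sup>2 - (ell2_norm (T' v))\<^sup>2 / M\<^sup>2"
  unfolding e ell2_norm_diff_power2[OF v c] i using n by simp
qed

text \<open>The vectors are \<open>v n = (1 - T T' / M\<^sup>2) ^ n (T \<xi>) = T (w n)\<close>. The squared norms of the \<open>v n\<close> decrease and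
 sum to at most \<open>M\<^sup>2 \<parallel>\<xi>\<parallel>\<^sup>2\<close>, because \<open>\<parallel>w n\<parallel>\<^sup>2\<close> drops by \<open>\<parallel>v n\<parallel>\<^sup>2 / M\<^sup>2\<close> in each step.\<close>

lemma hilbert_iteration:
 assumes p: "adjoint_pair I T T'" and M: "op_norm I T \<le> M" "0 < M" and x: "\<xi> \<in> ell2 I"
  and v0: "v 0 = T \<xi>" and vS: "\<And>n. v (Suc n) = (\<lambda>i. v n i + complex_of_real (- (1 / M\<^sup>2)) * T (T' (v n)) i)"
 shows "v n \<in> ell2 I" "ell2_norm (v n) \<le> ell2_norm (T \<xi>)" "real (Suc n) * (ell2_norm (v n))\<^sup>2 \<le> M\<^sup>2 * (ell2_norm \<xi>)\<^sup>2"
proof -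
 note D = adjoint_pairD[OF p]
 have p': "adjoint_pair I T' T" by (rule adjoint_pair_sym[OF p])
 have M': "op_norm I T' \<le> M" using adjoint_pair_norm[OF p] M(1) by simp
 define c where "c = complex_of_real (- (1 / M\<^sup>2))"
 define w where "w = rec_nat \<xi> (\<lambda>_ u i. u i + c * T' (T u) i)"
 have w0: "w 0 = \<xi>" and wS: "w (Suc n) = (\<lambda>i. w n i + c * T' (T (w n)) i)" for n by (simp_all add: w_def)
 have w: "w n \<in> ell2 I" for n
  by (induction n) (use hilbert_step(1)[OF p' M' M(2)] x in \<open>simp_all add: w0 wS c_def\<close>)
 have vw: "v n = T (w n)" for n
 proof (induction n)
  case (Suc n)
  have TT: "T' (T (w n)) \<in> ell2 I" by (rule bounded_ops_maps[OF D(2) bounded_ops_maps[OF D(1) w]])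
  show ?case unfolding vS wS bounded_ops_add[OF D(1) w ell2_scale(1)[OF TT]] bounded_ops_scale[OF D(1) TT] Suc c_def ..
 qed (simp add: v0 w0)
 show v: "v n \<in> ell2 I" for n unfolding vw by (rule bounded_ops_maps[OF D(1) w])
 have dec: "ell2_norm (v (Suc n)) \<le> ell2_norm (v n)" for n
 proof (rule power2_le_imp_le[OF _ ell2_norm_nonneg])
  have "0 \<le> (ell2_norm (T' (v n)))\<^sup>2 / M\<^sup>2" by simp
  thus "(ell2_norm (v (Suc n)))\<^sup>2 \<le> (ell2_norm (v n))\<^sup>2"
   using hilbert_step(2)[OF p M v[of n]] unfolding vS by linarith
 qed
 show "ell2_norm (v n) \<le> ell2_norm (T \<xi>)"
 proof (induction n)
  case (Suc n)
  thus ?case using dec[of n] by linarith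
 qed (simp add: v0)
 \<comment> \<open>In one step \<open>M\<^sup>2 * (ell2_norm (w n))\<^sup>2\<close> drops by at
   least the squared norm of \<open>v n\<close>; this pays for one more copy of that square, which
   afterwards only decreases.\<close>
 have "real n * (ell2_norm (v n))\<^sup>2 + M\<^sup>2 * (ell2_norm (w n))\<^sup>2 \<le> M\<^sup>2 * (ell2_norm \<xi>)\<^sup>2" for n
 proof (induction n)
  case (Suc n)
  have "(ell2_norm (w (Suc n)))\<^sup>2 \<le> (ell2_norm (w n))\<^sup>2 - (ell2_norm (v n))\<^sup>2 / M\<^sup>2"
   using hilbert_step(2)[OF p' M' M(2) w[of n]] unfolding wS c_def vw .
  hence "M\<^sup>2 * (ell2_norm (w (Suc n)))\<^sup>2 \<le> M\<^sup>2 * ((ell2_norm (w n))\<^sup>2 - (ell2_norm (v n))\<^sup>2 / M\<^sup>2)"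
   by (rule mult_left_mono) simp
  also have "\<dots> = M\<^sup>2 * (ell2_norm (w n))\<^sup>2 - (ell2_norm (v n))\<^sup>2" using M(2) by (simp add: right_diff_distrib)
  finally have 1: "M\<^sup>2 * (ell2_norm (w (Suc n)))\<^sup>2 \<le> M\<^sup>2 * (ell2_norm (w n))\<^sup>2 - (ell2_norm (v n))\<^sup>2" .
  have "real (Suc n) * (ell2_norm (v (Suc n)))\<^sup>2 \<le> real (Suc n) * (ell2_norm (v n))\<^sup>2"
   by (intro mult_left_mono power_mono dec ell2_norm_nonneg) simp
  thus ?case using 1 Suc by (simp add: algebra_simps)
 qed (simp add: w0)
 \<comment> \<open>The remaining term with \<open>w n\<close> is worth one further copy, which turns
   the factor \<open>n\<close> into \<open>Suc n\<close>.\<close>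
 moreover have "(ell2_norm (v n))\<^sup>2 \<le> M\<^sup>2 * (ell2_norm (w n))\<^sup>2" for n
 proof -
  have "ell2_norm (v n) \<le> M * ell2_norm (w n)"
   using op_norm_bound[OF D(1) w[of n]] mult_right_mono[OF M(1), of "ell2_norm (w n)"] unfolding vw by simp
  hence "(ell2_norm (v n))\<^sup>2 \<le> (M * ell2_norm (w n))\<^sup>2" by (rule power_mono) simp
  thus ?thesis by (simp add: power_mult_distrib)
 qed
 ultimately show "real (Suc n) * (ell2_norm (v n))\<^sup>2 \<le> M\<^sup>2 * (ell2_norm \<xi>)\<^sup>2"
  by (simp add: distrib_right) (smt (verit))
qed

abbreviation "convP \<equiv> convolution \<G>"
abbreviation "starP \<equiv> involution \<G>"
abbreviation "rnormP \<equiv> reduced_norm \<G>"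

text \<open>The vector iteration carried out inside C_c, so that one function realises it in all
  fibres simultaneously; it is the product of \<open>f\<close> with the n-th power of 1 - f f* / M^2
  on the left.\<close>

primrec iter_fun :: "real => 'a::left_cancel_monoid germ_fun => nat => 'a germ_fun" where
 "iter_fun M f 0 = f"
| "iter_fun M f (Suc n) = (\<lambda>z. iter_fun M f n z + complex_of_real (- (1 / M\<^sup>2)) * convP f (convP (starP f) (iter_fun M f n)) z)"

lemma iter_fun_CcP:
 assumes "f \<in> CcP" shows "iter_fun M f n \<in> CcP"
proof (induction n)
 case (Suc n)
 show ?case unfolding iter_fun.simps
  by (intro gen_span_add gen_span_scale conv_P_gen_span involution_P_gen_span assms Suc)
qed (simp add: assms)

lemma fibre_rep_iter:
 fixes w :: "'a::left_cancel_monoid set => bool"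
 assumes f: "f \<in> CcP" and w: "w \<in> Omega" and x: "\<xi> \<in> ell2 (fibre w)" and M: "rnormP f \<le> M" "0 < M"
 shows "ell2_norm (fibre_rep w (iter_fun M f n) \<xi>) \<le> ell2_norm (fibre_rep w f \<xi>)"
  "real (Suc n) * (ell2_norm (fibre_rep w (iter_fun M f n) \<xi>))\<^sup>2 \<le> M\<^sup>2 * (ell2_norm \<xi>)\<^sup>2"
proof -
 let ?T = "fibre_rep w f" and ?T' = "fibre_rep w (starP f)" and ?v = "\<lambda>n. fibre_rep w (iter_fun M f n) \<xi>"
 have p: "adjoint_pair (fibre w) ?T ?T'"
  using fibre_rep_adjoint[OF Omega_ci.closed invariant_Omega w f] unfolding groupoid_on_Omega .
 have m: "op_norm (fibre w) ?T \<le> M" using Omega_ci.rnorm_ge[OF f w] M(1) unfolding groupoid_on_Omega by simp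
 have s: "starP f \<in> CcP" by (rule involution_P_gen_span[OF f])
 have S: "?v (Suc n) = (\<lambda>i. ?v n i + complex_of_real (- (1 / M\<^sup>2)) * ?T (?T' (?v n)) i)" for n
 proof -
  note e = iter_fun_CcP[OF f, of M n]
  have se: "convP (starP f) (iter_fun M f n) \<in> CcP" by (rule conv_P_gen_span[OF s e])
  have fse: "convP f (convP (starP f) (iter_fun M f n)) \<in> CcP" by (rule conv_P_gen_span[OF f se])
  show ?thesis
   unfolding iter_fun.simps fibre_rep_add[OF subset_refl e gen_span_scale[OF fse]] fibre_rep_scale[OF subset_refl fse]
   using Omega_ci.fibre_rep_conv_op[OF f se w] Omega_ci.fibre_rep_conv_op[OF s e w] x unfolding groupoid_on_Omega by simp
 qed
 show "ell2_norm (?v n) \<le> ell2_norm (?T \<xi>)" "real (Suc n) * (ell2_norm (?v n))\<^sup>2 \<le> M\<^sup>2 * (ell2_norm \<xi>)\<^sup>2"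
  by (rule hilbert_iteration[where v = ?v, OF p m M(2) x _ S]; simp)+
qed

lemma rnorm_iter:
 assumes f: "f \<in> CcP" and M: "rnormP f \<le> M" "0 < M"
 shows "real (Suc n) * (rnormP (iter_fun M f n))\<^sup>2 \<le> M\<^sup>2"
proof -
 have "rnormP (iter_fun M f n) \<le> M / sqrt (real (Suc n))"
  unfolding groupoid_on_Omega[symmetric]
 proof (rule Omega_ci.rnorm_le)
  show nn: "0 \<le> M / sqrt (real (Suc n))" using M(2) by simp
  fix w :: "'a set => bool" assume w: "w \<in> Omega"
  show "fnorm w (iter_fun M f n) \<le> M / sqrt (real (Suc n))"
  proof (rule op_norm_le[OF _ nn])
   fix x assume x: "x \<in> ell2 (fibre w)"
   have "(sqrt (real (Suc n)) * ell2_norm (fibre_rep w (iter_fun M f n) x))\<^sup>2 \<le> (M * ell2_norm x)\<^sup>2"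
    using fibre_rep_iter(2)[OF f w x M, of n] by (simp add: power_mult_distrib)
   hence "sqrt (real (Suc n)) * ell2_norm (fibre_rep w (iter_fun M f n) x) \<le> M * ell2_norm x"
    by (rule power2_le_imp_le) (use M(2) in simp)
   thus "ell2_norm (fibre_rep w (iter_fun M f n) x) \<le> M / sqrt (real (Suc n)) * ell2_norm x"
    by (simp add: field_simps del: of_nat_Suc)
  qed
 qed
 hence "(rnormP (iter_fun M f n))\<^sup>2 \<le> (M / sqrt (real (Suc n)))\<^sup>2"
  by (rule power_mono) (use Omega_ci.rnorm_nonneg[OF iter_fun_CcP[OF f]] in \<open>simp add: groupoid_on_Omega\<close>)
 thus ?thesis by (simp add: power_divide field_simps del: of_nat_Suc)
qed

lemma bnorm_iter:
 assumes f: "f \<in> CcP" and M: "rnormP f \<le> M" "0 < M"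
 shows "bnorm (iter_fun M f n) \<le> bnorm f"
proof (rule bnorm_le[OF iter_fun_CcP[OF f] bnorm_nonneg[OF f]])
 fix w :: "'a set => bool" assume w: "w \<in> boundary_Omega"
 have wO: "w \<in> Omega" using w boundary_subset_Omega by blast
 show "fnorm w (iter_fun M f n) \<le> bnorm f"
 proof (rule op_norm_le[OF _ bnorm_nonneg[OF f]])
  fix x assume x: "x \<in> ell2 (fibre w)"
  have "ell2_norm (fibre_rep w f x) \<le> bnorm f * ell2_norm x"
   using op_norm_bound[OF Omega_ci.fibre_rep_bounded[OF f wO] x] mult_right_mono[OF bnorm_ge[OF f w], of "ell2_norm x"] by simp
  thus "ell2_norm (fibre_rep w (iter_fun M f n) x) \<le> bnorm f * ell2_norm x"
   using fibre_rep_iter(1)[OF f wO x M, of n] by linarith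
 qed
qed

lemma bnorm_involution:
 assumes f: "f \<in> CcP" shows "bnorm (starP f) \<le> bnorm f"
proof (rule bnorm_le[OF involution_P_gen_span[OF f] bnorm_nonneg[OF f]])
 fix w :: "'a set => bool" assume w: "w \<in> boundary_Omega"
 have wO: "w \<in> Omega" using w boundary_subset_Omega by blast
 show "fnorm w (starP f) \<le> bnorm f"
  using adjoint_pair_norm[OF fibre_rep_adjoint[OF Omega_ci.closed invariant_Omega wO f]] bnorm_ge[OF f w]
  unfolding groupoid_on_Omega by simp
qed

text \<open>Each step subtracts a product of \<open>f\<close>, its adjoint and an iterate. All three
  have boundary norm at most \<open>bnorm f\<close>, the iterate by \<open>bnorm_iter\<close>, so
  one step costs at most the cube divided by \<open>M\<^sup>2\<close>.\<close>

lemma bnorm_diff_iter: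
 assumes f: "f \<in> CcP" and M: "rnormP f \<le> M" "0 < M"
 shows "bnorm (fdiff f (iter_fun M f n)) \<le> real n * ((bnorm f) ^ 3 / M\<^sup>2)"
proof (induction n)
 case 0
 have "fdiff f (iter_fun M f 0) = (\<lambda>_. 0)" by simp
 thus ?case by (simp add: restrict_off_boundary(2)[OF gen_span.zero])
next
 case (Suc n)
 note e = iter_fun_CcP[OF f, of M n] and s = involution_P_gen_span[OF f] and b = bnorm_nonneg[OF f]
 have se: "convP (starP f) (iter_fun M f n) \<in> CcP" by (rule conv_P_gen_span[OF s e])
 have fse: "convP f (convP (starP f) (iter_fun M f n)) \<in> CcP" by (rule conv_P_gen_span[OF f se])
 have "bnorm (convP (starP f) (iter_fun M f n)) \<le> bnorm f * bnorm f"
  by (rule order_trans[OF bnorm_conv[OF s e]]) (intro mult_mono bnorm_involution f bnorm_iter M b bnorm_nonneg e)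
 hence "bnorm f * bnorm (convP (starP f) (iter_fun M f n)) \<le> bnorm f * (bnorm f * bnorm f)" using b by (rule mult_left_mono)
 hence "bnorm (convP f (convP (starP f) (iter_fun M f n))) \<le> bnorm f ^ 3"
  using bnorm_conv[OF f se] by (simp add: power3_eq_cube mult.assoc)
 hence d: "1 / M\<^sup>2 * bnorm (convP f (convP (starP f) (iter_fun M f n))) \<le> bnorm f ^ 3 / M\<^sup>2" by (simp add: divide_right_mono)
 have eq: "fdiff f (iter_fun M f (Suc n)) = (\<lambda>z. fdiff f (iter_fun M f n) z + complex_of_real (1 / M\<^sup>2) * convP f (convP (starP f) (iter_fun M f n)) z)"
  by (simp add: fun_eq_iff algebra_simps)
 have "bnorm (fdiff f (iter_fun M f (Suc n))) \<le> bnorm (fdiff f (iter_fun M f n)) + bnorm (\<lambda>z. complex_of_real (1 / M\<^sup>2) * convP f (convP (starP f) (iter_fun M f n)) z)"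
  unfolding eq by (rule bnorm_add[OF fdiff_gen_span[OF f e] gen_span_scale[OF fse]])
 also have "bnorm (\<lambda>z. complex_of_real (1 / M\<^sup>2) * convP f (convP (starP f) (iter_fun M f n)) z) =
   1 / M\<^sup>2 * bnorm (convP f (convP (starP f) (iter_fun M f n)))"
  unfolding bnorm_scale[OF fse] by (simp add: norm_divide norm_power)
 also have "bnorm (fdiff f (iter_fun M f n)) + \<dots> \<le> real n * (bnorm f ^ 3 / M\<^sup>2) + bnorm f ^ 3 / M\<^sup>2" using Suc d by (rule add_mono)
 also have "\<dots> = real (Suc n) * (bnorm f ^ 3 / M\<^sup>2)" by (simp add: distrib_right add_divide_distrib)
 finally show ?case .
qed

text \<open>The function \<open>k\<close> is \<open>f\<close> minus an iterate of \<open>f\<close>.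
  With more steps the reduced norm of the iterate shrinks, but the bound for the boundary norm of
  \<open>k\<close> grows; the number of steps balances the two.\<close>

lemma halving_step:
 assumes f: "f \<in> CcP" and r: "bnorm f \<le> \<rho>" "0 < \<rho>"
 shows "\<exists>k\<in>CcP. bnorm k \<le> \<rho> / 2 \<and> rnormP (fdiff f k) \<le> 2 * \<rho>"
proof -
 \<comment> \<open>Adding \<open>\<rho>\<close> makes \<open>M\<close> positive even if the reduced
   norm of \<open>f\<close> is zero.\<close>
 define M where "M = rnormP f + \<rho>"
 have R: "0 \<le> rnormP f" using Omega_ci.rnorm_nonneg[OF f] by (simp add: groupoid_on_Omega)
 have M: "rnormP f \<le> M" "0 < M" unfolding M_def using r(2) R by simp_all
 \<comment> \<open>The floor serves both bounds: \<open>n\<close> is small enough for n \<rho>^3 /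
   M^2 \<le> \<rho> / 2, and \<open>Suc n\<close> is large enough for M^2 / (n + 1) \<le> 2
   \<rho>^2, which gives reduced norm at most 2 \<rho>.\<close>
 define n where "n = nat \<lfloor>M\<^sup>2 / (2 * \<rho>\<^sup>2)\<rfloor>"
 have q: "0 \<le> M\<^sup>2 / (2 * \<rho>\<^sup>2)" by simp
 have n1: "real n \<le> M\<^sup>2 / (2 * \<rho>\<^sup>2)" unfolding n_def using q by simp
 have n2: "M\<^sup>2 / (2 * \<rho>\<^sup>2) \<le> real (Suc n)" unfolding n_def using q by linarith
 let ?e = "iter_fun M f n"
 note e = iter_fun_CcP[OF f, of M n]
 have "bnorm (fdiff f ?e) \<le> real n * ((bnorm f) ^ 3 / M\<^sup>2)" by (rule bnorm_diff_iter[OF f M])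
 also have "\<dots> \<le> M\<^sup>2 / (2 * \<rho>\<^sup>2) * (\<rho> ^ 3 / M\<^sup>2)"
  by (intro mult_mono n1 divide_right_mono power_mono r(1) bnorm_nonneg[OF f]) (use bnorm_nonneg[OF f] in auto)
 also have "\<dots> = \<rho> / 2" using M(2) r(2) by (simp add: power2_eq_square power3_eq_cube)
 finally have k: "bnorm (fdiff f ?e) \<le> \<rho> / 2" .
 have "M\<^sup>2 / (2 * \<rho>\<^sup>2) * (rnormP ?e)\<^sup>2 \<le> real (Suc n) * (rnormP ?e)\<^sup>2" using n2 by (rule mult_right_mono) simp
 also have "\<dots> \<le> M\<^sup>2" by (rule rnorm_iter[OF f M])
 finally have "(rnormP ?e)\<^sup>2 \<le> 2 * \<rho>\<^sup>2" using M(2) r(2) by (simp add: field_simps)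
 also have "\<dots> \<le> (2 * \<rho>)\<^sup>2" by (simp add: power_mult_distrib)
 finally have "rnormP ?e \<le> 2 * \<rho>" by (rule power2_le_imp_le) (use r(2) in simp)
 moreover have "fdiff f (fdiff f ?e) = ?e" by (simp add: fun_eq_iff)
 ultimately show ?thesis using k fdiff_gen_span[OF f e] by (intro bexI[of _ "fdiff f ?e"]) simp_all
qed

text \<open>Repeats \<open>halving_step\<close> with the bound halved each time. The distances 2
  \<rho> / 2^j between consecutive terms form a geometric series whose tail from i on is 4 \<rho> /
  2^i.\<close>

lemma halving_sequence:
 assumes f: "f \<in> CcP" and r: "bnorm f \<le> \<rho>" "0 < \<rho>"
 obtains F where "F 0 = f" "\<And>j. F j \<in> CcP" "\<And>j. bnorm (F j) \<le> \<rho> / 2 ^ j" "\<And>i j. i \<le> j ==> rnormP (fdiff (F i) (F j)) \<le> 4 * \<rho> / 2 ^ i"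
proof -
 have "\<exists>F. F 0 = f \<and> (\<forall>j. (F j \<in> CcP \<and> bnorm (F j) \<le> \<rho> / 2 ^ j) \<and> rnormP (fdiff (F j) (F (Suc j))) \<le> 2 * (\<rho> / 2 ^ j))"
 proof -
  have "\<exists>F. (\<forall>j. (F j \<in> CcP \<and> bnorm (F j) \<le> \<rho> / 2 ^ j \<and> (j = 0 \<longrightarrow> F j = f)) \<and> rnormP (fdiff (F j) (F (Suc j))) \<le> 2 * (\<rho> / 2 ^ j))"
  proof (rule dependent_nat_choice)
   show "\<exists>x. x \<in> CcP \<and> bnorm x \<le> \<rho> / 2 ^ 0 \<and> ((0::nat) = 0 \<longrightarrow> x = f)" using f r by auto
   fix x j assume x: "x \<in> CcP \<and> bnorm x \<le> \<rho> / 2 ^ j \<and> (j = 0 \<longrightarrow> x = f)"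
   have "\<exists>k\<in>CcP. bnorm k \<le> (\<rho> / 2 ^ j) / 2 \<and> rnormP (fdiff x k) \<le> 2 * (\<rho> / 2 ^ j)"
    by (rule halving_step) (use x r in auto)
   thus "\<exists>y. (y \<in> CcP \<and> bnorm y \<le> \<rho> / 2 ^ Suc j \<and> (Suc j = 0 \<longrightarrow> y = f)) \<and> rnormP (fdiff x y) \<le> 2 * (\<rho> / 2 ^ j)"
    by (auto simp: mult.commute)
  qed
  thus ?thesis by blast
 qed
 then obtain F where F: "F 0 = f" "\<And>j. F j \<in> CcP" "\<And>j. bnorm (F j) \<le> \<rho> / 2 ^ j" "\<And>j. rnormP (fdiff (F j) (F (Suc j))) \<le> 2 * (\<rho> / 2 ^ j)" by blast
 \<comment> \<open>Subtracting the tail beyond \<open>i + d\<close> makes the induction close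
   exactly, as consecutive tails differ by the new summand.\<close>
 have "rnormP (fdiff (F i) (F (i + d))) \<le> 4 * \<rho> / 2 ^ i - 4 * \<rho> / 2 ^ (i + d)" for i d
 proof (induction d)
  case 0
  have "fdiff (F i) (F (i + 0)) = (\<lambda>_. 0)" by simp
  thus ?case by (simp add: Omega_ci.rnorm_zero[unfolded groupoid_on_Omega])
 next
  case (Suc d)
  have e: "fdiff (F i) (F (i + Suc d)) = (\<lambda>z. fdiff (F i) (F (i + d)) z + fdiff (F (i + d)) (F (Suc (i + d))) z)"
   by (simp add: fun_eq_iff)
  have "rnormP (fdiff (F i) (F (i + Suc d))) \<le> rnormP (fdiff (F i) (F (i + d))) + rnormP (fdiff (F (i + d)) (F (Suc (i + d))))"
   unfolding e by (rule Omega_ci.rnorm_add[unfolded groupoid_on_Omega, OF fdiff_gen_span[OF F(2) F(2)] fdiff_gen_span[OF F(2) F(2)]])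
  also have "\<dots> \<le> 4 * \<rho> / 2 ^ i - 4 * \<rho> / 2 ^ (i + d) + 2 * (\<rho> / 2 ^ (i + d))" using Suc F(4)[of "i + d"] by linarith
  finally show ?case by (simp add: field_simps)
 qed
 note * = this
 have "rnormP (fdiff (F i) (F j)) \<le> 4 * \<rho> / 2 ^ i" if ij: "i \<le> j" for i j
 proof -
  have "0 \<le> 4 * \<rho> / 2 ^ j" using r(2) by simp
  thus ?thesis using *[of i "j - i"] ij by simp
 qed
 thus ?thesis using that[of F] F(1-3) by blast
qed

subsection \<open>Exactness\<close>

lemma Cc_algebra_simps [simp]:
 "elems (Cc_algebra G N) = Cc G" "zer (Cc_algebra G N) = (\<lambda>z. 0)" "add (Cc_algebra G N) = (\<lambda>f f' z. f z + f' z)"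
 "scl (Cc_algebra G N) = (\<lambda>c f z. c * f z)" "mul (Cc_algebra G N) = convolution G" "adj (Cc_algebra G N) = involution G"
 "nrm (Cc_algebra G N) = N"
 by (simp_all add: Cc_algebra_def)

abbreviation "CcA \<equiv> reduced_Cc_algebra \<G>"
abbreviation "CrA \<equiv> reduced_cstar_algebra \<G>"

lemma dst_Cc_algebra: "dst (Cc_algebra G N) f f' = N (fdiff f f')"
 by (simp add: dst_def)

lemma (in closed_invariant) seminormed_algebra_Cc:
 assumes N: "\<And>f. f \<in> CcY ==> N f = rnorm f"
 shows "seminormed_algebra (Cc_algebra (groupoid_on Y) N)"
proof
 let ?A = "Cc_algebra (groupoid_on Y) N"
 note s = Cc_algebra_simps Cc_eq
 note cl = gen_span_add gen_span_scale gen_span_conv[OF invariant] gen_span_involution[OF invariant]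
 show "zer ?A \<in> elems ?A" unfolding s by (rule gen_span.zero)
 fix a b d and c c' :: complex
 assume "a \<in> elems ?A"
 hence a: "a \<in> CcY" unfolding s .
 show "scl ?A c a \<in> elems ?A" unfolding s by (rule cl(2)[OF a])
 show "add ?A a (zer ?A) = a" unfolding s by simp
 show "add ?A a (scl ?A (-1) a) = zer ?A" unfolding s by simp
 show "scl ?A c (scl ?A c' a) = scl ?A (c * c') a"
  unfolding s by (simp add: mult.assoc)
 show "scl ?A 1 a = a" "scl ?A 0 a = zer ?A" unfolding s by simp_all
 show "0 \<le> nrm ?A a" unfolding s N[OF a] by (rule rnorm_nonneg[OF a])
 show "nrm ?A (scl ?A c a) = cmod c * nrm ?A a"
  unfolding s N[OF a] N[OF cl(2)[OF a]] by (rule rnorm_scale[OF a])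
 show "adj ?A a \<in> elems ?A" unfolding s by (rule cl(4)[OF a])
 show "adj ?A (scl ?A c a) = scl ?A (cnj c) (adj ?A a)"
  unfolding s by (rule involution_add)
 show "nrm ?A (adj ?A a) = nrm ?A a"
  unfolding s N[OF a] N[OF cl(4)[OF a]] by (rule rnorm_involution[OF a])
 assume "b \<in> elems ?A"
 hence b: "b \<in> CcY" unfolding s .
 show "add ?A a b \<in> elems ?A" unfolding s by (rule cl(1)[OF a b])
 show "add ?A a b = add ?A b a" unfolding s by (simp add: add.commute)
 show "scl ?A c (add ?A a b) =
   add ?A (scl ?A c a) (scl ?A c b)"
  unfolding s by (simp add: distrib_left)
 show "nrm ?A (add ?A a b) \<le> nrm ?A a + nrm ?A b"
  unfolding s N[OF a] N[OF b] N[OF cl(1)[OF a b]] by (rule rnorm_add[OF a b])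
 show "mul ?A a b \<in> elems ?A" unfolding s by (rule cl(3)[OF a b])
 show "mul ?A a (scl ?A c b) = scl ?A c (mul ?A a b)"
  unfolding s by (rule convolution_scale(2)[OF invariant a])
 show "mul ?A (scl ?A c a) b = scl ?A c (mul ?A a b)"
  unfolding s by (rule convolution_scale(1)[OF invariant a])
 show "nrm ?A (mul ?A a b) \<le> nrm ?A a * nrm ?A b"
  unfolding s N[OF a] N[OF b] N[OF cl(3)[OF a b]] by (rule rnorm_conv[OF a b])
 show "adj ?A (add ?A a b) = add ?A (adj ?A a) (adj ?A b)"
  unfolding s by (rule involution_add)
 assume "d \<in> elems ?A"
 hence d: "d \<in> CcY" unfolding s .
 show "add ?A (add ?A a b) d = add ?A a (add ?A b d)"
  unfolding s by (simp add: add.assoc)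
 show "mul ?A a (add ?A b d) = add ?A (mul ?A a b) (mul ?A a d)"
  unfolding s by (rule convolution_add_right[OF invariant a])
 show "mul ?A (add ?A a b) d = add ?A (mul ?A a d) (mul ?A b d)"
  unfolding s by (rule convolution_add_left[OF invariant a b])
qed

lemma Cc_P: "Cc \<G> = CcP"
 using Omega_ci.Cc_eq unfolding groupoid_on_Omega .

interpretation CP: seminormed_algebra "reduced_Cc_algebra (\<G> :: 'a::left_cancel_monoid germ top_groupoid)"
 using Omega_ci.seminormed_algebra_Cc[of rnormP] unfolding groupoid_on_Omega by simp

lemma Cc_off:
 assumes "f \<in> Cc off_boundary_groupoid"
 shows "f \<in> CcOff"
 using Cc_off_boundary[OF closedin_boundary boundary_subset_Omega] assms unfolding off_boundary_groupoid_eq by blast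

text \<open>A function supported off the boundary acts as zero on the boundary fibres, so the other
  fibres already account for its reduced norm. This makes the inclusion contractive, and it can be
  computed on Cauchy sequences.\<close>

lemma rnorm_off:
 fixes f :: "'a::left_cancel_monoid germ_fun"
 assumes f: "f \<in> CcOff"
 shows "rnormP f \<le> reduced_norm off_boundary_groupoid f"
proof -
 note fP = off_boundary_span[OF f]
 let ?O = "Omega - boundary_Omega :: ('a set => bool) set"
 have S: "reduced_norm off_boundary_groupoid f = Sup (insert 0 ((\<lambda>w. fnorm w f) ` ?O))"
  unfolding off_boundary_groupoid_eq by (rule reduced_norm_groupoid_on[OF invariant_complement[OF invariant_boundary]])
 have b: "bdd_above (insert 0 ((\<lambda>w. fnorm w f) ` ?O))"
  by (rule bdd_above_mono[OF Omega_ci.rnorm_bdd[OF fP]]) auto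
 have le: "x \<le> reduced_norm off_boundary_groupoid f" if "x \<in> insert 0 ((\<lambda>w. fnorm w f) ` ?O)" for x
  unfolding S by (rule cSup_upper[OF that b])
 have nn: "0 \<le> reduced_norm off_boundary_groupoid f" by (rule le) simp
 show ?thesis
  unfolding groupoid_on_Omega[symmetric]
 proof (rule Omega_ci.rnorm_le[OF nn])
  fix w :: "'a set => bool" assume w: "w \<in> Omega"
  show "fnorm w f \<le> reduced_norm off_boundary_groupoid f"
  proof (cases "w \<in> boundary_Omega")
   case True
   thus ?thesis using bnorm_ge[OF fP True] restrict_off_boundary(2)[OF f] nn by simp
  next
   case False
   thus ?thesis using w by (intro le) blast
  qed
 qed
qed

lemma extension_inclusion:
 assumes F: "F \<in> cseqs (reduced_Cc_algebra off_boundary_groupoid)"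
 shows "F \<in> cseqs CcA"
  "inclusion_map (cls (reduced_Cc_algebra off_boundary_groupoid) F) = cls CcA F"
proof -
 let ?C = "reduced_Cc_algebra off_boundary_groupoid"
 have z: "dst ?C a a = 0" if "a \<in> elems ?C" for a :: "'a germ_fun"
  unfolding dst_Cc_algebra off_boundary_groupoid_eq reduced_norm_groupoid_on[OF invariant_complement[OF invariant_boundary]]
  by (auto simp: fibre_rep_zero intro!: cSup_eq_maximum)
 have e: "a \<in> elems CcA" if "a \<in> elems ?C" for a :: "'a germ_fun"
  using off_boundary_span[OF Cc_off[of a]] that by (simp add: Cc_P)
 have d: "dst CcA a b \<le> dst ?C a b" if "a \<in> elems ?C" "b \<in> elems ?C" for a b :: "'a germ_fun"
  unfolding dst_Cc_algebra by (rule rnorm_off[OF fdiff_gen_span[OF Cc_off Cc_off]]) (use that in simp_all)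
 note E = CP.extension_completion[where \<pi> = "\<lambda>a. a", OF z e d F]
 show "F \<in> cseqs CcA" by (rule E(1))
 have "inclusion_Cc = (\<lambda>a. embed CcA (a :: 'a germ_fun))" by (simp add: inclusion_Cc_def fun_eq_iff)
 thus "inclusion_map (cls ?C F) = cls CcA F"
  using E(2) unfolding inclusion_map_def reduced_cstar_algebra_def by simp
qed

text \<open>Through \<open>N_eq\<close> the given norm of a restricted function becomes
  \<open>bnorm\<close>, a supremum over boundary fibres, to which the comparison with
  \<open>rho_nrm\<close> applies; \<open>norm_e\<close> supplies exactness.\<close>

locale boundary_norm =
 fixes N :: "'a::left_cancel_monoid germ_fun => real"
 assumes norm_e: "is_norm_e N" and N_eq: "\<And>f. f \<in> Cc boundary_groupoid ==> N f = reduced_norm boundary_groupoid f"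
begin

abbreviation "CcB \<equiv> boundary_Cc_algebra N"
abbreviation "CrB \<equiv> boundary_cstar_algebra N"
abbreviation "CcR \<equiv> reduced_Cc_algebra boundary_groupoid"
abbreviation "CrR \<equiv> reduced_cstar_algebra boundary_groupoid"

lemma seminormed_algebra_boundary: "seminormed_algebra CcB"
 unfolding boundary_groupoid_eq
 by (rule boundary_ci.seminormed_algebra_Cc) (rule N_eq[unfolded boundary_groupoid_eq boundary_ci.Cc_eq])

sublocale CB: seminormed_algebra "boundary_Cc_algebra N"
 by (rule seminormed_algebra_boundary)

lemma Cc_boundary: "Cc (boundary_groupoid :: 'a germ top_groupoid) = gen_span boundary_Omega (\<lambda>_. True)"
 using boundary_ci.Cc_eq unfolding boundary_groupoid_eq .

lemma restrict_in: "f \<in> CcP ==> restr f \<in> elems CcB"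
 using restrict_gen_span Cc_boundary by simp

lemma N_restrict: "f \<in> CcP ==> N (restr f) = bnorm f"
 using N_eq Cc_boundary restrict_gen_span unfolding bnorm_def by metis

lemma dst_restrict:
 assumes "f \<in> CcP" "f' \<in> CcP"
 shows "dst CcB (restr f) (restr f') = bnorm (fdiff f f')"
 unfolding dst_Cc_algebra N_restrict[OF fdiff_gen_span[OF assms], symmetric] restrict_add restrict_scale ..

lemma extension_restriction:
 assumes F: "F \<in> cseqs CcA"
 shows "(\<lambda>n. restr (F n)) \<in> cseqs CcB"
  "restriction_map N (cls CcA F) = cls CcB (\<lambda>n. restr (F n))"
proof -
 let ?C = CcA
 have d: "dst CcB (restr a) (restr b) \<le> dst ?C a b" if "a \<in> elems ?C" "b \<in> elems ?C" for a b :: "'a germ_fun"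
  using that dst_restrict[of a b] bnorm_le_rnorm[OF fdiff_gen_span[of a Omega _ b]] unfolding dst_Cc_algebra by (simp add: Cc_P)
 have e: "restr a \<in> elems CcB" if "a \<in> elems ?C" for a :: "'a germ_fun"
  by (rule restrict_in) (use that in \<open>simp add: Cc_P\<close>)
 note E = CB.extension_completion[where \<pi> = restr, OF CP.dst_self e d F]
 show "(\<lambda>n. restr (F n)) \<in> cseqs CcB" by (rule E(1))
 have "restriction_Cc N = (\<lambda>a. embed CcB (restr a))" by (simp add: restriction_Cc_def fun_eq_iff)
 thus "restriction_map N (cls ?C F) = cls CcB (\<lambda>n. restr (F n))"
  using E(2) unfolding restriction_map_def boundary_cstar_algebra_def by simp
qed

lemma exact: "short_exact (reduced_cstar_algebra off_boundary_groupoid) CrA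
   CrB inclusion_map (restriction_map N)"
 using norm_e unfolding is_norm_e_def by blast

text \<open>The halving sequence \<open>F\<close> of \<open>f\<close> represents an element of the kernel of restriction, hence of the image of
 the inclusion.\<close>

lemma near_off_boundary:
 fixes f :: "'a germ_fun"
 assumes f: "f \<in> CcP" and r: "bnorm f \<le> \<rho>" "0 < \<rho>"
 shows "\<exists>g\<in>CcOff. rnormP (fdiff f g) \<le> 5 * \<rho>"
proof -
 let ?A = "reduced_Cc_algebra (\<G> :: 'a germ top_groupoid)" and ?C = "reduced_Cc_algebra (off_boundary_groupoid :: 'a germ top_groupoid)"
 obtain F where F: "F 0 = f" "\<And>j. F j \<in> CcP" "\<And>j. bnorm (F j) \<le> \<rho> / 2 ^ j" "\<And>i j. i \<le> j ==> rnormP (fdiff (F i) (F j)) \<le> 4 * \<rho> / 2 ^ i"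
  by (rule halving_sequence[OF f r]) (rule that; assumption)
 have l: "vanishes (\<lambda>j. K / 2 ^ j)" for K :: real
  using tendsto_mult_right_zero[OF LIMSEQ_realpow_zero[of "1/2 :: real"], of K] by (simp add: power_divide)
 have FA: "F j \<in> elems ?A" for j using F(2) by (simp add: Cc_P)
 have FC: "F \<in> cseqs ?A"
  unfolding cauchy_seqs_def
 proof (intro CollectI conjI allI impI FA)
  fix e :: real assume e: "e > 0"
  obtain K where K: "4 * \<rho> / 2 ^ K < e" using order_tendstoD(2)[OF l e] unfolding eventually_sequentially by blast
  have i: "dst ?A (F m) (F n) < e" if "K \<le> m" "m \<le> n" for m n
  proof -
   have "4 * \<rho> / 2 ^ m \<le> 4 * \<rho> / 2 ^ K" using that r(2) by (intro divide_left_mono power_increasing) auto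
   thus ?thesis using F(4)[OF that(2)] K unfolding dst_Cc_algebra by linarith
  qed
  have "dst ?A (F m) (F n) < e" if "K \<le> m" "K \<le> n" for m n
   using i[of m n] i[of n m] that CP.dst_sym[OF FA FA, of m n] by (cases "m \<le> n") auto
  thus "\<exists>K. \<forall>m\<ge>K. \<forall>n\<ge>K. dst ?A (F m) (F n) < e" by blast
 qed
 have "vanishes (\<lambda>n. nrm CcB (restr (F n)))"
 proof (rule tendsto_sandwich[OF _ _ tendsto_const l[of \<rho>]])
  show "\<forall>\<^sub>F n in sequentially. 0 \<le> nrm CcB (restr (F n))"
   by (intro always_eventually allI) (simp add: N_restrict[OF F(2)] bnorm_nonneg[OF F(2)])
  show "\<forall>\<^sub>F n in sequentially. nrm CcB (restr (F n)) \<le> \<rho> / 2 ^ n"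
   by (intro always_eventually allI) (simp add: N_restrict[OF F(2)] F(3))
 qed
 hence "restriction_map N (cls ?A F) = zer CrB"
  unfolding extension_restriction(2)[OF FC] boundary_cstar_algebra_def by (simp only: CB.class_eq_zer_iff[OF extension_restriction(1)[OF FC]])
 moreover have "cls ?A F \<in> elems CrA"
  unfolding reduced_cstar_algebra_def CP.completion_elems using FC by blast
 ultimately have "cls ?A F \<in> inclusion_map ` elems (reduced_cstar_algebra off_boundary_groupoid)"
  using exact unfolding short_exact_def by blast
 then obtain x where x: "x \<in> elems (reduced_cstar_algebra off_boundary_groupoid)" "cls ?A F = inclusion_map x" by blast
 obtain G where G: "G \<in> cseqs ?C" "x = cls ?C G"
  using x(1) by (auto simp: reduced_cstar_algebra_def completion_def)
 have "cls ?A F = cls ?A G" using x(2) extension_inclusion(2)[OF G(1)] G(2) by simp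
 hence FG: "vanishes (\<lambda>n. dst ?A (F n) (G n))" using CP.cauchy_class_eq_iff[OF FC extension_inclusion(1)[OF G(1)]] by blast
 \<comment> \<open>At most 4 \<rho> is spent on the way from \<open>f = F 0\<close> to
   \<open>F n\<close>, and one further \<rho> on the approximation of \<open>F n\<close> by
   \<open>G n\<close>.\<close>
 obtain n where n: "dst ?A (F n) (G n) < \<rho>" using order_tendstoD(2)[OF FG r(2)] unfolding eventually_sequentially by blast
 have Goff: "G n \<in> CcOff"
  by (rule Cc_off) (use G(1) in \<open>simp add: cauchy_seqs_def\<close>)
 have GA: "G n \<in> elems ?A" using off_boundary_span[OF Goff] by (simp add: Cc_P)
 have "dst ?A (F 0) (G n) \<le> dst ?A (F 0) (F n) + dst ?A (F n) (G n)" by (rule CP.dst_triangle[OF FA FA GA])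
 also have "\<dots> \<le> 5 * \<rho>" using n F(4)[of 0 n] unfolding dst_Cc_algebra by simp
 finally have "rnormP (fdiff f (G n)) \<le> 5 * \<rho>" unfolding dst_Cc_algebra F(1) .
 thus ?thesis by (rule bexI[OF _ Goff])
qed

text \<open>The factor \<open>5\<close> is harmless, since the estimate is applied to sequences
  whose \<open>bnorm\<close> tends to zero.\<close>

lemma rho_near_ideal:
 fixes f :: "'a germ_fun"
 assumes f: "f \<in> CcP" and r: "bnorm f \<le> \<rho>" "0 < \<rho>"
 shows "\<exists>T\<in>boundary_ideal. dst Bop (rho_Cc f) T \<le> 5 * \<rho>"
proof -
 obtain g where g: "g \<in> CcOff" "rnormP (fdiff f g) \<le> 5 * \<rho>" using near_off_boundary[OF f r] by blast
 note gP = off_boundary_span[OF g(1)]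
 have "dst Bop (rho_Cc f) (rho_Cc g) \<le> 5 * \<rho>"
  unfolding dst_rho[OF f gP] using rho_norm_le[OF fdiff_gen_span[OF f gP]] g(2) by linarith
 thus ?thesis using rho_off_boundary[OF g(1)] by blast
qed

end

subsection \<open>The map induced by the regular representation\<close>

lemma op_definite:
 assumes "T \<in> bounded_ops I" "T' \<in> bounded_ops I" "dst (op_algebra I) T T' = 0"
 shows "T = T'"
proof
 have d: "op_diff I T T' = (\<lambda>x\<in>ell2 I. \<lambda>i. 0)"
  by (rule op_norm_eq_0[OF op_diff_bounded[OF assms(1,2)]]) (use assms(3) in \<open>simp add: dst_op_algebra\<close>)
 fix x show "T x = T' x"
 proof (cases "x \<in> ell2 I")
  case True
  thus ?thesis using fun_cong[OF d, of x] by (simp add: op_diff_def fun_eq_iff)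
 next
  case False
  thus ?thesis using bounded_ops_undefined assms(1,2) by metis
 qed
qed

lemma rho_lim_dif:
 assumes "rho_lim f T" "rho_lim f' T'"
 shows "rho_lim (\<lambda>n. fdiff (f n) (f' n)) (add Bop T (scl Bop (-1) T'))"
 by (rule rho_lim_add[OF assms(1) rho_lim_scl[OF assms(2)]])

lemma rho_lim_cauchy_seq:
 fixes F :: "nat => 'a::left_cancel_monoid germ_fun"
 assumes F: "F \<in> cseqs CcA"
 shows "\<exists>T. rho_lim F T"
proof -
 have FP: "F n \<in> CcP" for n using CP.cauchy_seqsD(1)[OF F, of n] by (simp add: Cc_P)
 show ?thesis
 proof (rule rho_lim_complete[OF FP])
  fix e :: real assume "e > 0"
  then obtain K where K: "\<forall>m\<ge>K. \<forall>n\<ge>K. rnormP (fdiff (F m) (F n)) < e"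
   using CP.cauchy_seqsD(2)[OF F] unfolding dst_Cc_algebra by blast
  have "rho_nrm (fdiff (F m) (F n)) \<le> e" if "K \<le> m" "K \<le> n" for m n
   using rho_norm_le[OF fdiff_gen_span[OF FP FP], of m n] K that by (meson less_imp_le order_trans)
  thus "\<exists>K. \<forall>m\<ge>K. \<forall>n\<ge>K. rho_nrm (fdiff (F m) (F n)) \<le> e" by blast
 qed
qed

text \<open>\<open>rho_map\<close> is a definite description. The limit is the same for all Cauchy
  sequences of the class because \<open>rho_Cc\<close> is contractive for the reduced norm, and
  limits of operators are unique.\<close>

lemma rho_map_class:
 fixes F :: "nat => 'a::left_cancel_monoid germ_fun"
 assumes F: "F \<in> cseqs CcA" and T: "rho_lim F T"
 shows "rho_map (cls CcA F) = T"
 unfolding rho_map_def extension_def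
proof (rule the_equality)
 note D = rho_limD[OF T]
 have lim: "vanishes (\<lambda>n. dst \<M> (rho_Cc (G n)) T)" if G: "G \<in> cls CcA F" for G
 proof -
  note M = CP.mem_cauchy_classD[OF F G]
  have GP: "G n \<in> CcP" for n using CP.cauchy_seqsD(1)[OF M(1), of n] by (simp add: Cc_P)
  show ?thesis unfolding dst_monoid
  proof (rule op.tendsto_dst_0[where u = "\<lambda>n. dst CcA (F n) (G n) + dst Bop (rho_Cc (F n)) T", OF rho_op_in[OF GP] D(2)])
   fix n
   have "dst Bop (rho_Cc (G n)) T \<le> dst Bop (rho_Cc (G n)) (rho_Cc (F n)) + dst Bop (rho_Cc (F n)) T"
    by (rule op.dst_triangle[OF rho_op_in[OF GP] D(4) D(2)])
   also have "dst Bop (rho_Cc (G n)) (rho_Cc (F n)) = dst Bop (rho_Cc (F n)) (rho_Cc (G n))"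
    by (rule op.dst_sym[OF rho_op_in[OF GP] D(4)])
   also have "\<dots> \<le> dst CcA (F n) (G n)"
    unfolding dst_rho[OF D(1) GP] dst_Cc_algebra by (rule rho_norm_le[OF fdiff_gen_span[OF D(1) GP]])
   finally show "dst Bop (rho_Cc (G n)) T \<le> dst CcA (F n) (G n) + dst Bop (rho_Cc (F n)) T" by simp
  qed (use tendsto_add[OF M(2) D(3)] in simp)
 qed
 thus "T \<in> Bel \<and> (\<forall>G\<in>cls CcA F. vanishes (\<lambda>n. dst \<M> (rho_Cc (G n)) T))"
  using rho_lim_monoid[OF T] by blast
 fix T' assume T': "T' \<in> Bel \<and> (\<forall>G\<in>cls CcA F. vanishes (\<lambda>n. dst \<M> (rho_Cc (G n)) T'))"
 have T'b: "T' \<in> elems Bop" using monoid_bounded[of T'] T' by simp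
 have "vanishes (\<lambda>n. dst Bop (rho_Cc (F n)) T')" using T' CP.cauchy_class_self[OF F] unfolding dst_monoid by blast
 hence "vanishes (\<lambda>n. dst Bop T' T)"
  by (rule op.dst_lim_trans[OF T'b D(4) D(2) op.dst_lim_sym[OF D(4) T'b] D(3)])
 hence "dst Bop T' T = 0" by (simp add: LIMSEQ_const_iff)
 thus "T' = T" using op_definite[of T' UNIV T] T'b D(2) by simp
qed

lemma rho_map_lim:
 fixes F :: "nat => 'a::left_cancel_monoid germ_fun"
 assumes F: "F \<in> cseqs CcA"
 shows "rho_lim F (rho_map (cls CcA F))"
 using rho_lim_cauchy_seq[OF F] rho_map_class[OF F] by metis

lemma reduced_elemsE:
 fixes a :: "(nat => 'a::left_cancel_monoid germ_fun) set"
 assumes "a \<in> elems CrA"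
 obtains F where "F \<in> cseqs CcA" "a = cls CcA F"
 using assms unfolding reduced_cstar_algebra_def CP.completion_elems by blast

lemma rho_map_star_hom: "star_hom CrA \<M> (rho_map :: _ => 'a::left_cancel_monoid op)"
 unfolding star_hom_def
proof (intro conjI Pi_I ballI allI)
 fix a b :: "(nat => 'a germ_fun) set" and c
 assume a: "a \<in> elems CrA"
 obtain F where F: "F \<in> cseqs CcA" "a = cls CcA F" using reduced_elemsE[OF a] .
 note LF = rho_map_lim[OF F(1), folded F(2)]
 show "rho_map a \<in> Bel" by (rule rho_lim_monoid[OF LF])
 show "rho_map (scl CrA c a) = scl \<M> c (rho_map a)"
  unfolding F(2) reduced_cstar_algebra_def CP.completion_scl[OF F(1)] monoid_cstar_algebra_simps
  by (rule rho_map_class[OF CP.cauchy_scl[OF F(1)]]) (use rho_lim_scl[OF LF] in \<open>simp add: F(2)\<close>)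
 obtain T' where T': "adjoint_pair UNIV (rho_map a) T'" "rho_lim (\<lambda>n. starP (F n)) T'" using rho_lim_adj[OF LF] .
 show "rho_map (adj CrA a) = adj \<M> (rho_map a)"
  unfolding monoid_cstar_algebra_simps adj_op_algebra[OF T'(1)] unfolding F(2) reduced_cstar_algebra_def CP.completion_adj[OF F(1)]
  by (rule rho_map_class[OF CP.cauchy_adj[OF F(1)]]) (use T'(2) in simp)
 assume b: "b \<in> elems CrA"
 obtain G where G: "G \<in> cseqs CcA" "b = cls CcA G" using reduced_elemsE[OF b] .
 note LG = rho_map_lim[OF G(1), folded G(2)]
 show "rho_map (add CrA a b) = add \<M> (rho_map a) (rho_map b)"
  unfolding monoid_cstar_algebra_simps unfolding F(2) G(2) reduced_cstar_algebra_def CP.completion_add[OF F(1) G(1)]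
  by (rule rho_map_class[OF CP.cauchy_add[OF F(1) G(1)]]) (use rho_lim_add[OF LF LG] in \<open>simp add: F(2) G(2)\<close>)
 show "rho_map (mul CrA a b) = mul \<M> (rho_map a) (rho_map b)"
  unfolding monoid_cstar_algebra_simps unfolding F(2) G(2) reduced_cstar_algebra_def CP.completion_mul[OF F(1) G(1)]
  by (rule rho_map_class[OF CP.cauchy_mul[OF F(1) G(1)]]) (use rho_lim_mul[OF LF LG] in \<open>simp add: F(2) G(2)\<close>)
qed

interpretation BQ: seminormed_quotient "\<M> :: 'a::left_cancel_monoid op star_algebra" boundary_ideal
proof -
 interpret seminormed_algebra "\<M> :: 'a op star_algebra" by (rule seminormed_algebra_monoid)
 show "seminormed_quotient (\<M> :: 'a op star_algebra) boundary_ideal"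
  by unfold_locales (use boundary_ideal_closed boundary_ideal_adj in auto)
qed

lemma quotient_map_star_hom: "star_hom \<M> boundary_quotient (quotient_map :: 'a::left_cancel_monoid op => _)"
 unfolding star_hom_def quotient_map_def boundary_quotient_def
 by (intro conjI Pi_I ballI allI) (simp_all only: BQ.quotient_simps BQ.quotient_add BQ.quotient_scl BQ.quotient_mul BQ.quotient_adj imageI)

lemma star_hom_comp: "star_hom A B \<pi> ==> star_hom B C t ==> star_hom A C (\<lambda>a. t (\<pi> a))"
 unfolding star_hom_def Pi_iff by (elim conjE, intro conjI ballI allI) simp_all

lemma star_hom_factor:
 assumes R: "star_hom A C R" "R ` elems A = elems C" and t: "star_hom A B t" and \<Phi>: "\<And>a. a \<in> elems A ==> \<Phi> (R a) = t a"
  and cl: "\<And>a b c. a \<in> elems A ==> b \<in> elems A ==> add A a b \<in> elems A \<and> scl A c a \<in> elems A \<and> mul A a b \<in> elems A \<and> adj A a \<in> elems A"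
 shows "star_hom C B \<Phi>"
 unfolding star_hom_def
proof (intro conjI Pi_I ballI allI)
 note r = R(1)[unfolded star_hom_def Pi_iff] and t = t[unfolded star_hom_def Pi_iff]
 fix x y c assume x: "x \<in> elems C"
 obtain a where a: "a \<in> elems A" "x = R a" using x R(2) by blast
 note ca = cl[OF a(1) a(1)]
 show "\<Phi> x \<in> elems B" using a \<Phi> t by auto
 have "\<Phi> (scl C c (R a)) = \<Phi> (R (scl A c a))" using r a(1) by simp
 also have "\<dots> = scl B c (\<Phi> (R a))" using \<Phi> ca a(1) t by simp
 finally show "\<Phi> (scl C c x) = scl B c (\<Phi> x)" unfolding a(2) .
 have "\<Phi> (adj C (R a)) = \<Phi> (R (adj A a))" using r a(1) by simp
 also have "\<dots> = adj B (\<Phi> (R a))" using \<Phi> ca a(1) t by simp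
 finally show "\<Phi> (adj C x) = adj B (\<Phi> x)" unfolding a(2) .
 assume y: "y \<in> elems C"
 obtain b where b: "b \<in> elems A" "y = R b" using y R(2) by blast
 note cb = cl[OF a(1) b(1)]
 have "\<Phi> (add C (R a) (R b)) = \<Phi> (R (add A a b))" using r a(1) b(1) by simp
 also have "\<dots> = add B (\<Phi> (R a)) (\<Phi> (R b))" using \<Phi> cb a(1) b(1) t by simp
 finally show "\<Phi> (add C x y) = add B (\<Phi> x) (\<Phi> y)" unfolding a(2) b(2) .
 have "\<Phi> (mul C (R a) (R b)) = \<Phi> (R (mul A a b))" using r a(1) b(1) by simp
 also have "\<dots> = mul B (\<Phi> (R a)) (\<Phi> (R b))" using \<Phi> cb a(1) b(1) t by simp
 finally show "\<Phi> (mul C x y) = mul B (\<Phi> x) (\<Phi> y)" unfolding a(2) b(2) .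
qed

lemma reduced_closed:
 fixes a b :: "(nat => 'a::left_cancel_monoid germ_fun) set"
 assumes "a \<in> elems CrA" "b \<in> elems CrA"
 shows "add CrA a b \<in> elems CrA \<and>
  scl CrA c a \<in> elems CrA \<and>
  mul CrA a b \<in> elems CrA \<and>
  adj CrA a \<in> elems CrA"
proof -
 obtain F where F: "F \<in> cseqs CcA" "a = cls CcA F" using reduced_elemsE[OF assms(1)] .
 obtain G where G: "G \<in> cseqs CcA" "b = cls CcA G" using reduced_elemsE[OF assms(2)] .
 show ?thesis unfolding F(2) G(2) reduced_cstar_algebra_def CP.completion_add[OF F(1) G(1)] CP.completion_mul[OF F(1) G(1)]
   CP.completion_scl[OF F(1)] CP.completion_adj[OF F(1)] CP.completion_elems
  by (intro conjI imageI CP.cauchy_add CP.cauchy_mul CP.cauchy_scl CP.cauchy_adj F(1) G(1))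
qed

section \<open>The canonical map\<close>

locale regular_boundary_norm = boundary_norm N for N :: "'a::left_cancel_monoid germ_fun => real" +
 assumes regular: "strongly_cstar_regular_on_boundary TYPE('a)"
begin

text \<open>Injectivity and well-definedness as one statement about approximating sequences.
  Membership forces the boundary norms to zero by \<open>bnorm_le_ideal\<close>, which rests on
  regularity; vanishing boundary norms give approximation from the ideal by
  \<open>rho_near_ideal\<close>, which rests on exactness.\<close>

lemma mem_ideal_iff:
 assumes u: "rho_lim u (T :: 'a op)"
 shows "T \<in> boundary_ideal \<longleftrightarrow> vanishes (\<lambda>n. bnorm (u n))"
proof
 note D = rho_limD[OF u]
 assume T: "T \<in> boundary_ideal"
 have "bnorm (u n) \<le> dst Bop (rho_Cc (u n)) T" for n
  using bnorm_le_ideal[OF regular boundary_idealD(4)[OF T] D(1)] unfolding dst_def op_algebra_simps(6) .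
 thus "vanishes (\<lambda>n. bnorm (u n))"
  using bnorm_nonneg[OF D(1)] by (intro tendsto_sandwich[OF _ _ tendsto_const D(3)]) auto
next
 note D = rho_limD[OF u]
 assume b: "vanishes (\<lambda>n. bnorm (u n))"
 \<comment> \<open>The added null sequence keeps the bound strictly positive, as
   \<open>rho_near_ideal\<close> requires.\<close>
 let ?r = "\<lambda>n. bnorm (u n) + 1 / (real n + 1)"
 have "vanishes (\<lambda>n. 1 / (real n + 1))" using LIMSEQ_inverse_real_of_nat by (simp add: inverse_eq_divide add.commute)
 hence r: "?r \<longlonglongrightarrow> 0" using tendsto_add[OF b] by fastforce
 have "\<exists>S\<in>boundary_ideal. dst Bop (rho_Cc (u n)) S \<le> 5 * ?r n" for n
  by (rule rho_near_ideal[OF D(1)]) (use bnorm_nonneg[OF D(1)[of n]] in \<open>auto intro: add_nonneg_pos\<close>)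
 then obtain S where S: "\<And>n. S n \<in> boundary_ideal" "\<And>n. dst Bop (rho_Cc (u n)) (S n) \<le> 5 * ?r n" by metis
 have Sb: "S n \<in> elems Bop" for n using monoid_bounded[OF boundary_idealD(1)[OF S(1)]] by simp
 have "vanishes (\<lambda>n. dst Bop (rho_Cc (u n)) (S n))"
  by (rule op.tendsto_dst_0[OF D(4) Sb S(2)]) (use tendsto_mult_right_zero[OF r, of 5] in simp)
 hence "vanishes (\<lambda>n. dst Bop (S n) T)"
  by (rule op.dst_lim_trans[OF Sb D(4) D(2) op.dst_lim_sym[OF D(4) Sb] D(3)])
 thus "T \<in> boundary_ideal" by (rule boundary_ideal_limit[OF S(1) rho_lim_monoid[OF u]])
qed

text \<open>The kernel of restriction is the preimage of the ideal. The operator \<open>b\<close> is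
  given by a sequence \<open>f\<close> that converges only under \<open>rho_Cc\<close> and has a
  Cauchy restriction; in this generality the lemma serves well-definedness, injectivity and
  surjectivity alike.\<close>

lemma restriction_eq_iff:
 assumes F: "F \<in> cseqs CcA" and f: "rho_lim f b"
  and G: "(\<lambda>n. restr (f n)) \<in> cseqs CcB"
 shows "restriction_map N (cls CcA F) = cls CcB (\<lambda>n. restr (f n))
  \<longleftrightarrow> quotient_map (rho_map (cls CcA F)) = quotient_map b"
proof -
 let ?a = "cls CcA F"
 have FP: "F n \<in> CcP" for n using CP.cauchy_seqsD(1)[OF F, of n] by (simp add: Cc_P)
 have "restriction_map N ?a = cls CcB (\<lambda>n. restr (f n)) \<longleftrightarrow> vanishes (\<lambda>n. bnorm (fdiff (F n) (f n)))"
  unfolding extension_restriction(2)[OF F] CB.cauchy_class_eq_iff[OF extension_restriction(1)[OF F] G] dst_restrict[OF FP rho_limD(1)[OF f]] ..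
 also have "\<dots> \<longleftrightarrow> add Bop (rho_map ?a) (scl Bop (-1) b) \<in> boundary_ideal"
  by (rule mem_ideal_iff[OF rho_lim_dif[OF rho_map_lim[OF F] f], symmetric])
 also have "\<dots> \<longleftrightarrow> quotient_map (rho_map ?a) = quotient_map b"
  unfolding quotient_map_def using BQ.coset_eq_iff[OF rho_lim_monoid[OF rho_map_lim[OF F]] rho_lim_monoid[OF f]]
  unfolding monoid_cstar_algebra_simps by blast
 finally show ?thesis .
qed

lemma restriction_hom:
 "star_hom CrA CrB (restriction_map N)"
 "restriction_map N ` elems CrA = elems CrB"
 using exact unfolding short_exact_def by blast+

lemma restriction_rho_eq_iff:
 assumes a: "a \<in> elems CrA" and b: "b \<in> elems CrA"
 shows "restriction_map N a = restriction_map N b \<longleftrightarrow> quotient_map (rho_map a) = quotient_map (rho_map b)"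
proof -
 obtain F where F: "F \<in> cseqs CcA" "a = cls CcA F" using reduced_elemsE[OF a] .
 obtain G where G: "G \<in> cseqs CcA" "b = cls CcA G" using reduced_elemsE[OF b] .
 show ?thesis
  using restriction_eq_iff[OF F(1) rho_map_lim[OF G(1)] extension_restriction(1)[OF G(1)]] extension_restriction(2)[OF G(1)] F(2) G(2) by simp
qed

text \<open>A sequence approximating \<open>b\<close> is Cauchy for \<open>rho_nrm\<close>, and by
  regularity its restriction is Cauchy for the boundary norm. The class of that restriction lies in
  the completed boundary algebra, so by exactness it is the restriction of some \<open>a\<close>,
  and \<open>rho_map a\<close> agrees with \<open>b\<close> modulo the ideal.\<close>

lemma rho_quotient_surj:
 assumes b: "(b :: 'a op) \<in> Bel"
 shows "\<exists>a\<in>elems CrA. quotient_map (rho_map a) = quotient_map b"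
proof -
 obtain f where f: "rho_lim f b" using monoid_rho_lim[OF b] by blast
 note fP = rho_limD(1)[OF f]
 have G: "(\<lambda>n. restr (f n)) \<in> cseqs CcB"
  unfolding cauchy_seqs_def
 proof (intro CollectI conjI allI impI restrict_in fP)
  fix e :: real assume "e > 0"
  then obtain K where K: "\<forall>m\<ge>K. \<forall>n\<ge>K. rho_nrm (fdiff (f m) (f n)) < e" using rho_lim_cauchy[OF f] by blast
  have "dst CcB (restr (f m)) (restr (f n)) < e" if "K \<le> m" "K \<le> n" for m n
   unfolding dst_restrict[OF fP fP] using bnorm_le_rho[OF regular fdiff_gen_span[OF fP fP], of m n] K that by (meson le_less_trans)
  thus "\<exists>K. \<forall>m\<ge>K. \<forall>n\<ge>K. dst CcB (restr (f m)) (restr (f n)) < e" by blast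
 qed
 hence "cls CcB (\<lambda>n. restr (f n)) \<in> elems CrB"
  unfolding boundary_cstar_algebra_def CB.completion_elems by blast
 then obtain a where a: "a \<in> elems CrA"
  "restriction_map N a = cls CcB (\<lambda>n. restr (f n))"
  unfolding restriction_hom(2)[symmetric] by (elim imageE) simp
 obtain F where F: "F \<in> cseqs CcA" "a = cls CcA F" using reduced_elemsE[OF a(1)] .
 have "quotient_map (rho_map a) = quotient_map b" using restriction_eq_iff[OF F(1) f G] a(2) unfolding F(2) by blast
 thus ?thesis by (rule bexI[OF _ a(1)])
qed

lemma canonical_map_iso:
 assumes \<Phi>: "is_canonical_map N \<Phi>"
 shows "star_iso CrB boundary_quotient \<Phi>"
 unfolding star_iso_def
proof
 show "star_hom CrB boundary_quotient \<Phi>" using \<Phi> unfolding is_canonical_map_def by blast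
 have c: "\<Phi> (restriction_map N a) = quotient_map (rho_map a)" if "a \<in> elems CrA" for a
  using \<Phi> that unfolding is_canonical_map_def by blast
 show "bij_betw \<Phi> (elems CrB) (elems boundary_quotient)"
  unfolding bij_betw_def
 proof
  show "inj_on \<Phi> (elems CrB)"
  proof (rule inj_onI)
   fix x y assume x: "x \<in> elems CrB" and y: "y \<in> elems CrB" and e: "\<Phi> x = \<Phi> y"
   obtain a where a: "a \<in> elems CrA" "x = restriction_map N a" using x unfolding restriction_hom(2)[symmetric] by (elim imageE)
   obtain b where b: "b \<in> elems CrA" "y = restriction_map N b" using y unfolding restriction_hom(2)[symmetric] by (elim imageE)
   show "x = y" using restriction_rho_eq_iff[OF a(1) b(1)] e unfolding a(2) b(2) c[OF a(1)] c[OF b(1)] by blast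
  qed
  have "rho_map a \<in> Bel" if "a \<in> elems CrA" for a
   using rho_map_star_hom that unfolding star_hom_def by blast
  note rB = this
  have "(\<lambda>a. quotient_map (rho_map a)) ` elems CrA = quotient_map ` (Bel :: 'a op set)"
  proof (intro equalityI image_subsetI)
   show "quotient_map (rho_map a) \<in> quotient_map ` Bel" if "a \<in> elems CrA" for a :: "(nat => 'a germ_fun) set" by (rule imageI[OF rB[OF that]])
   show "quotient_map b \<in> (\<lambda>a. quotient_map (rho_map a)) ` elems CrA" if b: "b \<in> Bel" for b :: "'a op"
   proof -
    obtain a where "a \<in> elems CrA" "quotient_map (rho_map a) = quotient_map b" using rho_quotient_surj[OF b] by blast
    thus ?thesis by (intro image_eqI[of _ _ a]) simp_all
   qed
  qed
  moreover have "\<Phi> ` elems CrB = (\<lambda>a. quotient_map (rho_map a)) ` elems CrA"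
   unfolding restriction_hom(2)[symmetric] image_image by (rule image_cong[OF refl c])
  moreover have "elems boundary_quotient = quotient_map ` (Bel :: 'a op set)"
   unfolding boundary_quotient_def quotient_map_def by (rule BQ.quotient_simps)
  ultimately show "\<Phi> ` elems CrB = elems boundary_quotient" by simp
 qed
qed

text \<open>By \<open>restriction_rho_eq_iff\<close> the value does not depend on the chosen
  preimage under restriction. Uniqueness rests on the surjectivity of restriction and, off the
  carrier, on extensionality.\<close>

lemma canonical_map_ex1: "\<exists>!\<Phi>. is_canonical_map N \<Phi>"
proof (rule ex_ex1I)
 let ?E = "elems CrB" and ?A = "reduced_cstar_algebra (\<G> :: 'a germ top_groupoid)"
 define \<Phi> where "\<Phi> = (\<lambda>x\<in>?E. quotient_map (rho_map (SOME a. a \<in> elems ?A \<and> restriction_map N a = x)))"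
 have c: "\<Phi> (restriction_map N a) = quotient_map (rho_map a)" if a: "a \<in> elems ?A" for a
 proof -
  let ?s = "SOME b. b \<in> elems ?A \<and> restriction_map N b = restriction_map N a"
  have s: "?s \<in> elems ?A \<and> restriction_map N ?s = restriction_map N a" by (rule someI[of _ a]) (use a in simp)
  have "restriction_map N a \<in> ?E" using a restriction_hom(2) by blast
  hence "\<Phi> (restriction_map N a) = quotient_map (rho_map ?s)" unfolding \<Phi>_def by simp
  thus ?thesis using restriction_rho_eq_iff[of ?s a] s a by simp
 qed
 have "star_hom CrB boundary_quotient \<Phi>"
  by (rule star_hom_factor[OF restriction_hom star_hom_comp[OF rho_map_star_hom quotient_map_star_hom] c reduced_closed])
 moreover have "\<Phi> \<in> extensional ?E" unfolding \<Phi>_def by simp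
 ultimately show "\<exists>\<Phi>. is_canonical_map N \<Phi>" using c unfolding is_canonical_map_def by blast
next
 fix \<Phi> \<Psi> assume c: "is_canonical_map N \<Phi>" "is_canonical_map N \<Psi>"
 have "\<Phi> x = \<Psi> x" if x: "x \<in> elems CrB" for x
 proof -
  obtain a where a: "a \<in> elems CrA" "x = restriction_map N a" using x unfolding restriction_hom(2)[symmetric] by (elim imageE)
  show ?thesis using c a unfolding is_canonical_map_def by simp
 qed
 thus "\<Phi> = \<Psi>" using c unfolding is_canonical_map_def by (metis extensionalityI)
qed

text \<open>The two norms are assumed equal only on C_c of the boundary groupoid, so the two normed
  algebras need not be equal as records. Distances inside C_c agree, hence so do Cauchy sequences
  and their classes, and the operations of the completions can be transferred one by one.\<close>

lemma reduced_boundary_eq: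
 fixes F G :: "nat => 'a germ_fun"
 shows "cseqs CcR = cseqs CcB"
  "F \<in> cseqs CcB ==> cls CcR F = cls CcB F"
proof -
 have d: "dst CcR f f' = dst CcB f f'"
  if "f \<in> Cc boundary_groupoid" "f' \<in> Cc boundary_groupoid" for f f' :: "'a germ_fun"
  unfolding dst_Cc_algebra by (rule N_eq[symmetric]) (use that fdiff_gen_span in \<open>simp add: Cc_boundary\<close>)
 show s: "cseqs CcR = cseqs CcB"
  unfolding cauchy_seqs_def by (rule Collect_cong, rule conj_cong) (use d in \<open>simp_all\<close>)
 show "cls CcR F = cls CcB F"
  if F: "F \<in> cseqs CcB"
  unfolding cauchy_class_def s
 proof (rule Collect_cong, rule conj_cong[OF refl])
  fix G :: "nat => 'a germ_fun" assume G: "G \<in> cseqs CcB"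
  have "F n \<in> Cc boundary_groupoid" "G n \<in> Cc boundary_groupoid" for n using CB.cauchy_seqsD(1)[OF F] CB.cauchy_seqsD(1)[OF G] by simp_all
  thus "(vanishes (\<lambda>n. dst CcR (F n) (G n))) = (vanishes (\<lambda>n. dst CcB (F n) (G n)))"
   using d by simp
 qed
qed

lemma reduced_boundary_ops:
 fixes x y :: "(nat => 'a germ_fun) set"
 shows "elems CrR = elems CrB"
  "x \<in> elems CrB ==> y \<in> elems CrB ==>
   add CrR x y = add CrB x y \<and>
   scl CrR c x = scl CrB c x \<and>
   mul CrR x y = mul CrB x y \<and>
   adj CrR x = adj CrB x"
proof -
 let ?R = "reduced_Cc_algebra (boundary_groupoid :: 'a germ top_groupoid)" and ?B = "boundary_Cc_algebra N"
 interpret CR: seminormed_algebra ?R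
  unfolding boundary_groupoid_eq by (rule boundary_ci.seminormed_algebra_Cc) simp
 note s = reduced_cstar_algebra_def boundary_cstar_algebra_def
 show "elems CrR = elems CrB"
  unfolding s CR.completion_elems CB.completion_elems reduced_boundary_eq(1) by (rule image_cong[OF refl reduced_boundary_eq(2)])
 assume "x \<in> elems CrB" "y \<in> elems CrB"
 then obtain F G where F: "F \<in> cseqs ?B" "x = cls ?B F" and G: "G \<in> cseqs ?B" "y = cls ?B G"
  unfolding s CB.completion_elems by blast
 have F': "F \<in> cseqs ?R" and G': "G \<in> cseqs ?R" using F G reduced_boundary_eq(1) by simp_all
 have x': "x = cls ?R F" and y': "y = cls ?R G" using F G reduced_boundary_eq(2) by simp_all
 have o: "add ?R = add ?B" "scl ?R = scl ?B" "mul ?R = mul ?B" "adj ?R = adj ?B" by simp_all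
 have "add (completion ?R) x y = add (completion ?B) x y"
  using CR.completion_add[OF F' G'] reduced_boundary_eq(2)[OF CB.cauchy_add[OF F(1) G(1)]] CB.completion_add[OF F(1) G(1)]
  unfolding x'[symmetric] y'[symmetric] F(2)[symmetric] G(2)[symmetric] o by simp
 moreover have "scl (completion ?R) c x = scl (completion ?B) c x"
  using CR.completion_scl[OF F', of c] reduced_boundary_eq(2)[OF CB.cauchy_scl[OF F(1), of c]] CB.completion_scl[OF F(1), of c]
  unfolding x'[symmetric] y'[symmetric] F(2)[symmetric] G(2)[symmetric] o by simp
 moreover have "mul (completion ?R) x y = mul (completion ?B) x y"
  using CR.completion_mul[OF F' G'] reduced_boundary_eq(2)[OF CB.cauchy_mul[OF F(1) G(1)]] CB.completion_mul[OF F(1) G(1)]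
  unfolding x'[symmetric] y'[symmetric] F(2)[symmetric] G(2)[symmetric] o by simp
 moreover have "adj (completion ?R) x = adj (completion ?B) x"
  using CR.completion_adj[OF F'] reduced_boundary_eq(2)[OF CB.cauchy_adj[OF F(1)]] CB.completion_adj[OF F(1)]
  unfolding x'[symmetric] y'[symmetric] F(2)[symmetric] G(2)[symmetric] o by simp
 ultimately show "add CrR x y = add CrB x y \<and>
   scl CrR c x = scl CrB c x \<and>
   mul CrR x y = mul CrB x y \<and>
   adj CrR x = adj CrB x"
  unfolding s by (intro conjI)
qed

lemma canonical_map_reduced_iso:
 assumes "is_canonical_map N \<Phi>"
 shows "star_iso CrR boundary_quotient \<Phi>"
 using canonical_map_iso[OF assms] unfolding star_iso_def star_hom_def reduced_boundary_ops(1)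
 by (elim conjE, intro conjI) (simp_all add: reduced_boundary_ops(2))

end

theorem theorem2p12:
  fixes norm_e :: "'a::left_cancel_monoid germ_fun \<Rightarrow> real"
  assumes norm_e: "is_norm_e norm_e"
    and norm_e_eq_norm_r: "\<forall>f\<in>Cc boundary_groupoid. norm_e f = reduced_norm boundary_groupoid f"
    and regular: "strongly_cstar_regular_on_boundary TYPE('a)"
  shows "(\<exists>!\<Phi>. is_canonical_map norm_e \<Phi>) \<and>
    (\<forall>\<Phi>. is_canonical_map norm_e \<Phi> \<longrightarrow>
       star_iso (boundary_cstar_algebra norm_e) boundary_quotient \<Phi> \<and>
       star_iso (reduced_cstar_algebra boundary_groupoid) boundary_quotient \<Phi>)"
proof -
 interpret regular_boundary_norm norm_e
  by unfold_locales (use assms in auto)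
 show ?thesis using canonical_map_ex1 canonical_map_iso canonical_map_reduced_iso by blast
qed

end
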